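(* Let $n\ge1$, $\lambda>0$, and let $d\nu=f\,d\gamma$ be a centered probability measure on $\mathbb{R}^n$ (i.e. $\int x\,d\nu=0$) in the class $\mathcal{P}(\lambda)$. Then $$\delta_{\rm LSI}(\nu)\,\ge\, c_2(\lambda)\,\mathrm{W}_2(\nu,\gamma)^2,$$ where $c_2(\lambda)=\frac12\Big(\frac{1}{c(\lambda)}-1\Big)$, $c(\lambda)=\frac{1-\lambda+\lambda\log\lambda}{(1-\lambda)^2}$ for $\lambda\ne1$ and $c(1)=\frac12$.
   Context: $\gamma$ is the standard Gaussian measure on $\mathbb{R}^n$, $d\gamma(x) = (2\pi)^{-n/2}e^{-|x|^2/2}dx$. For a probability measure $d\nu=f\,d\gamma$, $\mathrm{H}(\nu)=\int_{\mathbb{R}^n} f\log f\,d\gamma$, $\mathrm{I}(\nu)=\int_{\mathbb{R}^n}\frac{|\nabla f|^2}{f}\,d\gamma$ (integral over $\{f>0\}$), and $\delta_{\rm LSI}(\nu)=\frac12\mathrm{I}(\nu)-\mathrm{H}(\nu)$. Standing convention: the density $f\ge 0$ is regular enough (weakly differentiable, $f\in W^{1,1}_{loc}$) for these quantities to be well-defined, and they are finite. $\mathcal{P}(\lambda)$ is the class of Borel probability measures $\nu$ on $\mathbb{R}^n$ satisfying a Poincaré inequality with constant $\lambda>0$: for every smooth $g:\mathbb{R}^n\to\mathbb{R}$ with $\int g\,d\nu=0$, $\lambda\int_{\mathbb{R}^n} g^2\,d\nu\le\int_{\mathbb{R}^n}|\nabla g|^2\,d\nu$. $\mathrm{W}_2(\nu,\mu)=\inf_\pi\big(\int\int|x-y|^2d\pi(x,y)\big)^{1/2}$,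 infimum over couplings $\pi$ of $\nu$ and $\mu$, is the quadratic Kantorovich-Wasserstein distance ($|\cdot|$ Euclidean). *)

theory Defs
  imports "HOL-Probability.Probability"
begin

definition std_gaussian :: "'a::euclidean_space measure" where
  "std_gaussian = density lborel
     (\<lambda>x. ennreal ((2 * pi) powr (- (real DIM('a) / 2)) * exp (- (norm x)\<^sup>2 / 2)))"

definition grad :: "('a::euclidean_space \<Rightarrow> real) \<Rightarrow> 'a \<Rightarrow> 'a" where
  "grad g x = (THE D. GDERIV g x :> D)"

text \<open>A function is of class \<open>C\<^sup>k\<^sup>+\<^sup>1\<close> if it is differentiable everywhere and all its partial
  derivatives are of class \<open>C\<^sup>k\<close>.\<close>

primrec Ck :: "nat \<Rightarrow> ('a::euclidean_space \<Rightarrow> real) \<Rightarrow> bool" where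
  "Ck 0 g \<longleftrightarrow> continuous_on UNIV g"
| "Ck (Suc k) g \<longleftrightarrow> (\<forall>x. g differentiable (at x)) \<and> (\<forall>b\<in>Basis. Ck k (\<lambda>x. grad g x \<bullet> b))"

definition smooth :: "('a::euclidean_space \<Rightarrow> real) \<Rightarrow> bool" where
  "smooth g \<longleftrightarrow> (\<forall>k. Ck k g)"

definition locally_integrable ::
    "('a::euclidean_space \<Rightarrow> 'b::{banach, second_countable_topology}) \<Rightarrow> bool" where
  "locally_integrable g \<longleftrightarrow> (\<forall>K. compact K \<longrightarrow> set_integrable lborel K g)"

definition is_weak_gradient :: "('a::euclidean_space \<Rightarrow> real) \<Rightarrow> ('a \<Rightarrow> 'a) \<Rightarrow> bool" where
  "is_weak_gradient f G \<longleftrightarrow> locally_integrable f \<and> locally_integrable G \<and>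
     (\<forall>\<phi>. smooth \<phi> \<and> compact (closure {x. \<phi> x \<noteq> 0}) \<longrightarrow>
        (LINT x|lborel. f x *\<^sub>R grad \<phi> x) = - (LINT x|lborel. \<phi> x *\<^sub>R G x))"

text \<open>The space \<open>W\<^sup>1\<^sup>,\<^sup>1\<close> of locally integrable functions with locally integrable weak gradient.\<close>

definition W11_loc :: "('a::euclidean_space \<Rightarrow> real) \<Rightarrow> bool" where
  "W11_loc f \<longleftrightarrow> (\<exists>G. is_weak_gradient f G)"

text \<open>Weak gradients are unique up to null sets, so the choice below does not affect integrals.\<close>

definition weak_grad :: "('a::euclidean_space \<Rightarrow> real) \<Rightarrow> 'a \<Rightarrow> 'a" where
  "weak_grad f = (SOME G. is_weak_gradient f G)"

text \<open>The functionals of \<open>d\<nu> = f d\<gamma>\<close> are written as functionals of the density \<open>f\<close>. The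
  predicates \<open>finite_entropy\<close> and \<open>finite_fisher\<close> say that the integrals are finite; without
  them the Bochner integrals would default to \<open>0\<close>. Since \<open>ln 0 = 0\<close>, the integrand of the entropy
  is \<open>0\<close> where \<open>f\<close> vanishes.\<close>

definition entropy_gauss :: "('a::euclidean_space \<Rightarrow> real) \<Rightarrow> real" where
  "entropy_gauss f = (LINT x|std_gaussian. f x * ln (f x))"

definition finite_entropy :: "('a::euclidean_space \<Rightarrow> real) \<Rightarrow> bool" where
  "finite_entropy f \<longleftrightarrow> integrable std_gaussian (\<lambda>x. f x * ln (f x))"

definition fisher_gauss :: "('a::euclidean_space \<Rightarrow> real) \<Rightarrow> real" where
  "fisher_gauss f = (LINT x:{x. 0 < f x}|std_gaussian. (norm (weak_grad f x))\<^sup>2 / f x)"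

definition finite_fisher :: "('a::euclidean_space \<Rightarrow> real) \<Rightarrow> bool" where
  "finite_fisher f \<longleftrightarrow>
     set_integrable std_gaussian {x. 0 < f x} (\<lambda>x. (norm (weak_grad f x))\<^sup>2 / f x)"

definition lsi_deficit :: "('a::euclidean_space \<Rightarrow> real) \<Rightarrow> real" where
  "lsi_deficit f = fisher_gauss f / 2 - entropy_gauss f"

text \<open>Both sides of the Poincare inequality are read in \<open>[0, \<infinity>]\<close>.\<close>

definition poincare_class :: "real \<Rightarrow> 'a::euclidean_space measure set" where
  "poincare_class l = {\<nu>. sets \<nu> = sets borel \<and> prob_space \<nu> \<and>
     (\<forall>g. smooth g \<and> integrable \<nu> g \<and> (LINT x|\<nu>. g x) = 0 \<longrightarrow>
        ennreal l * (\<integral>\<^sup>+ x. ennreal ((g x)\<^sup>2) \<partial>\<nu>) \<le> (\<integral>\<^sup>+ x. ennreal ((norm (grad g x))\<^sup>2) \<partial>\<nu>))}"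

definition centered :: "'a::euclidean_space measure \<Rightarrow> bool" where
  "centered \<nu> \<longleftrightarrow> integrable \<nu> (\<lambda>x. x) \<and> (LINT x|\<nu>. x) = 0"

definition couplings :: "'a::euclidean_space measure \<Rightarrow> 'a measure \<Rightarrow> ('a \<times> 'a) measure set" where
  "couplings \<nu> \<mu> = {\<pi>. sets \<pi> = sets borel \<and> distr \<pi> borel fst = \<nu> \<and> distr \<pi> borel snd = \<mu>}"

definition ennreal_sqrt :: "ennreal \<Rightarrow> ennreal" where
  "ennreal_sqrt a = (if a = \<infinity> then \<infinity> else ennreal (sqrt (enn2real a)))"

definition W2 :: "'a::euclidean_space measure \<Rightarrow> 'a measure \<Rightarrow> ennreal" where
  "W2 \<nu> \<mu> = (INF \<pi>\<in>couplings \<nu> \<mu>. ennreal_sqrt (\<integral>\<^sup>+ (x, y). ennreal ((norm (x - y))\<^sup>2) \<partial>\<pi>))"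

definition lsi_c :: "real \<Rightarrow> real" where
  "lsi_c l = (if l = 1 then 1 / 2 else (1 - l + l * ln l) / (1 - l)\<^sup>2)"

definition lsi_c2 :: "real \<Rightarrow> real" where
  "lsi_c2 l = (1 / lsi_c l - 1) / 2"

end

theory Submission
  imports Defs "HOL-Real_Asymp.Real_Asymp"
begin

text \<open>Let \<open>P\<^sub>r\<close> be the Ornstein-Uhlenbeck operator at time \<open>- ln r\<close>. De Bruijn's identity writes the
  entropy as \<open>H(\<nu>) = \<integral>\<^sub>0\<^sup>1 r K(r) dr\<close> with \<open>K(r) = \<integral> \<bar>P\<^sub>r \<nabla>f\<bar>\<^sup>2 / P\<^sub>r f d\<gamma>\<close>. By duality, a bound for \<open>K(r)\<close> follows
  from a bound for the variance of \<open>P\<^sub>r h\<close> under \<open>\<nu>\<close>, with \<open>h\<close> the score of \<open>P\<^sub>r f\<close>; subtracting the mean of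
  \<open>P\<^sub>r h\<close> is harmless because \<open>\<integral> \<nabla>f d\<gamma> = \<integral> x d\<nu> = 0\<close>. The Poincare inequality for \<open>\<nu>\<close> together with the
  pointwise reverse Poincare inequality
  \<open>(1 - r\<^sup>2) \<bar>\<nabla>P\<^sub>r h\<bar>\<^sup>2 \<le> r\<^sup>2 (P\<^sub>r (h\<^sup>2) - (P\<^sub>r h)\<^sup>2)\<close> bounds that variance and yields
  \<open>K(r) \<le> r\<^sup>2 / (r\<^sup>2 + \<lambda> (1 - r\<^sup>2)) I(\<nu>)\<close>. Integrating, \<open>H(\<nu>) \<le> c(\<lambda>) I(\<nu>) / 2\<close>, so that
  \<open>\<delta>(\<nu>) \<ge> (1 / c(\<lambda>) - 1) H(\<nu>)\<close>. Talagrand's inequality \<open>W\<^sub>2(\<nu>, \<gamma>)\<^sup>2 \<le> 2 H(\<nu>)\<close> concludes; it is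
  witnessed by the Knothe map, which transports the conditional one-dimensional marginals
  monotonically.\<close>

section \<open>The Gaussian measure and the Mehler kernel\<close>

text \<open>De Bruijn's identity asks for a density with bounded gradient that stays away from 0 and
  infinity, whereas \<open>f\<close> is only locally W11 and may vanish or be unbounded. So
  \<open>f\<close> is replaced by \<open>wn\<close>: truncated by \<open>trunc\<close>, smoothed by
  the semigroup at a parameter d < 1, and lifted by a small constant. The Poincare inequality,
  however, is given for the measure with density \<open>f\<close> only, not for these
  regularisations. Hence the truncation is removed inside the de Bruijn integral before the
  contraction estimate is used; truncating merely has to keep the integrand dominated, which costs a
  factor 4 that does not reach the final constant. Afterwards d tends to 1, and Fatou's lemma
  suffices because the entropy is bounded from above. A second obstacle: weak gradients are tested
  against compactly supported functions only, while the Mehler kernel has full support; cutoffs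
  bridge this. The summand r^2 in the denominator of the contraction factor is the variance
  subtracted in the reverse Poincare inequality, moved to the other side; without it the factor
  would blow up as r tends to 1.\<close>

abbreviation gauss1 :: "real measure" where
  "gauss1 \<equiv> density lborel (\<lambda>x. ennreal (std_normal_density x))"

abbreviation vec_of :: "('a \<Rightarrow> real) \<Rightarrow> 'a::euclidean_space" where
  "vec_of f \<equiv> (\<Sum>b\<in>Basis. f b *\<^sub>R b)"

definition gauss_density :: "'a::euclidean_space \<Rightarrow> real" where
  "gauss_density x = (2 * pi) powr (- (real DIM('a) / 2)) * exp (- (norm x)\<^sup>2 / 2)"

lemma gauss_density_nonneg [simp]: "0 \<le> gauss_density x"
  by (simp add: gauss_density_def)

lemma gauss_density_measurable [measurable]: "gauss_density \<in> borel_measurable borel"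
  unfolding gauss_density_def by measurable

lemma std_gaussian_eq: "std_gaussian = density lborel (\<lambda>x. ennreal (gauss_density x))"
  by (simp add: std_gaussian_def gauss_density_def)

lemma sets_std_gaussian [simp, measurable_cong]: "sets std_gaussian = sets borel"
  by (simp add: std_gaussian_eq)

lemma space_std_gaussian [simp]: "space std_gaussian = UNIV"
  by (simp add: std_gaussian_eq)

lemma gauss_density_vec_of:
  "gauss_density (vec_of f :: 'a::euclidean_space) = (\<Prod>b\<in>(Basis::'a set). std_normal_density (f b))"
proof -
  have n: "(norm (vec_of f :: 'a))\<^sup>2 = (\<Sum>b\<in>(Basis::'a set). (f b)\<^sup>2)"
    by (simp add: norm_eq_sqrt_inner euclidean_inner[of "vec_of f" "vec_of f"] sum_nonneg power2_eq_square)
  have c: "(2 * pi) powr (- (real DIM('a) / 2)) = (\<Prod>b\<in>(Basis::'a set). (1 / sqrt (2 * pi)))"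
    by (simp add: powr_minus powr_powr[symmetric] powr_half_sqrt[symmetric] powr_realpow[symmetric] divide_simps
      powr_powr del: powr_half_sqrt)
  show ?thesis
    unfolding gauss_density_def n c std_normal_density_def prod.distrib
    by (simp add: exp_sum[symmetric] sum_negf[symmetric] sum_divide_distrib)
qed

lemma prob_space_gauss1: "prob_space gauss1"
  by (rule prob_space_normal_density) simp

lemma PiM_gauss1:
  "PiM (Basis::'a::euclidean_space set) (\<lambda>_. gauss1)
     = density (PiM Basis (\<lambda>_. lborel)) (\<lambda>f. ennreal (gauss_density (vec_of f :: 'a)))"
proof -
  interpret product_sigma_finite "\<lambda>_. lborel :: real measure" by standard
  interpret G: product_prob_space "\<lambda>_. gauss1" "Basis :: 'a set"
    by (intro product_prob_spaceI prob_space_gauss1)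
  show ?thesis
  proof (rule G.PiM_eqI[symmetric])
    fix A :: "'a \<Rightarrow> real set" assume A: "\<And>i. i \<in> Basis \<Longrightarrow> A i \<in> sets gauss1"
    then have [measurable]: "\<And>i. i \<in> Basis \<Longrightarrow> A i \<in> sets borel" by simp
    have "emeasure (density (PiM Basis (\<lambda>_. lborel)) (\<lambda>f. ennreal (gauss_density (vec_of f :: 'a)))) (PiE Basis A)
      = (\<integral>\<^sup>+f. (\<Prod>b\<in>Basis. ennreal (std_normal_density (f b)) * indicator (A b) (f b)) \<partial>PiM (Basis::'a set) (\<lambda>_. lborel))"
      by (subst emeasure_density)
         (auto simp: gauss_density_vec_of prod.distrib prod_ennreal space_PiM PiE_iff indicator_def prod_eq_1_iff
           intro!: nn_integral_cong sets_PiM_I_finite)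
    also have "\<dots> = (\<Prod>b\<in>Basis. \<integral>\<^sup>+x. ennreal (std_normal_density x) * indicator (A b) x \<partial>lborel)"
      by (rule product_nn_integral_prod) auto
    also have "\<dots> = (\<Prod>b\<in>Basis. emeasure gauss1 (A b))"
      by (intro prod.cong refl) (simp add: emeasure_density)
    finally show "emeasure (density (PiM Basis (\<lambda>_. lborel)) (\<lambda>f. ennreal (gauss_density (vec_of f :: 'a)))) (PiE Basis A)
      = (\<Prod>b\<in>Basis. emeasure gauss1 (A b))" .
  next
    show "sets (density (PiM (Basis::'a set) (\<lambda>_. lborel)) (\<lambda>f. ennreal (gauss_density (vec_of f :: 'a)))) =
      sets (PiM Basis (\<lambda>_. gauss1))"
      by (simp cong: sets_PiM_cong)
  qed auto
qed

text \<open>The product form gives total mass 1 and the moments coordinate by coordinate, and it is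
  the setting in which the Knothe map acts.\<close>

lemma std_gaussian_PiM:
  "(std_gaussian :: 'a::euclidean_space measure) = distr (PiM Basis (\<lambda>_. gauss1)) borel vec_of"
  unfolding PiM_gauss1 std_gaussian_eq
  by (subst lborel_eq, subst density_distr) (auto simp: sets_PiM_cong)

interpretation gauss: prob_space "std_gaussian :: 'a::euclidean_space measure"
proof -
  interpret P: product_prob_space "\<lambda>_. gauss1" "Basis :: 'a set"
    by (intro product_prob_spaceI prob_space_gauss1)
  have "prob_space (distr (PiM Basis (\<lambda>_. gauss1)) borel (vec_of :: _ \<Rightarrow> 'a))"
    by (rule P.prob_space_distr) measurable
  then show "prob_space (std_gaussian :: 'a measure)"
    by (simp add: std_gaussian_PiM)
qed

text \<open>The transition density of the semigroup, i.e. of c x + sqrt(1 - c^2) z for Gaussian z,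
  taken relative to the Gaussian measure itself. Relative to that measure the kernel is symmetric in
  x and y.\<close>

definition mehler :: "real \<Rightarrow> 'a::euclidean_space \<Rightarrow> 'a \<Rightarrow> real" where
  "mehler c x y = (1 / sqrt (1 - c\<^sup>2)) ^ DIM('a)
     * exp (- (c\<^sup>2 * (norm x)\<^sup>2 - 2 * c * (x \<bullet> y) + c\<^sup>2 * (norm y)\<^sup>2) / (2 * (1 - c\<^sup>2)))"

lemma mehler_commute: "mehler c x y = mehler c y x"
  by (simp add: mehler_def inner_commute algebra_simps)

lemma mehler_pos: "c\<^sup>2 < 1 \<Longrightarrow> 0 < mehler c x y"
  by (simp add: mehler_def)

lemma mehler_measurable [measurable]:
  "(\<lambda>p. mehler c (fst p) (snd p)) \<in> borel_measurable (borel \<Otimes>\<^sub>M borel)"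
  "mehler c x \<in> borel_measurable borel" "(\<lambda>x. mehler c x y) \<in> borel_measurable borel"
  unfolding mehler_def by measurable

text \<open>Completing the square in the exponent. The power of sqrt(1 - c^2) is the Jacobian of z
  to c x + sqrt(1 - c^2) z, so this is the change of variables of \<open>distr_mehler\<close> at the
  level of densities.\<close>

lemma mehler_gauss_density:
  fixes x z :: "'a::euclidean_space"
  assumes "c\<^sup>2 < 1"
  shows "mehler c x (c *\<^sub>R x + sqrt (1 - c\<^sup>2) *\<^sub>R z) * gauss_density (c *\<^sub>R x + sqrt (1 - c\<^sup>2) *\<^sub>R z)
      * sqrt (1 - c\<^sup>2) ^ DIM('a) = gauss_density z"
proof -
  let ?s = "sqrt (1 - c\<^sup>2)"
  have s: "0 < ?s" "?s\<^sup>2 = 1 - c\<^sup>2" using assms by auto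
  define y where "y = c *\<^sub>R x + ?s *\<^sub>R z"
  have z: "?s *\<^sub>R z = y - c *\<^sub>R x" by (simp add: y_def)
  have "?s\<^sup>2 * (norm z)\<^sup>2 = (norm (?s *\<^sub>R z))\<^sup>2" using s by (simp add: power_mult_distrib)
  also have "\<dots> = (norm y)\<^sup>2 - 2 * c * (x \<bullet> y) + c\<^sup>2 * (norm x)\<^sup>2"
    unfolding z power2_norm_eq_inner
    by (simp add: inner_diff_left inner_diff_right inner_commute power2_eq_square[of c] algebra_simps)
  finally have e: "(1 - c\<^sup>2) * (norm z)\<^sup>2 = (norm y)\<^sup>2 - 2 * c * (x \<bullet> y) + c\<^sup>2 * (norm x)\<^sup>2"
    using s by simp
  have "- (c\<^sup>2 * (norm x)\<^sup>2 - 2 * c * (x \<bullet> y) + c\<^sup>2 * (norm y)\<^sup>2) / (2 * (1 - c\<^sup>2)) + - (norm y)\<^sup>2 / 2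
      = - ((1 - c\<^sup>2) * (norm z)\<^sup>2) / (2 * (1 - c\<^sup>2))"
    unfolding e using assms by (simp add: field_simps)
  also have "\<dots> = - (norm z)\<^sup>2 / 2" using assms by (simp add: field_simps)
  finally have ex: "exp (- (c\<^sup>2 * (norm x)\<^sup>2 - 2 * c * (x \<bullet> y) + c\<^sup>2 * (norm y)\<^sup>2) / (2 * (1 - c\<^sup>2)))
    * exp (- (norm y)\<^sup>2 / 2) = exp (- (norm z)\<^sup>2 / 2)"
    by (simp add: exp_add[symmetric])
  have p: "(1 / ?s) ^ DIM('a) * ?s ^ DIM('a) = 1"
    using s by (simp add: power_mult_distrib[symmetric])
  have "mehler c x y * gauss_density y * ?s ^ DIM('a) =
    (2 * pi) powr (- (real DIM('a) / 2)) * ((1 / ?s) ^ DIM('a) * ?s ^ DIM('a)) *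
    (exp (- (c\<^sup>2 * (norm x)\<^sup>2 - 2 * c * (x \<bullet> y) + c\<^sup>2 * (norm y)\<^sup>2) / (2 * (1 - c\<^sup>2)))
    * exp (- (norm y)\<^sup>2 / 2))"
    unfolding mehler_def gauss_density_def by (simp only: mult_ac)
  then show ?thesis
    unfolding p ex y_def[symmetric] gauss_density_def by simp
qed

lemma distr_mehler:
  fixes x :: "'a::euclidean_space"
  assumes c: "c\<^sup>2 < 1"
  shows "distr std_gaussian borel (\<lambda>z. c *\<^sub>R x + sqrt (1 - c\<^sup>2) *\<^sub>R z)
    = density std_gaussian (\<lambda>y. ennreal (mehler c x y))"
proof (rule measure_eqI)
  let ?s = "sqrt (1 - c\<^sup>2)"
  have s: "0 < ?s" using c by auto
  fix A assume "A \<in> sets (distr std_gaussian borel (\<lambda>z. c *\<^sub>R x + ?s *\<^sub>R z))"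
  then have [measurable]: "A \<in> sets borel" by simp
  have "emeasure (density std_gaussian (\<lambda>y. ennreal (mehler c x y))) A
    = (\<integral>\<^sup>+y. ennreal (gauss_density y) * (ennreal (mehler c x y) * indicator A y) \<partial>lborel)"
    by (simp add: emeasure_density std_gaussian_eq nn_integral_density)
  also have "\<dots> = (\<integral>\<^sup>+y. ennreal (gauss_density y) * (ennreal (mehler c x y) * indicator A y)
      \<partial>density (distr lborel borel (\<lambda>z. c *\<^sub>R x + ?s *\<^sub>R z)) (\<lambda>_. \<bar>?s\<bar>^DIM('a)))"
    using lborel_affine[of ?s "c *\<^sub>R x"] s by simp
  also have "\<dots> = (\<integral>\<^sup>+z. ennreal (mehler c x (c *\<^sub>R x + ?s *\<^sub>R z) * gauss_density (c *\<^sub>R x + ?s *\<^sub>R z) * ?s ^ DIM('a))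
       * indicator A (c *\<^sub>R x + ?s *\<^sub>R z) \<partial>lborel)"
  proof -
    have "ennreal (mehler c x y * gauss_density y * ?s ^ DIM('a))
      = ennreal (mehler c x y) * ennreal (gauss_density y) * ennreal (?s ^ DIM('a))" for y :: 'a
      unfolding ennreal_mult''[OF zero_le_power[OF less_imp_le[OF s]]] ennreal_mult''[OF gauss_density_nonneg] ..
    then show ?thesis using s by (simp only:) (simp add: nn_integral_density nn_integral_distr mult_ac)
  qed
  also have "\<dots> = (\<integral>\<^sup>+z. ennreal (gauss_density z) * indicator A (c *\<^sub>R x + ?s *\<^sub>R z) \<partial>lborel)"
    by (simp add: mehler_gauss_density[OF c])
  also have "\<dots> = emeasure (distr std_gaussian borel (\<lambda>z. c *\<^sub>R x + ?s *\<^sub>R z)) A"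
    by (simp add: nn_integral_indicator[symmetric] nn_integral_distr std_gaussian_eq nn_integral_density del: nn_integral_indicator)
  finally show "emeasure (distr std_gaussian borel (\<lambda>z. c *\<^sub>R x + ?s *\<^sub>R z)) A
    = emeasure (density std_gaussian (\<lambda>y. ennreal (mehler c x y))) A" by simp
qed simp

lemma nn_integral_mehler:
  assumes "c\<^sup>2 < 1" and [measurable]: "F \<in> borel_measurable borel"
  shows "(\<integral>\<^sup>+z. F (c *\<^sub>R x + sqrt (1 - c\<^sup>2) *\<^sub>R z) \<partial>std_gaussian) = (\<integral>\<^sup>+y. ennreal (mehler c x y) * F y \<partial>std_gaussian)"
proof -
  have "(\<integral>\<^sup>+z. F (c *\<^sub>R x + sqrt (1 - c\<^sup>2) *\<^sub>R z) \<partial>std_gaussian)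
    = (\<integral>\<^sup>+y. F y \<partial>distr std_gaussian borel (\<lambda>z. c *\<^sub>R x + sqrt (1 - c\<^sup>2) *\<^sub>R z))"
    by (simp add: nn_integral_distr)
  then show ?thesis unfolding distr_mehler[OF assms(1)] by (simp add: nn_integral_density)
qed

lemma integrable_mehler:
  fixes F :: "'a::euclidean_space \<Rightarrow> 'b::{banach, second_countable_topology}"
  assumes "c\<^sup>2 < 1" and [measurable]: "F \<in> borel_measurable borel"
  shows "integrable std_gaussian (\<lambda>z. F (c *\<^sub>R x + sqrt (1 - c\<^sup>2) *\<^sub>R z))
    \<longleftrightarrow> integrable std_gaussian (\<lambda>y. mehler c x y *\<^sub>R F y)"
proof -
  have "integrable std_gaussian (\<lambda>z. F (c *\<^sub>R x + sqrt (1 - c\<^sup>2) *\<^sub>R z))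
    = integrable (distr std_gaussian borel (\<lambda>z. c *\<^sub>R x + sqrt (1 - c\<^sup>2) *\<^sub>R z)) F"
    by (simp add: integrable_distr_eq)
  then show ?thesis unfolding distr_mehler[OF assms(1)]
    by (subst (asm) integrable_density) (use mehler_pos[OF assms(1)] in \<open>auto intro!: AE_I2 less_imp_le\<close>)
qed

lemma integral_mehler:
  fixes F :: "'a::euclidean_space \<Rightarrow> 'b::{banach, second_countable_topology}"
  assumes "c\<^sup>2 < 1" and [measurable]: "F \<in> borel_measurable borel"
  shows "(LINT z|std_gaussian. F (c *\<^sub>R x + sqrt (1 - c\<^sup>2) *\<^sub>R z)) = (LINT y|std_gaussian. mehler c x y *\<^sub>R F y)"
proof -
  have "(LINT z|std_gaussian. F (c *\<^sub>R x + sqrt (1 - c\<^sup>2) *\<^sub>R z))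
    = (LINT y|distr std_gaussian borel (\<lambda>z. c *\<^sub>R x + sqrt (1 - c\<^sup>2) *\<^sub>R z). F y)"
    by (simp add: integral_distr)
  then show ?thesis unfolding distr_mehler[OF assms(1)]
    by (subst (asm) integral_density) (use mehler_pos[OF assms(1)] in \<open>auto intro!: AE_I2 less_imp_le\<close>)
qed

interpretation gauss2: pair_prob_space "std_gaussian :: 'a::euclidean_space measure" "std_gaussian :: 'a measure"
  by standard

text \<open>The joint law of the stationary process at two times, with correlation c.\<close>

definition ou_pair :: "real \<Rightarrow> ('a::euclidean_space \<times> 'a) measure" where
  "ou_pair c = distr (std_gaussian \<Otimes>\<^sub>M std_gaussian) (borel \<Otimes>\<^sub>M borel)
     (\<lambda>(x, z). (x, c *\<^sub>R x + sqrt (1 - c\<^sup>2) *\<^sub>R z))"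

lemma nn_integral_ou_pair:
  assumes c: "c\<^sup>2 < 1" and [measurable]: "F \<in> borel_measurable (borel \<Otimes>\<^sub>M borel)"
  shows "(\<integral>\<^sup>+p. F p \<partial>ou_pair c) = (\<integral>\<^sup>+x. \<integral>\<^sup>+y. ennreal (mehler c x y) * F (x, y) \<partial>std_gaussian \<partial>std_gaussian)"
  unfolding ou_pair_def
  by (subst nn_integral_distr, simp, simp, subst gauss.nn_integral_fst[symmetric])
     (simp_all add: nn_integral_mehler[OF c, where F="\<lambda>y. F (_, y)"])

text \<open>Reversibility: the pair has the symmetric density \<open>mehler c\<close> with respect
  to the product Gaussian measure, so the swap is Fubini together with
  \<open>mehler_commute\<close>. Self-adjointness and invariance of the semigroup rest on
  this.\<close>

lemma ou_pair_swap:
  assumes c: "c\<^sup>2 < 1"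
  shows "distr (ou_pair c) (borel \<Otimes>\<^sub>M borel) (\<lambda>(x, y). (y, x)) = (ou_pair c :: ('a::euclidean_space \<times> 'a) measure)"
proof (rule measure_eqI)
  fix A assume "A \<in> sets (distr (ou_pair c) (borel \<Otimes>\<^sub>M borel) (\<lambda>(x, y). (y, x :: 'a)))"
  then have [measurable]: "A \<in> sets (borel \<Otimes>\<^sub>M borel)" by simp
  have [measurable_cong]: "sets (ou_pair c) = sets (borel \<Otimes>\<^sub>M (borel :: 'a measure))"
    by (simp add: ou_pair_def)
  have "emeasure (distr (ou_pair c) (borel \<Otimes>\<^sub>M borel) (\<lambda>(x, y). (y, x))) A
    = (\<integral>\<^sup>+p. indicator A (snd p, fst p) \<partial>ou_pair c)"
    by (simp add: nn_integral_indicator[symmetric] nn_integral_distr split_beta del: nn_integral_indicator)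
  also have "\<dots> = (\<integral>\<^sup>+x. \<integral>\<^sup>+y. ennreal (mehler c x y) * indicator A (y, x) \<partial>std_gaussian \<partial>std_gaussian)"
    by (subst nn_integral_ou_pair[OF c]) simp_all
  also have "\<dots> = (\<integral>\<^sup>+x. \<integral>\<^sup>+y. ennreal (mehler c x y) * indicator A (x, y) \<partial>std_gaussian \<partial>std_gaussian)"
    by (subst gauss2.Fubini') (simp_all add: mehler_commute[of c])
  also have "\<dots> = (\<integral>\<^sup>+p. indicator A p \<partial>ou_pair c)"
    by (subst nn_integral_ou_pair[OF c]) simp_all
  finally show "emeasure (distr (ou_pair c) (borel \<Otimes>\<^sub>M borel) (\<lambda>(x, y). (y, x))) A = emeasure (ou_pair c) A"
    by simp
qed (simp add: ou_pair_def)

section \<open>Smooth functions\<close>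

lemma grad_eqI: "GDERIV g x :> D \<Longrightarrow> grad g x = D"
proof -
  assume D: "GDERIV g x :> D"
  show ?thesis unfolding grad_def
  proof (rule the_equality)
    show "GDERIV g x :> D" by (rule D)
    fix E assume "GDERIV g x :> E"
    with D have "(\<lambda>h. h \<bullet> E) = (\<lambda>h. h \<bullet> D)"
      unfolding gderiv_def by (rule has_derivative_unique[rotated])
    then show "E = D" by (metis inner_commute vector_eq_ldot)
  qed
qed

lemma GDERIV_grad: "g differentiable (at x) \<Longrightarrow> GDERIV g x :> grad g x"
proof -
  assume "g differentiable (at x)"
  then obtain D where D: "(g has_derivative D) (at x)" by (auto simp: differentiable_def)
  then interpret D: bounded_linear D by (rule has_derivative_bounded_linear)
  have "D h = h \<bullet> (\<Sum>b\<in>Basis. D b *\<^sub>R b)" for h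
  proof -
    have "D h = D (\<Sum>b\<in>Basis. (h \<bullet> b) *\<^sub>R b)" by (simp add: euclidean_representation)
    also have "\<dots> = (\<Sum>b\<in>Basis. (h \<bullet> b) * D b)" by (simp add: D.sum D.scaleR)
    finally show ?thesis by (simp add: inner_sum_right mult.commute)
  qed
  then have "D = (\<lambda>h. h \<bullet> (\<Sum>b\<in>Basis. D b *\<^sub>R b))" by (rule ext)
  with D have G: "GDERIV g x :> (\<Sum>b\<in>Basis. D b *\<^sub>R b)" unfolding gderiv_def by (rule back_subst)
  show ?thesis unfolding grad_eqI[OF G] by (rule G)
qed

lemma GDERIV_differentiable: "GDERIV g x :> D \<Longrightarrow> g differentiable (at x)"
  unfolding gderiv_def differentiable_def by blast

text \<open>Since \<open>grad\<close> is a definite description, smoothness proofs supply the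
  gradient by hand; this rule replaces \<open>grad g\<close> by any pointwise formula for
  it.\<close>

lemma Ck_SucI:
  assumes "\<And>x. GDERIV g x :> G x" and "\<And>b. b \<in> Basis \<Longrightarrow> Ck k (\<lambda>x. G x \<bullet> b)"
  shows "Ck (Suc k) g"
proof -
  have "grad g = G" using grad_eqI[OF assms(1)] by blast
  moreover have "g differentiable (at x)" for x by (rule GDERIV_differentiable[OF assms(1)])
  ultimately show ?thesis using assms(2) by simp
qed

lemma Ck_GDERIV: "Ck (Suc k) g \<Longrightarrow> GDERIV g x :> grad g x"
  using GDERIV_grad by auto

lemma Ck_Suc_imp: "Ck (Suc k) g \<Longrightarrow> Ck k g"
proof (induction k arbitrary: g)
  case 0
  then show ?case
    by (auto intro!: continuous_at_imp_continuous_on differentiable_imp_continuous_within)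
next
  case (Suc k)
  show ?case using Suc.prems Suc.IH by auto
qed

lemma GDERIV_inner: "GDERIV (\<lambda>x. x \<bullet> v) x :> v"
  unfolding gderiv_def by (intro bounded_linear_imp_has_derivative bounded_linear_inner_left)

lemma Ck_const: "Ck k (\<lambda>x. a)"
  by (induction k arbitrary: a) (simp, rule Ck_SucI[OF GDERIV_const], simp)

lemma Ck_inner: "Ck k (\<lambda>x. x \<bullet> v)"
  by (cases k) (auto intro!: continuous_intros Ck_SucI[OF GDERIV_inner] Ck_const simp del: Ck.simps(2))

lemma Ck_add: "Ck k f \<Longrightarrow> Ck k g \<Longrightarrow> Ck k (\<lambda>x. f x + g x)"
proof (induction k arbitrary: f g)
  case (Suc k)
  show ?case
    by (rule Ck_SucI[OF GDERIV_add[OF Ck_GDERIV[OF Suc.prems(1)] Ck_GDERIV[OF Suc.prems(2)]]])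
       (use Suc in \<open>auto simp: inner_add_left\<close>)
qed (auto intro!: continuous_intros)

lemma Ck_mult: "Ck k f \<Longrightarrow> Ck k g \<Longrightarrow> Ck k (\<lambda>x. f x * g x)"
proof (induction k arbitrary: f g)
  case (Suc k)
  have fg: "Ck k f" "Ck k g" using Suc.prems by (auto dest: Ck_Suc_imp simp del: Ck.simps)
  show ?case
  proof (rule Ck_SucI[OF GDERIV_mult[OF Ck_GDERIV[OF Suc.prems(1)] Ck_GDERIV[OF Suc.prems(2)]]])
    fix b :: 'a assume b: "b \<in> Basis"
    have "Ck k (\<lambda>x. grad f x \<bullet> b)" "Ck k (\<lambda>x. grad g x \<bullet> b)" using Suc.prems b by auto
    from Ck_add[OF Suc.IH[OF fg(1) this(2)] Suc.IH[OF fg(2) this(1)]]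
    show "Ck k (\<lambda>x. (f x *\<^sub>R grad g x + g x *\<^sub>R grad f x) \<bullet> b)"
      unfolding inner_add_left inner_scaleR_left .
  qed
qed (auto intro!: continuous_intros)

lemma Ck_cmult: "Ck k f \<Longrightarrow> Ck k (\<lambda>x. a * f x)"
  by (intro Ck_mult Ck_const)

lemma GDERIV_quadratic: "GDERIV (\<lambda>y. v \<bullet> y + \<beta> * (y \<bullet> y) + r) x :> v + (2 * \<beta>) *\<^sub>R x"
  unfolding gderiv_def
  by (auto intro!: derivative_eq_intros simp: inner_add_right inner_commute algebra_simps)

lemma Ck_affine: "Ck k (\<lambda>y. (v + a *\<^sub>R y) \<bullet> b)"
  using Ck_add[OF Ck_const[of k "v \<bullet> b"] Ck_cmult[OF Ck_inner[of k b], of a]]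
  by (simp add: inner_add_left)

text \<open>Each derivative is the same exponential times an affine function, so the induction
  closes. The Gaussian factors of the Mehler kernel, and the kernel taken against Lebesgue measure,
  are of this form.\<close>

lemma Ck_exp_quadratic: "Ck k (\<lambda>y. exp (v \<bullet> y + \<beta> * (y \<bullet> y) + r))"
proof (induction k)
  case 0 then show ?case by (auto intro!: continuous_intros)
next
  case (Suc k)
  show ?case
  proof (rule Ck_SucI)
    fix x show "GDERIV (\<lambda>y. exp (v \<bullet> y + \<beta> * (y \<bullet> y) + r)) x
        :> exp (v \<bullet> x + \<beta> * (x \<bullet> x) + r) *\<^sub>R (v + (2 * \<beta>) *\<^sub>R x)"
      by (rule GDERIV_DERIV_compose[OF GDERIV_quadratic DERIV_exp])
  next
    fix b :: 'a
    show "Ck k (\<lambda>x. (exp (v \<bullet> x + \<beta> * (x \<bullet> x) + r) *\<^sub>R (v + (2 * \<beta>) *\<^sub>R x)) \<bullet> b)"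
      unfolding inner_scaleR_left by (rule Ck_mult[OF Suc Ck_affine])
  qed
qed

text \<open>Allowing all exponents \<open>m\<close> makes the family closed under differentiation.\<close>

definition bump_tail :: "nat \<Rightarrow> real \<Rightarrow> real" where
  "bump_tail m t = (if 0 < t then exp (- (1 / t)) / t ^ m else 0)"

lemma bump_tail_tendsto_0: "((\<lambda>t. bump_tail m t) \<longlongrightarrow> 0) (at 0)"
proof -
  have "((\<lambda>t. exp (- (1 / t)) / t ^ m) \<longlongrightarrow> 0) (at_right (0::real))"
  proof -
    have "((\<lambda>y::real. y ^ m / exp y) \<longlongrightarrow> 0) at_top" by (rule tendsto_power_div_exp_0)
    then have "((\<lambda>t::real. (inverse t) ^ m / exp (inverse t)) \<longlongrightarrow> 0) (at_right 0)"
      by (rule filterlim_compose[OF _ filterlim_inverse_at_top_right])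
    then show ?thesis by (simp add: exp_minus divide_inverse power_inverse mult.commute)
  qed
  moreover have "\<forall>\<^sub>F t in at_right 0. exp (- (1 / t)) / t ^ m = bump_tail m t"
    by (simp add: bump_tail_def eventually_at_filter)
  ultimately have "((\<lambda>t. bump_tail m t) \<longlongrightarrow> 0) (at_right 0)"
    by (rule Lim_transform_eventually)
  moreover have "((\<lambda>t. bump_tail m t) \<longlongrightarrow> 0) (at_left 0)"
    by (rule tendsto_eventually) (auto simp: eventually_at_filter bump_tail_def)
  ultimately show ?thesis by (simp add: filterlim_split_at)
qed

lemma DERIV_bump_tail: "(bump_tail m has_real_derivative bump_tail (m + 2) t - m * bump_tail (m + 1) t) (at t)"
proof -
  consider "t > 0" | "t < 0" | "t = 0" by linarith
  then show ?thesis
  proof cases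
    case 1
    have "((\<lambda>t. exp (- (1 / t)) / t ^ m) has_real_derivative
      (exp (- (1 / t)) * (1 / t\<^sup>2) * t ^ m - exp (- (1 / t)) * (m * t ^ (m - 1))) / (t ^ m * t ^ m)) (at t)"
      by (rule derivative_eq_intros refl | use 1 in \<open>simp add: power2_eq_square\<close>)+
    moreover have "(exp (- (1 / t)) * (1 / t\<^sup>2) * t ^ m - exp (- (1 / t)) * (m * t ^ (m - 1))) / (t ^ m * t ^ m)
      = bump_tail (m + 2) t - m * bump_tail (m + 1) t"
    proof -
      have e: "(E * (1 / (t * t)) * P - E * (r * Q)) / (P * P) = E / (P * (t * t)) - r * (E / (P * t))"
        if "r * Q * t = r * P" "P \<noteq> 0" for E P Q r :: real
      proof -
        have "r * Q = r * P / t" using that 1 by (simp add: eq_divide_eq)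
        then show ?thesis using that(2) 1 by (simp add: diff_divide_distrib mult.commute mult.left_commute)
      qed
      show ?thesis
        unfolding bump_tail_def power_add power2_eq_square power_one_right
        using 1 e[of "real m" "t ^ (m - 1)" "t ^ m" "exp (- (1 / t))"]
        by (cases m) simp_all
    qed
    ultimately have "((\<lambda>t. exp (- (1 / t)) / t ^ m) has_real_derivative bump_tail (m + 2) t - m * bump_tail (m + 1) t) (at t)"
      by simp
    moreover have "\<forall>\<^sub>F s in nhds t. exp (- (1 / s)) / s ^ m = bump_tail m s"
      using eventually_nhds_in_open[of "{0<..}" t] 1 by (auto elim!: eventually_mono simp: bump_tail_def)
    ultimately show ?thesis by (subst (asm) DERIV_cong_ev[OF refl _ refl]) auto
  next
    case 2
    have "\<forall>\<^sub>F s in nhds t. 0 = bump_tail m s"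
      using eventually_nhds_in_open[of "{..<0}" t] 2 by (auto elim!: eventually_mono simp: bump_tail_def)
    moreover have "((\<lambda>t::real. 0) has_real_derivative bump_tail (m + 2) t - m * bump_tail (m + 1) t) (at t)"
      using 2 by (simp add: bump_tail_def)
    ultimately show ?thesis by (subst (asm) DERIV_cong_ev[OF refl _ refl]) auto
  next
    case 3
    \<comment> \<open>At 0 the difference quotient is again a member of the family, with the
      exponent raised by one, so its limit is known.\<close>
    have "(bump_tail m h - bump_tail m 0) / h = bump_tail (Suc m) h" for h
      by (simp add: bump_tail_def)
    then show ?thesis using bump_tail_tendsto_0[of "Suc m"] 3
      by (simp add: DERIV_def bump_tail_def)
  qed
qed

lemma Ck_bump_tail: "Ck k (\<lambda>y. bump_tail m (v \<bullet> y + \<beta> * (y \<bullet> y) + r))"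
proof (induction k arbitrary: m)
  case 0
  have "isCont (bump_tail m) t" for t by (rule DERIV_isCont[OF DERIV_bump_tail])
  then have "continuous_on UNIV (bump_tail m)" by (simp add: continuous_at_imp_continuous_on)
  then show ?case
    by (auto intro!: continuous_intros continuous_on_compose2[of UNIV "bump_tail m"])
next
  case (Suc k)
  show ?case
  proof (rule Ck_SucI)
    fix x
    let ?q = "v \<bullet> x + \<beta> * (x \<bullet> x) + r"
    show "GDERIV (\<lambda>y. bump_tail m (v \<bullet> y + \<beta> * (y \<bullet> y) + r)) x
        :> (bump_tail (m + 2) ?q - m * bump_tail (m + 1) ?q) *\<^sub>R (v + (2 * \<beta>) *\<^sub>R x)"
      by (rule GDERIV_DERIV_compose[OF GDERIV_quadratic DERIV_bump_tail])
  next
    fix b :: 'a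
    have "Ck k (\<lambda>x. bump_tail (m + 2) (v \<bullet> x + \<beta> * (x \<bullet> x) + r) + - real m * bump_tail (m + 1) (v \<bullet> x + \<beta> * (x \<bullet> x) + r))"
      by (intro Ck_add Ck_cmult Suc)
    from Ck_mult[OF this Ck_affine[of k v "2 * \<beta>" b]]
    show "Ck k (\<lambda>x. ((bump_tail (m + 2) (v \<bullet> x + \<beta> * (x \<bullet> x) + r) - m * bump_tail (m + 1) (v \<bullet> x + \<beta> * (x \<bullet> x) + r))
        *\<^sub>R (v + (2 * \<beta>) *\<^sub>R x)) \<bullet> b)"
      by simp
  qed
qed

text \<open>Written through x . x instead of the norm, so that \<open>Ck_bump_tail\<close> applies
  directly; the factor \<open>exp 1\<close> normalises the value at the origin to 1.\<close>

definition cutoff :: "real \<Rightarrow> 'a::euclidean_space \<Rightarrow> real" where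
  "cutoff R x = exp 1 * bump_tail 0 (1 - (x \<bullet> x) / R\<^sup>2)"

lemma Ck_cutoff: "Ck k (cutoff R)"
  using Ck_cmult[OF Ck_bump_tail[of k 0 0 "- 1 / R\<^sup>2" 1], of "exp 1"]
  unfolding cutoff_def[abs_def] by (simp add: algebra_simps)

lemma cutoff_nonneg: "0 \<le> cutoff R x"
  by (simp add: cutoff_def bump_tail_def)

lemma cutoff_le_1: "cutoff R x \<le> 1"
proof (cases "0 < 1 - (x \<bullet> x) / R\<^sup>2")
  case True
  have "1 - (x \<bullet> x) / R\<^sup>2 \<le> 1" by simp
  then have "1 \<le> 1 / (1 - (x \<bullet> x) / R\<^sup>2)" using True by (simp add: field_simps)
  then show ?thesis using True by (simp add: cutoff_def bump_tail_def exp_add[symmetric])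
qed (simp add: cutoff_def bump_tail_def)

lemma cutoff_eq_0: "0 < R \<Longrightarrow> R \<le> norm x \<Longrightarrow> cutoff R x = 0"
  using power_mono[of R "norm x" 2] by (simp add: cutoff_def bump_tail_def dot_square_norm field_simps not_less)

lemma cutoff_tendsto_1: "((\<lambda>n. cutoff (real (Suc n)) x) \<longlongrightarrow> 1) sequentially"
proof -
  have 1: "((\<lambda>n. 1 - (x \<bullet> x) / (real (Suc n))\<^sup>2) \<longlongrightarrow> 1) sequentially" by real_asymp
  have "isCont (bump_tail 0) 1" by (rule DERIV_isCont[OF DERIV_bump_tail])
  from isCont_tendsto_compose[OF this 1]
  have "((\<lambda>n. exp 1 * bump_tail 0 (1 - (x \<bullet> x) / (real (Suc n))\<^sup>2)) \<longlongrightarrow> exp 1 * bump_tail 0 1) sequentially"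
    by (intro tendsto_intros)
  then show ?thesis by (simp add: cutoff_def bump_tail_def exp_minus)
qed

text \<open>With u = 1 / t the claim is u^2 exp(-u) <= 2, which the quadratic Taylor bound for exp
  gives.\<close>

lemma bump_tail_le: "0 \<le> bump_tail 2 t" "t \<le> 1 \<Longrightarrow> bump_tail 2 t \<le> 2"
proof -
  show "0 \<le> bump_tail 2 t" by (simp add: bump_tail_def)
  show "bump_tail 2 t \<le> 2"
  proof (cases "0 < t")
    case True
    define u where "u = 1 / t"
    have u: "0 < u" using True by (simp add: u_def)
    have "u\<^sup>2 / 2 \<le> exp u"
      using exp_lower_Taylor_quadratic[of u] u by (smt (verit))
    then have "u\<^sup>2 \<le> 2 * exp u" by simp
    then show ?thesis using True by (simp add: bump_tail_def u_def exp_minus field_simps)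
  qed (simp add: bump_tail_def)
qed

lemma grad_cutoff:
  fixes x :: "'a::euclidean_space"
  assumes "0 < R"
  shows "GDERIV (cutoff R) x :> grad (cutoff R) x" "norm (grad (cutoff R) x) \<le> 12 / R"
proof -
  have D: "GDERIV (cutoff R) x :> (exp 1 * bump_tail 2 (1 - (x \<bullet> x) / R\<^sup>2)) *\<^sub>R ((- 2 / R\<^sup>2) *\<^sub>R x)"
  proof -
    have "GDERIV (\<lambda>y. bump_tail 0 (0 \<bullet> y + (- 1 / R\<^sup>2) * (y \<bullet> y) + 1)) x :>
      (bump_tail (0 + 2) (0 \<bullet> x + (- 1 / R\<^sup>2) * (x \<bullet> x) + 1) - real 0 * bump_tail (0 + 1) (0 \<bullet> x + (- 1 / R\<^sup>2) * (x \<bullet> x) + 1))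
        *\<^sub>R (0 + (2 * (- 1 / R\<^sup>2)) *\<^sub>R x)"
      by (rule GDERIV_DERIV_compose[OF GDERIV_quadratic DERIV_bump_tail])
    from GDERIV_mult[OF GDERIV_const[of "exp 1"] this] show ?thesis
      unfolding cutoff_def[abs_def] by (simp add: algebra_simps numeral_2_eq_2)
  qed
  then show "GDERIV (cutoff R) x :> grad (cutoff R) x" using grad_eqI[OF D] by simp
  have "norm (grad (cutoff R) x) = exp 1 * bump_tail 2 (1 - (x \<bullet> x) / R\<^sup>2) * (2 * norm x / R\<^sup>2)"
    using bump_tail_le(1)[of "1 - (x \<bullet> x) / R\<^sup>2"] grad_eqI[OF D] by simp
  also have "\<dots> \<le> 12 / R"
  proof (cases "norm x < R")
    case True
    \<comment> \<open>The 12 is made of three factors: e is at most 3, \<open>bump_tail 2\<close> is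
      at most 2, and norm x < R in 2 norm x / R^2 leaves 2 / R.\<close>
    have "exp 1 * bump_tail 2 (1 - (x \<bullet> x) / R\<^sup>2) * (2 * norm x / R\<^sup>2) \<le> (3 * 2) * (2 * R / R\<^sup>2)"
      using exp_le bump_tail_le[of "1 - (x \<bullet> x) / R\<^sup>2"] True assms
      by (intro mult_mono divide_right_mono) auto
    then show ?thesis using assms by (simp add: power2_eq_square)
  next
    case False
    then have "R\<^sup>2 \<le> (norm x)\<^sup>2" using assms by (intro power_mono) auto
    then have "1 \<le> (x \<bullet> x) / R\<^sup>2"
      using assms unfolding dot_square_norm by (subst le_divide_eq_1_pos) auto
    then have "bump_tail 2 (1 - (x \<bullet> x) / R\<^sup>2) = 0"
      by (simp add: bump_tail_def)
    then show ?thesis using assms by simp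
  qed
  finally show "norm (grad (cutoff R) x) \<le> 12 / R" .
qed

text \<open>Dominated convergence along sequences. On the ball the mean value inequality bounds the
  increment by B y times the step, and the subtracted linear term obeys the same bound, hence the
  majorant \<open>2 * B y\<close>. Real parameters are covered as well, the reals being a Euclidean
  space.\<close>

lemma GDERIV_integral:
  fixes k :: "'a::euclidean_space \<Rightarrow> 'b \<Rightarrow> real" and kg :: "'a \<Rightarrow> 'b \<Rightarrow> 'a"
  assumes e: "0 < e"
    and D: "\<And>x y. y \<in> space M \<Longrightarrow> x \<in> ball x0 e \<Longrightarrow> GDERIV (\<lambda>x. k x y) x :> kg x y"
    and int: "\<And>x. x \<in> ball x0 e \<Longrightarrow> integrable M (k x)"
    and meas [measurable]: "kg x0 \<in> borel_measurable M"
    and B: "integrable M B" "\<And>x y. y \<in> space M \<Longrightarrow> x \<in> ball x0 e \<Longrightarrow> norm (kg x y) \<le> B y"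
  shows "GDERIV (\<lambda>x. LINT y|M. k x y) x0 :> (LINT y|M. kg x0 y)"
    and "integrable M (kg x0)"
proof -
  show ig: "integrable M (kg x0)"
    by (rule Bochner_Integration.integrable_bound[OF B(1)]) (use B(2)[of _ x0] e in \<open>auto intro!: AE_I2 order_trans[OF _ abs_ge_self]\<close>)
  let ?F = "\<lambda>x. LINT y|M. k x y" and ?G = "LINT y|M. kg x0 y"
  have "((\<lambda>h. (?F (x0 + h) - ?F x0 - h \<bullet> ?G) / norm h) \<longlongrightarrow> 0) (at 0)"
    unfolding tendsto_at_iff_sequentially
  proof (intro allI impI)
    fix X :: "nat \<Rightarrow> 'a" assume X0: "\<forall>i. X i \<in> UNIV - {0}" and X: "X \<longlonglongrightarrow> 0"
    from X e have "\<forall>\<^sub>F n in sequentially. dist (X n) 0 < e" by (rule tendstoD)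
    then obtain N where N: "\<And>n. N \<le> n \<Longrightarrow> norm (X n) < e" by (auto simp: eventually_sequentially)
    \<comment> \<open>Shifting by \<open>N\<close> discards the terms that lie outside the
      ball.\<close>
    let ?q = "\<lambda>n y. (k (x0 + X (n + N)) y - k x0 y - X (n + N) \<bullet> kg x0 y) / norm (X (n + N))"
    have Xn: "X (n + N) \<noteq> 0" "x0 + X (n + N) \<in> ball x0 e" for n
      using X0 N[of "n + N"] by (auto simp: dist_norm)
    have x0: "x0 \<in> ball x0 e" using e by simp
    have "(\<lambda>n. LINT y|M. ?q n y) \<longlonglongrightarrow> (LINT y|M. 0)"
    proof (rule integral_dominated_convergence[where w="\<lambda>y. 2 * B y"])
      show "integrable M (\<lambda>y. 2 * B y)" using B(1) by simp
      show "?q n \<in> borel_measurable M" for n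
        using borel_measurable_integrable[OF int[OF Xn(2)[of n]]] borel_measurable_integrable[OF int[OF x0]]
        by measurable
      show "AE y in M. (\<lambda>n. ?q n y) \<longlonglongrightarrow> 0"
      proof (rule AE_I2)
        fix y assume y: "y \<in> space M"
        have "((\<lambda>h. (k (x0 + h) y - k x0 y - h \<bullet> kg x0 y) / norm h) \<longlongrightarrow> 0) (at 0)"
          by (rule tendsto_norm_zero_cancel)
             (use D[OF y x0] in \<open>simp add: gderiv_def has_derivative_at norm_divide\<close>)
        moreover have "(\<lambda>n. X (n + N)) \<longlonglongrightarrow> 0" using X by (rule LIMSEQ_ignore_initial_segment)
        ultimately show "(\<lambda>n. ?q n y) \<longlonglongrightarrow> 0"
          unfolding tendsto_at_iff_sequentially using Xn(1) by (auto simp: o_def)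
      qed
      show "AE y in M. norm (?q n y) \<le> 2 * B y" for n
      proof (rule AE_I2)
        fix y assume y: "y \<in> space M"
        have "norm (k (x0 + X (n + N)) y - k x0 y) \<le> B y * norm (x0 + X (n + N) - x0)"
        proof (rule differentiable_bound[of "ball x0 e" "\<lambda>x. k x y" "\<lambda>x h. h \<bullet> kg x y"])
          show "((\<lambda>x. k x y) has_derivative (\<lambda>h. h \<bullet> kg x y)) (at x within ball x0 e)" if "x \<in> ball x0 e" for x
            using D[OF y that] unfolding gderiv_def by (rule has_derivative_at_withinI)
          show "onorm (\<lambda>h. h \<bullet> kg x y) \<le> B y" if "x \<in> ball x0 e" for x
          proof (rule onorm_le)
            fix h
            have "norm (h \<bullet> kg x y) \<le> norm h * norm (kg x y)" by (simp add: Cauchy_Schwarz_ineq2)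
            also have "\<dots> \<le> B y * norm h" using mult_left_mono[OF B(2)[OF y that], of "norm h"] by (simp add: mult.commute)
            finally show "norm (h \<bullet> kg x y) \<le> B y * norm h" .
          qed
        qed (use x0 Xn in auto)
        moreover have "\<bar>X (n + N) \<bullet> kg x0 y\<bar> \<le> norm (X (n + N)) * B y"
          by (rule order_trans[OF Cauchy_Schwarz_ineq2 mult_left_mono[OF B(2)[OF y x0]]]) simp
        ultimately have "\<bar>k (x0 + X (n + N)) y - k x0 y - X (n + N) \<bullet> kg x0 y\<bar> \<le> 2 * (norm (X (n + N)) * B y)"
          by (simp add: mult.commute[of "B y"])
        then show "norm (?q n y) \<le> 2 * B y" using Xn(1)[of n] by (simp add: pos_divide_le_eq mult.commute mult.left_commute)
      qed
    qed simp
    moreover have "(LINT y|M. ?q n y) = (?F (x0 + X (n + N)) - ?F x0 - X (n + N) \<bullet> ?G) / norm (X (n + N))" for n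
      using int[OF Xn(2)] int[OF x0] ig by simp
    ultimately have "(\<lambda>n. (?F (x0 + X (n + N)) - ?F x0 - X (n + N) \<bullet> ?G) / norm (X (n + N))) \<longlonglongrightarrow> 0"
      by (simp only: Bochner_Integration.integral_zero)
    then show "((\<lambda>h. (?F (x0 + h) - ?F x0 - h \<bullet> ?G) / norm h) \<circ> X) \<longlonglongrightarrow> 0"
      unfolding o_def by (rule LIMSEQ_offset)
  qed
  from tendsto_norm_zero[OF this]
  show "GDERIV ?F x0 :> ?G"
    unfolding gderiv_def has_derivative_at by (auto intro: bounded_linear_inner_left simp: norm_divide)
qed

section \<open>Moments of the Gaussian measure and smoothness of Laplace transforms\<close>

lemma gauss1_moments:
  "integrable gauss1 (\<lambda>x. x)" "integral\<^sup>L gauss1 (\<lambda>x. x) = 0"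
  "integrable gauss1 (\<lambda>x. x\<^sup>2)" "integral\<^sup>L gauss1 (\<lambda>x. x\<^sup>2) = 1"
  "integral\<^sup>L gauss1 (\<lambda>x. 1 :: real) = 1"
proof -
  show "integrable gauss1 (\<lambda>x. x)" "integral\<^sup>L gauss1 (\<lambda>x. x) = 0"
    using integrable_std_normal_moment[of 1] std_normal_moment_odd[of 0]
    by (simp_all add: integrable_density integral_density has_bochner_integral_iff)
  show "integrable gauss1 (\<lambda>x. x\<^sup>2)" "integral\<^sup>L gauss1 (\<lambda>x. x\<^sup>2) = 1"
    using integrable_std_normal_moment[of 2] std_normal_moment_even[of 1]
    by (simp_all add: integrable_density integral_density has_bochner_integral_iff)
  show "integral\<^sup>L gauss1 (\<lambda>x. 1 :: real) = 1"
    using prob_space.prob_space[OF prob_space_gauss1] by (subst lebesgue_integral_const) simp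
qed

lemma gauss_moments_inner:
  fixes b b' :: "'a::euclidean_space"
  assumes b: "b \<in> Basis" "b' \<in> Basis"
  shows "integrable std_gaussian (\<lambda>x. (x \<bullet> b) * (x \<bullet> b'))"
    and "(LINT x|std_gaussian. (x \<bullet> b) * (x \<bullet> b')) = (if b = b' then 1 else 0)"
    and "(LINT x|std_gaussian. x \<bullet> b) = 0"
proof -
  interpret G: product_prob_space "\<lambda>_. gauss1" "Basis :: 'a set"
    by (intro product_prob_spaceI prob_space_gauss1)
  have vb: "vec_of f \<bullet> c = f c" if "c \<in> Basis" for f and c :: 'a
    using that by simp
  \<comment> \<open>Factors equal to 1 away from b and b' make the monomial a full product over
    \<open>Basis\<close>; for b = b' the two conditions multiply to x^2.\<close>
  let ?h = "\<lambda>i x. (if i = b then x else 1) * (if i = b' then x else (1 :: real))"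
  have prod: "(\<Prod>i\<in>Basis. ?h i (f i)) = f b * f b'" for f
    unfolding prod.distrib using b by (simp add: prod.delta)
  have i1: "integrable gauss1 (\<lambda>x. 1 :: real)" by (rule G.M.integrable_const)
  have hi: "integrable gauss1 (?h i)" for i
    using gauss1_moments i1 by (cases "i = b"; cases "i = b'") (simp_all add: power2_eq_square)
  have hv: "integral\<^sup>L gauss1 (?h i) = (if i = b then if i = b' then 1 else 0 else if i = b' then 0 else 1)" for i
    using gauss1_moments by (cases "i = b"; cases "i = b'") (simp_all add: power2_eq_square del: lebesgue_integral_const)
  have 1: "integrable (PiM Basis (\<lambda>_. gauss1)) (\<lambda>f. f b * f b')"
    using G.product_integrable_prod[of Basis ?h] hi unfolding prod by simp
  have 2: "(LINT f|PiM Basis (\<lambda>_. gauss1). f b * f b') = (if b = b' then 1 else 0)"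
  proof -
    have "(LINT f|PiM Basis (\<lambda>_. gauss1). f b * f b') = (\<Prod>i\<in>Basis. integral\<^sup>L gauss1 (?h i))"
      using G.product_integral_prod[of Basis ?h] hi unfolding prod by simp
    also have "\<dots> = (if b = b' then 1 else 0)"
      unfolding hv using b by (auto intro!: prod.neutral)
    finally show ?thesis .
  qed
  show "integrable std_gaussian (\<lambda>x. (x \<bullet> b) * (x \<bullet> b'))"
    unfolding std_gaussian_PiM using 1 b by (subst integrable_distr_eq) (auto simp: vb simp del: inner_sum_left_Basis)
  show "(LINT x|std_gaussian. (x \<bullet> b) * (x \<bullet> b')) = (if b = b' then 1 else 0)"
    unfolding std_gaussian_PiM using 2 b by (subst integral_distr) (auto simp: vb simp del: inner_sum_left_Basis)
  let ?k = "\<lambda>i x. (if i = b then x else (1 :: real))"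
  have prodk: "(\<Prod>i\<in>Basis. ?k i (f i)) = f b" for f using b by (simp add: prod.delta)
  have ki: "integrable gauss1 (?k i)" for i
    using gauss1_moments i1 by (cases "i = b") simp_all
  have "(LINT f|PiM Basis (\<lambda>_. gauss1). f b) = (\<Prod>i\<in>Basis. integral\<^sup>L gauss1 (?k i))"
    using G.product_integral_prod[of Basis ?k] ki unfolding prodk by simp
  also have "\<dots> = 0" using b gauss1_moments(2) by (intro prod_zero bexI[of _ b]) auto
  finally show "(LINT x|std_gaussian. x \<bullet> b) = 0"
    unfolding std_gaussian_PiM using b by (subst integral_distr) (auto simp: vb simp del: inner_sum_left_Basis)
qed

lemma integrable_gauss_norm_sq: "integrable std_gaussian (\<lambda>x::'a::euclidean_space. (norm x)\<^sup>2)"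
proof -
  have "(norm x)\<^sup>2 = (\<Sum>b\<in>Basis. (x \<bullet> b) * (x \<bullet> b))" for x :: 'a
    unfolding power2_norm_eq_inner by (rule euclidean_inner)
  then show ?thesis by (simp add: gauss_moments_inner)
qed

lemma integrable_gauss_norm: "integrable std_gaussian (\<lambda>x::'a::euclidean_space. norm x)"
proof (rule Bochner_Integration.integrable_bound)
  show "integrable std_gaussian (\<lambda>x::'a. 1 + (norm x)\<^sup>2)"
    by (intro Bochner_Integration.integrable_add gauss.integrable_const integrable_gauss_norm_sq)
  have "t \<le> 1 + t\<^sup>2" for t :: real
    using zero_le_power2[of "t - 1/2"] by (simp add: power2_eq_square algebra_simps)
  then show "AE x in std_gaussian. norm (norm x) \<le> norm (1 + (norm x)\<^sup>2)"
    by (intro AE_I2) simp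
qed simp

text \<open>A derivative of a Laplace transform is again one, with m multiplied by
  \<open>\<beta>\<close> and a coordinate of y. Finiteness of the exponential moments for every
  natural k is stable under that multiplication, which closes the induction.\<close>

lemma Ck_laplace:
  fixes m :: "'a::euclidean_space \<Rightarrow> real" and M :: "'a measure" and x :: 'a
  assumes M [measurable_cong]: "sets M = sets borel"
    and m: "m \<in> borel_measurable borel" "\<And>k::nat. integrable M (\<lambda>y. m y * exp (real k * norm y))"
  shows "integrable M (\<lambda>y. m y * exp (\<beta> * (x \<bullet> y)))"
    and "integrable M (\<lambda>y. (m y * exp (\<beta> * (x \<bullet> y)) * \<beta>) *\<^sub>R y)"
    and "GDERIV (\<lambda>x. LINT y|M. m y * exp (\<beta> * (x \<bullet> y))) x
      :> (LINT y|M. (m y * exp (\<beta> * (x \<bullet> y)) * \<beta>) *\<^sub>R y)"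
    and "Ck j (\<lambda>x. LINT y|M. m y * exp (\<beta> * (x \<bullet> y)))"
proof -
  have bnd: "\<beta> * (x \<bullet> y) \<le> \<bar>\<beta>\<bar> * norm x * norm y" for x y :: 'a
  proof -
    have "\<beta> * (x \<bullet> y) \<le> \<bar>\<beta>\<bar> * \<bar>x \<bullet> y\<bar>" by (metis abs_ge_self abs_mult)
    also have "\<dots> \<le> \<bar>\<beta>\<bar> * (norm x * norm y)" by (intro mult_left_mono Cauchy_Schwarz_ineq2) simp
    finally show ?thesis by (simp add: mult.assoc)
  qed
  have int: "integrable M (\<lambda>y. m y * exp (\<beta> * (x \<bullet> y)))"
    if [measurable]: "m \<in> borel_measurable borel" and k: "\<And>k::nat. integrable M (\<lambda>y. m y * exp (real k * norm y))" for m :: "'a \<Rightarrow> real" and x :: 'a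
  proof (rule Bochner_Integration.integrable_bound[OF k[of "nat \<lceil>\<bar>\<beta>\<bar> * norm x\<rceil>"]])
    show "AE y in M. norm (m y * exp (\<beta> * (x \<bullet> y))) \<le> norm (m y * exp (real (nat \<lceil>\<bar>\<beta>\<bar> * norm x\<rceil>) * norm y))"
    proof (rule AE_I2)
      fix y :: 'a
      have "\<bar>\<beta>\<bar> * norm x * norm y \<le> real (nat \<lceil>\<bar>\<beta>\<bar> * norm x\<rceil>) * norm y"
        by (intro mult_right_mono real_nat_ceiling_ge) simp
      with bnd[of x y] show "norm (m y * exp (\<beta> * (x \<bullet> y))) \<le> norm (m y * exp (real (nat \<lceil>\<bar>\<beta>\<bar> * norm x\<rceil>) * norm y))"
        by (simp add: abs_mult mult_left_mono)
    qed
  qed measurable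
  have D: "GDERIV (\<lambda>x. LINT y|M. m y * exp (\<beta> * (x \<bullet> y))) x
      :> (LINT y|M. (m y * exp (\<beta> * (x \<bullet> y)) * \<beta>) *\<^sub>R y)"
     and I: "integrable M (\<lambda>y. (m y * exp (\<beta> * (x \<bullet> y)) * \<beta>) *\<^sub>R y)"
    if [measurable]: "m \<in> borel_measurable borel" and k: "\<And>k::nat. integrable M (\<lambda>y. m y * exp (real k * norm y))" for m :: "'a \<Rightarrow> real" and x :: 'a
  proof -
    \<comment> \<open>\<open>norm x + 1\<close> bounds the norm on the unit ball around x; the last
      \<open>+ 1\<close> absorbs the factor norm y through norm y <= exp (norm y).\<close>
    let ?n = "nat \<lceil>\<bar>\<beta>\<bar> * (norm x + 1) + 1\<rceil>"
    note G = GDERIV_integral[of 1 M x "\<lambda>x y. m y * exp (\<beta> * (x \<bullet> y))" "\<lambda>x y. (m y * exp (\<beta> * (x \<bullet> y)) * \<beta>) *\<^sub>R y"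
        "\<lambda>y. \<bar>\<beta>\<bar> * \<bar>m y * exp (real ?n * norm y)\<bar>", OF zero_less_one]
    have d: "GDERIV (\<lambda>x. m y * exp (\<beta> * (x \<bullet> y))) x' :> (m y * exp (\<beta> * (x' \<bullet> y)) * \<beta>) *\<^sub>R y" for x' y
      unfolding gderiv_def by (auto intro!: derivative_eq_intros simp: algebra_simps)
    have b: "norm ((m y * exp (\<beta> * (x' \<bullet> y)) * \<beta>) *\<^sub>R y) \<le> \<bar>\<beta>\<bar> * \<bar>m y * exp (real ?n * norm y)\<bar>"
      if "x' \<in> ball x 1" for x' y
    proof -
      have nx: "norm x' \<le> norm x + 1"
        using that norm_triangle_ineq2[of x' x] by (simp add: dist_norm norm_minus_commute)
      have "norm y \<le> exp (norm y)" using exp_ge_add_one_self[of "norm y"] by linarith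
      then have "exp (\<beta> * (x' \<bullet> y)) * norm y \<le> exp (\<bar>\<beta>\<bar> * norm x' * norm y) * exp (norm y)"
        using bnd[of x' y] by (intro mult_mono) auto
      also have "\<dots> = exp ((\<bar>\<beta>\<bar> * norm x' + 1) * norm y)" by (simp add: exp_add[symmetric] algebra_simps)
      also have "\<dots> \<le> exp (real ?n * norm y)"
      proof -
        have "\<bar>\<beta>\<bar> * norm x' + 1 \<le> \<bar>\<beta>\<bar> * (norm x + 1) + 1" using nx by (intro add_right_mono mult_left_mono) auto
        also have "\<dots> \<le> real ?n" by (rule real_nat_ceiling_ge)
        finally have "(\<bar>\<beta>\<bar> * norm x' + 1) * norm y \<le> real ?n * norm y" by (intro mult_right_mono) auto
        then show ?thesis by simp
      qed
      finally have "\<bar>\<beta>\<bar> * \<bar>m y\<bar> * (exp (\<beta> * (x' \<bullet> y)) * norm y) \<le> \<bar>\<beta>\<bar> * \<bar>m y\<bar> * exp (real ?n * norm y)"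
        by (intro mult_left_mono) auto
      then show ?thesis by (simp add: abs_mult mult_ac)
    qed
    show "GDERIV (\<lambda>x. LINT y|M. m y * exp (\<beta> * (x \<bullet> y))) x
      :> (LINT y|M. (m y * exp (\<beta> * (x \<bullet> y)) * \<beta>) *\<^sub>R y)"
      by (rule G(1)[OF d int[OF that] _ _ b]) (use k[of ?n] in auto)
    show "integrable M (\<lambda>y. (m y * exp (\<beta> * (x \<bullet> y)) * \<beta>) *\<^sub>R y)"
      by (rule G(2)[OF d int[OF that] _ _ b]) (use k[of ?n] in auto)
  qed
  show "integrable M (\<lambda>y. m y * exp (\<beta> * (x \<bullet> y)))"
    "integrable M (\<lambda>y. (m y * exp (\<beta> * (x \<bullet> y)) * \<beta>) *\<^sub>R y)"
    "GDERIV (\<lambda>x. LINT y|M. m y * exp (\<beta> * (x \<bullet> y))) x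
      :> (LINT y|M. (m y * exp (\<beta> * (x \<bullet> y)) * \<beta>) *\<^sub>R y)"
    by (rule int[OF m] I[OF m] D[OF m])+
  show "Ck j (\<lambda>x. LINT y|M. m y * exp (\<beta> * (x \<bullet> y)))"
    using m
  proof (induction j arbitrary: m)
    case 0
    show ?case
      unfolding Ck.simps(1)
      by (rule continuous_at_imp_continuous_on, intro ballI,
          rule differentiable_imp_continuous_within[OF GDERIV_differentiable[OF D[OF 0]]])
  next
    case (Suc j)
    show ?case
    proof (rule Ck_SucI[OF D[OF Suc.prems]])
      fix b :: 'a assume b: "b \<in> Basis"
      have [measurable]: "m \<in> borel_measurable borel" by fact
      have "integrable M (\<lambda>y. (m y * \<beta> * (y \<bullet> b)) * exp (real k * norm y))" for k :: nat
      proof (rule Bochner_Integration.integrable_bound[OF integrable_mult_right[OF Suc.prems(2)[of "Suc k"], of \<beta>]])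
        show "AE y in M. norm ((m y * \<beta> * (y \<bullet> b)) * exp (real k * norm y)) \<le> norm (\<beta> * (m y * exp (real (Suc k) * norm y)))"
        proof (rule AE_I2)
          fix y :: 'a
          have "\<bar>y \<bullet> b\<bar> \<le> exp (norm y)" using exp_ge_add_one_self[of "norm y"] Basis_le_norm[OF b, of y] by linarith
          then have "\<bar>y \<bullet> b\<bar> * exp (real k * norm y) \<le> exp (norm y) * exp (real k * norm y)" by (intro mult_right_mono) auto
          also have "\<dots> = exp (real (Suc k) * norm y)" by (simp add: exp_add[symmetric] algebra_simps)
          finally have "\<bar>\<beta>\<bar> * \<bar>m y\<bar> * (\<bar>y \<bullet> b\<bar> * exp (real k * norm y)) \<le> \<bar>\<beta>\<bar> * \<bar>m y\<bar> * exp (real (Suc k) * norm y)"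
            by (intro mult_left_mono) auto
          then show "norm ((m y * \<beta> * (y \<bullet> b)) * exp (real k * norm y)) \<le> norm (\<beta> * (m y * exp (real (Suc k) * norm y)))"
            by (simp add: abs_mult mult_ac)
        qed
      qed measurable
      from Suc.IH[OF _ this] have "Ck j (\<lambda>x. LINT y|M. (m y * \<beta> * (y \<bullet> b)) * exp (\<beta> * (x \<bullet> y)))" by simp
      moreover have "(LINT y|M. (m y * exp (\<beta> * (x \<bullet> y)) * \<beta>) *\<^sub>R y) \<bullet> b
        = (LINT y|M. (m y * \<beta> * (y \<bullet> b)) * exp (\<beta> * (x \<bullet> y)))" for x
        by (subst integral_inner_left[symmetric]) (use I[OF Suc.prems] in \<open>auto simp: mult_ac\<close>)
      ultimately show "Ck j (\<lambda>x. (LINT y|M. (m y * exp (\<beta> * (x \<bullet> y)) * \<beta>) *\<^sub>R y) \<bullet> b)" by simp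
    qed
  qed
qed

section \<open>The Ornstein-Uhlenbeck semigroup\<close>

lemma prob_std_gaussian_UNIV [simp]: "measure (std_gaussian :: 'a::euclidean_space measure) UNIV = 1"
  using gauss.prob_space[where 'a='a] by simp

text \<open>In terms of the time \<open>t\<close> of the semigroup, \<open>c = exp (- t)\<close>.\<close>

definition ou :: "real \<Rightarrow> ('a::euclidean_space \<Rightarrow> real) \<Rightarrow> 'a \<Rightarrow> real" where
  "ou c u x = (LINT z|std_gaussian. u (c *\<^sub>R x + sqrt (1 - c\<^sup>2) *\<^sub>R z))"

lemma ou_measurable [measurable]:
  assumes [measurable]: "u \<in> borel_measurable borel"
  shows "ou c u \<in> borel_measurable borel"
  unfolding ou_def by measurable

lemma ou_mehler:
  assumes "c\<^sup>2 < 1" and [measurable]: "u \<in> borel_measurable borel"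
  shows "ou c u x = (LINT y|std_gaussian. mehler c x y * u y)"
  unfolding ou_def by (subst integral_mehler[OF assms]) simp

lemma mehler_eq:
  fixes x y :: "'a::euclidean_space"
  assumes "c\<^sup>2 < 1"
  shows "mehler c x y = (1 / sqrt (1 - c\<^sup>2)) ^ DIM('a)
    * exp ((norm x)\<^sup>2 / 2 - (norm (c *\<^sub>R y - x))\<^sup>2 / (2 * (1 - c\<^sup>2)))"
proof -
  have "(norm (c *\<^sub>R y - x))\<^sup>2 = c\<^sup>2 * (norm y)\<^sup>2 - 2 * c * (x \<bullet> y) + (norm x)\<^sup>2"
    unfolding power2_norm_eq_inner
    by (simp add: inner_diff_left inner_diff_right inner_commute power2_eq_square[of c] algebra_simps)
  moreover have "A / 2 - (B - C + A) / (2 * (1 - c\<^sup>2)) = - (c\<^sup>2 * A - C + B) / (2 * (1 - c\<^sup>2))" for A B C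
  proof -
    have "A / 2 = ((1 - c\<^sup>2) * A) / ((1 - c\<^sup>2) * 2)"
      using assms by (subst mult_divide_mult_cancel_left) auto
    then have "A / 2 - (B - C + A) / (2 * (1 - c\<^sup>2)) = ((1 - c\<^sup>2) * A - (B - C + A)) / (2 * (1 - c\<^sup>2))"
      by (simp only: diff_divide_distrib mult.commute)
    also have "(1 - c\<^sup>2) * A - (B - C + A) = - (c\<^sup>2 * A - C + B)" by (simp add: algebra_simps)
    finally show ?thesis .
  qed
  ultimately show ?thesis unfolding mehler_def by (simp only:)
qed

text \<open>For fixed x the kernel is bounded in y, which is why \<open>ou c u\<close> makes sense
  at every point for merely integrable \<open>u\<close>.\<close>

lemma mehler_le:
  fixes x y :: "'a::euclidean_space"
  assumes "c\<^sup>2 < 1"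
  shows "mehler c x y \<le> (1 / sqrt (1 - c\<^sup>2)) ^ DIM('a) * exp ((norm x)\<^sup>2 / 2)"
  unfolding mehler_eq[OF assms] using assms by (intro mult_left_mono) auto

lemma integrable_mehler_mult:
  assumes c: "c\<^sup>2 < 1" and u: "integrable std_gaussian u"
  shows "integrable std_gaussian (\<lambda>y. mehler c x y * u y)"
proof -
  have [measurable]: "u \<in> borel_measurable borel" using borel_measurable_integrable[OF u] by simp
  let ?K = "(1 / sqrt (1 - c\<^sup>2)) ^ DIM('a) * exp ((norm x)\<^sup>2 / 2)"
  show ?thesis
  proof (rule Bochner_Integration.integrable_bound)
    show "integrable std_gaussian (\<lambda>y. ?K * u y)" using u by simp
    show "AE y in std_gaussian. norm (mehler c x y * u y) \<le> norm (?K * u y)"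
      using mehler_le[OF c, of x] c
      by (intro AE_I2) (auto simp: abs_mult abs_of_pos[OF mehler_pos[OF c]] intro!: mult_right_mono)
  qed simp
qed

lemma integrable_ou_kernel:
  fixes u :: "'a::euclidean_space \<Rightarrow> real"
  assumes c: "c\<^sup>2 < 1" and u: "integrable std_gaussian u"
  shows "integrable std_gaussian (\<lambda>z. u (c *\<^sub>R x + sqrt (1 - c\<^sup>2) *\<^sub>R z))"
  using integrable_mehler_mult[OF assms] borel_measurable_integrable[OF u]
  by (subst integrable_mehler[OF c]) auto

text \<open>The derivative is carried by the kernel, so \<open>u\<close> need only be integrable.
  The kernel splits into a Gaussian in x, a Gaussian in y and exp(\<open>\<beta>\<close> x . y); the
  Gaussian in y makes all exponential moments finite, and what remains is a Laplace
  transform.\<close>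

lemma ou_smooth:
  fixes u :: "'a::euclidean_space \<Rightarrow> real"
  assumes c: "c \<noteq> 0" "c\<^sup>2 < 1" and u: "integrable std_gaussian u"
  shows "Ck k (ou c u)"
    and "integrable std_gaussian (\<lambda>z. u (c *\<^sub>R x + sqrt (1 - c\<^sup>2) *\<^sub>R z) *\<^sub>R z)"
    and "GDERIV (ou c u) x
      :> (c / sqrt (1 - c\<^sup>2)) *\<^sub>R (LINT z|std_gaussian. u (c *\<^sub>R x + sqrt (1 - c\<^sup>2) *\<^sub>R z) *\<^sub>R z)"
proof -
  define s where "s = sqrt (1 - c\<^sup>2)"
  have s: "0 < s" "s\<^sup>2 = 1 - c\<^sup>2" using c by (auto simp: s_def)
  have um [measurable]: "u \<in> borel_measurable borel" using borel_measurable_integrable[OF u] by simp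
  define \<alpha> where "\<alpha> = c\<^sup>2 / (2 * s\<^sup>2)"
  define \<beta> where "\<beta> = c / s\<^sup>2"
  have \<alpha>: "0 < \<alpha>" using c s(1) by (simp add: \<alpha>_def)
  define E where "E = (\<lambda>x :: 'a. (1 / s) ^ DIM('a) * exp (0 \<bullet> x + (- \<alpha>) * (x \<bullet> x) + 0))"
  define m where "m = (\<lambda>y. u y * exp (- \<alpha> * (y \<bullet> y)))"
  have mm [measurable]: "m \<in> borel_measurable borel" unfolding m_def by measurable
  have mk: "mehler c x y = E x * (exp (- \<alpha> * (y \<bullet> y)) * exp (\<beta> * (x \<bullet> y)))" for x y :: 'a
    unfolding mehler_def E_def s(2)[symmetric] s_def[symmetric] \<alpha>_def \<beta>_def
    using s(1) by (simp add: dot_square_norm exp_add[symmetric] add_divide_distrib diff_divide_distrib)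
  have int: "integrable std_gaussian (\<lambda>y. m y * exp (real k * norm y))" for k :: nat
  proof (rule Bochner_Integration.integrable_bound)
    show "integrable std_gaussian (\<lambda>y. exp ((real k)\<^sup>2 / (4 * \<alpha>)) * u y)" using u by simp
    show "AE y in std_gaussian. norm (m y * exp (real k * norm y)) \<le> norm (exp ((real k)\<^sup>2 / (4 * \<alpha>)) * u y)"
    proof (rule AE_I2)
      fix y :: 'a
      \<comment> \<open>Completing the square: the Gaussian weight beats exp(k |y|), the worst case
        being |y| = k / (2 \<open>\<alpha>\<close>).\<close>
      have "0 \<le> \<alpha> * (norm y - real k / (2 * \<alpha>))\<^sup>2" using \<alpha> by simp
      also have "\<dots> = \<alpha> * (norm y)\<^sup>2 - real k * norm y + (real k)\<^sup>2 / (4 * \<alpha>)"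
        using \<alpha> by (simp add: power2_eq_square field_simps)
      finally have "exp (- \<alpha> * (y \<bullet> y)) * exp (real k * norm y) \<le> exp ((real k)\<^sup>2 / (4 * \<alpha>))"
        by (simp add: dot_square_norm exp_add[symmetric])
      then have "\<bar>u y\<bar> * (exp (- \<alpha> * (y \<bullet> y)) * exp (real k * norm y)) \<le> \<bar>u y\<bar> * exp ((real k)\<^sup>2 / (4 * \<alpha>))"
        by (intro mult_left_mono) auto
      then show "norm (m y * exp (real k * norm y)) \<le> norm (exp ((real k)\<^sup>2 / (4 * \<alpha>)) * u y)"
        by (simp add: m_def abs_mult mult_ac)
    qed
  qed simp
  note L = Ck_laplace[OF sets_std_gaussian mm int, where \<beta>=\<beta>]
  define L where "L = (\<lambda>x. LINT y|std_gaussian. m y * exp (\<beta> * (x \<bullet> y)))"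
  have ou: "ou c u = (\<lambda>x. E x * L x)"
  proof
    fix x show "ou c u x = E x * L x"
      unfolding ou_mehler[OF c(2) um] mk L_def m_def
      by (simp add: Bochner_Integration.integral_mult_right_zero[symmetric] mult_ac del: Bochner_Integration.integral_mult_right_zero)
  qed
  show "Ck k (ou c u)"
    unfolding ou E_def L_def by (intro Ck_mult Ck_const Ck_exp_quadratic L(4))
  have DE: "GDERIV E x :> (E x) *\<^sub>R ((- 2 * \<alpha>) *\<^sub>R x)"
    using GDERIV_mult[OF GDERIV_const[of "(1 / s) ^ DIM('a)" x] GDERIV_DERIV_compose[OF GDERIV_quadratic[of 0 "- \<alpha>" 0 x] DERIV_exp]]
    unfolding E_def by (simp add: mult.assoc)
  have D: "GDERIV (ou c u) x :> E x *\<^sub>R (LINT y|std_gaussian. (m y * exp (\<beta> * (x \<bullet> y)) * \<beta>) *\<^sub>R y)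
      + L x *\<^sub>R ((E x) *\<^sub>R ((- 2 * \<alpha>) *\<^sub>R x))"
    unfolding ou L_def by (rule GDERIV_mult[OF DE L(3)])
  have \<beta>\<alpha>: "\<beta> * c = 2 * \<alpha>" "\<beta> = c / s * (1 / s)" using s(1) by (simp_all add: \<alpha>_def \<beta>_def power2_eq_square)
  \<comment> \<open>Under y = c x + s z the vector (y - c x) / s is z, so this is u(y) z expressed
    through y.\<close>
  let ?F = "\<lambda>y. u y *\<^sub>R ((1 / s) *\<^sub>R (y - c *\<^sub>R x))"
  have Fz: "?F (c *\<^sub>R x + s *\<^sub>R z) = u (c *\<^sub>R x + s *\<^sub>R z) *\<^sub>R z" for z
    using s(1) by simp
  have I1: "integrable std_gaussian (\<lambda>y. E x *\<^sub>R ((m y * exp (\<beta> * (x \<bullet> y)) * \<beta>) *\<^sub>R y))"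
    by (intro integrable_scaleR_right L(2))
  have I2: "integrable std_gaussian (\<lambda>y. (m y * exp (\<beta> * (x \<bullet> y))) *\<^sub>R ((E x) *\<^sub>R ((- 2 * \<alpha>) *\<^sub>R x)))"
    by (intro integrable_scaleR_left impI L(1))
  have eq: "E x *\<^sub>R ((m y * exp (\<beta> * (x \<bullet> y)) * \<beta>) *\<^sub>R y) + (m y * exp (\<beta> * (x \<bullet> y))) *\<^sub>R ((E x) *\<^sub>R ((- 2 * \<alpha>) *\<^sub>R x))
    = (c / s) *\<^sub>R (mehler c x y *\<^sub>R ?F y)" for y
  proof -
    have "(c / s) *\<^sub>R (mehler c x y *\<^sub>R ?F y) = (E x * (m y * exp (\<beta> * (x \<bullet> y))) * \<beta>) *\<^sub>R (y - c *\<^sub>R x)"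
      unfolding mk \<beta>\<alpha>(2) m_def by (simp add: mult_ac)
    also have "\<dots> = (E x * (m y * exp (\<beta> * (x \<bullet> y))) * \<beta>) *\<^sub>R y - (E x * (m y * exp (\<beta> * (x \<bullet> y))) * (\<beta> * c)) *\<^sub>R x"
      by (simp add: scaleR_diff_right mult_ac)
    finally show ?thesis unfolding \<beta>\<alpha>(1) by (simp add: mult_ac)
  qed
  have "integrable std_gaussian (\<lambda>y. (s / c) *\<^sub>R ((c / s) *\<^sub>R (mehler c x y *\<^sub>R ?F y)))"
    using Bochner_Integration.integrable_add[OF I1 I2] unfolding eq by (rule integrable_scaleR_right)
  then have mF: "integrable std_gaussian (\<lambda>y. mehler c x y *\<^sub>R ?F y)"
    using c(1) s(1) by simp
  then have "integrable std_gaussian (\<lambda>z. ?F (c *\<^sub>R x + s *\<^sub>R z))"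
    unfolding s_def by (subst integrable_mehler[OF c(2)]) auto
  then show "integrable std_gaussian (\<lambda>z. u (c *\<^sub>R x + sqrt (1 - c\<^sup>2) *\<^sub>R z) *\<^sub>R z)"
    unfolding Fz unfolding s_def .
  have "(c / s) *\<^sub>R (LINT z|std_gaussian. u (c *\<^sub>R x + s *\<^sub>R z) *\<^sub>R z) = (c / s) *\<^sub>R (LINT y|std_gaussian. mehler c x y *\<^sub>R ?F y)"
  proof -
    have "(LINT z|std_gaussian. u (c *\<^sub>R x + s *\<^sub>R z) *\<^sub>R z) = (LINT z|std_gaussian. ?F (c *\<^sub>R x + s *\<^sub>R z))"
      by (simp only: Fz)
    also have "\<dots> = (LINT y|std_gaussian. mehler c x y *\<^sub>R ?F y)"
      unfolding s_def by (rule integral_mehler[OF c(2)]) measurable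
    finally show ?thesis by (rule arg_cong[of _ _ "scaleR (c / s)"])
  qed
  also have "\<dots> = (LINT y|std_gaussian. (c / s) *\<^sub>R (mehler c x y *\<^sub>R ?F y))"
    by (rule integral_scaleR_right[symmetric])
  also have "\<dots> = (LINT y|std_gaussian. E x *\<^sub>R ((m y * exp (\<beta> * (x \<bullet> y)) * \<beta>) *\<^sub>R y))
      + (LINT y|std_gaussian. (m y * exp (\<beta> * (x \<bullet> y))) *\<^sub>R ((E x) *\<^sub>R ((- 2 * \<alpha>) *\<^sub>R x)))"
    unfolding eq[symmetric] by (rule Bochner_Integration.integral_add[OF I1 I2])
  also have "\<dots> = E x *\<^sub>R (LINT y|std_gaussian. (m y * exp (\<beta> * (x \<bullet> y)) * \<beta>) *\<^sub>R y)
      + L x *\<^sub>R ((E x) *\<^sub>R ((- 2 * \<alpha>) *\<^sub>R x))"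
    unfolding L_def using L(1) by (simp only: integral_scaleR_right integral_scaleR_left)
  finally have e: "(c / s) *\<^sub>R (LINT z|std_gaussian. u (c *\<^sub>R x + s *\<^sub>R z) *\<^sub>R z)
    = E x *\<^sub>R (LINT y|std_gaussian. (m y * exp (\<beta> * (x \<bullet> y)) * \<beta>) *\<^sub>R y)
      + L x *\<^sub>R ((E x) *\<^sub>R ((- 2 * \<alpha>) *\<^sub>R x))" .
  show "GDERIV (ou c u) x
      :> (c / sqrt (1 - c\<^sup>2)) *\<^sub>R (LINT z|std_gaussian. u (c *\<^sub>R x + sqrt (1 - c\<^sup>2) *\<^sub>R z) *\<^sub>R z)"
    unfolding s_def[symmetric] e by (rule D)
qed

section \<open>The semigroup on the product space: invariance, self-adjointness, composition,
  convergence\<close>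

abbreviation gauss_pair :: "('a::euclidean_space \<times> 'a) measure" where
  "gauss_pair \<equiv> std_gaussian \<Otimes>\<^sub>M std_gaussian"

abbreviation rot :: "real \<Rightarrow> 'a::euclidean_space \<times> 'a \<Rightarrow> 'a" where
  "rot c p \<equiv> c *\<^sub>R fst p + sqrt (1 - c\<^sup>2) *\<^sub>R snd p"

lemma distr_rot_swap:
  assumes c: "c\<^sup>2 < 1"
  shows "distr gauss_pair (borel \<Otimes>\<^sub>M borel) (\<lambda>p. (rot c p, fst p))
    = distr gauss_pair (borel \<Otimes>\<^sub>M (borel :: 'a::euclidean_space measure)) (\<lambda>p. (fst p, rot c p))"
  using ou_pair_swap[OF c, where 'a='a]
  unfolding ou_pair_def case_prod_beta' by (simp add: distr_distr o_def)

lemma rot_swap: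
  fixes F :: "'a::euclidean_space \<times> 'a \<Rightarrow> 'b::{banach, second_countable_topology}"
  assumes c: "c\<^sup>2 < 1" and [measurable]: "F \<in> borel_measurable (borel \<Otimes>\<^sub>M borel)"
  shows "integrable gauss_pair (\<lambda>p. F (rot c p, fst p)) \<longleftrightarrow> integrable gauss_pair (\<lambda>p. F (fst p, rot c p))"
    and "(LINT p|gauss_pair. F (rot c p, fst p)) = (LINT p|gauss_pair. F (fst p, rot c p))"
proof -
  note e = distr_rot_swap[OF c, where 'a='a]
  show "integrable gauss_pair (\<lambda>p. F (rot c p, fst p)) \<longleftrightarrow> integrable gauss_pair (\<lambda>p. F (fst p, rot c p))"
    using arg_cong[OF e, of "\<lambda>M. integrable M F"] by (simp add: integrable_distr_eq)
  show "(LINT p|gauss_pair. F (rot c p, fst p)) = (LINT p|gauss_pair. F (fst p, rot c p))"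
    using arg_cong[OF e, of "\<lambda>M. integral\<^sup>L M F"] by (simp add: integral_distr)
qed

lemma integrable_fst_gauss_pair:
  fixes u :: "'a::euclidean_space \<Rightarrow> 'b::{banach, second_countable_topology}"
  assumes "integrable std_gaussian u"
  shows "integrable gauss_pair (\<lambda>p :: 'a \<times> 'a. u (fst p))" "integrable gauss_pair (\<lambda>p :: 'a \<times> 'a. u (snd p))"
proof -
  have [measurable]: "u \<in> borel_measurable borel" using borel_measurable_integrable[OF assms] by simp
  show "integrable gauss_pair (\<lambda>p :: 'a \<times> 'a. u (fst p))"
    by (rule gauss2.Fubini_integrable) (use assms in auto)
  show "integrable gauss_pair (\<lambda>p :: 'a \<times> 'a. u (snd p))"
    by (rule gauss2.Fubini_integrable) (use assms in auto)
qed

text \<open>Invariance of the Gaussian measure: reversibility applied to a function of a single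
  coordinate.\<close>

lemma integrable_rot:
  fixes u :: "'a::euclidean_space \<Rightarrow> 'b::{banach, second_countable_topology}"
  assumes c: "c\<^sup>2 < 1" and u: "integrable std_gaussian u"
  shows "integrable gauss_pair (\<lambda>p. u (rot c p))" "(LINT p|gauss_pair. u (rot c p)) = integral\<^sup>L std_gaussian u"
proof -
  have [measurable]: "u \<in> borel_measurable borel" using borel_measurable_integrable[OF u] by simp
  show "integrable gauss_pair (\<lambda>p. u (rot c p))"
    using rot_swap(1)[OF c, of "\<lambda>p. u (fst p)"] integrable_fst_gauss_pair[OF u] by simp
  have "(LINT p|gauss_pair. u (rot c p)) = (LINT p|gauss_pair. u (fst p))"
    using rot_swap(2)[OF c, of "\<lambda>p. u (fst p)"] by simp
  also have "\<dots> = integral\<^sup>L std_gaussian u"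
    using gauss2.integral_fst'[OF integrable_fst_gauss_pair(1)[OF u]] by simp
  finally show "(LINT p|gauss_pair. u (rot c p)) = integral\<^sup>L std_gaussian u" .
qed

lemma ou_integral:
  assumes c: "c\<^sup>2 < 1" and u: "integrable std_gaussian u"
  shows "integrable std_gaussian (ou c u)" "integral\<^sup>L std_gaussian (ou c u) = integral\<^sup>L std_gaussian u"
  using gauss2.integrable_fst'[OF integrable_rot(1)[OF c u]] gauss2.integral_fst'[OF integrable_rot(1)[OF c u]]
    integrable_rot(2)[OF c u]
  unfolding ou_def[abs_def] by simp_all

lemma ou_abs_le: "\<bar>ou c u x\<bar> \<le> ou c (\<lambda>x. \<bar>u x\<bar>) x"
  unfolding ou_def by (rule integral_abs_bound)

lemma ou_diff:
  assumes "c\<^sup>2 < 1" "integrable std_gaussian u" "integrable std_gaussian v"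
  shows "ou c (\<lambda>x. u x - v x) x = ou c u x - ou c v x"
  unfolding ou_def using assms by (intro Bochner_Integration.integral_diff integrable_ou_kernel) auto

lemma ou_L1_contraction:
  assumes c: "c\<^sup>2 < 1" and u: "integrable std_gaussian u"
  shows "(LINT x|std_gaussian. \<bar>ou c u x\<bar>) \<le> (LINT x|std_gaussian. \<bar>u x\<bar>)"
proof -
  have "(LINT x|std_gaussian. \<bar>ou c u x\<bar>) \<le> (LINT x|std_gaussian. ou c (\<lambda>x. \<bar>u x\<bar>) x)"
    using ou_integral(1)[OF c u] ou_integral(1)[OF c integrable_abs[OF u]]
    by (intro integral_mono ou_abs_le) auto
  then show ?thesis using ou_integral(2)[OF c integrable_abs[OF u]] by simp
qed

lemma ou_bounded:
  fixes u :: "'a::euclidean_space \<Rightarrow> real"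
  assumes u: "u \<in> borel_measurable borel" and b: "\<And>x. \<bar>u x\<bar> \<le> B"
  shows "\<bar>ou c u x\<bar> \<le> B"
proof -
  have "0 \<le> B" using b[of 0] by linarith
  have [measurable]: "u \<in> borel_measurable borel" by fact
  have i: "integrable std_gaussian (\<lambda>z. \<bar>u (c *\<^sub>R x + sqrt (1 - c\<^sup>2) *\<^sub>R z)\<bar>)"
    by (rule gauss.integrable_const_bound[where B=B]) (use b in auto)
  have "\<bar>ou c u x\<bar> \<le> ou c (\<lambda>x. \<bar>u x\<bar>) x" by (rule ou_abs_le)
  also have "\<dots> \<le> (LINT z|(std_gaussian :: 'a measure). B)"
    unfolding ou_def by (rule integral_mono[OF i gauss.integrable_const]) (use b in auto)
  finally show ?thesis by simp
qed

text \<open>Self-adjointness in the pairing of bounded with integrable functions. A density is only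
  integrable, so its partner has to be bounded; this is why the score is truncated later on.\<close>

lemma ou_symmetric:
  assumes c: "c\<^sup>2 < 1" and u: "integrable std_gaussian u"
    and h [measurable]: "h \<in> borel_measurable borel" and b: "\<And>x. \<bar>h x\<bar> \<le> B"
  shows "(LINT x|std_gaussian. h x * ou c u x) = (LINT x|std_gaussian. u x * ou c h x)"
    and "integrable std_gaussian (\<lambda>x. h x * ou c u x)" "integrable std_gaussian (\<lambda>x. u x * ou c h x)"
proof -
  have [measurable]: "u \<in> borel_measurable borel" using borel_measurable_integrable[OF u] by simp
  have "0 \<le> B" using b[of 0] by linarith
  have 1: "integrable gauss_pair (\<lambda>p. h (fst p) * u (rot c p))"
  proof (rule Bochner_Integration.integrable_bound)
    show "integrable gauss_pair (\<lambda>p. B * u (rot c p))" using integrable_rot(1)[OF c u] by simp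
    show "AE p in gauss_pair. norm (h (fst p) * u (rot c p)) \<le> norm (B * u (rot c p))"
      using b \<open>0 \<le> B\<close> by (intro AE_I2) (auto simp: abs_mult intro!: mult_right_mono)
  qed measurable
  have 2: "integrable gauss_pair (\<lambda>p. u (fst p) * h (rot c p))"
    using 1 rot_swap(1)[OF c, of "\<lambda>p. h (fst p) * u (snd p)"] by (simp add: mult.commute)
  have 3: "(LINT p|gauss_pair. h (fst p) * u (rot c p)) = (LINT p|gauss_pair. u (fst p) * h (rot c p))"
    using rot_swap(2)[OF c, of "\<lambda>p. h (fst p) * u (snd p)"] by (simp add: mult.commute)
  show "integrable std_gaussian (\<lambda>x. h x * ou c u x)" "integrable std_gaussian (\<lambda>x. u x * ou c h x)"
    using gauss2.integrable_fst'[OF 1] gauss2.integrable_fst'[OF 2] by (simp_all add: ou_def)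
  show "(LINT x|std_gaussian. h x * ou c u x) = (LINT x|std_gaussian. u x * ou c h x)"
    using gauss2.integral_fst'[OF 1] gauss2.integral_fst'[OF 2] 3 by (simp add: ou_def)
qed

text \<open>For fixed x the two Gaussian increments enter only through s sqrt(1 - r^2) z + sqrt(1 -
  s^2) z', which is \<open>\<sigma>\<close> times a \<open>rot\<close> of (z, z'). Composition thus
  reduces to invariance of the Gaussian measure.\<close>

lemma ou_semigroup:
  assumes r: "0 < r" "r < 1" and s: "0 < s" "s < 1" and u: "integrable std_gaussian u"
  shows "ou r (ou s u) x = ou (r * s) u x"
proof -
  have r2: "r\<^sup>2 < 1" and s2: "s\<^sup>2 < 1" using r s by (auto simp: abs_square_less_1)
  have "r * s < 1 * 1" using r s by (intro mult_strict_mono) auto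
  then have rs2: "(r * s)\<^sup>2 < 1" using r s by (simp add: abs_square_less_1)
  define \<sigma> where "\<sigma> = sqrt (1 - (r * s)\<^sup>2)"
  have \<sigma>: "0 < \<sigma>" "\<sigma>\<^sup>2 = 1 - (r * s)\<^sup>2" using rs2 by (auto simp: \<sigma>_def)
  \<comment> \<open>The cosine of that rotation; \<open>c2\<close> identifies the square of its
    sine.\<close>
  define c where "c = s * sqrt (1 - r\<^sup>2) / \<sigma>"
  have c2: "1 - c\<^sup>2 = (1 - s\<^sup>2) / \<sigma>\<^sup>2"
  proof -
    have "c\<^sup>2 = s\<^sup>2 * (1 - r\<^sup>2) / \<sigma>\<^sup>2" using r2 by (simp add: c_def power_mult_distrib power_divide)
    then have "1 - c\<^sup>2 = (\<sigma>\<^sup>2 - s\<^sup>2 * (1 - r\<^sup>2)) / \<sigma>\<^sup>2" using \<sigma>(1) by (simp add: diff_divide_distrib)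
    also have "\<sigma>\<^sup>2 - s\<^sup>2 * (1 - r\<^sup>2) = 1 - s\<^sup>2" unfolding \<sigma>(2) by (simp add: power_mult_distrib algebra_simps)
    finally show ?thesis .
  qed
  have cl: "c\<^sup>2 < 1"
  proof -
    have "0 < (1 - s\<^sup>2) / \<sigma>\<^sup>2" using s2 \<sigma>(1) by simp
    then show ?thesis using c2 by linarith
  qed
  have sc: "\<sigma> * sqrt (1 - c\<^sup>2) = sqrt (1 - s\<^sup>2)" "\<sigma> * c = s * sqrt (1 - r\<^sup>2)"
    unfolding c2 using \<sigma>(1) by (simp_all add: real_sqrt_divide c_def)
  let ?g = "\<lambda>w. u ((r * s) *\<^sub>R x + \<sigma> *\<^sub>R w)"
  have g: "integrable std_gaussian ?g" using integrable_ou_kernel[OF rs2 u] by (simp add: \<sigma>_def)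
  have "ou s u (r *\<^sub>R x + sqrt (1 - r\<^sup>2) *\<^sub>R z) = ou c ?g z" for z
  proof -
    have "s *\<^sub>R (r *\<^sub>R x + sqrt (1 - r\<^sup>2) *\<^sub>R z) + sqrt (1 - s\<^sup>2) *\<^sub>R z'
      = (r * s) *\<^sub>R x + \<sigma> *\<^sub>R (c *\<^sub>R z + sqrt (1 - c\<^sup>2) *\<^sub>R z')" for z'
      unfolding scaleR_add_right scaleR_scaleR sc by (simp add: mult.commute add.assoc)
    then show ?thesis unfolding ou_def by (simp only:)
  qed
  then have "ou r (ou s u) x = integral\<^sup>L std_gaussian (ou c ?g)"
    by (simp add: ou_def[of r])
  also have "\<dots> = ou (r * s) u x" unfolding ou_integral(2)[OF cl g] by (simp add: ou_def \<sigma>_def)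
  finally show ?thesis .
qed

text \<open>Values are clamped, then approximated almost everywhere by continuous functions clamped
  at the same level, so that constants dominate. The approximant has to be bounded as well as
  continuous, because \<open>ou\<close> of it is to converge pointwise by dominated
  convergence.\<close>

lemma gauss_L1_approx:
  fixes u :: "'a::euclidean_space \<Rightarrow> real"
  assumes u: "integrable std_gaussian u" and e: "0 < e"
  obtains k B where "continuous_on UNIV k" "\<And>x. \<bar>k x\<bar> \<le> B" "(LINT x|std_gaussian. \<bar>u x - k x\<bar>) < e"
proof -
  have um [measurable]: "u \<in> borel_measurable borel" using borel_measurable_integrable[OF u] by simp
  let ?cl = "\<lambda>N x. max (- N) (min N x) :: real"
  have "(\<lambda>n. LINT x|std_gaussian. \<bar>u x - ?cl (real n) (u x)\<bar>) \<longlonglongrightarrow> (LINT x|(std_gaussian::'a measure). 0)"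
  proof (rule integral_dominated_convergence[where w="\<lambda>x. \<bar>u x\<bar>"])
    show "AE x in std_gaussian. (\<lambda>n. \<bar>u x - ?cl (real n) (u x)\<bar>) \<longlonglongrightarrow> 0"
    proof (rule AE_I2)
      fix x
      obtain N where N: "\<bar>u x\<bar> \<le> real N" using real_arch_simple by blast
      have "\<bar>u x - ?cl (real n) (u x)\<bar> = 0" if "N \<le> n" for n using N that by (auto simp: max_def min_def)
      then show "(\<lambda>n. \<bar>u x - ?cl (real n) (u x)\<bar>) \<longlonglongrightarrow> 0"
        by (intro tendsto_eventually) (auto simp: eventually_sequentially)
    qed
    show "integrable std_gaussian (\<lambda>x. \<bar>u x\<bar>)" using u by simp
  qed (auto simp: max_def min_def)
  then have "(\<lambda>n. LINT x|std_gaussian. \<bar>u x - ?cl (real n) (u x)\<bar>) \<longlonglongrightarrow> 0" by simp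
  then have "\<forall>\<^sub>F n in sequentially. (LINT x|std_gaussian. \<bar>u x - ?cl (real n) (u x)\<bar>) < e / 2"
    using e by (intro order_tendstoD(2)) auto
  then obtain N where N: "(LINT x|std_gaussian. \<bar>u x - ?cl (real N) (u x)\<bar>) < e / 2"
    by (auto simp: eventually_sequentially)
  define v where "v = (\<lambda>x. ?cl (real N) (u x))"
  have vm [measurable]: "v \<in> borel_measurable borel" unfolding v_def by measurable
  have vb: "\<bar>v x\<bar> \<le> real N" for x by (auto simp: v_def)
  have vi: "integrable std_gaussian v" by (rule gauss.integrable_const_bound[where B="real N"]) (use vb in auto)
  \<comment> \<open>This notion supplies continuous functions converging to v off a Lebesgue null
    set, which is also a null set of the Gaussian measure.\<close>
  have "v measurable_on UNIV"
    by (rule lebesgue_measurable_imp_measurable_on) (auto intro: measurable_completion)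
  then obtain Z g where Z: "negligible Z" and gc: "\<And>n. continuous_on UNIV (g n)"
    and gl: "\<And>x. x \<notin> Z \<Longrightarrow> (\<lambda>n. g n x) \<longlonglongrightarrow> v x"
    unfolding measurable_on_def by auto
  have "AE x in lebesgue. x \<notin> Z"
    using Z unfolding negligible_iff_null_sets by (rule AE_not_in)
  then have "AE x in lborel. x \<notin> Z" by (simp add: AE_completion_iff)
  then have AE: "AE x in std_gaussian. x \<notin> Z"
    unfolding std_gaussian_eq by (subst AE_density) auto
  define k' where "k' = (\<lambda>n x. ?cl (real N) (g n x))"
  have kc: "continuous_on UNIV (k' n)" for n
    unfolding k'_def by (intro continuous_intros gc)
  have km [measurable]: "k' n \<in> borel_measurable borel" for n using kc by (rule borel_measurable_continuous_onI)
  have kb: "\<bar>k' n x\<bar> \<le> real N" for n x by (auto simp: k'_def)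
  have ki: "integrable std_gaussian (k' n)" for n by (rule gauss.integrable_const_bound[where B="real N"]) (use kb in auto)
  have "(\<lambda>n. LINT x|std_gaussian. \<bar>v x - k' n x\<bar>) \<longlonglongrightarrow> (LINT x|(std_gaussian::'a measure). 0)"
  proof (rule integral_dominated_convergence[where w="\<lambda>_. real N + real N"])
    show "AE x in std_gaussian. (\<lambda>n. \<bar>v x - k' n x\<bar>) \<longlonglongrightarrow> 0"
      using AE
    proof eventually_elim
      case (elim x)
      have "(\<lambda>n. \<bar>v x - k' n x\<bar>) \<longlonglongrightarrow> \<bar>v x - ?cl (real N) (v x)\<bar>"
        unfolding k'_def by (intro tendsto_intros gl elim)
      moreover have "?cl (real N) (v x) = v x" using vb[of x] by auto
      ultimately show ?case by simp
    qed
    show "AE x in std_gaussian. norm \<bar>v x - k' n x\<bar> \<le> real N + real N" for n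
    proof (rule AE_I2)
      fix x show "norm \<bar>v x - k' n x\<bar> \<le> real N + real N" using vb[of x] kb[of n x] by simp
    qed
  qed auto
  then have "(\<lambda>n. LINT x|std_gaussian. \<bar>v x - k' n x\<bar>) \<longlonglongrightarrow> 0" by simp
  then have "\<forall>\<^sub>F n in sequentially. (LINT x|std_gaussian. \<bar>v x - k' n x\<bar>) < e / 2"
    using e by (intro order_tendstoD(2)) auto
  then obtain n where vk': "(LINT x|std_gaussian. \<bar>v x - k' n x\<bar>) < e / 2"
    by (auto simp: eventually_sequentially)
  define k where "k = k' n"
  note kc = kc[of n, folded k_def] and ki = ki[of n, folded k_def] and kb = kb[of n, folded k_def]
    and vk = vk'[folded k_def]
  have "(LINT x|std_gaussian. \<bar>u x - k x\<bar>) \<le> (LINT x|std_gaussian. \<bar>u x - v x\<bar> + \<bar>v x - k x\<bar>)"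
    using u vi ki by (intro integral_mono) auto
  also have "\<dots> = (LINT x|std_gaussian. \<bar>u x - v x\<bar>) + (LINT x|std_gaussian. \<bar>v x - k x\<bar>)"
    using u vi ki by (intro Bochner_Integration.integral_add) auto
  also have "\<dots> < e" using N vk unfolding v_def by simp
  finally show thesis using that[OF kc kb] by blast
qed

text \<open>A three-epsilon argument: \<open>ou\<close> contracts L1, so only bounded continuous
  functions have to be examined, and for these the convergence is pointwise and bounded.\<close>

lemma ou_tendsto_L1:
  fixes u :: "'a::euclidean_space \<Rightarrow> real"
  assumes u: "integrable std_gaussian u" and c: "\<And>n. (c n)\<^sup>2 < 1" "c \<longlonglongrightarrow> 1"
  shows "(\<lambda>n. LINT x|std_gaussian. \<bar>ou (c n) u x - u x\<bar>) \<longlonglongrightarrow> 0"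
proof (rule LIMSEQ_I)
  fix e :: real assume "0 < e"
  then have e3: "0 < e / 3" by simp
  from gauss_L1_approx[OF u e3] obtain k B where k: "continuous_on UNIV k" "\<And>x. \<bar>k x\<bar> \<le> B"
    "(LINT x|std_gaussian. \<bar>u x - k x\<bar>) < e / 3" by blast
  have km [measurable]: "k \<in> borel_measurable borel" using k(1) by (rule borel_measurable_continuous_onI)
  have um [measurable]: "u \<in> borel_measurable borel" using borel_measurable_integrable[OF u] by simp
  have ki: "integrable std_gaussian k" by (rule gauss.integrable_const_bound[where B=B]) (use k in auto)
  have pt: "(\<lambda>n. ou (c n) k x) \<longlonglongrightarrow> k x" for x
  proof -
    have "(\<lambda>n. LINT z|std_gaussian. k (c n *\<^sub>R x + sqrt (1 - (c n)\<^sup>2) *\<^sub>R z)) \<longlonglongrightarrow> (LINT z|(std_gaussian::'a measure). k x)"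
    proof (rule integral_dominated_convergence[where w="\<lambda>_. B"])
      show "AE z in std_gaussian. (\<lambda>n. k (c n *\<^sub>R x + sqrt (1 - (c n)\<^sup>2) *\<^sub>R z)) \<longlonglongrightarrow> k x"
      proof (rule AE_I2)
        fix z :: 'a
        have "(\<lambda>n. c n *\<^sub>R x + sqrt (1 - (c n)\<^sup>2) *\<^sub>R z) \<longlonglongrightarrow> 1 *\<^sub>R x + sqrt (1 - 1\<^sup>2) *\<^sub>R z"
          using c(2) by (intro tendsto_intros)
        then have "(\<lambda>n. c n *\<^sub>R x + sqrt (1 - (c n)\<^sup>2) *\<^sub>R z) \<longlonglongrightarrow> x" by simp
        with k(1) show "(\<lambda>n. k (c n *\<^sub>R x + sqrt (1 - (c n)\<^sup>2) *\<^sub>R z)) \<longlonglongrightarrow> k x"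
          by (auto simp: continuous_on_eq_continuous_at intro: isCont_tendsto_compose)
      qed
    qed (use k(2) in auto)
    then show ?thesis by (simp add: ou_def)
  qed
  have B0: "0 \<le> B" using k(2)[of 0] by linarith
  have okb: "\<bar>ou (c n) k x\<bar> \<le> B" for n x by (rule ou_bounded[OF km k(2)])
  have "(\<lambda>n. LINT x|std_gaussian. \<bar>ou (c n) k x - k x\<bar>) \<longlonglongrightarrow> (LINT x|(std_gaussian::'a measure). 0)"
  proof (rule integral_dominated_convergence[where w="\<lambda>_. B + B"])
    show "AE x in std_gaussian. (\<lambda>n. \<bar>ou (c n) k x - k x\<bar>) \<longlonglongrightarrow> 0"
      using pt by (intro AE_I2 tendsto_rabs_zero) (auto simp: LIM_zero_iff)
    show "AE x in std_gaussian. norm \<bar>ou (c n) k x - k x\<bar> \<le> B + B" for n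
    proof (rule AE_I2)
      fix x show "norm \<bar>ou (c n) k x - k x\<bar> \<le> B + B" using okb[of n x] k(2)[of x] by simp
    qed
  qed auto
  then have "(\<lambda>n. LINT x|std_gaussian. \<bar>ou (c n) k x - k x\<bar>) \<longlonglongrightarrow> 0" by simp
  then have "\<forall>\<^sub>F n in sequentially. (LINT x|std_gaussian. \<bar>ou (c n) k x - k x\<bar>) < e / 3"
    using e3 by (rule order_tendstoD(2))
  then obtain N where N: "\<And>n. N \<le> n \<Longrightarrow> (LINT x|std_gaussian. \<bar>ou (c n) k x - k x\<bar>) < e / 3"
    by (auto simp: eventually_sequentially)
  have "norm ((LINT x|std_gaussian. \<bar>ou (c n) u x - u x\<bar>) - 0) < e" if n: "N \<le> n" for n
  proof -
    note oi = ou_integral(1)[OF c(1)[of n]]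
    have d: "integrable std_gaussian (\<lambda>x. u x - k x)" using u ki by simp
    have i1: "integrable std_gaussian (\<lambda>x. \<bar>ou (c n) (\<lambda>x. u x - k x) x\<bar>)" using oi[OF d] by simp
    have i2: "integrable std_gaussian (\<lambda>x. \<bar>ou (c n) k x - k x\<bar>)" using oi[OF ki] ki by simp
    have i3: "integrable std_gaussian (\<lambda>x. \<bar>u x - k x\<bar>)" using d by simp
    have "(LINT x|std_gaussian. \<bar>ou (c n) u x - u x\<bar>)
      \<le> (LINT x|std_gaussian. \<bar>ou (c n) (\<lambda>x. u x - k x) x\<bar> + (\<bar>ou (c n) k x - k x\<bar> + \<bar>u x - k x\<bar>))"
    proof (rule integral_mono)
      show "integrable std_gaussian (\<lambda>x. \<bar>ou (c n) u x - u x\<bar>)" using oi[OF u] u by simp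
      show "integrable std_gaussian (\<lambda>x. \<bar>ou (c n) (\<lambda>x. u x - k x) x\<bar> + (\<bar>ou (c n) k x - k x\<bar> + \<bar>u x - k x\<bar>))"
        using i1 i2 i3 by simp
      show "\<bar>ou (c n) u x - u x\<bar> \<le> \<bar>ou (c n) (\<lambda>x. u x - k x) x\<bar> + (\<bar>ou (c n) k x - k x\<bar> + \<bar>u x - k x\<bar>)" for x
        unfolding ou_diff[OF c(1) u ki] by linarith
    qed
    also have "\<dots> = (LINT x|std_gaussian. \<bar>ou (c n) (\<lambda>x. u x - k x) x\<bar>)
      + ((LINT x|std_gaussian. \<bar>ou (c n) k x - k x\<bar>) + (LINT x|std_gaussian. \<bar>u x - k x\<bar>))"
      using i1 i2 i3 by simp
    also have "\<dots> < e / 3 + (e / 3 + e / 3)"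
      using ou_L1_contraction[OF c(1)[of n] d] N[OF n] k(3) by linarith
    finally show ?thesis by simp
  qed
  then show "\<exists>N. \<forall>n\<ge>N. norm ((LINT x|std_gaussian. \<bar>ou (c n) u x - u x\<bar>) - 0) < e" by blast
qed

section \<open>Contraction of the Fisher information\<close>

lemma integrable_bounded_mult_gauss:
  fixes v :: "'a::euclidean_space \<Rightarrow> real" and w :: "'a \<Rightarrow> 'b::{banach, second_countable_topology}"
  assumes [measurable]: "v \<in> borel_measurable borel" and B: "\<And>x. \<bar>v x\<bar> \<le> B" and w: "integrable std_gaussian w"
  shows "integrable std_gaussian (\<lambda>x. v x *\<^sub>R w x)"
proof -
  have [measurable]: "w \<in> borel_measurable borel" using borel_measurable_integrable[OF w] by simp
  have B0: "0 \<le> B" using B[of 0] by linarith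
  show ?thesis
  proof (rule Bochner_Integration.integrable_bound)
    show "integrable std_gaussian (\<lambda>x. B *\<^sub>R w x)" using w by simp
    show "AE x in std_gaussian. norm (v x *\<^sub>R w x) \<le> norm (B *\<^sub>R w x)"
      using B B0 by (intro AE_I2) (auto intro!: mult_right_mono)
  qed simp
qed

lemma integrable_gauss_inner:
  fixes a :: "'a::euclidean_space"
  shows "integrable std_gaussian (\<lambda>x :: 'a. x)" "integrable std_gaussian (\<lambda>x. x \<bullet> a)"
proof -
  show "integrable std_gaussian (\<lambda>x::'a. x)"
    using integrable_gauss_norm by (subst integrable_norm_iff[symmetric]) auto
  then show "integrable std_gaussian (\<lambda>x. x \<bullet> a)" by (rule integrable_inner_left)
qed

text \<open>Bessel's inequality for the Hermite polynomials of degree at most one: m and a are the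
  coefficients of v, and the square of the residual v - m - z . a has nonnegative integral.\<close>

lemma gauss_bessel:
  fixes v :: "'a::euclidean_space \<Rightarrow> real"
  assumes vm [measurable]: "v \<in> borel_measurable borel" and B: "\<And>x. \<bar>v x\<bar> \<le> B"
  shows "(norm (LINT z|std_gaussian. v z *\<^sub>R z))\<^sup>2 \<le> (LINT z|std_gaussian. (v z)\<^sup>2) - (LINT z|std_gaussian. v z)\<^sup>2"
proof -
  define a where "a = (LINT z|std_gaussian. v z *\<^sub>R z)"
  define m where "m = (LINT z|std_gaussian. v z)"
  have vi: "integrable std_gaussian v" by (rule gauss.integrable_const_bound[where B=B]) (use B in auto)
  have v2i: "integrable std_gaussian (\<lambda>z. (v z)\<^sup>2)"
    using integrable_bounded_mult_gauss[OF vm B vi] by (simp add: power2_eq_square)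
  have vzi: "integrable std_gaussian (\<lambda>z. v z *\<^sub>R z)" by (rule integrable_bounded_mult_gauss[OF vm B integrable_gauss_inner(1)])
  have vLi: "integrable std_gaussian (\<lambda>z. v z * (z \<bullet> a))" "(LINT z|std_gaussian. v z * (z \<bullet> a)) = (norm a)\<^sup>2"
    using integrable_inner_left[OF vzi, of a] integral_inner_left[OF vzi, of a]
    by (simp_all add: a_def power2_norm_eq_inner)
  have L: "(LINT z|std_gaussian. z \<bullet> a) = 0"
  proof -
    have "(LINT z|(std_gaussian::'a measure). z) = 0"
    proof (rule euclidean_eqI)
      fix b :: 'a assume b: "b \<in> Basis"
      show "(LINT z|(std_gaussian::'a measure). z) \<bullet> b = 0 \<bullet> b"
        using integral_inner_left[OF integrable_gauss_inner(1), of b] gauss_moments_inner(3)[OF b b] by simp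
    qed
    then show ?thesis using integral_inner_left[OF integrable_gauss_inner(1), of a] by simp
  qed
  have zz: "(z \<bullet> a)\<^sup>2 = (\<Sum>b\<in>Basis. \<Sum>b'\<in>Basis. ((a \<bullet> b) * (a \<bullet> b')) * ((z \<bullet> b) * (z \<bullet> b')))" for z :: 'a
    unfolding power2_eq_square euclidean_inner[of z a] sum_product
    by (simp add: mult_ac)
  have L2i: "integrable std_gaussian (\<lambda>z. (z \<bullet> a)\<^sup>2)"
    unfolding zz by (intro Bochner_Integration.integrable_sum integrable_mult_right gauss_moments_inner(1))
  have L2: "(LINT z|std_gaussian. (z \<bullet> a)\<^sup>2) = (norm a)\<^sup>2"
  proof -
    have "(LINT z|std_gaussian. (z \<bullet> a)\<^sup>2) = (\<Sum>b\<in>Basis. \<Sum>b'\<in>Basis. ((a \<bullet> b) * (a \<bullet> b')) * (if b = b' then 1 else 0))"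
      unfolding zz
      by (simp add: gauss_moments_inner Bochner_Integration.integral_sum integrable_mult_right cong: sum.cong)
    also have "\<dots> = (\<Sum>b\<in>Basis. (a \<bullet> b) * (a \<bullet> b))" by (simp add: if_distrib sum.delta cong: if_cong)
    finally show ?thesis unfolding power2_norm_eq_inner euclidean_inner[of a a] .
  qed
  have "0 \<le> (LINT z|std_gaussian. (v z - m - z \<bullet> a)\<^sup>2)" by (rule Bochner_Integration.integral_nonneg) simp
  also have "\<dots> = (LINT z|std_gaussian. (v z)\<^sup>2 + m\<^sup>2 + (z \<bullet> a)\<^sup>2 - (2 * m) * v z - 2 * (v z * (z \<bullet> a)) + (2 * m) * (z \<bullet> a))"
    by (intro Bochner_Integration.integral_cong refl) (simp add: power2_eq_square algebra_simps)
  also have "\<dots> = (LINT z|std_gaussian. (v z)\<^sup>2) + m\<^sup>2 + (norm a)\<^sup>2 - (2 * m) * m - 2 * (norm a)\<^sup>2 + (2 * m) * 0"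
    using v2i L2i vi vLi integrable_gauss_inner(2)[of a] L L2
    by (simp add: m_def[symmetric])
  finally show ?thesis unfolding a_def[symmetric] m_def[symmetric] by (simp add: power2_eq_square)
qed

text \<open>The gradient at 0 of one smoothed function is computed twice, with the derivative on the
  kernel and with the derivative on the integrand. Rescaling q by 1 / s makes the integrand at the
  origin equal to q(z).\<close>

lemma gauss_ibp:
  fixes q :: "'a::euclidean_space \<Rightarrow> real"
  assumes D: "\<And>x. GDERIV q x :> gq x" and B: "\<And>x. \<bar>q x\<bar> \<le> B" "\<And>x. norm (gq x) \<le> B'"
    and [measurable]: "gq \<in> borel_measurable borel"
  shows "(LINT z|std_gaussian. q z *\<^sub>R z) = (LINT z|std_gaussian. gq z)"
proof -
  \<comment> \<open>Any value strictly between 0 and 1 serves.\<close>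
  define c :: real where "c = 1 / 2"
  define s where "s = sqrt (1 - c\<^sup>2)"
  have c: "c \<noteq> 0" "c\<^sup>2 < 1" "0 < c" by (simp_all add: c_def power2_eq_square)
  have s: "0 < s" using c by (simp add: s_def)
  have "continuous_on UNIV q"
    by (rule continuous_at_imp_continuous_on, intro ballI,
          rule differentiable_imp_continuous_within[OF GDERIV_differentiable[OF D]])
  then have qm [measurable]: "q \<in> borel_measurable borel" by (rule borel_measurable_continuous_onI)
  let ?u = "\<lambda>y. q ((1 / s) *\<^sub>R y)"
  have ui: "integrable std_gaussian ?u" by (rule gauss.integrable_const_bound[where B=B]) (use B in auto)
  have ou: "ou c ?u = (\<lambda>x. LINT z|std_gaussian. q ((c / s) *\<^sub>R x + z))"
    unfolding ou_def s_def[symmetric] using s by (simp add: scaleR_add_right fun_eq_iff)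
  have 1: "GDERIV (ou c ?u) 0 :> (c / s) *\<^sub>R (LINT z|std_gaussian. q z *\<^sub>R z)"
    using ou_smooth(3)[OF c(1,2) ui, of 0] s unfolding s_def[symmetric] by simp
  have 2: "GDERIV (ou c ?u) 0 :> (LINT z|std_gaussian. (c / s) *\<^sub>R gq ((c / s) *\<^sub>R 0 + z))"
    unfolding ou
  proof (rule GDERIV_integral(1)[OF zero_less_one])
    fix x z :: 'a
    have "((\<lambda>x. (c / s) *\<^sub>R x + z) has_derivative (\<lambda>h. (c / s) *\<^sub>R h)) (at x)"
      by (auto intro!: derivative_eq_intros)
    from has_derivative_compose[OF this D[unfolded gderiv_def]]
    show "GDERIV (\<lambda>x. q ((c / s) *\<^sub>R x + z)) x :> (c / s) *\<^sub>R gq ((c / s) *\<^sub>R x + z)"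
      unfolding gderiv_def by (simp add: mult.commute)
    show "norm ((c / s) *\<^sub>R gq ((c / s) *\<^sub>R x + z)) \<le> (c / s) * B'"
      using B(2) c s by (simp add: divide_right_mono mult_left_mono)
    show "integrable std_gaussian (\<lambda>z. q ((c / s) *\<^sub>R x + z))"
      by (rule gauss.integrable_const_bound[where B=B]) (use B in auto)
  qed (auto)
  have "(c / s) *\<^sub>R (LINT z|std_gaussian. q z *\<^sub>R z) = (c / s) *\<^sub>R (LINT z|std_gaussian. gq z)"
    using trans[OF grad_eqI[OF 1, symmetric] grad_eqI[OF 2]]
    unfolding scaleR_zero_right add_0_left integral_scaleR_right .
  then show ?thesis using c s by simp
qed

text \<open>For the truncated score: with h the clamp of q one keeps h^2 <= h q, so the quadratic
  term is controlled by the pairing itself.\<close>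

lemma clamp_mult:
  fixes y r :: real
  assumes "0 \<le> r"
  shows "(max (- r) (min r y))\<^sup>2 \<le> max (- r) (min r y) * y" "0 \<le> max (- r) (min r y) * y"
proof -
  consider "r < y" | "y < - r" | "- r \<le> y" "y \<le> r" by linarith
  then have "(max (- r) (min r y))\<^sup>2 \<le> max (- r) (min r y) * y \<and> 0 \<le> max (- r) (min r y) * y"
  proof cases
    case 1 then show ?thesis using assms mult_left_mono[of r y r] by (simp add: power2_eq_square)
  next
    case 2 then show ?thesis using assms mult_left_mono[of r "- y" r] mult_nonneg_nonneg[of r "- y"]
      by (simp add: power2_eq_square min_def max_def)
  next
    case 3 then show ?thesis by (simp add: power2_eq_square)
  qed
  then show "(max (- r) (min r y))\<^sup>2 \<le> max (- r) (min r y) * y" "0 \<le> max (- r) (min r y) * y" by auto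
qed

lemma weighted_young:
  fixes A W k F :: real
  assumes "0 < k" "0 < F"
  shows "A * W \<le> k / 2 * (A\<^sup>2 / F) + 1 / (2 * k) * (F * W\<^sup>2)"
proof -
  have "0 \<le> (k * A - F * W)\<^sup>2 / (2 * k * F)" using assms by simp
  also have "\<dots> = k / 2 * (A\<^sup>2 / F) + 1 / (2 * k) * (F * W\<^sup>2) - A * W"
    unfolding power2_diff power2_eq_square using assms by (simp add: field_simps)
  finally show ?thesis by simp
qed

lemma integral_density_real:
  fixes f g :: "'a::euclidean_space \<Rightarrow> real"
  assumes "f \<in> borel_measurable borel" "\<And>x. 0 \<le> f x" "g \<in> borel_measurable borel"
  shows "(LINT x|density std_gaussian (\<lambda>x. ennreal (f x)). g x) = (LINT x|std_gaussian. f x * g x)"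
    and "integrable (density std_gaussian (\<lambda>x. ennreal (f x))) g \<longleftrightarrow> integrable std_gaussian (\<lambda>x. f x * g x)"
proof -
  show "(LINT x|density std_gaussian (\<lambda>x. ennreal (f x)). g x) = (LINT x|std_gaussian. f x * g x)"
    using assms by (subst integral_density) auto
  show "integrable (density std_gaussian (\<lambda>x. ennreal (f x))) g \<longleftrightarrow> integrable std_gaussian (\<lambda>x. f x * g x)"
    using assms by (subst integrable_density) auto
qed

lemma gauss_density_prob:
  fixes f :: "'a::euclidean_space \<Rightarrow> real"
  assumes [measurable]: "f \<in> borel_measurable borel" and f: "\<And>x. 0 \<le> f x"
    and P: "prob_space (density std_gaussian (\<lambda>x. ennreal (f x)))"
  shows "integrable std_gaussian f" "integral\<^sup>L std_gaussian f = 1"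
proof -
  interpret P: prob_space "density std_gaussian (\<lambda>x. ennreal (f x))" by (rule P)
  have 1: "(\<integral>\<^sup>+x. ennreal (f x) \<partial>std_gaussian) = 1"
    using P.emeasure_space_1 by (simp add: emeasure_density)
  show "integrable std_gaussian f"
    by (rule integrableI_nonneg) (use f 1 in auto)
  show "integral\<^sup>L std_gaussian f = 1"
    by (subst integral_eq_nn_integral) (use f 1 in auto)
qed

text \<open>The Mehler kernel is strictly positive, so a zero of \<open>ou c f\<close> would force f
  = 0 almost everywhere. Division by \<open>ou c f\<close> is therefore legitimate at every
  point.\<close>

lemma ou_pos:
  fixes f :: "'a::euclidean_space \<Rightarrow> real"
  assumes c: "c\<^sup>2 < 1" and f: "integrable std_gaussian f" "\<And>x. 0 \<le> f x" "0 < integral\<^sup>L std_gaussian f"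
  shows "0 < ou c f x"
proof -
  have fm [measurable]: "f \<in> borel_measurable borel" using borel_measurable_integrable[OF f(1)] by simp
  have nn: "0 \<le> mehler c x y * f y" for y
    by (intro mult_nonneg_nonneg less_imp_le[OF mehler_pos[OF c]] f(2))
  have "ou c f x \<noteq> 0"
  proof
    assume "ou c f x = 0"
    then have "(LINT y|std_gaussian. mehler c x y * f y) = 0" unfolding ou_mehler[OF c fm]
      by simp
    then have "AE y in std_gaussian. mehler c x y * f y = 0"
      using integral_nonneg_eq_0_iff_AE[OF integrable_mehler_mult[OF c f(1)]] nn by simp
    then have "AE y in std_gaussian. f y = 0"
      by eventually_elim (metis mult_eq_0_iff mehler_pos[OF c] less_irrefl)
    then have "integral\<^sup>L std_gaussian f = integral\<^sup>L std_gaussian (\<lambda>_ :: 'a. 0)"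
      by (intro integral_cong_AE) auto
    with f(3) show False by simp
  qed
  moreover have "0 \<le> ou c f x" unfolding ou_def by (rule Bochner_Integration.integral_nonneg) (rule f(2))
  ultimately show ?thesis by simp
qed

text \<open>The gradient of \<open>ou c h\<close> at x is c / sqrt(1 - c^2) times the degree-one
  Hermite coefficient of h(c x + sqrt(1 - c^2) z) as a function of z, and
  \<open>gauss_bessel\<close> bounds that coefficient by the variance.\<close>

lemma ou_reverse_poincare:
  fixes h :: "'a::euclidean_space \<Rightarrow> real"
  assumes c: "0 < c" "c < 1" and h [measurable]: "h \<in> borel_measurable borel" and B: "\<And>x. \<bar>h x\<bar> \<le> B"
  shows "(1 - c\<^sup>2) * (norm (grad (ou c h) x))\<^sup>2 \<le> c\<^sup>2 * (ou c (\<lambda>x. (h x)\<^sup>2) x - (ou c h x)\<^sup>2)"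
proof -
  have c2: "c \<noteq> 0" "c\<^sup>2 < 1" using c by (auto simp: abs_square_less_1)
  have hi: "integrable std_gaussian h" by (rule gauss.integrable_const_bound[where B=B]) (use B in auto)
  let ?v = "\<lambda>z. h (c *\<^sub>R x + sqrt (1 - c\<^sup>2) *\<^sub>R z)"
  have "(norm (grad (ou c h) x))\<^sup>2 = c\<^sup>2 / (1 - c\<^sup>2) * (norm (LINT z|std_gaussian. ?v z *\<^sub>R z))\<^sup>2"
    unfolding grad_eqI[OF ou_smooth(3)[OF c2 hi]] using c2 by (simp add: power_mult_distrib power_divide)
  then have "(1 - c\<^sup>2) * (norm (grad (ou c h) x))\<^sup>2 = c\<^sup>2 * (norm (LINT z|std_gaussian. ?v z *\<^sub>R z))\<^sup>2"
    using c2 by simp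
  also have "\<dots> \<le> c\<^sup>2 * (ou c (\<lambda>x. (h x)\<^sup>2) x - (ou c h x)\<^sup>2)"
    unfolding ou_def by (rule mult_left_mono[OF gauss_bessel]) (use B in auto)
  finally show ?thesis .
qed

text \<open>\<open>ou c h - m\<close> is smooth with mean zero, hence an admissible test function.
  In the reverse Poincare inequality the subtracted square of \<open>ou c h\<close> integrates to
  the variance plus m^2; dropping m^2 and moving the variance to the left adds c^2 to l (1 -
  c^2).\<close>

lemma ou_variance:
  fixes f h :: "'a::euclidean_space \<Rightarrow> real"
  assumes l: "0 < l" and c: "0 < c" "c < 1"
    and fm: "f \<in> borel_measurable borel" and f: "\<And>x. 0 \<le> f x"
    and P: "prob_space (density std_gaussian (\<lambda>x. ennreal (f x)))"
    and poin: "density std_gaussian (\<lambda>x. ennreal (f x)) \<in> poincare_class l"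
    and h: "h \<in> borel_measurable borel" and B: "\<And>x. \<bar>h x\<bar> \<le> B"
  defines "m \<equiv> (LINT x|std_gaussian. f x * ou c h x)"
  shows "integrable std_gaussian (\<lambda>x. f x * (ou c h x - m)\<^sup>2)"
    and "(c\<^sup>2 + l * (1 - c\<^sup>2)) * (LINT x|std_gaussian. f x * (ou c h x - m)\<^sup>2)
      \<le> c\<^sup>2 * (LINT x|std_gaussian. (h x)\<^sup>2 * ou c f x)"
proof -
  let ?\<nu> = "density std_gaussian (\<lambda>x. ennreal (f x))"
  note [measurable] = fm h
  have c2: "c \<noteq> 0" "c\<^sup>2 < 1" using c by (auto simp: abs_square_less_1)
  note fi = gauss_density_prob[OF fm f P]
  have hi: "integrable std_gaussian h" by (rule gauss.integrable_const_bound[where B=B]) (use B in auto)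
  let ?g = "\<lambda>x. ou c h x - m"
  have gm [measurable]: "ou c h \<in> borel_measurable borel" by measurable
  have gb: "\<bar>ou c h x\<bar> \<le> B" for x by (rule ou_bounded[OF h B])
  have B0: "0 \<le> B" using B[of 0] by linarith
  have fb: "integrable std_gaussian (\<lambda>x. f x * k x)" if [measurable]: "k \<in> borel_measurable borel" and "\<And>x. \<bar>k x\<bar> \<le> K" for k :: "'a \<Rightarrow> real" and K
    using integrable_bounded_mult_gauss[OF that fi(1)] by (simp add: mult.commute)
  have mi: "integrable std_gaussian (\<lambda>x. f x * ou c h x)" by (rule fb[OF gm gb])
  have g0: "(LINT x|?\<nu>. ?g x) = 0"
  proof -
    have "(LINT x|?\<nu>. ?g x) = (LINT x|std_gaussian. f x * ou c h x - m * f x)"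
      using integral_density_real(1)[OF fm f, of ?g] by (simp add: right_diff_distrib mult.commute)
    also have "\<dots> = m - m * 1" using mi fi by (simp add: m_def)
    finally show ?thesis by simp
  qed
  have gi: "integrable ?\<nu> ?g"
    using integral_density_real(2)[OF fm f, of ?g] mi fi(1) by (simp add: right_diff_distrib)
  have "smooth ?g"
    unfolding smooth_def using Ck_add[OF ou_smooth(1)[OF c2 hi] Ck_const[of _ "- m"]] by simp
  then have P0: "ennreal l * (\<integral>\<^sup>+x. ennreal ((?g x)\<^sup>2) \<partial>?\<nu>) \<le> (\<integral>\<^sup>+x. ennreal ((norm (grad ?g x))\<^sup>2) \<partial>?\<nu>)"
    using poin gi g0 unfolding poincare_class_def by blast
  have gg: "grad ?g x = grad (ou c h) x" for x
    by (rule grad_eqI) (use GDERIV_diff[OF ou_smooth(3)[OF c2 hi, of x] GDERIV_const[where k=m]]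
        grad_eqI[OF ou_smooth(3)[OF c2 hi, of x]] in simp)
  have mb: "\<bar>m\<bar> \<le> B"
  proof -
    have "\<bar>m\<bar> \<le> (LINT x|std_gaussian. \<bar>f x * ou c h x\<bar>)" unfolding m_def by (rule integral_abs_bound)
    also have "\<dots> \<le> (LINT x|std_gaussian. f x * B)"
    proof (rule integral_mono)
      show "integrable std_gaussian (\<lambda>x. \<bar>f x * ou c h x\<bar>)" using mi by (rule integrable_abs)
      show "\<bar>f x * ou c h x\<bar> \<le> f x * B" for x using gb[of x] f[of x] by (simp add: abs_mult mult_left_mono)
    qed (use fi(1) in simp)
    finally show ?thesis using fi by simp
  qed
  have g2b: "\<bar>(?g x)\<^sup>2\<bar> \<le> (B + B)\<^sup>2" for x
  proof -
    have "\<bar>?g x\<bar> \<le> B + B" using gb[of x] mb by linarith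
    from power_mono[OF this abs_ge_zero, of 2] show ?thesis by simp
  qed
  show Vi: "integrable std_gaussian (\<lambda>x. f x * (?g x)\<^sup>2)" by (rule fb[OF _ g2b]) measurable
  let ?V = "LINT x|std_gaussian. f x * (?g x)\<^sup>2"
  let ?R = "\<lambda>x. c\<^sup>2 / (1 - c\<^sup>2) * (ou c (\<lambda>x. (h x)\<^sup>2) x - (ou c h x)\<^sup>2)"
  have h2b: "\<bar>(h x)\<^sup>2\<bar> \<le> B\<^sup>2" for x using B[of x] by (simp add: abs_le_square_iff[symmetric])
  have oh2b: "\<bar>ou c (\<lambda>x. (h x)\<^sup>2) x\<bar> \<le> B\<^sup>2" for x by (rule ou_bounded[OF _ h2b]) measurable
  have o2b: "\<bar>(ou c h x)\<^sup>2\<bar> \<le> B\<^sup>2" for x using gb[of x] by (simp add: abs_le_square_iff[symmetric])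
  have i1: "integrable std_gaussian (\<lambda>x. f x * ou c (\<lambda>x. (h x)\<^sup>2) x)" by (rule fb[OF _ oh2b]) measurable
  have i2: "integrable std_gaussian (\<lambda>x. f x * (ou c h x)\<^sup>2)" by (rule fb[OF _ o2b]) measurable
  have Ri: "integrable std_gaussian (\<lambda>x. f x * ?R x)"
    using Bochner_Integration.integrable_diff[OF i1 i2, THEN integrable_mult_right, of "c\<^sup>2 / (1 - c\<^sup>2)"]
    by (simp add: right_diff_distrib mult_ac)
  have grR: "(norm (grad (ou c h) x))\<^sup>2 \<le> ?R x" for x
    using ou_reverse_poincare[OF c h B, of x] c2 by (simp add: field_simps)
  have R0: "0 \<le> ?R x" for x using order_trans[OF zero_le_power2 grR] .
  have "ennreal (l * ?V) = ennreal l * (\<integral>\<^sup>+x. ennreal ((?g x)\<^sup>2) \<partial>?\<nu>)"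
    using l f nn_integral_eq_integral[OF Vi]
    by (simp add: ennreal_mult nn_integral_density ennreal_mult')
  also note P0
  also have "(\<integral>\<^sup>+x. ennreal ((norm (grad ?g x))\<^sup>2) \<partial>?\<nu>) \<le> (\<integral>\<^sup>+x. ennreal (?R x) \<partial>?\<nu>)"
    unfolding gg by (intro nn_integral_mono ennreal_leI grR)
  also have "\<dots> = (\<integral>\<^sup>+x. ennreal (f x * ?R x) \<partial>std_gaussian)"
    unfolding ennreal_mult[OF f R0] by (rule nn_integral_density) measurable
  also have "\<dots> = ennreal (LINT x|std_gaussian. f x * ?R x)"
    by (intro nn_integral_eq_integral Ri AE_I2 mult_nonneg_nonneg f R0)
  finally have "l * ?V \<le> (LINT x|std_gaussian. f x * ?R x)"
    by (subst (asm) ennreal_le_iff) (intro Bochner_Integration.integral_nonneg mult_nonneg_nonneg f R0)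
  also have "\<dots> = c\<^sup>2 / (1 - c\<^sup>2) * ((LINT x|std_gaussian. f x * ou c (\<lambda>x. (h x)\<^sup>2) x) - (LINT x|std_gaussian. f x * (ou c h x)\<^sup>2))"
  proof -
    have "(LINT x|std_gaussian. f x * ?R x) = (LINT x|std_gaussian. c\<^sup>2 / (1 - c\<^sup>2) * (f x * ou c (\<lambda>x. (h x)\<^sup>2) x - f x * (ou c h x)\<^sup>2))"
      by (intro Bochner_Integration.integral_cong refl) (simp add: right_diff_distrib mult_ac)
    then show ?thesis using i1 i2 by simp
  qed
  also have "(LINT x|std_gaussian. f x * (ou c h x)\<^sup>2) = ?V + m\<^sup>2"
  proof -
    have "(LINT x|std_gaussian. f x * (ou c h x)\<^sup>2) = (LINT x|std_gaussian. f x * (?g x)\<^sup>2 + (2 * m) * (f x * ou c h x) - m\<^sup>2 * f x)"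
      by (intro Bochner_Integration.integral_cong refl) (simp add: power2_eq_square algebra_simps)
    also have "\<dots> = ?V + (2 * m) * m - m\<^sup>2 * 1" using Vi mi fi by (simp add: m_def)
    finally show ?thesis by (simp add: power2_eq_square)
  qed
  \<comment> \<open>Self-adjointness moves the semigroup from h^2 to the density.\<close>
  also have "(LINT x|std_gaussian. f x * ou c (\<lambda>x. (h x)\<^sup>2) x) = (LINT x|std_gaussian. (h x)\<^sup>2 * ou c f x)"
    using ou_symmetric(1)[OF c2(2) fi(1), of "\<lambda>x. (h x)\<^sup>2" "B\<^sup>2"] h2b by simp
  finally have "l * ?V * (1 - c\<^sup>2) \<le> c\<^sup>2 * ((LINT x|std_gaussian. (h x)\<^sup>2 * ou c f x) - (?V + m\<^sup>2))"
    using c2 by (simp add: field_simps)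
  moreover have "0 \<le> c\<^sup>2 * m\<^sup>2" by (intro mult_nonneg_nonneg zero_le_power2)
  moreover have "A * (X - (V + Y)) = A * X - A * V - A * Y" "(A + l * D) * V = A * V + l * V * D" for A X V Y D :: real
    by (simp_all add: algebra_simps)
  ultimately show "(c\<^sup>2 + l * (1 - c\<^sup>2)) * ?V \<le> c\<^sup>2 * (LINT x|std_gaussian. (h x)\<^sup>2 * ou c f x)"
    by (simp only:)
qed

text \<open>Duality: with \<open>h\<close> a truncation of the score \<open>ou c g / ou c f\<close> one has
  \<open>\<integral> h (ou c g) = \<integral> g (ou c h) = \<integral> g (ou c h - m)\<close>, the last step because \<open>\<integral> g = 0\<close>; Young's
  inequality and the variance bound for \<open>ou c h\<close> finish the argument.\<close>

lemma fisher_contraction: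
  fixes f g :: "'a::euclidean_space \<Rightarrow> real"
  assumes l: "0 < l" and c: "0 < c" "c < 1"
    and fm: "f \<in> borel_measurable borel" and f: "\<And>x. 0 \<le> f x"
    and P: "prob_space (density std_gaussian (\<lambda>x. ennreal (f x)))"
    and poin: "density std_gaussian (\<lambda>x. ennreal (f x)) \<in> poincare_class l"
    and g: "integrable std_gaussian g" "integral\<^sup>L std_gaussian g = 0" "\<And>x. f x = 0 \<Longrightarrow> g x = 0"
    and J: "integrable std_gaussian (\<lambda>x. (g x)\<^sup>2 / f x)"
  defines "\<kappa> \<equiv> c\<^sup>2 / (c\<^sup>2 + l * (1 - c\<^sup>2))"
  shows "integrable std_gaussian (\<lambda>x. (ou c g x)\<^sup>2 / ou c f x)"
    and "(LINT x|std_gaussian. (ou c g x)\<^sup>2 / ou c f x) \<le> \<kappa> * (LINT x|std_gaussian. (g x)\<^sup>2 / f x)"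
proof -
  have c2: "c \<noteq> 0" "c\<^sup>2 < 1" using c by (auto simp: abs_square_less_1)
  note [measurable] = fm
  have gm [measurable]: "g \<in> borel_measurable borel" using borel_measurable_integrable[OF g(1)] by simp
  note fi = gauss_density_prob[OF fm f P]
  have D: "0 < c\<^sup>2 + l * (1 - c\<^sup>2)" using l c2 by (intro add_pos_pos) auto
  have \<kappa>: "0 < \<kappa>" using D c2 by (simp add: \<kappa>_def)
  let ?F = "ou c f" and ?G = "ou c g"
  have F: "0 < ?F x" for x by (rule ou_pos[OF c2(2) fi(1) f]) (simp add: fi)
  let ?J = "LINT x|std_gaussian. (g x)\<^sup>2 / f x"
  define q where "q = (\<lambda>x. ?G x / ?F x)"
  define h where "h = (\<lambda>N::nat. \<lambda>x. max (- real N) (min (real N) (q x)))"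
  have qm [measurable]: "q \<in> borel_measurable borel" unfolding q_def by measurable
  have hm [measurable]: "h N \<in> borel_measurable borel" for N unfolding h_def by measurable
  have hb: "\<bar>h N x\<bar> \<le> real N" for N x by (auto simp: h_def)
  have hq: "(h N x)\<^sup>2 \<le> h N x * q x" "0 \<le> h N x * q x" for N x
    unfolding h_def by (rule clamp_mult, simp)+
  have hG: "h N x * ?G x = h N x * q x * ?F x" for N x using F[of x] by (simp add: q_def)
  have hGi: "integrable std_gaussian (\<lambda>x. h N x * ?G x)" for N by (rule ou_symmetric(2)[OF c2(2) g(1) hm hb])
  have hFi: "integrable std_gaussian (\<lambda>x. (h N x)\<^sup>2 * ?F x)" for N
  proof -
    have "\<bar>(h N x)\<^sup>2\<bar> \<le> (real N)\<^sup>2" for x using hb[of N x] by (simp add: abs_le_square_iff[symmetric])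
    from ou_symmetric(2)[OF c2(2) fi(1) _ this] show ?thesis by simp
  qed
  have bound: "(LINT x|std_gaussian. h N x * ?G x) \<le> \<kappa> * ?J" for N
  proof -
    let ?B = "LINT x|std_gaussian. h N x * ?G x"
    define m where "m = (LINT x|std_gaussian. f x * ou c (h N) x)"
    note V = ou_variance[OF l c fm f P poin hm hb, of N, folded m_def]
    let ?w = "\<lambda>x. ou c (h N) x - m"
    let ?V = "LINT x|std_gaussian. f x * (?w x)\<^sup>2"
    \<comment> \<open>Clamping errs in the right direction: the quadratic term is at most
      \<open>?B\<close>, so the variance bound closes on \<open>?B\<close> itself.\<close>
    have AB: "(LINT x|std_gaussian. (h N x)\<^sup>2 * ?F x) \<le> ?B"
    proof (rule integral_mono[OF hFi hGi])
      show "(h N x)\<^sup>2 * ?F x \<le> h N x * ?G x" for x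
        unfolding hG by (intro mult_right_mono hq less_imp_le[OF F])
    qed
    have "(c\<^sup>2 + l * (1 - c\<^sup>2)) * ?V \<le> c\<^sup>2 * ?B"
      using V(2) mult_left_mono[OF AB, of "c\<^sup>2"] by simp
    then have VB: "?V \<le> \<kappa> * ?B" using D by (simp add: \<kappa>_def field_simps)
    have gi: "integrable std_gaussian (\<lambda>x. g x * ou c (h N) x)" by (rule ou_symmetric(3)[OF c2(2) g(1) hm hb])
    have "?B = (LINT x|std_gaussian. g x * ou c (h N) x)" by (rule ou_symmetric(1)[OF c2(2) g(1) hm hb])
    also have "\<dots> = (LINT x|std_gaussian. g x * ?w x)"
      using gi g by (simp add: right_diff_distrib)
    \<comment> \<open>With this weight in Young's inequality the variance term is at most half of
      \<open>?B\<close> and is absorbed on the left.\<close>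
    also have "\<dots> \<le> (LINT x|std_gaussian. \<kappa> / 2 * ((g x)\<^sup>2 / f x) + 1 / (2 * \<kappa>) * (f x * (?w x)\<^sup>2))"
    proof (rule integral_mono)
      show "integrable std_gaussian (\<lambda>x. g x * ?w x)" using gi g(1) by (simp add: right_diff_distrib)
      show "integrable std_gaussian (\<lambda>x. \<kappa> / 2 * ((g x)\<^sup>2 / f x) + 1 / (2 * \<kappa>) * (f x * (?w x)\<^sup>2))"
        by (intro Bochner_Integration.integrable_add integrable_mult_right J V(1))
      fix x
      show "g x * ?w x \<le> \<kappa> / 2 * ((g x)\<^sup>2 / f x) + 1 / (2 * \<kappa>) * (f x * (?w x)\<^sup>2)"
      \<comment> \<open>Where f vanishes so does g, and the quotient is read with division by 0
        equal to 0.\<close>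
      proof (cases "f x = 0")
        case False
        then have fx: "0 < f x" using f[of x] by simp
        show ?thesis using weighted_young[OF \<kappa> fx] by simp
      qed (simp add: g(3))
    qed
    also have "\<dots> = \<kappa> / 2 * ?J + 1 / (2 * \<kappa>) * ?V"
      by (simp only: Bochner_Integration.integral_add[OF integrable_mult_right[OF J] integrable_mult_right[OF V(1)]]
        Bochner_Integration.integral_mult_right_zero)
    also have "\<dots> \<le> \<kappa> / 2 * ?J + 1 / (2 * \<kappa>) * (\<kappa> * ?B)"
      using VB \<kappa> by (intro add_left_mono mult_left_mono) auto
    finally show ?thesis using \<kappa> by simp
  qed
  \<comment> \<open>Fatou's lemma removes the truncation, since at each point \<open>h N\<close> is
    eventually the score; the finite bound also yields integrability.\<close>
  have "(\<integral>\<^sup>+x. ennreal ((?G x)\<^sup>2 / ?F x) \<partial>std_gaussian)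
    = (\<integral>\<^sup>+x. liminf (\<lambda>N. ennreal (h N x * ?G x)) \<partial>std_gaussian)"
  proof (intro nn_integral_cong)
    fix x
    obtain N where N: "\<bar>q x\<bar> \<le> real N" using real_arch_simple by blast
    have "h n x = q x" if "N \<le> n" for n using N that by (auto simp: h_def max_def min_def)
    then have "(\<lambda>N. ennreal (h N x * ?G x)) \<longlonglongrightarrow> ennreal (q x * ?G x)"
      by (intro tendsto_eventually) (auto simp: eventually_sequentially intro!: exI[of _ N])
    then have "liminf (\<lambda>N. ennreal (h N x * ?G x)) = ennreal (q x * ?G x)"
      by (rule lim_imp_Liminf[OF sequentially_bot])
    then show "ennreal ((?G x)\<^sup>2 / ?F x) = liminf (\<lambda>N. ennreal (h N x * ?G x))"
      by (simp add: q_def power2_eq_square)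
  qed
  also have "\<dots> \<le> liminf (\<lambda>N. \<integral>\<^sup>+x. ennreal (h N x * ?G x) \<partial>std_gaussian)"
    by (rule nn_integral_liminf) measurable
  also have "\<dots> \<le> ennreal (\<kappa> * ?J)"
  proof (intro Liminf_le always_eventually allI)
    fix N
    have "0 \<le> h N x * ?G x" for x unfolding hG using hq(2) less_imp_le[OF F] by simp
    then have "(\<integral>\<^sup>+x. ennreal (h N x * ?G x) \<partial>std_gaussian) = ennreal (LINT x|std_gaussian. h N x * ?G x)"
      by (intro nn_integral_eq_integral hGi AE_I2)
    also have "\<dots> \<le> ennreal (\<kappa> * ?J)" by (rule ennreal_leI[OF bound])
    finally show "(\<integral>\<^sup>+x. ennreal (h N x * ?G x) \<partial>std_gaussian) \<le> ennreal (\<kappa> * ?J)" .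
  qed simp
  finally have fin: "(\<integral>\<^sup>+x. ennreal ((?G x)\<^sup>2 / ?F x) \<partial>std_gaussian) \<le> ennreal (\<kappa> * ?J)" .
  have nn: "0 \<le> (?G x)\<^sup>2 / ?F x" for x using less_imp_le[OF F] by simp
  show int: "integrable std_gaussian (\<lambda>x. (?G x)\<^sup>2 / ?F x)"
    by (rule integrableI_nonneg) (use nn le_less_trans[OF fin ennreal_less_top] in auto)
  have "0 \<le> \<kappa> * ?J" using \<kappa> f by (intro mult_nonneg_nonneg Bochner_Integration.integral_nonneg) auto
  then show "(LINT x|std_gaussian. (?G x)\<^sup>2 / ?F x) \<le> \<kappa> * ?J"
    using fin nn_integral_eq_integral[OF int] nn by (simp add: ennreal_le_iff)
qed

section \<open>De Bruijn's identity\<close>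

text \<open>The bounds \<open>a\<close> and \<open>b\<close> keep the logarithm bounded along the
  semigroup and \<open>B\<close> controls the gradient; together they dominate every derivative of
  the entropy in the semigroup parameter.\<close>

locale regular_density =
  fixes w :: "'a::euclidean_space \<Rightarrow> real" and gw :: "'a \<Rightarrow> 'a" and a b B :: real
  assumes D: "\<And>x. GDERIV w x :> gw x"
    and gm [measurable]: "gw \<in> borel_measurable borel"
    and gB: "\<And>x. norm (gw x) \<le> B"
    and a: "0 < a" and wa: "\<And>x. a \<le> w x" and wb: "\<And>x. w x \<le> b"
begin

definition vou :: "real \<Rightarrow> 'a \<Rightarrow> 'a" where
  "vou r x = (LINT z|std_gaussian. gw (r *\<^sub>R x + sqrt (1 - r\<^sup>2) *\<^sub>R z))"

definition ent :: "real \<Rightarrow> real" where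
  "ent r = (LINT x|std_gaussian. ou r w x * ln (ou r w x))"

lemma w_cont: "isCont w x"
  by (rule differentiable_imp_continuous_within[OF GDERIV_differentiable[OF D]])

lemma wm [measurable]: "w \<in> borel_measurable borel"
  using w_cont by (intro borel_measurable_continuous_onI continuous_at_imp_continuous_on) auto

lemma w_abs: "\<bar>w x\<bar> \<le> b"
  using a wa[of x] wb[of x] by simp

lemma w_int: "integrable std_gaussian (\<lambda>z. w (r *\<^sub>R x + s *\<^sub>R z))"
  by (rule gauss.integrable_const_bound[where B=b]) (use w_abs in auto)

lemma gw_int: "integrable std_gaussian (\<lambda>z. gw (r *\<^sub>R x + s *\<^sub>R z))"
  by (rule gauss.integrable_const_bound[where B=B]) (use gB in auto)

lemma ou_ge: "a \<le> ou r w x" and ou_le: "ou r w x \<le> b"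
proof -
  have "(LINT z|(std_gaussian::'a measure). a) \<le> ou r w x" "ou r w x \<le> (LINT z|(std_gaussian::'a measure). b)"
    unfolding ou_def by (intro integral_mono w_int gauss.integrable_const wa wb)+
  then show "a \<le> ou r w x" "ou r w x \<le> b" by simp_all
qed

lemma ou_w_pos: "0 < ou r w x"
  using a ou_ge[of r x] by linarith

lemma B_nonneg: "0 \<le> B"
  using gB[of 0] norm_ge_zero order_trans by blast

definition lnB :: real where
  "lnB = \<bar>ln a\<bar> + \<bar>ln b\<bar>"

lemma ln_ou: "\<bar>ln (ou r w x)\<bar> \<le> lnB"
proof -
  have "ln a \<le> ln (ou r w x)" "ln (ou r w x) \<le> ln b"
    using a ou_ge[of r x] ou_le[of r x] ou_w_pos[of r x] by auto
  then show ?thesis unfolding lnB_def by linarith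
qed

lemma vou_bound: "norm (vou r x) \<le> B"
proof -
  have "norm (vou r x) \<le> (LINT z|std_gaussian. norm (gw (r *\<^sub>R x + sqrt (1 - r\<^sup>2) *\<^sub>R z)))"
    unfolding vou_def by (rule integral_norm_bound)
  also have "\<dots> \<le> (LINT z|(std_gaussian::'a measure). B)"
    by (intro integral_mono gauss.integrable_const gB integrable_norm gw_int)
  finally show ?thesis by simp
qed

lemma vou_measurable [measurable]: "vou r \<in> borel_measurable borel"
  unfolding vou_def[abs_def] by measurable

text \<open>Commutation of gradient and semigroup. The derivative falls on w, so no factor 1 /
  sqrt(1 - r^2) appears.\<close>

lemma GDERIV_ou_w: "GDERIV (ou r w) x :> r *\<^sub>R vou r x"
proof -
  have "GDERIV (\<lambda>x. LINT z|std_gaussian. w (r *\<^sub>R x + sqrt (1 - r\<^sup>2) *\<^sub>R z)) x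
    :> (LINT z|std_gaussian. r *\<^sub>R gw (r *\<^sub>R x + sqrt (1 - r\<^sup>2) *\<^sub>R z))"
  proof (rule GDERIV_integral(1)[OF zero_less_one])
    fix x z :: 'a
    have "((\<lambda>x. r *\<^sub>R x + sqrt (1 - r\<^sup>2) *\<^sub>R z) has_derivative (\<lambda>h. r *\<^sub>R h)) (at x)"
      by (auto intro!: derivative_eq_intros)
    from has_derivative_compose[OF this D[unfolded gderiv_def]]
    show "GDERIV (\<lambda>x. w (r *\<^sub>R x + sqrt (1 - r\<^sup>2) *\<^sub>R z)) x :> r *\<^sub>R gw (r *\<^sub>R x + sqrt (1 - r\<^sup>2) *\<^sub>R z)"
      unfolding gderiv_def by (simp add: mult.commute)
    show "norm (r *\<^sub>R gw (r *\<^sub>R x + sqrt (1 - r\<^sup>2) *\<^sub>R z)) \<le> \<bar>r\<bar> * B"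
      using gB by (simp add: mult_left_mono)
  qed (auto intro: w_int)
  then show ?thesis unfolding ou_def[abs_def] vou_def integral_scaleR_right .
qed

lemma ent_integrand: "\<bar>ou r w x * ln (ou r w x)\<bar> \<le> b * lnB"
proof -
  have "0 \<le> b" using w_abs[of 0] by linarith
  then show ?thesis unfolding abs_mult by (intro mult_mono ou_bounded[OF wm w_abs] ln_ou abs_ge_zero)
qed

text \<open>Continuity is needed up to the endpoints because \<open>ent\<close> is differentiated
  only for 0 < r < 1; at r = 1 the path r x + sqrt(1 - r^2) z has no derivative in r.\<close>

lemma ent_cont: "continuous_on {0..1} ent"
  unfolding continuous_on_sequentially
proof (intro allI ballI impI, elim conjE)
  fix X :: "nat \<Rightarrow> real" and r assume X: "\<forall>n. X n \<in> {0..1}" "X \<longlonglongrightarrow> r"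
  have 1: "(\<lambda>n. ou (X n) w x) \<longlonglongrightarrow> ou r w x" for x
    unfolding ou_def
  proof (rule integral_dominated_convergence[where w="\<lambda>_. b"])
    show "AE z in std_gaussian. (\<lambda>n. w (X n *\<^sub>R x + sqrt (1 - (X n)\<^sup>2) *\<^sub>R z)) \<longlonglongrightarrow> w (r *\<^sub>R x + sqrt (1 - r\<^sup>2) *\<^sub>R z)"
      by (intro AE_I2 isCont_tendsto_compose[OF w_cont] tendsto_intros X(2))
  qed (use w_abs in auto)
  have "(\<lambda>n. ent (X n)) \<longlonglongrightarrow> ent r"
    unfolding ent_def
  proof (rule integral_dominated_convergence[where w="\<lambda>_. b * lnB"])
    show "AE x in std_gaussian. (\<lambda>n. ou (X n) w x * ln (ou (X n) w x)) \<longlonglongrightarrow> ou r w x * ln (ou r w x)"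
      using ou_w_pos[of r] by (intro AE_I2 tendsto_intros 1) (simp add: less_imp_neq[symmetric])
    show "AE x in std_gaussian. norm (ou (X n) w x * ln (ou (X n) w x)) \<le> b * lnB" for n
      using ent_integrand by (intro AE_I2) simp
  qed auto
  then show "(ent \<circ> X) \<longlonglongrightarrow> ent r" by (simp add: o_def)
qed

text \<open>The derivative of \<open>ou r w x\<close> in r: the second factor is the velocity of the
  point r x + sqrt(1 - r^2) z.\<close>

definition dou :: "real \<Rightarrow> 'a \<Rightarrow> real" where
  "dou r x = (LINT z|std_gaussian. gw (r *\<^sub>R x + sqrt (1 - r\<^sup>2) *\<^sub>R z) \<bullet> (x - (r / sqrt (1 - r\<^sup>2)) *\<^sub>R z))"

lemma dou_measurable [measurable]: "dou r \<in> borel_measurable borel"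
  unfolding dou_def[abs_def] by measurable

context
  fixes r :: real assumes r: "0 < r" "r < 1"
begin

text \<open>Locally uniform control of that velocity: on the ball of radius \<open>re\<close> around
  r the parameter p stays between 0 and (1 + r) / 2, where p / sqrt(1 - p^2) is at most
  \<open>rK\<close>.\<close>

definition rK :: real where
  "rK = 1 / sqrt (1 - ((1 + r) / 2)\<^sup>2)"

definition re :: real where
  "re = min r (1 - r) / 2"

lemma re_pos: "0 < re"
  using r by (simp add: re_def)

lemma ball_re:
  assumes "p \<in> ball r re"
  shows "0 < p" "p < 1" "\<bar>p / sqrt (1 - p\<^sup>2)\<bar> \<le> rK"
proof -
  have p: "0 < p" "p \<le> (1 + r) / 2"
    using assms r by (auto simp: re_def dist_real_def abs_if min_def split: if_splits)
  then show "0 < p" "p < 1" using r by auto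
  have r1: "((1 + r) / 2)\<^sup>2 < 1" using r by (simp add: abs_square_less_1)
  have "p\<^sup>2 \<le> ((1 + r) / 2)\<^sup>2" using p by (intro power_mono) auto
  then have s: "sqrt (1 - ((1 + r) / 2)\<^sup>2) \<le> sqrt (1 - p\<^sup>2)" "0 < sqrt (1 - ((1 + r) / 2)\<^sup>2)"
    using r1 by auto
  have "p / sqrt (1 - p\<^sup>2) \<le> 1 / sqrt (1 - ((1 + r) / 2)\<^sup>2)"
    using s p \<open>p < 1\<close> by (intro frac_le) auto
  moreover have "0 \<le> p / sqrt (1 - p\<^sup>2)" using p s by (intro divide_nonneg_nonneg) linarith+
  ultimately show "\<bar>p / sqrt (1 - p\<^sup>2)\<bar> \<le> rK" by (simp add: rK_def)
qed

lemma dou_int_bound: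
  assumes "p \<in> ball r re"
  shows "norm (gw (p *\<^sub>R x + sqrt (1 - p\<^sup>2) *\<^sub>R z) \<bullet> (x - (p / sqrt (1 - p\<^sup>2)) *\<^sub>R z)) \<le> B * (norm x + rK * norm z)"
proof -
  have "norm (gw (p *\<^sub>R x + sqrt (1 - p\<^sup>2) *\<^sub>R z) \<bullet> (x - (p / sqrt (1 - p\<^sup>2)) *\<^sub>R z))
    \<le> norm (gw (p *\<^sub>R x + sqrt (1 - p\<^sup>2) *\<^sub>R z)) * norm (x - (p / sqrt (1 - p\<^sup>2)) *\<^sub>R z)"
    by (simp add: Cauchy_Schwarz_ineq2)
  also have "\<dots> \<le> B * (norm x + rK * norm z)"
  proof (intro mult_mono gB B_nonneg norm_ge_zero)
    have "norm (x - (p / sqrt (1 - p\<^sup>2)) *\<^sub>R z) \<le> norm x + \<bar>p / sqrt (1 - p\<^sup>2)\<bar> * norm z"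
      using norm_triangle_ineq4[of x "(p / sqrt (1 - p\<^sup>2)) *\<^sub>R z"] by (simp only: norm_scaleR)
    also have "\<dots> \<le> norm x + rK * norm z" using ball_re(3)[OF assms] by (intro add_left_mono mult_right_mono) auto
    finally show "norm (x - (p / sqrt (1 - p\<^sup>2)) *\<^sub>R z) \<le> norm x + rK * norm z" .
  qed
  finally show ?thesis .
qed

lemma dou_dom: "integrable std_gaussian (\<lambda>z :: 'a. B * (norm x + rK * norm z))"
  by (intro integrable_mult_right Bochner_Integration.integrable_add gauss.integrable_const integrable_gauss_norm)

lemma dou_bound:
  assumes "p \<in> ball r re" shows "\<bar>dou p x\<bar> \<le> B * (norm x + rK * (LINT z|(std_gaussian :: 'a measure). norm z))"
proof -
  have "\<bar>dou p x\<bar> \<le> (LINT z|(std_gaussian :: 'a measure). B * (norm x + rK * norm z))"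
    unfolding dou_def real_norm_def[symmetric]
    by (rule Bochner_Integration.integral_norm_bound_integral[OF _ dou_dom dou_int_bound[OF assms]])
      (rule Bochner_Integration.integrable_bound[OF dou_dom[of x]],
       simp, rule AE_I2, rule order_trans[OF dou_int_bound[OF assms]], simp)
  also have "\<dots> = B * (norm x + rK * (LINT z|(std_gaussian :: 'a measure). norm z))"
    by (simp add: integrable_gauss_norm)
  finally show ?thesis .
qed

lemma DERIV_ou:
  assumes "p \<in> ball r re"
  shows "((\<lambda>p. ou p w x) has_real_derivative dou p x) (at p)"
proof -
  obtain e where e: "0 < e" "ball p e \<subseteq> ball r re"
    using assms open_ball[of r re] by (metis open_contains_ball)
  have "GDERIV (\<lambda>p. ou p w x) p :> dou p x"
    unfolding ou_def dou_def
  proof (rule GDERIV_integral(1)[OF e(1) _ _ _ dou_dom[of x]])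
    fix q and z :: 'a assume q: "q \<in> ball p e"
    then have q': "q \<in> ball r re" using e by auto
    have qq: "q\<^sup>2 < 1" using ball_re[OF q'] by (simp add: abs_square_less_1)
    have "((\<lambda>q. q *\<^sub>R x + sqrt (1 - q\<^sup>2) *\<^sub>R z) has_derivative (\<lambda>h. h *\<^sub>R (x - (q / sqrt (1 - q\<^sup>2)) *\<^sub>R z))) (at q)"
    proof -
      have "((\<lambda>q. sqrt (1 - q\<^sup>2)) has_real_derivative (- (q / sqrt (1 - q\<^sup>2)))) (at q)"
        using qq by (auto intro!: derivative_eq_intros simp: field_simps)
      then have "((\<lambda>q. sqrt (1 - q\<^sup>2)) has_derivative (\<lambda>h. - (q / sqrt (1 - q\<^sup>2)) * h)) (at q)"
        unfolding has_field_derivative_def .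
      from has_derivative_add[OF has_derivative_scaleR_left[OF has_derivative_ident, of x] has_derivative_scaleR_left[OF this, of z]]
      show ?thesis by (rule has_derivative_eq_rhs) (simp add: fun_eq_iff scaleR_diff_right mult.commute)
    qed
    from has_derivative_compose[OF this D[unfolded gderiv_def]]
    show "GDERIV (\<lambda>q. w (q *\<^sub>R x + sqrt (1 - q\<^sup>2) *\<^sub>R z)) q
        :> gw (q *\<^sub>R x + sqrt (1 - q\<^sup>2) *\<^sub>R z) \<bullet> (x - (q / sqrt (1 - q\<^sup>2)) *\<^sub>R z)"
      unfolding gderiv_def by (simp add: inner_commute)
    show "norm (gw (q *\<^sub>R x + sqrt (1 - q\<^sup>2) *\<^sub>R z) \<bullet> (x - (q / sqrt (1 - q\<^sup>2)) *\<^sub>R z)) \<le> B * (norm x + rK * norm z)"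
      by (rule dou_int_bound[OF q'])
  qed (auto intro: w_int)
  then show ?thesis by simp
qed

lemma DERIV_ent_dou: "(ent has_real_derivative (LINT x|std_gaussian. (1 + ln (ou r w x)) * dou r x)) (at r)"
proof -
  have "GDERIV (\<lambda>r. LINT x|std_gaussian. ou r w x * ln (ou r w x)) r :> (LINT x|std_gaussian. (1 + ln (ou r w x)) * dou r x)"
  proof (rule GDERIV_integral(1)[OF re_pos])
    fix p and x :: 'a assume p: "p \<in> ball r re"
    have "((\<lambda>p. ou p w x * ln (ou p w x)) has_real_derivative
       dou p x * ln (ou p w x) + 1 / ou p w x * dou p x * ou p w x) (at p)"
      by (rule DERIV_mult[OF DERIV_ou[OF p] DERIV_chain2[OF DERIV_ln_divide[OF ou_w_pos] DERIV_ou[OF p]]])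
    then show "GDERIV (\<lambda>p. ou p w x * ln (ou p w x)) p :> (1 + ln (ou p w x)) * dou p x"
      using ou_w_pos[of p x] by (simp add: algebra_simps)
    have "\<bar>1 + ln (ou p w x)\<bar> \<le> 1 + lnB" using ln_ou[of p x] by linarith
    then show "norm ((1 + ln (ou p w x)) * dou p x) \<le> (1 + lnB) * (B * (norm x + rK * (LINT z|(std_gaussian :: 'a measure). norm z)))"
      unfolding real_norm_def abs_mult by (intro mult_mono dou_bound[OF p]) auto
  next
    fix p
    show "integrable std_gaussian (\<lambda>x. ou p w x * ln (ou p w x))"
      by (rule gauss.integrable_const_bound[where B="b * lnB"]) (use ent_integrand in auto)
    show "integrable std_gaussian (\<lambda>x :: 'a. (1 + lnB) * (B * (norm x + rK * (LINT z|(std_gaussian :: 'a measure). norm z))))"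
      by (intro integrable_mult_right Bochner_Integration.integrable_add gauss.integrable_const integrable_gauss_norm)
  qed simp
  then show ?thesis unfolding ent_def[abs_def] by simp
qed

text \<open>The velocity x - (r / s) z equals (x - r y) / s^2 with y = r x + s z. Exchanging x and y
  by reversibility turns it into z / s, so Gaussian integration by parts in z moves a derivative
  onto L = 1 + ln (ou r w), whose gradient is G. A second exchange collects the average of
  \<open>gw\<close> into \<open>vou\<close>.\<close>

lemma DERIV_ent: "(ent has_real_derivative r * (LINT x|std_gaussian. (norm (vou r x))\<^sup>2 / ou r w x)) (at r)"
proof -
  define s where "s = sqrt (1 - r\<^sup>2)"
  have r2: "r\<^sup>2 < 1" using r by (simp add: abs_square_less_1)
  have s: "0 < s" "s\<^sup>2 = 1 - r\<^sup>2" using r2 by (auto simp: s_def)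
  define L where "L = (\<lambda>x. 1 + ln (ou r w x))"
  define G where "G = (\<lambda>x. (r / ou r w x) *\<^sub>R vou r x)"
  have Lm [measurable]: "L \<in> borel_measurable borel" unfolding L_def by measurable
  have Gm [measurable]: "G \<in> borel_measurable borel" unfolding G_def by measurable
  have LB: "\<bar>L x\<bar> \<le> 1 + lnB" for x using ln_ou[of r x] unfolding L_def by linarith
  have L0: "0 \<le> 1 + lnB" using LB[of 0] by linarith
  have GB: "norm (G x) \<le> r / a * B" for x
  proof -
    have "norm (G x) = r / ou r w x * norm (vou r x)"
      using r ou_w_pos[of r x] by (simp add: G_def)
    also have "\<dots> \<le> r / a * B"
      using r a ou_ge[of r x] B_nonneg by (intro mult_mono vou_bound divide_left_mono) auto
    finally show ?thesis .
  qed
  have DL: "GDERIV L x :> G x" for x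
    using GDERIV_DERIV_compose[OF GDERIV_ou_w[of r x] DERIV_add[OF DERIV_const[of 1] DERIV_ln_divide[OF ou_w_pos[of r x]]]]
    unfolding L_def G_def by simp
  have rot: "rot r p = r *\<^sub>R fst p + s *\<^sub>R snd p" for p :: "'a \<times> 'a" by (simp add: s_def)
  have nfi: "integrable gauss_pair (\<lambda>p :: 'a \<times> 'a. norm (fst p))" "integrable gauss_pair (\<lambda>p :: 'a \<times> 'a. norm (snd p))"
    using integrable_fst_gauss_pair[OF integrable_gauss_norm[where 'a='a]] by auto
  have dom: "integrable gauss_pair (\<lambda>p :: 'a \<times> 'a. (1 + lnB) * (B * (norm (fst p) + rK * norm (snd p))))"
    by (intro integrable_mult_right Bochner_Integration.integrable_add nfi)
  let ?F1 = "\<lambda>p :: 'a \<times> 'a. L (fst p) * (gw (rot r p) \<bullet> (fst p - (r / s) *\<^sub>R snd p))"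
  have rball: "r \<in> ball r re" using re_pos by simp
  have F1i: "integrable gauss_pair ?F1"
  proof (rule Bochner_Integration.integrable_bound[OF dom], measurable)
    show "AE p in gauss_pair. norm (?F1 p) \<le> norm ((1 + lnB) * (B * (norm (fst p) + rK * norm (snd p))))"
    proof (rule AE_I2)
      fix p :: "'a \<times> 'a"
      have "\<bar>gw (rot r p) \<bullet> (fst p - (r / s) *\<^sub>R snd p)\<bar> \<le> B * (norm (fst p) + rK * norm (snd p))"
        using dou_int_bound[OF rball, of "fst p" "snd p"] unfolding s_def by simp
      then have "\<bar>?F1 p\<bar> \<le> (1 + lnB) * (B * (norm (fst p) + rK * norm (snd p)))"
        unfolding abs_mult by (intro mult_mono LB L0) auto
      then show "norm (?F1 p) \<le> norm ((1 + lnB) * (B * (norm (fst p) + rK * norm (snd p))))" by simp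
    qed
  qed
  \<comment> \<open>A function of the pair (x, y) alone, without z, so that \<open>rot_swap\<close>
    is applicable.\<close>
  let ?F = "\<lambda>p. L (fst p) * (gw (snd p) \<bullet> ((1 / s\<^sup>2) *\<^sub>R (fst p - r *\<^sub>R snd p)))"
  have F1F: "?F1 p = ?F (fst p, rot r p)" for p
  proof -
    have "fst p - r *\<^sub>R rot r p = s\<^sup>2 *\<^sub>R fst p - (r * s) *\<^sub>R snd p"
      unfolding rot s(2) by (simp add: algebra_simps power2_eq_square)
    then have "(1 / s\<^sup>2) *\<^sub>R (fst p - r *\<^sub>R rot r p) = fst p - (r / s) *\<^sub>R snd p"
      using s(1) by (simp add: scaleR_diff_right power2_eq_square)
    then show ?thesis by simp
  qed
  have Fsw: "?F (rot r p, fst p) = L (rot r p) * (gw (fst p) \<bullet> ((1 / s) *\<^sub>R snd p))" for p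
    unfolding rot using s(1) by (simp add: power2_eq_square)
  have F2i: "integrable gauss_pair (\<lambda>p. ?F (rot r p, fst p))"
    using F1i unfolding F1F by (subst rot_swap(1)[OF r2]) auto
  have Fsw': "?F (rot r p, fst p) = L (r *\<^sub>R fst p + s *\<^sub>R snd p) * (gw (fst p) \<bullet> ((1 / s) *\<^sub>R snd p))" for p
    unfolding Fsw unfolding rot ..
  have F2i': "integrable gauss_pair (\<lambda>p. L (r *\<^sub>R fst p + s *\<^sub>R snd p) * (gw (fst p) \<bullet> ((1 / s) *\<^sub>R snd p)))"
    using F2i unfolding Fsw unfolding rot .
  have gG: "\<bar>gw x \<bullet> G y\<bar> \<le> B * (r / a * B)" for x y
    by (rule order_trans[OF Cauchy_Schwarz_ineq2 mult_mono[OF gB GB B_nonneg norm_ge_zero]])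
  have G1i: "integrable gauss_pair (\<lambda>p. gw (rot r p) \<bullet> G (fst p))"
    by (rule gauss2.P.integrable_const_bound[where B="B * (r / a * B)"])
       (rule AE_I2, unfold real_norm_def, rule gG, measurable)
  have G2i: "integrable gauss_pair (\<lambda>p. gw (fst p) \<bullet> G (rot r p))"
    by (rule gauss2.P.integrable_const_bound[where B="B * (r / a * B)"])
       (rule AE_I2, unfold real_norm_def, rule gG, measurable)
  have ibp: "(LINT z|std_gaussian. L (r *\<^sub>R x + s *\<^sub>R z) *\<^sub>R z) = s *\<^sub>R (LINT z|std_gaussian. G (r *\<^sub>R x + s *\<^sub>R z))" for x
  proof -
    have "(LINT z|std_gaussian. L (r *\<^sub>R x + s *\<^sub>R z) *\<^sub>R z) = (LINT z|std_gaussian. s *\<^sub>R G (r *\<^sub>R x + s *\<^sub>R z))"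
    proof (rule gauss_ibp)
      show "GDERIV (\<lambda>z. L (r *\<^sub>R x + s *\<^sub>R z)) z :> s *\<^sub>R G (r *\<^sub>R x + s *\<^sub>R z)" for z
      proof -
        have "((\<lambda>z. r *\<^sub>R x + s *\<^sub>R z) has_derivative (\<lambda>h. s *\<^sub>R h)) (at z)"
          by (auto intro!: derivative_eq_intros)
        from has_derivative_compose[OF this DL[unfolded gderiv_def]]
        show ?thesis unfolding gderiv_def by (simp add: mult.commute)
      qed
      show "norm (s *\<^sub>R G (r *\<^sub>R x + s *\<^sub>R z)) \<le> s * (r / a * B)" for z
        using s(1) mult_left_mono[OF GB, of s] by simp
    qed (rule LB, measurable)
    then show ?thesis unfolding integral_scaleR_right .
  qed
  have LGi: "integrable std_gaussian (\<lambda>z. L (r *\<^sub>R x + s *\<^sub>R z) *\<^sub>R z)" for x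
    by (rule integrable_bounded_mult_gauss[OF _ LB integrable_gauss_inner(1)]) measurable
  have Gi: "integrable std_gaussian (\<lambda>z. G (r *\<^sub>R x + s *\<^sub>R z))" for x
    by (rule gauss.integrable_const_bound[where B="r / a * B"]) (use GB in auto)
  have "(LINT x|std_gaussian. (1 + ln (ou r w x)) * dou r x) = (LINT p|gauss_pair. ?F1 p)"
    unfolding gauss2.integral_fst'[OF F1i, symmetric] by (simp add: L_def dou_def s_def)
  also have "\<dots> = (LINT p|gauss_pair. ?F (rot r p, fst p))"
    unfolding F1F by (rule rot_swap(2)[OF r2, symmetric]) measurable
  also have "\<dots> = (LINT x|std_gaussian. LINT z|std_gaussian. L (r *\<^sub>R x + s *\<^sub>R z) * (gw x \<bullet> ((1 / s) *\<^sub>R z)))"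
    using gauss2.integral_fst'[OF F2i'] unfolding Fsw' by (simp only: fst_conv snd_conv)
  also have "\<dots> = (LINT x|std_gaussian. gw x \<bullet> (LINT z|std_gaussian. G (r *\<^sub>R x + s *\<^sub>R z)))"
  proof (intro Bochner_Integration.integral_cong refl)
    fix x
    have "(LINT z|std_gaussian. L (r *\<^sub>R x + s *\<^sub>R z) * (gw x \<bullet> ((1 / s) *\<^sub>R z)))
      = (LINT z|std_gaussian. ((1 / s) *\<^sub>R gw x) \<bullet> (L (r *\<^sub>R x + s *\<^sub>R z) *\<^sub>R z))"
      by (intro Bochner_Integration.integral_cong refl) simp
    also have "\<dots> = ((1 / s) *\<^sub>R gw x) \<bullet> (LINT z|std_gaussian. L (r *\<^sub>R x + s *\<^sub>R z) *\<^sub>R z)"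
      by (rule integral_inner_right) (rule LGi)
    also have "\<dots> = gw x \<bullet> (LINT z|std_gaussian. G (r *\<^sub>R x + s *\<^sub>R z))"
      unfolding ibp using s(1) by simp
    finally show "(LINT z|std_gaussian. L (r *\<^sub>R x + s *\<^sub>R z) * (gw x \<bullet> ((1 / s) *\<^sub>R z)))
      = gw x \<bullet> (LINT z|std_gaussian. G (r *\<^sub>R x + s *\<^sub>R z))" .
  qed
  also have "\<dots> = (LINT x|std_gaussian. LINT z|std_gaussian. gw x \<bullet> G (r *\<^sub>R x + s *\<^sub>R z))"
    by (intro Bochner_Integration.integral_cong refl integral_inner_right[symmetric]) (rule Gi)
  also have "\<dots> = (LINT p|gauss_pair. gw (fst p) \<bullet> G (rot r p))"
    unfolding gauss2.integral_fst'[OF G2i, symmetric] unfolding rot by simp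
  also have "\<dots> = (LINT p|gauss_pair. gw (rot r p) \<bullet> G (fst p))"
    using rot_swap(2)[OF r2, of "\<lambda>p. gw (fst p) \<bullet> G (snd p)"] by simp
  also have "\<dots> = (LINT x|std_gaussian. vou r x \<bullet> G x)"
    unfolding gauss2.integral_fst'[OF G1i, symmetric]
    by (intro Bochner_Integration.integral_cong refl) (simp add: vou_def gw_int)
  also have "\<dots> = (LINT x|std_gaussian. r * ((norm (vou r x))\<^sup>2 / ou r w x))"
    by (intro Bochner_Integration.integral_cong refl) (simp add: G_def power2_norm_eq_inner)
  also have "\<dots> = r * (LINT x|std_gaussian. (norm (vou r x))\<^sup>2 / ou r w x)"
    by (rule Bochner_Integration.integral_mult_right_zero)
  finally show ?thesis using DERIV_ent_dou by (simp only:)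
qed

end

text \<open>At r = 1 the semigroup is the identity and at r = 0 it yields the constant m; these are
  the two boundary terms.\<close>

theorem de_bruijn:
  defines "m \<equiv> integral\<^sup>L std_gaussian w"
  shows "((\<lambda>r. r * (LINT x|std_gaussian. (norm (vou r x))\<^sup>2 / ou r w x)) has_integral
    (LINT x|std_gaussian. w x * ln (w x)) - m * ln m) {0..1}"
proof -
  have "((\<lambda>r. r * (LINT x|std_gaussian. (norm (vou r x))\<^sup>2 / ou r w x)) has_integral (ent 1 - ent 0)) {0..1}"
    by (rule fundamental_theorem_of_calculus_interior[OF zero_le_one ent_cont])
       (simp add: has_real_derivative_iff_has_vector_derivative[symmetric] DERIV_ent)
  moreover have "ent 1 = (LINT x|std_gaussian. w x * ln (w x))" "ent 0 = m * ln m"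
    unfolding ent_def ou_def m_def by simp_all
  ultimately show ?thesis by simp
qed

end

section \<open>Weak gradients\<close>

text \<open>A bounded truncation for which \<open>t (trunc' e t)\<^sup>2 / trunc e t\<close> stays bounded, so that it increases the
  Fisher information of a density by at most a constant factor.\<close>

definition trunc :: "real \<Rightarrow> real \<Rightarrow> real" where
  "trunc e t = t\<^sup>2 / (e + t + e * t\<^sup>2)"

definition trunc' :: "real \<Rightarrow> real \<Rightarrow> real" where
  "trunc' e t = t * (2 * e + t) / (e + t + e * t\<^sup>2)\<^sup>2"

lemma trunc_measurable [measurable]:
  "trunc e \<in> borel_measurable borel" "trunc' e \<in> borel_measurable borel"
  unfolding trunc_def[abs_def] trunc'_def[abs_def] by measurable

lemma trunc_0 [simp]: "trunc e 0 = 0" "trunc' e 0 = 0"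
  by (simp_all add: trunc_def trunc'_def)

context
  fixes e t :: real assumes e: "0 < e" and t: "0 \<le> t"
begin

lemma trunc_denom: "0 < e + t + e * t\<^sup>2"
  using e t by (intro add_pos_nonneg) auto

lemma trunc_nonneg: "0 \<le> trunc e t"
  unfolding trunc_def using trunc_denom by simp

lemma trunc_le: "trunc e t \<le> t"
proof -
  have "t\<^sup>2 \<le> t * (e + t + e * t\<^sup>2)" using e t by (simp add: algebra_simps power2_eq_square)
  then show ?thesis unfolding trunc_def using trunc_denom by (simp add: pos_divide_le_eq)
qed

lemma trunc_bounded: "trunc e t \<le> 1 / e"
proof -
  have "t\<^sup>2 * e \<le> e + t + e * t\<^sup>2" using e t by (simp add: mult.commute)
  then show ?thesis unfolding trunc_def using trunc_denom e by (simp add: divide_le_eq field_simps)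
qed

lemma trunc'_nonneg: "0 \<le> trunc' e t"
  unfolding trunc'_def using e t by simp

lemma trunc'_le_1: "trunc' e t \<le> 1"
proof -
  have "t * (2 * e + t) \<le> (e + t)\<^sup>2" by (simp add: power2_eq_square algebra_simps)
  also have "\<dots> \<le> (e + t + e * t\<^sup>2)\<^sup>2" using e t by (intro power_mono) auto
  finally show ?thesis unfolding trunc'_def using trunc_denom by simp
qed

lemma trunc'_sq_le: "t * (trunc' e t)\<^sup>2 \<le> 4 * trunc e t"
proof -
  let ?d = "e + t + e * t\<^sup>2"
  \<comment> \<open>The constant 4 arises here: t is at most the denominator and 2 e + t at most
    twice the denominator.\<close>
  have "t * (2 * e + t)\<^sup>2 \<le> ?d * (2 * ?d)\<^sup>2"
    using e t by (intro mult_mono power_mono) auto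
  then have "t\<^sup>2 * (t * (2 * e + t)\<^sup>2) \<le> t\<^sup>2 * (?d * (2 * ?d)\<^sup>2)" by (intro mult_left_mono) auto
  also have "t\<^sup>2 * (d * (2 * d)\<^sup>2) = 4 * t\<^sup>2 * d ^ 3" for d
    by (simp add: power2_eq_square power3_eq_cube)
  finally have "t\<^sup>2 * (t * (2 * e + t)\<^sup>2) / ?d ^ 4 \<le> 4 * t\<^sup>2 * ?d ^ 3 / ?d ^ 4"
    using trunc_denom by (intro divide_right_mono) auto
  also have "\<dots> = 4 * trunc e t"
    using trunc_denom by (simp add: trunc_def power_eq_if[of _ 4] power3_eq_cube)
  also have "t\<^sup>2 * (t * (2 * e + t)\<^sup>2) / ?d ^ 4 = t * (trunc' e t)\<^sup>2"
    unfolding trunc'_def by (simp add: power_divide power_mult_distrib power_mult[symmetric])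
  finally show ?thesis .
qed

lemma DERIV_trunc: "(trunc e has_real_derivative trunc' e t) (at t)"
proof -
  have "((\<lambda>t. t\<^sup>2 / (e + t + e * t\<^sup>2)) has_real_derivative
    (2 * t * (e + t + e * t\<^sup>2) - t\<^sup>2 * (1 + e * (2 * t))) / ((e + t + e * t\<^sup>2) * (e + t + e * t\<^sup>2))) (at t)"
    using trunc_denom by (auto intro!: derivative_eq_intros)
  moreover have "2 * t * (e + t + e * t\<^sup>2) - t\<^sup>2 * (1 + e * (2 * t)) = t * (2 * e + t)"
    by (simp add: power2_eq_square algebra_simps)
  ultimately show ?thesis unfolding trunc_def[abs_def] trunc'_def power2_eq_square[of "e + t + e * t\<^sup>2"] by simp
qed

lemma isCont_trunc': "isCont (trunc' e) t"
  unfolding trunc'_def[abs_def] using trunc_denom by (intro continuous_intros) simp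

end

text \<open>The derivatives converge to the indicator of t > 0 and not to 1, so in the limit the
  weak gradient survives only where the density is positive.\<close>

lemma trunc_tendsto:
  assumes "0 \<le> t"
  shows "(\<lambda>n. trunc (1 / real (Suc n)) t) \<longlonglongrightarrow> t"
    and "(\<lambda>n. trunc' (1 / real (Suc n)) t) \<longlonglongrightarrow> (if t = 0 then 0 else 1)"
proof -
  have e: "(\<lambda>n. 1 / real (Suc n)) \<longlonglongrightarrow> 0" by (rule lim_inverse_n'[THEN LIMSEQ_Suc])
  have d: "(\<lambda>n. 1 / real (Suc n) + t + 1 / real (Suc n) * t\<^sup>2) \<longlonglongrightarrow> 0 + t + 0 * t\<^sup>2" by (intro tendsto_intros e)
  show "(\<lambda>n. trunc (1 / real (Suc n)) t) \<longlonglongrightarrow> t"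
  proof (cases "t = 0")
    case False
    have "(\<lambda>n. trunc (1 / real (Suc n)) t) \<longlonglongrightarrow> t\<^sup>2 / (0 + t + 0 * t\<^sup>2)"
      unfolding trunc_def by (intro tendsto_divide tendsto_const d) (use False in simp)
    then show ?thesis using False by (simp add: power2_eq_square)
  qed simp
  show "(\<lambda>n. trunc' (1 / real (Suc n)) t) \<longlonglongrightarrow> (if t = 0 then 0 else 1)"
  proof (cases "t = 0")
    case False
    have "(\<lambda>n. trunc' (1 / real (Suc n)) t) \<longlonglongrightarrow> t * (2 * 0 + t) / (0 + t + 0 * t\<^sup>2)\<^sup>2"
      unfolding trunc'_def by (intro tendsto_divide tendsto_power tendsto_mult tendsto_add tendsto_const d e) (use False in simp)
    then show ?thesis using False by (simp add: power2_eq_square)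
  qed simp
qed

section \<open>Localising the weak gradient\<close>

lemma set_integrable_cball_bound:
  fixes g :: "'a::euclidean_space \<Rightarrow> 'b::{banach, second_countable_topology}"
    and h :: "'a \<Rightarrow> 'c::{banach, second_countable_topology}"
  assumes "set_integrable lborel (cball 0 R) g" "h \<in> borel_measurable borel"
    and "\<And>x. norm x \<le> R \<Longrightarrow> norm (h x) \<le> C * norm (g x)" "\<And>x. R < norm x \<Longrightarrow> h x = 0"
  shows "integrable lborel h"
proof (rule Bochner_Integration.integrable_bound)
  show "integrable lborel (\<lambda>x. C *\<^sub>R (indicat_real (cball 0 R) x *\<^sub>R g x))"
    using assms(1) unfolding set_integrable_def by (rule integrable_scaleR_right)
  show "AE x in lborel. norm (h x) \<le> norm (C *\<^sub>R (indicat_real (cball 0 R) x *\<^sub>R g x))"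
  proof (rule AE_I2)
    fix x
    show "norm (h x) \<le> norm (C *\<^sub>R (indicat_real (cball 0 R) x *\<^sub>R g x))"
    proof (cases "norm x \<le> R")
      case True
      have "norm (h x) \<le> C * norm (g x)" by (rule assms(3)[OF True])
      also have "\<dots> \<le> \<bar>C\<bar> * norm (g x)" by (intro mult_right_mono) auto
      finally show ?thesis using True by simp
    qed (use assms(4) in simp)
  qed
qed (use assms(2) in simp)

lemma continuous_cball_bound:
  fixes k :: "'a::euclidean_space \<Rightarrow> 'b::real_normed_vector"
  assumes "continuous_on UNIV k"
  obtains C where "0 \<le> C" "\<And>x. norm x \<le> R \<Longrightarrow> norm (k x) \<le> C"
proof -
  have "compact (k ` cball 0 R)"
    by (intro compact_continuous_image continuous_on_subset[OF assms]) auto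
  then have "bounded (k ` cball 0 R)" by (rule compact_imp_bounded)
  then obtain C where "\<And>y. y \<in> k ` cball 0 R \<Longrightarrow> norm y \<le> C" unfolding bounded_iff by blast
  then show thesis using that[of "max 0 C"] by (simp add: le_max_iff_disj)
qed

lemma continuous_grad:
  fixes \<phi> :: "'a::euclidean_space \<Rightarrow> real"
  assumes "smooth \<phi>"
  shows "continuous_on UNIV \<phi>" "continuous_on UNIV (grad \<phi>)" "GDERIV \<phi> x :> grad \<phi> x"
proof -
  have "Ck 0 \<phi>" "Ck (Suc 0) \<phi>" using assms unfolding smooth_def by blast+
  then show "continuous_on UNIV \<phi>" "GDERIV \<phi> x :> grad \<phi> x" using GDERIV_grad by auto
  show "continuous_on UNIV (grad \<phi>)"
    using \<open>Ck (Suc 0) \<phi>\<close> by (subst continuous_on_componentwise) auto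
qed

lemma smooth_mult: "smooth \<phi> \<Longrightarrow> smooth \<eta> \<Longrightarrow> smooth (\<lambda>x. \<phi> x * \<eta> x)"
  unfolding smooth_def by (auto intro: Ck_mult)

lemma smooth_cutoff: "smooth (cutoff R)"
  unfolding smooth_def by (auto intro: Ck_cutoff)

locale weak_pair =
  fixes f :: "'a::euclidean_space \<Rightarrow> real" and G :: "'a \<Rightarrow> 'a"
  assumes wg: "is_weak_gradient f G"
    and fm [measurable]: "f \<in> borel_measurable borel" and f0: "\<And>x. 0 \<le> f x"
    and fint: "integrable std_gaussian f"
    and fisher: "set_integrable std_gaussian {x. 0 < f x} (\<lambda>x. (norm (G x))\<^sup>2 / f x)"
begin

lemma f_loc: "set_integrable lborel (cball 0 R) f" and G_loc: "set_integrable lborel (cball 0 R) G"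
  using wg unfolding is_weak_gradient_def locally_integrable_def by auto

text \<open>Local integrability includes measurability on balls, and G is the pointwise limit of its
  restrictions.\<close>

lemma Gm [measurable]: "G \<in> borel_measurable borel"
proof (rule borel_measurable_LIMSEQ_metric)
  show "(\<lambda>x. indicat_real (cball 0 (real n)) x *\<^sub>R G x) \<in> borel_measurable borel" for n
    using borel_measurable_integrable[OF G_loc[unfolded set_integrable_def, of "real n"]] by simp
  fix x :: 'a
  obtain N where N: "norm x \<le> real N" using real_arch_simple by blast
  have "indicat_real (cball 0 (real n)) x *\<^sub>R G x = G x" if "N \<le> n" for n
    using N that by (simp add: indicator_def)
  then show "(\<lambda>n. indicat_real (cball 0 (real n)) x *\<^sub>R G x) \<longlonglongrightarrow> G x"
    by (intro tendsto_eventually) (auto simp: eventually_sequentially intro!: exI[of _ N])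
qed

lemma fisher_integrable:
  "integrable std_gaussian (\<lambda>x. (norm (if 0 < f x then G x else 0))\<^sup>2 / f x)"
proof -
  have eq: "indicat_real {x. 0 < f x} x *\<^sub>R ((norm (G x))\<^sup>2 / f x) = (norm (if 0 < f x then G x else 0))\<^sup>2 / f x" for x
    by (cases "0 < f x") simp_all
  show ?thesis using fisher unfolding set_integrable_def eq .
qed

text \<open>By |G| <= f + |G|^2 / f on the set where f is positive, finite Fisher information gives
  integrability on the whole space, beyond what the definition of a weak gradient provides.\<close>

lemma G_pos_integrable: "integrable std_gaussian (\<lambda>x. if 0 < f x then G x else 0)"
proof (rule Bochner_Integration.integrable_bound)
  show "integrable std_gaussian (\<lambda>x. f x + (norm (if 0 < f x then G x else 0))\<^sup>2 / f x)"
    by (intro Bochner_Integration.integrable_add fint fisher_integrable)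
  show "AE x in std_gaussian. norm (if 0 < f x then G x else 0)
    \<le> norm (f x + (norm (if 0 < f x then G x else 0))\<^sup>2 / f x)"
  proof (rule AE_I2)
    fix x
    show "norm (if 0 < f x then G x else 0) \<le> norm (f x + (norm (if 0 < f x then G x else 0))\<^sup>2 / f x)"
    proof (cases "0 < f x")
      case True
      have "norm (G x) * f x \<le> f x * f x + (norm (G x))\<^sup>2"
      proof -
        have "0 \<le> norm (G x) * f x" using True by simp
        moreover have "0 \<le> b * b + a\<^sup>2 - 2 * (a * b)" for a b :: real
          using zero_le_power2[of "b - a"] by (simp add: power2_eq_square algebra_simps)
        from this[of "f x" "norm (G x)"] have "0 \<le> f x * f x + (norm (G x))\<^sup>2 - 2 * (norm (G x) * f x)" .
        ultimately show ?thesis by linarith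
      qed
      then have "norm (G x) \<le> f x + (norm (G x))\<^sup>2 / f x" using True by (simp add: field_simps)
      also have "\<dots> \<le> \<bar>f x + (norm (G x))\<^sup>2 / f x\<bar>" by simp
      finally show ?thesis using True by simp
    qed simp
  qed
qed measurable

text \<open>Together with \<open>cutG\<close>, its gradient by the product rule, a compactly
  supported version of the pair f, G.\<close>

definition cutF :: "real \<Rightarrow> 'a \<Rightarrow> real" where
  "cutF R x = cutoff R x * f x"

definition cutG :: "real \<Rightarrow> 'a \<Rightarrow> 'a" where
  "cutG R x = cutoff R x *\<^sub>R G x + f x *\<^sub>R grad (cutoff R) x"

lemma cutoff_measurable [measurable]:
  "cutoff R \<in> borel_measurable (borel :: 'a measure)" "grad (cutoff R) \<in> borel_measurable (borel :: 'a measure)"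
  by (intro borel_measurable_continuous_onI continuous_grad smooth_cutoff)+

lemma cutF_measurable [measurable]: "cutF R \<in> borel_measurable borel" "cutG R \<in> borel_measurable borel"
  unfolding cutF_def[abs_def] cutG_def[abs_def] by measurable

text \<open>On the open complement of the closed ball the cutoff is constantly 0.\<close>

lemma grad_cutoff_0:
  assumes "0 < R" "R < norm x" shows "grad (cutoff R) (x :: 'a) = 0"
proof (rule grad_eqI)
  have "((\<lambda>x. 0 :: real) has_derivative (\<lambda>h. 0)) (at x)" by simp
  then have "(cutoff R has_derivative (\<lambda>h. 0)) (at x)"
    by (rule has_derivative_transform_within_open[OF _ open_Compl[OF closed_cball[of 0 R]]]) (use assms in \<open>auto simp: cutoff_eq_0\<close>)
  then show "GDERIV (cutoff R) x :> 0" unfolding gderiv_def by simp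
qed

lemma cut_outside:
  assumes "0 < R" "R < norm x" shows "cutF R x = 0" "cutG R x = 0"
  using assms by (simp_all add: cutF_def cutG_def cutoff_eq_0 grad_cutoff_0)

text \<open>The product of \<open>\<eta>\<close> with the cutoff is an admissible test function, and
  expanding its gradient moves the cutoff onto f. So \<open>\<eta>\<close> itself carries no
  condition on its support.\<close>

lemma cut_weak:
  assumes R: "0 < R" and \<eta>: "smooth \<eta>"
  shows "(LINT x|lborel. cutF R x *\<^sub>R grad \<eta> x) = - (LINT x|lborel. \<eta> x *\<^sub>R cutG R x)"
    and "integrable lborel (\<lambda>x. cutF R x *\<^sub>R grad \<eta> x)" "integrable lborel (\<lambda>x. \<eta> x *\<^sub>R cutG R x)"
proof -
  note c\<eta> = continuous_grad[OF \<eta>] and c\<chi> = continuous_grad[OF smooth_cutoff[of R, where 'a='a]]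
  have [measurable]: "\<eta> \<in> borel_measurable borel" "grad \<eta> \<in> borel_measurable borel"
    by (intro borel_measurable_continuous_onI c\<eta>)+
  obtain C1 where C1: "0 \<le> C1" "\<And>x. norm x \<le> R \<Longrightarrow> norm (\<eta> x) \<le> C1" using continuous_cball_bound[OF c\<eta>(1)] by blast
  obtain C2 where C2: "0 \<le> C2" "\<And>x. norm x \<le> R \<Longrightarrow> norm (grad \<eta> x) \<le> C2" using continuous_cball_bound[OF c\<eta>(2)] by blast
  obtain C3 where C3: "0 \<le> C3" "\<And>x. norm x \<le> R \<Longrightarrow> norm (grad (cutoff R) (x :: 'a)) \<le> C3"
    using continuous_cball_bound[OF c\<chi>(2)] by blast
  have \<chi>: "0 \<le> cutoff R x" "cutoff R x \<le> 1" for x :: 'a by (rule cutoff_nonneg cutoff_le_1)+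
  let ?\<phi> = "\<lambda>x. cutoff R x * \<eta> x"
  have s\<phi>: "smooth ?\<phi>" by (rule smooth_mult[OF smooth_cutoff \<eta>])
  have "closure {x. ?\<phi> x \<noteq> 0} \<subseteq> cball 0 R"
  proof (rule closure_minimal)
    show "{x. ?\<phi> x \<noteq> 0} \<subseteq> cball 0 R"
    proof
      fix x assume "x \<in> {x. ?\<phi> x \<noteq> 0}"
      then show "x \<in> cball 0 R" using cutoff_eq_0[OF R, of x] by (cases "norm x \<le> R") auto
    qed
  qed simp
  then have "compact (closure {x. ?\<phi> x \<noteq> 0})"
    by (metis closed_closure compact_cball compact_Int_closed inf.absorb_iff2)
  then have W: "(LINT x|lborel. f x *\<^sub>R grad ?\<phi> x) = - (LINT x|lborel. ?\<phi> x *\<^sub>R G x)"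
    using wg s\<phi> unfolding is_weak_gradient_def by blast
  have g\<phi>: "grad ?\<phi> x = cutoff R x *\<^sub>R grad \<eta> x + \<eta> x *\<^sub>R grad (cutoff R) x" for x
    by (rule grad_eqI[OF GDERIV_mult[OF c\<chi>(3) c\<eta>(3)]])
  show i1: "integrable lborel (\<lambda>x. cutF R x *\<^sub>R grad \<eta> x)"
  proof (rule set_integrable_cball_bound[OF f_loc])
    show "norm (cutF R x *\<^sub>R grad \<eta> x) \<le> C2 * norm (f x)" if "norm x \<le> R" for x
    proof -
      have "norm (cutF R x *\<^sub>R grad \<eta> x) = cutoff R x * (norm (f x) * norm (grad \<eta> x))"
        using \<chi>(1)[of x] by (simp add: cutF_def abs_mult)
      also have "\<dots> \<le> 1 * (norm (f x) * C2)" using \<chi> C2(2)[OF that] by (intro mult_mono) auto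
      finally show ?thesis by (simp add: mult.commute)
    qed
  qed (simp_all add: cut_outside[OF R])
  have i2: "integrable lborel (\<lambda>x. f x *\<^sub>R (\<eta> x *\<^sub>R grad (cutoff R) x))"
  proof (rule set_integrable_cball_bound[OF f_loc])
    show "norm (f x *\<^sub>R (\<eta> x *\<^sub>R grad (cutoff R) x)) \<le> C1 * C3 * norm (f x)" if "norm x \<le> R" for x
    proof -
      have "norm (f x *\<^sub>R (\<eta> x *\<^sub>R grad (cutoff R) x)) = (norm (\<eta> x) * norm (grad (cutoff R) x)) * norm (f x)"
        by (simp add: abs_mult)
      also have "\<dots> \<le> (C1 * C3) * norm (f x)"
        using C1 C3 that by (intro mult_right_mono mult_mono) auto
      finally show ?thesis .
    qed
  qed (simp_all add: grad_cutoff_0[OF R])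
  have i3: "integrable lborel (\<lambda>x. (cutoff R x * \<eta> x) *\<^sub>R G x)"
  proof (rule set_integrable_cball_bound[OF G_loc])
    show "norm ((cutoff R x * \<eta> x) *\<^sub>R G x) \<le> C1 * norm (G x)" if "norm x \<le> R" for x
    proof -
      have "norm ((cutoff R x * \<eta> x) *\<^sub>R G x) = (cutoff R x * norm (\<eta> x)) * norm (G x)"
        using \<chi>(1)[of x] by (simp add: abs_mult)
      also have "\<dots> \<le> (1 * C1) * norm (G x)" using \<chi> C1(2)[OF that] by (intro mult_right_mono mult_mono) auto
      finally show ?thesis by simp
    qed
  qed (simp_all add: cutoff_eq_0[OF R] less_imp_le)
  have e: "\<eta> x *\<^sub>R cutG R x = (cutoff R x * \<eta> x) *\<^sub>R G x + f x *\<^sub>R (\<eta> x *\<^sub>R grad (cutoff R) x)" for x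
    by (simp add: cutG_def scaleR_add_right mult.commute)
  show "integrable lborel (\<lambda>x. \<eta> x *\<^sub>R cutG R x)"
    unfolding e by (intro Bochner_Integration.integrable_add i2 i3)
  have "(LINT x|lborel. f x *\<^sub>R grad ?\<phi> x)
    = (LINT x|lborel. cutF R x *\<^sub>R grad \<eta> x + f x *\<^sub>R (\<eta> x *\<^sub>R grad (cutoff R) x))"
    unfolding g\<phi> cutF_def by (simp add: scaleR_add_right mult.commute)
  also have "\<dots> = (LINT x|lborel. cutF R x *\<^sub>R grad \<eta> x) + (LINT x|lborel. f x *\<^sub>R (\<eta> x *\<^sub>R grad (cutoff R) x))"
    by (rule Bochner_Integration.integral_add[OF i1 i2])
  finally have "(LINT x|lborel. cutF R x *\<^sub>R grad \<eta> x) =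
    - ((LINT x|lborel. (cutoff R x * \<eta> x) *\<^sub>R G x) + (LINT x|lborel. f x *\<^sub>R (\<eta> x *\<^sub>R grad (cutoff R) x)))"
    using W by (simp add: algebra_simps)
  also have "\<dots> = - (LINT x|lborel. \<eta> x *\<^sub>R cutG R x)"
    unfolding e Bochner_Integration.integral_add[OF i3 i2] ..
  finally show "(LINT x|lborel. cutF R x *\<^sub>R grad \<eta> x) = - (LINT x|lborel. \<eta> x *\<^sub>R cutG R x)" .
qed

end

lemma lborel_gauss_integrable:
  fixes h :: "'a::euclidean_space \<Rightarrow> 'b::{banach, second_countable_topology}"
  assumes h: "integrable lborel h"
  shows "integrable std_gaussian h"
proof -
  have [measurable]: "h \<in> borel_measurable borel" using borel_measurable_integrable[OF h] by simp
  have "integrable lborel (\<lambda>x. gauss_density x *\<^sub>R h x)"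
  proof (rule Bochner_Integration.integrable_bound)
    let ?C = "(2 * pi) powr (- (real DIM('a) / 2))"
    show "integrable lborel (\<lambda>x. ?C *\<^sub>R h x)" using h by (rule integrable_scaleR_right)
    show "AE x in lborel. norm (gauss_density x *\<^sub>R h x) \<le> norm (?C *\<^sub>R h x)"
    proof (rule AE_I2)
      fix x :: 'a
      have "gauss_density x \<le> ?C" unfolding gauss_density_def by (intro mult_left_le) auto
      then show "norm (gauss_density x *\<^sub>R h x) \<le> norm (?C *\<^sub>R h x)" by (auto intro!: mult_right_mono)
    qed
  qed simp
  then show ?thesis unfolding std_gaussian_eq by (subst integrable_density) auto
qed

text \<open>Against Lebesgue measure the transition kernel is the exponential of a quadratic in y,
  hence smooth and usable as \<open>\<eta>\<close> in \<open>cut_weak\<close>.\<close>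

lemma mehler_gauss_exp:
  fixes x y :: "'a::euclidean_space"
  assumes c: "c\<^sup>2 < 1"
  shows "mehler c x y * gauss_density y = ((1 / sqrt (1 - c\<^sup>2)) ^ DIM('a) * (2 * pi) powr (- (real DIM('a) / 2)))
    * exp (((c / (1 - c\<^sup>2)) *\<^sub>R x) \<bullet> y + (- (1 / (2 * (1 - c\<^sup>2)))) * (y \<bullet> y) + - (c\<^sup>2 * (norm x)\<^sup>2 / (2 * (1 - c\<^sup>2))))"
proof -
  define s where "s = 1 - c\<^sup>2"
  have s: "0 < s" "c\<^sup>2 = 1 - s" using c by (auto simp: s_def)
  have "- (c\<^sup>2 * X - 2 * c * Y + c\<^sup>2 * Z) / (2 * s) + - Z / 2 = c / s * Y + - (1 / (2 * s)) * Z + - (c\<^sup>2 * X / (2 * s))" for X Y Z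
  proof -
    have "- (c\<^sup>2 * X - 2 * c * Y + c\<^sup>2 * Z) / (2 * s) + - Z / 2 = (- (c\<^sup>2 * X - 2 * c * Y + c\<^sup>2 * Z) + - (s * Z)) / (2 * s)"
      using s(1) by (simp add: field_simps)
    also have "\<dots> = (2 * c * Y - Z - c\<^sup>2 * X) / (2 * s)" unfolding s(2) by (simp add: algebra_simps)
    also have "\<dots> = c / s * Y + - (1 / (2 * s)) * Z + - (c\<^sup>2 * X / (2 * s))"
      using s(1) by (simp add: diff_divide_distrib)
    finally show ?thesis .
  qed
  from this[of "(norm x)\<^sup>2" "x \<bullet> y" "(norm y)\<^sup>2"]
  have "exp (- (c\<^sup>2 * (norm x)\<^sup>2 - 2 * c * (x \<bullet> y) + c\<^sup>2 * (norm y)\<^sup>2) / (2 * s)) * exp (- (norm y)\<^sup>2 / 2)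
    = exp (((c / s) *\<^sub>R x) \<bullet> y + (- (1 / (2 * s))) * (y \<bullet> y) + - (c\<^sup>2 * (norm x)\<^sup>2 / (2 * s)))"
    unfolding exp_add[symmetric] dot_square_norm by simp
  note E = this
  have r: "(a * e1) * (b * e2) = (a * b) * (e1 * e2)" for a b e1 e2 :: real by simp
  show ?thesis unfolding mehler_def gauss_density_def s_def[symmetric] by (subst r) (simp only: E)
qed

lemma GDERIV_exp_quadratic:
  "GDERIV (\<lambda>y. A * exp (v \<bullet> y + \<beta> * (y \<bullet> y) + r)) y :> (A * exp (v \<bullet> y + \<beta> * (y \<bullet> y) + r)) *\<^sub>R (v + (2 * \<beta>) *\<^sub>R y)"
  using GDERIV_mult[OF GDERIV_const[of A y] GDERIV_DERIV_compose[OF GDERIV_quadratic[of v \<beta> r y] DERIV_exp]]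
  by (simp add: mult.assoc)

context weak_pair begin

lemma cutG_lborel: "0 < R \<Longrightarrow> integrable lborel (cutG R)"
  using cut_weak(3)[of R "\<lambda>_. 1"] Ck_const by (auto simp: smooth_def)

lemma cutG_int: "0 < R \<Longrightarrow> integrable std_gaussian (cutG R)"
  by (intro lborel_gauss_integrable cutG_lborel)

lemma cutF_bounds: "0 \<le> cutF R x" "cutF R x \<le> f x"
  using cutoff_nonneg[of R x] cutoff_le_1[of R x] f0[of x] unfolding cutF_def
  by (auto intro: mult_left_le_one_le)

lemma cutF_int: "integrable std_gaussian (cutF R)"
  by (rule Bochner_Integration.integrable_bound[OF fint])
     (use cutF_bounds f0 in \<open>auto intro!: AE_I2\<close>)

text \<open>Two readings of \<open>cut_weak\<close> with the transition density as
  \<open>\<eta>\<close>: the derivative on the kernel is the gradient formula of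
  \<open>ou_smooth\<close>, the derivative on the density is the average of
  \<open>cutG\<close>.\<close>

lemma grad_ou_cut:
  assumes c: "0 < c" "c < 1" and R: "0 < R"
  shows "GDERIV (ou c (cutF R)) x :> c *\<^sub>R (LINT z|std_gaussian. cutG R (c *\<^sub>R x + sqrt (1 - c\<^sup>2) *\<^sub>R z))"
proof -
  have c2: "c \<noteq> 0" "c\<^sup>2 < 1" using c by (auto simp: abs_square_less_1)
  define s where "s = sqrt (1 - c\<^sup>2)"
  have s: "0 < s" "1 - c\<^sup>2 = s\<^sup>2" using c2 by (auto simp: s_def)
  define \<eta> where "\<eta> = (\<lambda>y. mehler c x y * gauss_density y)"
  note e = mehler_gauss_exp[OF c2(2), of x, unfolded s(2)]
  have sm: "smooth \<eta>" unfolding \<eta>_def e smooth_def by (intro allI Ck_mult Ck_const Ck_exp_quadratic)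
  have g\<eta>: "grad \<eta> y = \<eta> y *\<^sub>R ((1 / s\<^sup>2) *\<^sub>R (c *\<^sub>R x - y))" for y
  proof (rule grad_eqI)
    have "(c / s\<^sup>2) *\<^sub>R x + (2 * (- (1 / (2 * s\<^sup>2)))) *\<^sub>R y = (1 / s\<^sup>2) *\<^sub>R (c *\<^sub>R x - y)"
      by (simp add: scaleR_diff_right)
    then show "GDERIV \<eta> y :> \<eta> y *\<^sub>R ((1 / s\<^sup>2) *\<^sub>R (c *\<^sub>R x - y))"
      unfolding \<eta>_def e by (intro GDERIV_subst[OF GDERIV_exp_quadratic]) (simp only:)
  qed
  let ?F = "\<lambda>y. cutF R y *\<^sub>R ((1 / s\<^sup>2) *\<^sub>R (c *\<^sub>R x - y))"
  have Fz: "?F (c *\<^sub>R x + s *\<^sub>R z) = (- (1 / s)) *\<^sub>R (cutF R (c *\<^sub>R x + s *\<^sub>R z) *\<^sub>R z)" for z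
    using s(1) by (simp add: power2_eq_square)
  have "(LINT y|lborel. cutF R y *\<^sub>R grad \<eta> y) = (LINT y|lborel. gauss_density y *\<^sub>R (mehler c x y *\<^sub>R ?F y))"
    unfolding g\<eta> unfolding \<eta>_def by (simp add: mult_ac)
  also have "\<dots> = (LINT y|std_gaussian. mehler c x y *\<^sub>R ?F y)"
    unfolding std_gaussian_eq by (subst integral_density) auto
  also have "\<dots> = (LINT z|std_gaussian. ?F (c *\<^sub>R x + s *\<^sub>R z))"
    unfolding s_def by (rule integral_mehler[OF c2(2), symmetric]) measurable
  also have "\<dots> = (- (1 / s)) *\<^sub>R (LINT z|std_gaussian. cutF R (c *\<^sub>R x + s *\<^sub>R z) *\<^sub>R z)"
    unfolding Fz by (rule integral_scaleR_right)
  finally have 1: "(LINT y|lborel. cutF R y *\<^sub>R grad \<eta> y) = (- (1 / s)) *\<^sub>R (LINT z|std_gaussian. cutF R (c *\<^sub>R x + s *\<^sub>R z) *\<^sub>R z)" .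
  have "(LINT y|lborel. \<eta> y *\<^sub>R cutG R y) = (LINT y|lborel. gauss_density y *\<^sub>R (mehler c x y *\<^sub>R cutG R y))"
    unfolding \<eta>_def by (simp add: mult_ac)
  also have "\<dots> = (LINT y|std_gaussian. mehler c x y *\<^sub>R cutG R y)"
    unfolding std_gaussian_eq by (subst integral_density) auto
  also have "\<dots> = (LINT z|std_gaussian. cutG R (c *\<^sub>R x + s *\<^sub>R z))"
    unfolding s_def by (rule integral_mehler[OF c2(2), symmetric]) measurable
  finally have 2: "(LINT y|lborel. \<eta> y *\<^sub>R cutG R y) = (LINT z|std_gaussian. cutG R (c *\<^sub>R x + s *\<^sub>R z))" .
  have "(1 / s) *\<^sub>R (LINT z|std_gaussian. cutF R (c *\<^sub>R x + s *\<^sub>R z) *\<^sub>R z) = (LINT z|std_gaussian. cutG R (c *\<^sub>R x + s *\<^sub>R z))"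
    using cut_weak(1)[OF R sm] unfolding 1 2 by simp
  then have "c *\<^sub>R ((1 / s) *\<^sub>R (LINT z|std_gaussian. cutF R (c *\<^sub>R x + s *\<^sub>R z) *\<^sub>R z)) = c *\<^sub>R (LINT z|std_gaussian. cutG R (c *\<^sub>R x + s *\<^sub>R z))"
    by (rule arg_cong)
  then have "(c / s) *\<^sub>R (LINT z|std_gaussian. cutF R (c *\<^sub>R x + s *\<^sub>R z) *\<^sub>R z) = c *\<^sub>R (LINT z|std_gaussian. cutG R (c *\<^sub>R x + s *\<^sub>R z))"
    unfolding scaleR_scaleR by simp
  then show ?thesis using ou_smooth(3)[OF c2 cutF_int[of R], of x] unfolding s_def[symmetric] by (simp only:)
qed

text \<open>\<open>cutG\<close> vanishes outside the ball of radius R, and by symmetry the kernel is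
  bounded for y in that ball by a constant independent of x. So the average is bounded although
  \<open>cutG\<close> itself is only integrable.\<close>

lemma cutG_ou_bound:
  assumes c: "c\<^sup>2 < 1" and R: "0 < R"
  obtains K where "\<And>x. norm (LINT z|std_gaussian. cutG R (c *\<^sub>R x + sqrt (1 - c\<^sup>2) *\<^sub>R z)) \<le> K"
proof -
  let ?C = "(1 / sqrt (1 - c\<^sup>2)) ^ DIM('a) * exp (R\<^sup>2 / 2)"
  have "norm (LINT z|std_gaussian. cutG R (c *\<^sub>R x + sqrt (1 - c\<^sup>2) *\<^sub>R z)) \<le> (LINT y|std_gaussian. ?C * norm (cutG R y))" for x
  proof -
    have ni: "integrable std_gaussian (\<lambda>y. norm (cutG R y))" using cutG_int[OF R] by simp
    have "norm (LINT z|std_gaussian. cutG R (c *\<^sub>R x + sqrt (1 - c\<^sup>2) *\<^sub>R z)) \<le> ou c (\<lambda>y. norm (cutG R y)) x"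
      unfolding ou_def by (rule integral_norm_bound)
    also have "\<dots> = (LINT y|std_gaussian. mehler c x y * norm (cutG R y))"
      by (rule ou_mehler[OF c]) measurable
    also have "\<dots> \<le> (LINT y|std_gaussian. ?C * norm (cutG R y))"
    proof (rule integral_mono)
      show "integrable std_gaussian (\<lambda>y. mehler c x y * norm (cutG R y))" by (rule integrable_mehler_mult[OF c ni])
      show "integrable std_gaussian (\<lambda>y. ?C * norm (cutG R y))" using ni by simp
      fix y
      show "mehler c x y * norm (cutG R y) \<le> ?C * norm (cutG R y)"
      proof (cases "norm y \<le> R")
        case True
        have "mehler c x y \<le> (1 / sqrt (1 - c\<^sup>2)) ^ DIM('a) * exp ((norm y)\<^sup>2 / 2)"
          unfolding mehler_commute[of c x y] by (rule mehler_le[OF c])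
        also have "\<dots> \<le> ?C" using True c by (intro mult_left_mono) (auto intro!: power_mono)
        finally show ?thesis by (rule mult_right_mono) simp
      qed (use cut_outside[OF R] in simp)
    qed
    finally show ?thesis .
  qed
  then show thesis by (rule that)
qed

end

section \<open>Integration by parts for truncated densities\<close>

locale test_fun =
  fixes \<phi> :: "'a::euclidean_space \<Rightarrow> real" and g\<phi> :: "'a \<Rightarrow> 'a" and C C' :: real
  assumes D\<phi>: "\<And>x. GDERIV \<phi> x :> g\<phi> x" and g\<phi>m [measurable]: "g\<phi> \<in> borel_measurable borel"
    and \<phi>b: "\<And>x. \<bar>\<phi> x\<bar> \<le> C" and g\<phi>b: "\<And>x. norm (g\<phi> x) \<le> C'"
begin

lemma \<phi>m [measurable]: "\<phi> \<in> borel_measurable borel"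
  by (rule borel_measurable_continuous_onI, rule continuous_at_imp_continuous_on, intro ballI,
      rule differentiable_imp_continuous_within[OF GDERIV_differentiable[OF D\<phi>]])

lemma C_nonneg: "0 \<le> C" "0 \<le> C'"
  using \<phi>b[of 0] g\<phi>b[of 0] norm_ge_zero[of "g\<phi> 0"] by linarith+

end

locale weak_test = weak_pair f G + test_fun \<phi> g\<phi> C C'
  for f :: "'a::euclidean_space \<Rightarrow> real" and G and \<phi> :: "'a \<Rightarrow> real" and g\<phi> C C'
begin

text \<open>The bracket is the Gaussian adjoint of a partial derivative applied to
  \<open>\<phi>\<close>; it grows at most linearly, so \<open>div_dom\<close> supplies the
  majorant.\<close>

lemma div_bound:
  assumes "\<bar>u\<bar> \<le> U" "b \<in> Basis"
  shows "\<bar>u * (\<phi> x * (x \<bullet> b) - g\<phi> x \<bullet> b)\<bar> \<le> U * (C * norm x + C')"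
proof -
  have "\<bar>\<phi> x * (x \<bullet> b)\<bar> \<le> C * norm x"
    unfolding abs_mult by (intro mult_mono \<phi>b C_nonneg Basis_le_norm[OF assms(2)]) simp
  moreover have "\<bar>g\<phi> x \<bullet> b\<bar> \<le> C'" using Basis_le_norm[OF assms(2), of "g\<phi> x"] g\<phi>b[of x] by linarith
  ultimately have "\<bar>\<phi> x * (x \<bullet> b) - g\<phi> x \<bullet> b\<bar> \<le> C * norm x + C'" by linarith
  then show ?thesis unfolding abs_mult using assms(1) by (intro mult_mono) auto
qed

lemma div_dom: "integrable std_gaussian (\<lambda>x :: 'a. U * (C * norm x + C'))"
  by (intro integrable_mult_right Bochner_Integration.integrable_add integrable_gauss_norm gauss.integrable_const)

text \<open>The definition of a weak gradient gives no chain rule, so the composition with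
  \<open>trunc\<close> is differentiated for the smooth function \<open>ou c (cutF R)\<close>. The
  two parameters are removed in \<open>trunc_ibp_cut\<close> (c to 1) and \<open>trunc_ibp\<close>
  (R to infinity).\<close>

lemma trunc_ibp_smooth:
  assumes e: "0 < e" and c: "0 < c" "c < 1" and R: "0 < R" and b: "b \<in> Basis"
  shows "(LINT x|std_gaussian. trunc e (ou c (cutF R) x) * (\<phi> x * (x \<bullet> b) - g\<phi> x \<bullet> b))
    = c * (LINT x|std_gaussian. trunc' e (ou c (cutF R) x) * \<phi> x * ou c (\<lambda>x. cutG R x \<bullet> b) x)"
proof -
  have c2: "c \<noteq> 0" "c\<^sup>2 < 1" using c by (auto simp: abs_square_less_1)
  define Q where "Q = ou c (cutF R)"
  define K where "K = (\<lambda>x. LINT z|std_gaussian. cutG R (c *\<^sub>R x + sqrt (1 - c\<^sup>2) *\<^sub>R z))"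
  have Qm [measurable]: "Q \<in> borel_measurable borel" unfolding Q_def by measurable
  have Km [measurable]: "K \<in> borel_measurable borel" unfolding K_def by measurable
  obtain B where B: "\<And>x. norm (K x) \<le> B" using cutG_ou_bound[OF c2(2) R] unfolding K_def by blast
  have Q0: "0 \<le> Q x" for x unfolding Q_def ou_def by (rule Bochner_Integration.integral_nonneg) (rule cutF_bounds)
  have DQ: "GDERIV Q x :> c *\<^sub>R K x" for x unfolding Q_def K_def by (rule grad_ou_cut[OF c R])
  note T = trunc_nonneg[OF e Q0] trunc_bounded[OF e Q0] trunc'_nonneg[OF e Q0] trunc'_le_1[OF e Q0]
  have Ta: "\<bar>trunc e (Q x)\<bar> \<le> 1 / e" "\<bar>trunc' e (Q x)\<bar> \<le> 1" for x using T[of x] by auto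
  let ?A = "\<lambda>x. trunc e (Q x) *\<^sub>R g\<phi> x" and ?B = "\<lambda>x. (trunc' e (Q x) * \<phi> x) *\<^sub>R (c *\<^sub>R K x)"
  have Ab: "norm (?A x) \<le> 1 / e * C'" for x
    unfolding norm_scaleR using Ta(1)[of x] e by (intro mult_mono g\<phi>b) auto
  have Bb: "norm (?B x) \<le> 1 * C * (c * B)" for x
    unfolding norm_scaleR abs_mult using Ta(2)[of x] \<phi>b[of x] B[of x] c C_nonneg
    by (intro mult_mono) auto
  have Ai: "integrable std_gaussian ?A" by (rule gauss.integrable_const_bound[OF AE_I2[OF Ab]]) measurable
  have Bi: "integrable std_gaussian ?B" by (rule gauss.integrable_const_bound[OF AE_I2[OF Bb]]) measurable
  have qb: "\<bar>trunc e (Q x) * \<phi> x\<bar> \<le> 1 / e * C" for x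
    unfolding abs_mult using Ta(1)[of x] e by (intro mult_mono \<phi>b) auto
  have qi: "integrable std_gaussian (\<lambda>x. (trunc e (Q x) * \<phi> x) *\<^sub>R x)"
    by (rule integrable_bounded_mult_gauss[OF _ qb integrable_gauss_inner(1)]) measurable
  have "(LINT x|std_gaussian. (trunc e (Q x) * \<phi> x) *\<^sub>R x) = (LINT x|std_gaussian. ?A x + ?B x)"
  proof (rule gauss_ibp[OF _ qb])
    show "GDERIV (\<lambda>x. trunc e (Q x) * \<phi> x) x :> ?A x + ?B x" for x
      using GDERIV_mult[OF GDERIV_DERIV_compose[OF DQ[of x] DERIV_trunc[OF e Q0[of x]]] D\<phi>[of x]] by (simp add: mult_ac)
    show "norm (?A x + ?B x) \<le> 1 / e * C' + 1 * C * (c * B)" for x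
      by (rule order_trans[OF norm_triangle_ineq add_mono[OF Ab Bb]])
  qed measurable
  also have "\<dots> = (LINT x|std_gaussian. ?A x) + (LINT x|std_gaussian. ?B x)"
    by (rule Bochner_Integration.integral_add[OF Ai Bi])
  finally have "(LINT x|std_gaussian. (trunc e (Q x) * \<phi> x) *\<^sub>R x) \<bullet> b - (LINT x|std_gaussian. ?A x) \<bullet> b
     = (LINT x|std_gaussian. ?B x) \<bullet> b" by (simp add: inner_add_left)
  moreover have "(LINT x|std_gaussian. (trunc e (Q x) * \<phi> x) *\<^sub>R x) \<bullet> b - (LINT x|std_gaussian. ?A x) \<bullet> b
    = (LINT x|std_gaussian. trunc e (Q x) * (\<phi> x * (x \<bullet> b) - g\<phi> x \<bullet> b))"
    unfolding integral_inner_left[OF qi, symmetric] integral_inner_left[OF Ai, symmetric]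
    by (subst Bochner_Integration.integral_diff[symmetric])
       (use integrable_inner_left[OF qi] integrable_inner_left[OF Ai] in \<open>auto simp: algebra_simps\<close>)
  moreover have Kb: "K x \<bullet> b = ou c (\<lambda>x. cutG R x \<bullet> b) x" for x
    unfolding K_def ou_def
    by (rule integral_inner_left[symmetric])
       (subst integrable_mehler[OF c2(2)], simp,
        rule Bochner_Integration.integrable_bound[OF integrable_mehler_mult[OF c2(2) integrable_norm[OF cutG_int[OF R]], of x]],
        simp, simp)
  moreover have "(LINT x|std_gaussian. ?B x) \<bullet> b
    = c * (LINT x|std_gaussian. trunc' e (Q x) * \<phi> x * ou c (\<lambda>x. cutG R x \<bullet> b) x)"
    unfolding integral_inner_left[OF Bi, symmetric] Kb[symmetric]
    by (subst Bochner_Integration.integral_mult_right_zero[symmetric]) (simp add: mult_ac)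
  ultimately show ?thesis unfolding Q_def by simp
qed

text \<open>The truncated factors are bounded and converge almost everywhere along a subsequence,
  whereas the gradients converge in L1; the product passes to the limit with no more than
  that.\<close>

lemma trunc_ibp_cut:
  assumes e: "0 < e" and R: "0 < R" and b: "b \<in> Basis"
  shows "(LINT x|std_gaussian. trunc e (cutF R x) * (\<phi> x * (x \<bullet> b) - g\<phi> x \<bullet> b))
    = (LINT x|std_gaussian. trunc' e (cutF R x) * \<phi> x * (cutG R x \<bullet> b))"
proof -
  define c where "c = (\<lambda>n. 1 - 1 / real (n + 2))"
  have c: "0 < c n" "c n < 1" for n by (auto simp: c_def field_simps)
  have c2: "(c n)\<^sup>2 < 1" for n using c[of n] by (simp add: abs_square_less_1)
  have cl: "c \<longlonglongrightarrow> 1" unfolding c_def by real_asymp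
  let ?g = "\<lambda>x. cutG R x \<bullet> b"
  have gi: "integrable std_gaussian ?g" by (intro integrable_inner_left cutG_int R)
  note oi = ou_integral(1)[OF c2]
  have "(\<lambda>n. LINT x|std_gaussian. norm (ou (c n) (cutF R) x - cutF R x)) \<longlonglongrightarrow> 0"
    using ou_tendsto_L1[OF cutF_int[of R] c2 cl] by simp
  from tendsto_L1_AE_subseq[OF _ this] oi[OF cutF_int[of R]] cutF_int[of R]
  obtain r where r: "strict_mono r" and ae0: "AE x in std_gaussian. (\<lambda>n. ou (c (r n)) (cutF R) x - cutF R x) \<longlonglongrightarrow> 0"
    by auto
  have ae: "AE x in std_gaussian. (\<lambda>n. ou (c (r n)) (cutF R) x) \<longlonglongrightarrow> cutF R x"
    using ae0 by eventually_elim (simp add: LIM_zero_iff)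
  have crl: "(\<lambda>n. c (r n)) \<longlonglongrightarrow> 1" using LIMSEQ_subseq_LIMSEQ[OF cl r] by (simp add: o_def)
  define Q where "Q = (\<lambda>n. ou (c (r n)) (cutF R))"
  have Qm [measurable]: "Q n \<in> borel_measurable borel" for n unfolding Q_def by measurable
  have Q0: "0 \<le> Q n x" for n x unfolding Q_def ou_def by (rule Bochner_Integration.integral_nonneg) (rule cutF_bounds)
  have Ta: "\<bar>trunc e (Q n x)\<bar> \<le> 1 / e" "\<bar>trunc' e (Q n x)\<bar> \<le> 1" for n x
    using trunc_nonneg[OF e Q0] trunc_bounded[OF e Q0] trunc'_nonneg[OF e Q0] trunc'_le_1[OF e Q0] by auto
  have t1: "AE x in std_gaussian. (\<lambda>n. trunc e (Q n x)) \<longlonglongrightarrow> trunc e (cutF R x)"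
    using ae unfolding Q_def by eventually_elim (rule isCont_tendsto_compose[OF DERIV_isCont[OF DERIV_trunc[OF e cutF_bounds(1)]]])
  have t2: "AE x in std_gaussian. (\<lambda>n. trunc' e (Q n x)) \<longlonglongrightarrow> trunc' e (cutF R x)"
    using ae unfolding Q_def by eventually_elim (rule isCont_tendsto_compose[OF isCont_trunc'[OF e cutF_bounds(1)]])
  have L: "(\<lambda>n. LINT x|std_gaussian. trunc e (Q n x) * (\<phi> x * (x \<bullet> b) - g\<phi> x \<bullet> b))
    \<longlonglongrightarrow> (LINT x|std_gaussian. trunc e (cutF R x) * (\<phi> x * (x \<bullet> b) - g\<phi> x \<bullet> b))"
  proof (rule integral_dominated_convergence[where w="\<lambda>x. 1 / e * (C * norm x + C')"])
    show "AE x in std_gaussian. (\<lambda>n. trunc e (Q n x) * (\<phi> x * (x \<bullet> b) - g\<phi> x \<bullet> b))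
        \<longlonglongrightarrow> trunc e (cutF R x) * (\<phi> x * (x \<bullet> b) - g\<phi> x \<bullet> b)"
      using t1 by eventually_elim (intro tendsto_intros)
    show "AE x in std_gaussian. norm (trunc e (Q n x) * (\<phi> x * (x \<bullet> b) - g\<phi> x \<bullet> b)) \<le> 1 / e * (C * norm x + C')" for n
      unfolding real_norm_def by (intro AE_I2 div_bound Ta b)
    show "integrable std_gaussian (\<lambda>x :: 'a. 1 / e * (C * norm x + C'))" by (rule div_dom)
  qed simp_all
  have M: "(\<lambda>n. LINT x|std_gaussian. trunc' e (Q n x) * \<phi> x * ?g x) \<longlonglongrightarrow> (LINT x|std_gaussian. trunc' e (cutF R x) * \<phi> x * ?g x)"
  proof (rule integral_dominated_convergence[where w="\<lambda>x. 1 * C * \<bar>?g x\<bar>"])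
    show "AE x in std_gaussian. (\<lambda>n. trunc' e (Q n x) * \<phi> x * ?g x) \<longlonglongrightarrow> trunc' e (cutF R x) * \<phi> x * ?g x"
      using t2 by eventually_elim (intro tendsto_intros)
    show "AE x in std_gaussian. norm (trunc' e (Q n x) * \<phi> x * ?g x) \<le> 1 * C * \<bar>?g x\<bar>" for n
      unfolding real_norm_def abs_mult by (intro AE_I2 mult_mono Ta \<phi>b C_nonneg mult_nonneg_nonneg) auto
    show "integrable std_gaussian (\<lambda>x. 1 * C * \<bar>?g x\<bar>)" using gi by simp
  qed simp_all
  let ?P = "\<lambda>n. LINT x|std_gaussian. trunc' e (Q n x) * \<phi> x * ou (c (r n)) ?g x"
  \<comment> \<open>The smoothed gradient is exchanged for its limit at the price of an L1 distance,
    since its weights are bounded by C.\<close>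
  have "(\<lambda>n. ?P n - (LINT x|std_gaussian. trunc' e (Q n x) * \<phi> x * ?g x)) \<longlonglongrightarrow> 0"
  proof (rule tendsto_rabs_zero_cancel, rule tendsto_sandwich[OF always_eventually always_eventually tendsto_const])
    have "(\<lambda>n. LINT x|std_gaussian. \<bar>ou (c (r n)) ?g x - ?g x\<bar>) \<longlonglongrightarrow> 0"
      by (rule ou_tendsto_L1[OF gi c2 crl])
    then show "(\<lambda>n. C * (LINT x|std_gaussian. \<bar>ou (c (r n)) ?g x - ?g x\<bar>)) \<longlonglongrightarrow> 0"
      by (rule tendsto_mult_right_zero)
    show "\<forall>n. \<bar>?P n - (LINT x|std_gaussian. trunc' e (Q n x) * \<phi> x * ?g x)\<bar>
      \<le> C * (LINT x|std_gaussian. \<bar>ou (c (r n)) ?g x - ?g x\<bar>)"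
    proof
      fix n
      have kb: "\<bar>trunc' e (Q n x) * \<phi> x\<bar> \<le> 1 * C" for x
        unfolding abs_mult by (intro mult_mono Ta \<phi>b) auto
      have i1: "integrable std_gaussian (\<lambda>x. trunc' e (Q n x) * \<phi> x * ou (c (r n)) ?g x)"
        using integrable_bounded_mult_gauss[OF _ kb oi[OF gi]] by simp
      have i2: "integrable std_gaussian (\<lambda>x. trunc' e (Q n x) * \<phi> x * ?g x)"
        using integrable_bounded_mult_gauss[OF _ kb gi] by simp
      have i3: "integrable std_gaussian (\<lambda>x. C * \<bar>ou (c (r n)) ?g x - ?g x\<bar>)"
        using oi[OF gi] gi by simp
      have "\<bar>?P n - (LINT x|std_gaussian. trunc' e (Q n x) * \<phi> x * ?g x)\<bar>
        = \<bar>LINT x|std_gaussian. trunc' e (Q n x) * \<phi> x * ou (c (r n)) ?g x - trunc' e (Q n x) * \<phi> x * ?g x\<bar>"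
        using i1 i2 by simp
      also have "\<dots> \<le> (LINT x|std_gaussian. C * \<bar>ou (c (r n)) ?g x - ?g x\<bar>)"
        unfolding real_norm_def[symmetric]
      proof (rule Bochner_Integration.integral_norm_bound_integral[OF Bochner_Integration.integrable_diff[OF i1 i2]])
        show "integrable std_gaussian (\<lambda>x. C * norm (ou (c (r n)) ?g x - ?g x))" using i3 by simp
        fix x
        have "trunc' e (Q n x) * \<phi> x * ou (c (r n)) ?g x - trunc' e (Q n x) * \<phi> x * ?g x
          = (trunc' e (Q n x) * \<phi> x) * (ou (c (r n)) ?g x - ?g x)" by (simp add: algebra_simps)
        then show "norm (trunc' e (Q n x) * \<phi> x * ou (c (r n)) ?g x - trunc' e (Q n x) * \<phi> x * ?g x)
          \<le> C * norm (ou (c (r n)) ?g x - ?g x)"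
          using kb[of x] by (simp only: norm_mult) (intro mult_right_mono, simp_all)
      qed
      finally show "\<bar>?P n - (LINT x|std_gaussian. trunc' e (Q n x) * \<phi> x * ?g x)\<bar>
        \<le> C * (LINT x|std_gaussian. \<bar>ou (c (r n)) ?g x - ?g x\<bar>)" by simp
    qed
  qed auto
  from tendsto_add[OF this M] have "?P \<longlonglongrightarrow> (LINT x|std_gaussian. trunc' e (cutF R x) * \<phi> x * ?g x)" by simp
  from tendsto_mult[OF crl this]
  have "(\<lambda>n. c (r n) * ?P n) \<longlonglongrightarrow> (LINT x|std_gaussian. trunc' e (cutF R x) * \<phi> x * ?g x)" by simp
  moreover have "c (r n) * ?P n = (LINT x|std_gaussian. trunc e (Q n x) * (\<phi> x * (x \<bullet> b) - g\<phi> x \<bullet> b))" for n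
    unfolding Q_def by (rule trunc_ibp_smooth[OF e c R b, symmetric])
  ultimately show ?thesis using L by (simp add: LIMSEQ_unique)
qed

text \<open>The gradient of the cutoff is of order 1 / R, and \<open>trunc'\<close> vanishes at 0;
  the integrand therefore sees G only where f is positive, and there \<open>G_pos_integrable\<close>
  dominates it.\<close>

lemma trunc_ibp:
  assumes e: "0 < e" and b: "b \<in> Basis"
  shows "(LINT x|std_gaussian. trunc e (f x) * (\<phi> x * (x \<bullet> b) - g\<phi> x \<bullet> b))
    = (LINT x|std_gaussian. trunc' e (f x) * \<phi> x * (G x \<bullet> b))"
proof -
  let ?F = "\<lambda>n. cutF (real (Suc n))" and ?G = "\<lambda>n. cutG (real (Suc n))"
  let ?H = "\<lambda>x. if 0 < f x then G x else 0"
  have Fl: "(\<lambda>n. ?F n x) \<longlonglongrightarrow> f x" for x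
    unfolding cutF_def using tendsto_mult[OF cutoff_tendsto_1[of x] tendsto_const[of "f x"]] by simp
  have gcl: "(\<lambda>n. grad (cutoff (real (Suc n))) x) \<longlonglongrightarrow> 0" for x :: 'a
  proof (rule tendsto_norm_zero_cancel, rule tendsto_sandwich[OF always_eventually always_eventually tendsto_const])
    show "\<forall>n. norm (grad (cutoff (real (Suc n))) x) \<le> 12 / real (Suc n)"
      using grad_cutoff(2)[of "real (Suc n)" x for n] by simp
    show "(\<lambda>n. 12 / real (Suc n)) \<longlonglongrightarrow> 0" by real_asymp
  qed auto
  have Gl: "(\<lambda>n. ?G n x) \<longlonglongrightarrow> G x" for x
    unfolding cutG_def
    using tendsto_add[OF tendsto_scaleR[OF cutoff_tendsto_1[of x] tendsto_const[of "G x"]] tendsto_scaleR[OF tendsto_const[of "f x"] gcl[of x]]]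
    by simp
  have Ta: "\<bar>trunc e (?F n x)\<bar> \<le> 1 / e" "\<bar>trunc' e (?F n x)\<bar> \<le> 1" for n x
    using trunc_nonneg[OF e cutF_bounds(1)] trunc_bounded[OF e cutF_bounds(1)]
      trunc'_nonneg[OF e cutF_bounds(1)] trunc'_le_1[OF e cutF_bounds(1)] by auto
  have L: "(\<lambda>n. LINT x|std_gaussian. trunc e (?F n x) * (\<phi> x * (x \<bullet> b) - g\<phi> x \<bullet> b))
    \<longlonglongrightarrow> (LINT x|std_gaussian. trunc e (f x) * (\<phi> x * (x \<bullet> b) - g\<phi> x \<bullet> b))"
  proof (rule integral_dominated_convergence[where w="\<lambda>x. 1 / e * (C * norm x + C')"])
    show "AE x in std_gaussian. (\<lambda>n. trunc e (?F n x) * (\<phi> x * (x \<bullet> b) - g\<phi> x \<bullet> b))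
        \<longlonglongrightarrow> trunc e (f x) * (\<phi> x * (x \<bullet> b) - g\<phi> x \<bullet> b)"
      by (intro AE_I2 tendsto_mult tendsto_const isCont_tendsto_compose[OF DERIV_isCont[OF DERIV_trunc[OF e f0]]] Fl)
    show "AE x in std_gaussian. norm (trunc e (?F n x) * (\<phi> x * (x \<bullet> b) - g\<phi> x \<bullet> b)) \<le> 1 / e * (C * norm x + C')" for n
      unfolding real_norm_def by (intro AE_I2 div_bound Ta b)
    show "integrable std_gaussian (\<lambda>x :: 'a. 1 / e * (C * norm x + C'))" by (rule div_dom)
  qed simp_all
  have M: "(\<lambda>n. LINT x|std_gaussian. trunc' e (?F n x) * \<phi> x * (?G n x \<bullet> b))
    \<longlonglongrightarrow> (LINT x|std_gaussian. trunc' e (f x) * \<phi> x * (G x \<bullet> b))"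
  proof (rule integral_dominated_convergence[where w="\<lambda>x. 1 * C * (norm (?H x) + f x * 12)"])
    show "AE x in std_gaussian. (\<lambda>n. trunc' e (?F n x) * \<phi> x * (?G n x \<bullet> b)) \<longlonglongrightarrow> trunc' e (f x) * \<phi> x * (G x \<bullet> b)"
      by (intro AE_I2 tendsto_mult tendsto_const tendsto_inner isCont_tendsto_compose[OF isCont_trunc'[OF e f0]] Fl Gl)
    show "AE x in std_gaussian. norm (trunc' e (?F n x) * \<phi> x * (?G n x \<bullet> b)) \<le> 1 * C * (norm (?H x) + f x * 12)" for n
    proof (rule AE_I2)
      fix x
      show "norm (trunc' e (?F n x) * \<phi> x * (?G n x \<bullet> b)) \<le> 1 * C * (norm (?H x) + f x * 12)"
      proof (cases "f x = 0")
        case True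
        then show ?thesis using C_nonneg by (simp add: cutF_def)
      next
        case False
        then have fx: "0 < f x" using f0[of x] by simp
        have "\<bar>?G n x \<bullet> b\<bar> \<le> norm (?G n x)" by (rule Basis_le_norm[OF b])
        also have "\<dots> \<le> cutoff (real (Suc n)) x * norm (G x) + f x * norm (grad (cutoff (real (Suc n))) x)"
          unfolding cutG_def by (rule order_trans[OF norm_triangle_ineq]) (use fx in \<open>simp add: abs_of_nonneg[OF cutoff_nonneg] del: of_nat_Suc\<close>)
        also have "\<dots> \<le> 1 * norm (?H x) + f x * 12"
        proof (intro add_mono mult_mono)
          have "12 / real (Suc n) \<le> 12" by (simp add: field_simps)
          then show "norm (grad (cutoff (real (Suc n))) x) \<le> 12"
            using grad_cutoff(2)[of "real (Suc n)" x] by simp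
        qed (use fx cutoff_le_1 in auto)
        finally have "\<bar>?G n x \<bullet> b\<bar> \<le> norm (?H x) + f x * 12" by simp
        then show ?thesis unfolding real_norm_def abs_mult
          using Ta(2)[of n x] \<phi>b[of x] C_nonneg by (intro mult_mono) auto
      qed
    qed
    show "integrable std_gaussian (\<lambda>x. 1 * C * (norm (?H x) + f x * 12))"
      by (intro integrable_mult_right Bochner_Integration.integrable_add integrable_norm G_pos_integrable integrable_mult_left fint)
  qed simp_all
  show ?thesis
    by (rule LIMSEQ_unique[OF L]) (use M trunc_ibp_cut[OF e _ b, of "real (Suc n)" for n] in simp)
qed

end

text \<open>The kernel is bounded with bounded gradient, so \<open>trunc_ibp\<close> can be tested
  with it. Its gradient carries the factor t = |c y - x|, tamed by t exp(-t^2 / 2) <= 1.\<close>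

lemma mehler_test_fun:
  fixes x :: "'a::euclidean_space"
  assumes c: "0 < c" "c < 1"
  shows "test_fun (mehler c x) (\<lambda>y. mehler c x y *\<^sub>R ((c / (1 - c\<^sup>2)) *\<^sub>R (x - c *\<^sub>R y)))
    ((1 / sqrt (1 - c\<^sup>2)) ^ DIM('a) * exp ((norm x)\<^sup>2 / 2))
    ((1 / sqrt (1 - c\<^sup>2)) ^ DIM('a) * exp ((norm x)\<^sup>2 / 2) * (c / (1 - c\<^sup>2)))"
proof
  let ?A = "(1 / sqrt (1 - c\<^sup>2)) ^ DIM('a)"
  have c2: "c\<^sup>2 < 1" using c by (simp add: abs_square_less_1)
  define s where "s = 1 - c\<^sup>2"
  have s: "0 < s" "s \<le> 1" using c2 by (auto simp: s_def)
  show "GDERIV (mehler c x) y :> mehler c x y *\<^sub>R ((c / (1 - c\<^sup>2)) *\<^sub>R (x - c *\<^sub>R y))" for y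
  proof -
    have m: "mehler c x = (\<lambda>y. ?A * exp (((c / s) *\<^sub>R x) \<bullet> y + (- (c\<^sup>2 / (2 * s))) * (y \<bullet> y) + - (c\<^sup>2 * (norm x)\<^sup>2 / (2 * s))))"
    proof
      fix y
      have "- (X - 2 * c * Y + Z) / (2 * s) = c / s * Y + - (Z / (2 * s)) + - (X / (2 * s))" for X Y Z
        using s by (simp add: diff_divide_distrib add_divide_distrib)
      from this[of "c\<^sup>2 * (norm x)\<^sup>2" "x \<bullet> y" "c\<^sup>2 * (norm y)\<^sup>2"]
      show "mehler c x y = ?A * exp (((c / s) *\<^sub>R x) \<bullet> y + (- (c\<^sup>2 / (2 * s))) * (y \<bullet> y) + - (c\<^sup>2 * (norm x)\<^sup>2 / (2 * s)))"
        unfolding mehler_def s_def[symmetric] dot_square_norm by simp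
    qed
    have "(c / s) *\<^sub>R x + (2 * (- (c\<^sup>2 / (2 * s)))) *\<^sub>R y = (c / (1 - c\<^sup>2)) *\<^sub>R (x - c *\<^sub>R y)"
      unfolding s_def[symmetric] by (simp add: scaleR_diff_right power2_eq_square)
    then show ?thesis unfolding m by (intro GDERIV_subst[OF GDERIV_exp_quadratic]) (simp only:)
  qed
  show "\<bar>mehler c x y\<bar> \<le> ?A * exp ((norm x)\<^sup>2 / 2)" for y
    using mehler_le[OF c2, of x y] mehler_pos[OF c2, of x y] by simp
  show "norm (mehler c x y *\<^sub>R ((c / (1 - c\<^sup>2)) *\<^sub>R (x - c *\<^sub>R y))) \<le> ?A * exp ((norm x)\<^sup>2 / 2) * (c / (1 - c\<^sup>2))" for y
  proof -
    define t where "t = norm (c *\<^sub>R y - x)"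
    have t0: "0 \<le> t" by (simp add: t_def)
    have "exp (- (t\<^sup>2 / (2 * s))) \<le> exp (- (t\<^sup>2 / 2))"
    proof -
      have "t\<^sup>2 / 2 \<le> t\<^sup>2 / (2 * s)" using s by (intro divide_left_mono) auto
      then show ?thesis by simp
    qed
    moreover have "t * exp (- (t\<^sup>2 / 2)) \<le> 1"
    proof -
      have "t \<le> 1 + t\<^sup>2 / 2" using zero_le_power2[of "t - 1"] by (simp add: power2_eq_square algebra_simps)
      also have "\<dots> \<le> exp (t\<^sup>2 / 2)" by (rule exp_ge_add_one_self)
      finally show ?thesis by (simp add: exp_minus field_simps)
    qed
    ultimately have te: "exp (- (t\<^sup>2 / (2 * s))) * t \<le> 1"
      using mult_left_mono[of "exp (- (t\<^sup>2 / (2 * s)))" "exp (- (t\<^sup>2 / 2))" t] t0 by (simp add: mult.commute)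
    have m: "mehler c x y = ?A * exp ((norm x)\<^sup>2 / 2) * exp (- (t\<^sup>2 / (2 * s)))"
      unfolding mehler_eq[OF c2] t_def s_def[symmetric] by (simp add: exp_add[symmetric])
    have "norm (mehler c x y *\<^sub>R ((c / (1 - c\<^sup>2)) *\<^sub>R (x - c *\<^sub>R y))) = mehler c x y * (c / s) * t"
      unfolding s_def[symmetric] t_def using mehler_pos[OF c2, of x y] c s by (simp add: norm_minus_commute)
    also have "\<dots> = (?A * exp ((norm x)\<^sup>2 / 2) * (c / s)) * (exp (- (t\<^sup>2 / (2 * s))) * t)"
      unfolding m by (simp only: mult_ac)
    also have "\<dots> \<le> (?A * exp ((norm x)\<^sup>2 / 2) * (c / s)) * 1"
      using te c s c2 by (intro mult_left_mono mult_nonneg_nonneg zero_le_power) auto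
    finally show ?thesis unfolding s_def by simp
  qed
  show "(\<lambda>y. mehler c x y *\<^sub>R ((c / (1 - c\<^sup>2)) *\<^sub>R (x - c *\<^sub>R y))) \<in> borel_measurable borel" by measurable
qed

definition vec_ou :: "real \<Rightarrow> ('a::euclidean_space \<Rightarrow> 'a) \<Rightarrow> 'a \<Rightarrow> 'a" where
  "vec_ou c V x = (LINT z|std_gaussian. V (c *\<^sub>R x + sqrt (1 - c\<^sup>2) *\<^sub>R z))"

lemma vec_ou_measurable [measurable]:
  assumes [measurable]: "V \<in> borel_measurable borel"
  shows "vec_ou c V \<in> borel_measurable borel"
  unfolding vec_ou_def[abs_def] by measurable

lemma vec_ou_integrable:
  fixes V :: "'a::euclidean_space \<Rightarrow> 'a"
  assumes c: "c\<^sup>2 < 1" and V: "integrable std_gaussian V"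
  shows "integrable std_gaussian (\<lambda>z. V (c *\<^sub>R x + sqrt (1 - c\<^sup>2) *\<^sub>R z))"
proof -
  have [measurable]: "V \<in> borel_measurable borel" using borel_measurable_integrable[OF V] by simp
  show ?thesis
    by (subst integrable_norm_iff[symmetric], measurable)
       (rule integrable_ou_kernel[OF c integrable_norm[OF V]])
qed

lemma vec_ou_inner:
  fixes V :: "'a::euclidean_space \<Rightarrow> 'a"
  assumes c: "c\<^sup>2 < 1" and V: "integrable std_gaussian V"
  shows "vec_ou c V x \<bullet> b = ou c (\<lambda>x. V x \<bullet> b) x"
  unfolding vec_ou_def ou_def by (rule integral_inner_left[symmetric]) (rule vec_ou_integrable[OF assms])

lemma vec_ou_semigroup:
  fixes V :: "'a::euclidean_space \<Rightarrow> 'a"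
  assumes r: "0 < r" "r < 1" and s: "0 < s" "s < 1" and V: "integrable std_gaussian V"
  shows "vec_ou r (vec_ou s V) x = vec_ou (r * s) V x"
proof (rule euclidean_eqI)
  fix b :: 'a assume b: "b \<in> Basis"
  have r2: "r\<^sup>2 < 1" and s2: "s\<^sup>2 < 1" using r s by (auto simp: abs_square_less_1)
  have "r * s < 1 * 1" using r s by (intro mult_strict_mono) auto
  then have rs2: "(r * s)\<^sup>2 < 1" using r s by (simp add: abs_square_less_1)
  have [measurable]: "V \<in> borel_measurable borel" using borel_measurable_integrable[OF V] by simp
  note Vb = integrable_inner_left[OF V, of b]
  have nV: "integrable std_gaussian (\<lambda>x. norm (V x))" using V by simp
  have vi: "integrable std_gaussian (vec_ou s V)"
  proof (rule Bochner_Integration.integrable_bound[OF ou_integral(1)[OF s2 nV]])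
    show "AE x in std_gaussian. norm (vec_ou s V x) \<le> norm (ou s (\<lambda>x. norm (V x)) x)"
      unfolding vec_ou_def ou_def real_norm_def
      by (intro AE_I2 order_trans[OF integral_norm_bound abs_ge_self])
  qed measurable
  have "vec_ou r (vec_ou s V) x \<bullet> b = ou r (ou s (\<lambda>x. V x \<bullet> b)) x"
    unfolding vec_ou_inner[OF r2 vi] vec_ou_inner[OF s2 V] ..
  also have "\<dots> = vec_ou (r * s) V x \<bullet> b"
    unfolding ou_semigroup[OF r s Vb] vec_ou_inner[OF rs2 V] ..
  finally show "vec_ou r (vec_ou s V) x \<bullet> b = vec_ou (r * s) V x \<bullet> b" .
qed

text \<open>t = a / (2 U) suffices and avoids the optimal sqrt(Q / U), which degenerates for Q =
  0.\<close>

lemma square_le_of_young: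
  fixes a U Q :: real
  assumes "0 \<le> a" "0 < U" "\<And>t. 0 < t \<Longrightarrow> a \<le> t * U + Q / t" "0 \<le> Q"
  shows "a\<^sup>2 \<le> 4 * U * Q"
proof (cases "a = 0")
  case False
  then have a: "0 < a" using assms(1) by simp
  have "a \<le> a / (2 * U) * U + Q / (a / (2 * U))" using assms(3)[of "a / (2 * U)"] a assms(2) by simp
  then have "a / 2 \<le> 2 * U * Q / a" using assms(2) a by (simp add: field_simps)
  then show ?thesis using a by (simp add: field_simps power2_eq_square)
qed (use assms in simp)

context weak_pair begin

text \<open>The Fisher information does not see the weak gradient where \<open>f\<close> vanishes.\<close>

definition H :: "'a \<Rightarrow> 'a" where
  "H x = (if 0 < f x then G x else 0)"

definition tf :: "real \<Rightarrow> 'a \<Rightarrow> real" where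
  "tf e x = trunc e (f x)"

definition tV :: "real \<Rightarrow> 'a \<Rightarrow> 'a" where
  "tV e x = trunc' e (f x) *\<^sub>R G x"

lemma H_int: "integrable std_gaussian H"
  using G_pos_integrable unfolding H_def[abs_def] .

lemma tf_measurable [measurable]: "tf e \<in> borel_measurable borel" "tV e \<in> borel_measurable borel" "H \<in> borel_measurable borel"
  unfolding tf_def[abs_def] tV_def[abs_def] H_def[abs_def] by measurable

lemma fisher_int: "integrable std_gaussian (\<lambda>x. (norm (H x))\<^sup>2 / f x)"
  using fisher_integrable unfolding H_def .

text \<open>Integration by parts against the constant 1, with the truncation removed. For a centered
  measure it makes the components of H mean-free, as \<open>fisher_contraction\<close>
  demands.\<close>

lemma mean_H:
  assumes m: "integrable std_gaussian (\<lambda>x. f x * norm x)" and b: "b \<in> Basis"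
  shows "(LINT x|std_gaussian. H x \<bullet> b) = (LINT x|std_gaussian. f x * (x \<bullet> b))"
proof -
  interpret weak_test f G "\<lambda>_. 1" "\<lambda>_. 0" 1 0
    by unfold_locales (auto intro: GDERIV_const)
  let ?e = "\<lambda>n. 1 / real (Suc n)"
  have e: "0 < ?e n" for n by simp
  have L: "(\<lambda>n. LINT x|std_gaussian. trunc (?e n) (f x) * (x \<bullet> b)) \<longlonglongrightarrow> (LINT x|std_gaussian. f x * (x \<bullet> b))"
  proof (rule integral_dominated_convergence[where w="\<lambda>x. f x * norm x"])
    show "AE x in std_gaussian. (\<lambda>n. trunc (?e n) (f x) * (x \<bullet> b)) \<longlonglongrightarrow> f x * (x \<bullet> b)"
      by (intro AE_I2 tendsto_mult tendsto_const trunc_tendsto f0)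
    show "AE x in std_gaussian. norm (trunc (?e n) (f x) * (x \<bullet> b)) \<le> f x * norm x" for n
      unfolding real_norm_def abs_mult
      using trunc_nonneg[OF e f0] trunc_le[OF e f0] f0 Basis_le_norm[OF b]
      by (intro AE_I2 mult_mono) (auto simp del: of_nat_Suc)
  qed (use m in simp_all)
  have R: "(\<lambda>n. LINT x|std_gaussian. trunc' (?e n) (f x) * (G x \<bullet> b)) \<longlonglongrightarrow> (LINT x|std_gaussian. H x \<bullet> b)"
  proof (rule integral_dominated_convergence[where w="\<lambda>x. norm (H x)"])
    show "AE x in std_gaussian. (\<lambda>n. trunc' (?e n) (f x) * (G x \<bullet> b)) \<longlonglongrightarrow> H x \<bullet> b"
    proof (rule AE_I2)
      fix x
      have "(\<lambda>n. trunc' (?e n) (f x) * (G x \<bullet> b)) \<longlonglongrightarrow> (if f x = 0 then 0 else 1) * (G x \<bullet> b)"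
        by (intro tendsto_mult tendsto_const trunc_tendsto f0)
      then show "(\<lambda>n. trunc' (?e n) (f x) * (G x \<bullet> b)) \<longlonglongrightarrow> H x \<bullet> b"
        using f0[of x] by (cases "f x = 0") (auto simp: H_def)
    qed
    show "AE x in std_gaussian. norm (trunc' (?e n) (f x) * (G x \<bullet> b)) \<le> norm (H x)" for n
    proof (rule AE_I2)
      fix x
      show "norm (trunc' (?e n) (f x) * (G x \<bullet> b)) \<le> norm (H x)"
      proof (cases "f x = 0")
        case False
        have "\<bar>trunc' (?e n) (f x)\<bar> * \<bar>G x \<bullet> b\<bar> \<le> 1 * norm (G x)"
          using trunc'_nonneg[OF e f0, of n x] trunc'_le_1[OF e f0, of n x]
          by (intro mult_mono Basis_le_norm[OF b]) auto
        then show ?thesis using False f0[of x] by (simp add: H_def abs_mult)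
      qed simp
    qed
  qed (use H_int in simp_all)
  show ?thesis
    by (rule LIMSEQ_unique[OF R]) (use L trunc_ibp[OF e b] in simp)
qed

context
  fixes e :: real assumes e: "0 < e"
begin

lemma tf_bounds: "0 \<le> tf e x" "tf e x \<le> f x" "\<bar>tf e x\<bar> \<le> 1 / e"
  using trunc_nonneg[OF e f0] trunc_le[OF e f0] trunc_bounded[OF e f0] unfolding tf_def by auto

lemma tf_int: "integrable std_gaussian (tf e)"
  by (rule gauss.integrable_const_bound[where B="1 / e"]) (use tf_bounds(3) in auto)

lemma tV_le: "norm (tV e x) \<le> norm (H x)"
proof (cases "f x = 0")
  case False
  have "\<bar>trunc' e (f x)\<bar> * norm (G x) \<le> 1 * norm (G x)"
    using trunc'_nonneg[OF e f0, of x] trunc'_le_1[OF e f0, of x] by (intro mult_right_mono) auto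
  then show ?thesis using False f0[of x] by (simp add: tV_def H_def)
qed (simp add: tV_def)

lemma tV_int: "integrable std_gaussian (tV e)"
  by (rule Bochner_Integration.integrable_bound[OF integrable_norm[OF H_int]]) (use tV_le in auto)

text \<open>Completing the square with \<open>trunc'_sq_le\<close>. The bound is linear in
  \<open>tf e\<close> and in the Fisher integrand, so the semigroup can average it;
  \<open>square_le_of_young\<close> then restores a quadratic estimate.\<close>

lemma tV_young:
  assumes "0 < t" shows "norm (tV e x) \<le> t * tf e x + ((norm (H x))\<^sup>2 / f x) / t"
proof (cases "f x = 0")
  case False
  then have fx: "0 < f x" using f0[of x] by simp
  define A where "A = trunc' e (f x)"
  define N where "N = norm (G x)"
  have A0: "0 \<le> A" unfolding A_def by (rule trunc'_nonneg[OF e f0])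
  have A2: "f x * A\<^sup>2 \<le> 4 * tf e x" unfolding A_def tf_def by (rule trunc'_sq_le[OF e f0])
  have "0 \<le> (t * f x * A / 2 - N)\<^sup>2 / (t * f x)" using assms fx by simp
  also have "\<dots> = t * (f x * A\<^sup>2) / 4 - A * N + N\<^sup>2 / f x / t"
    using assms fx by (simp add: power2_eq_square field_simps)
  also have "\<dots> \<le> t * tf e x - A * N + N\<^sup>2 / f x / t"
    using mult_left_mono[OF A2, of t] assms by simp
  finally have "A * N \<le> t * tf e x + N\<^sup>2 / f x / t" by simp
  then show ?thesis using fx A0 by (simp add: tV_def H_def A_def N_def)
qed (use tf_bounds[of x] assms in \<open>simp add: tV_def\<close>)

text \<open>\<open>trunc_ibp\<close> with the Mehler kernel as test function turns the gradient
  formula of \<open>ou_smooth\<close>, where the derivative sits on the kernel, into an average of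
  the truncated gradient.\<close>

lemma grad_ou_trunc:
  assumes c: "0 < c" "c < 1"
  shows "GDERIV (ou c (tf e)) x :> c *\<^sub>R vec_ou c (tV e) x"
proof -
  have c2: "c \<noteq> 0" "c\<^sup>2 < 1" using c by (auto simp: abs_square_less_1)
  define s where "s = sqrt (1 - c\<^sup>2)"
  have s: "0 < s" "1 - c\<^sup>2 = s\<^sup>2" "c\<^sup>2 = 1 - s\<^sup>2" using c2 by (auto simp: s_def)
  interpret M: test_fun "mehler c x" "\<lambda>y. mehler c x y *\<^sub>R ((c / (1 - c\<^sup>2)) *\<^sub>R (x - c *\<^sub>R y))"
    "(1 / sqrt (1 - c\<^sup>2)) ^ DIM('a) * exp ((norm x)\<^sup>2 / 2)"
    "(1 / sqrt (1 - c\<^sup>2)) ^ DIM('a) * exp ((norm x)\<^sup>2 / 2) * (c / (1 - c\<^sup>2))"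
    by (rule mehler_test_fun[OF c])
  interpret weak_test f G "mehler c x" "\<lambda>y. mehler c x y *\<^sub>R ((c / (1 - c\<^sup>2)) *\<^sub>R (x - c *\<^sub>R y))"
    "(1 / sqrt (1 - c\<^sup>2)) ^ DIM('a) * exp ((norm x)\<^sup>2 / 2)"
    "(1 / sqrt (1 - c\<^sup>2)) ^ DIM('a) * exp ((norm x)\<^sup>2 / 2) * (c / (1 - c\<^sup>2))" ..
  note S = ou_smooth[OF c2 tf_int]
  have "(c / s) *\<^sub>R (LINT z|std_gaussian. tf e (c *\<^sub>R x + s *\<^sub>R z) *\<^sub>R z) = c *\<^sub>R vec_ou c (tV e) x"
  proof (rule euclidean_eqI)
    fix b :: 'a assume b: "b \<in> Basis"
    let ?F = "\<lambda>y. tf e y * ((1 / s) * ((y - c *\<^sub>R x) \<bullet> b))"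
    have Fz: "?F (c *\<^sub>R x + s *\<^sub>R z) = (tf e (c *\<^sub>R x + s *\<^sub>R z) *\<^sub>R z) \<bullet> b" for z
      using s(1) by simp
    have "(LINT z|std_gaussian. tf e (c *\<^sub>R x + s *\<^sub>R z) *\<^sub>R z) \<bullet> b = (LINT z|std_gaussian. ?F (c *\<^sub>R x + s *\<^sub>R z))"
      unfolding Fz by (rule integral_inner_left[symmetric]) (use S(2)[of x] in \<open>simp add: s_def\<close>)
    also have "\<dots> = (LINT y|std_gaussian. mehler c x y *\<^sub>R ?F y)"
      unfolding s_def by (rule integral_mehler[OF c2(2)]) measurable
    also have "\<dots> = (LINT y|std_gaussian. s * (trunc e (f y) * (mehler c x y * (y \<bullet> b) - (mehler c x y *\<^sub>R ((c / (1 - c\<^sup>2)) *\<^sub>R (x - c *\<^sub>R y))) \<bullet> b)))"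
    proof (intro Bochner_Integration.integral_cong refl)
      fix y
      \<comment> \<open>The relation s^2 + c^2 = 1 matches (y - c x) / s with the adjoint derivative
        of the kernel.\<close>
      have "s * (Y - c / (1 - c\<^sup>2) * (X - c * Y)) = 1 / s * (Y - c * X)" for X Y
      proof -
        have "s\<^sup>2 * Y - c * (X - c * Y) = (s\<^sup>2 + c\<^sup>2) * Y - c * X" by (simp add: algebra_simps power2_eq_square)
        also have "\<dots> = Y - c * X" unfolding s(3) by simp
        finally have "s\<^sup>2 * Y - c * (X - c * Y) = Y - c * X" .
        then have "(s\<^sup>2 * Y - c * (X - c * Y)) / s = (Y - c * X) / s" by simp
        then show ?thesis unfolding s(2) using s(1) by (simp add: diff_divide_distrib right_diff_distrib power2_eq_square)
      qed
      from this[of "y \<bullet> b" "x \<bullet> b"]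
      have eq: "(1 / s) * ((y - c *\<^sub>R x) \<bullet> b) = s * (y \<bullet> b - c / (1 - c\<^sup>2) * (x \<bullet> b - c * (y \<bullet> b)))"
        by (simp add: inner_diff_left)
      show "mehler c x y *\<^sub>R ?F y = s * (trunc e (f y) * (mehler c x y * (y \<bullet> b) - (mehler c x y *\<^sub>R ((c / (1 - c\<^sup>2)) *\<^sub>R (x - c *\<^sub>R y))) \<bullet> b))"
        unfolding eq tf_def by (simp add: inner_diff_left right_diff_distrib mult_ac)
    qed
    also have "\<dots> = s * (LINT y|std_gaussian. trunc e (f y) * (mehler c x y * (y \<bullet> b) - (mehler c x y *\<^sub>R ((c / (1 - c\<^sup>2)) *\<^sub>R (x - c *\<^sub>R y))) \<bullet> b))"
      by (rule Bochner_Integration.integral_mult_right_zero)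
    also have "\<dots> = s * (LINT y|std_gaussian. trunc' e (f y) * mehler c x y * (G y \<bullet> b))"
      unfolding trunc_ibp[OF e b] ..
    also have "(LINT y|std_gaussian. trunc' e (f y) * mehler c x y * (G y \<bullet> b)) = (LINT y|std_gaussian. mehler c x y * (tV e y \<bullet> b))"
      by (simp add: tV_def mult_ac)
    also have "\<dots> = vec_ou c (tV e) x \<bullet> b"
      unfolding vec_ou_inner[OF c2(2) tV_int] by (rule ou_mehler[OF c2(2), symmetric]) measurable
    finally show "((c / s) *\<^sub>R (LINT z|std_gaussian. tf e (c *\<^sub>R x + s *\<^sub>R z) *\<^sub>R z)) \<bullet> b = (c *\<^sub>R vec_ou c (tV e) x) \<bullet> b"
      using s(1) by simp
  qed
  then show ?thesis using S(3)[of x] unfolding s_def by simp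
qed

text \<open>In its kernel form the gradient involves \<open>tf e\<close> alone, which is at most 1 /
  e. So the averaged field is bounded although \<open>tV e\<close> is only known to be
  integrable.\<close>

lemma vec_ou_tV_bound:
  assumes c: "0 < c" "c < 1"
  shows "norm (c *\<^sub>R vec_ou c (tV e) x) \<le> c / sqrt (1 - c\<^sup>2) * (1 / e * (LINT z|(std_gaussian :: 'a measure). norm z))"
proof -
  have c2: "c \<noteq> 0" "c\<^sup>2 < 1" using c by (auto simp: abs_square_less_1)
  note S = ou_smooth[OF c2 tf_int]
  have "c *\<^sub>R vec_ou c (tV e) x = (c / sqrt (1 - c\<^sup>2)) *\<^sub>R (LINT z|std_gaussian. tf e (c *\<^sub>R x + sqrt (1 - c\<^sup>2) *\<^sub>R z) *\<^sub>R z)"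
    using grad_eqI[OF grad_ou_trunc[OF c, of x]] grad_eqI[OF S(3)[of x]] by simp
  also have "norm \<dots> \<le> c / sqrt (1 - c\<^sup>2) * (LINT z|(std_gaussian :: 'a measure). 1 / e * norm z)"
  proof -
    have "norm (LINT z|std_gaussian. tf e (c *\<^sub>R x + sqrt (1 - c\<^sup>2) *\<^sub>R z) *\<^sub>R z) \<le> (LINT z|(std_gaussian :: 'a measure). 1 / e * norm z)"
      by (rule Bochner_Integration.integral_norm_bound_integral[OF S(2) integrable_mult_right[OF integrable_gauss_norm]])
         (unfold norm_scaleR real_norm_def, intro mult_right_mono tf_bounds norm_ge_zero)
    moreover have nn: "0 \<le> c / sqrt (1 - c\<^sup>2)" using c c2 by simp
    ultimately show ?thesis unfolding norm_scaleR abs_of_nonneg[OF nn] by (rule mult_left_mono)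
  qed
  also have "(LINT z|(std_gaussian :: 'a measure). 1 / e * norm z) = 1 / e * (LINT z|(std_gaussian :: 'a measure). norm z)"
    by (rule Bochner_Integration.integral_mult_right_zero)
  finally show ?thesis .
qed

end

end

section \<open>The improved logarithmic Sobolev inequality\<close>

lemma lsi_c_integral:
  assumes l: "0 < l"
  shows "((\<lambda>r. r * (r\<^sup>2 / (r\<^sup>2 + l * (1 - r\<^sup>2)))) has_integral lsi_c l / 2) {0..1::real}"
proof (cases "l = 1")
  case True
  have "((\<lambda>r::real. r ^ 3) has_integral 1 ^ 4 / 4 - 0 ^ 4 / 4) {0..1}"
    by (rule fundamental_theorem_of_calculus)
       (auto intro!: derivative_eq_intros simp: has_real_derivative_iff_has_vector_derivative[symmetric])
  then show ?thesis using True by (simp add: lsi_c_def power3_eq_cube power2_eq_square mult.assoc)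
next
  case False
  define a where "a = 1 - l"
  define A where "A = 1 / a"
  define B where "B = l / a\<^sup>2"
  have a: "a \<noteq> 0" using False by (simp add: a_def)
  \<comment> \<open>A primitive by polynomial division: r^3 / (l + a r^2) = r / a - (l / a) r / (l +
    a r^2).\<close>
  define F where "F = (\<lambda>r. (A * r\<^sup>2 - B * ln (l + a * r\<^sup>2)) / 2)"
  have "((\<lambda>r. r * (r\<^sup>2 / (r\<^sup>2 + l * (1 - r\<^sup>2)))) has_integral F 1 - F 0) {0..1}"
  proof (rule fundamental_theorem_of_calculus, simp)
    fix r :: real assume r: "r \<in> {0..1}"
    then have r2: "r\<^sup>2 \<le> 1" by (simp add: abs_square_le_1)
    have e: "r\<^sup>2 + l * (1 - r\<^sup>2) = l + a * r\<^sup>2" by (simp add: a_def algebra_simps)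
    have d: "0 < l + a * r\<^sup>2"
    proof (cases "r = 0")
      case False
      then have "0 < r\<^sup>2" by simp
      moreover have "0 \<le> l * (1 - r\<^sup>2)" using l r2 by simp
      ultimately show ?thesis using e by linarith
    qed (use l in simp)
    define D where "D = l + a * r\<^sup>2"
    have D: "D \<noteq> 0" using d by (simp add: D_def)
    have "(F has_real_derivative (A * (2 * r) - B * (a * (2 * r) / D)) / 2) (at r)"
      unfolding F_def D_def using d by (auto intro!: derivative_eq_intros)
    moreover have "(A * (2 * r) - B * (a * (2 * r) / D)) / 2 = r * (r\<^sup>2 / (r\<^sup>2 + l * (1 - r\<^sup>2)))"
    proof -
      have "B * (a * (2 * r) / D) = 2 * (r / a * (l / D))" using a by (simp add: B_def power2_eq_square)
      then have "(A * (2 * r) - B * (a * (2 * r) / D)) / 2 = r / a * (1 - l / D)"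
        by (simp add: A_def right_diff_distrib mult_ac)
      also have "1 - l / D = (D - l) / D" using D by (simp add: diff_divide_distrib)
      also have "D - l = a * r\<^sup>2" by (simp add: D_def)
      finally show ?thesis unfolding e D_def[symmetric] using a by simp
    qed
    ultimately have "(F has_real_derivative r * (r\<^sup>2 / (r\<^sup>2 + l * (1 - r\<^sup>2)))) (at r)" by (simp only:)
    then show "(F has_vector_derivative r * (r\<^sup>2 / (r\<^sup>2 + l * (1 - r\<^sup>2)))) (at r within {0..1})"
      unfolding has_real_derivative_iff_has_vector_derivative[symmetric] by (rule has_field_derivative_at_within)
  qed
  moreover have "F 1 - F 0 = lsi_c l / 2"
  proof -
    have "F 1 - F 0 = (A + B * ln l) / 2" by (simp add: F_def a_def)
    also have "A = a / a\<^sup>2" using a by (simp add: A_def power2_eq_square)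
    finally show ?thesis using False by (simp add: lsi_c_def add_divide_distrib a_def B_def)
  qed
  ultimately show ?thesis by simp
qed

text \<open>Strictness comes from ln u < u - 1 at u = 1 / l, different from 1. Positivity permits
  division by \<open>lsi_c l\<close>.\<close>

lemma lsi_c_pos:
  assumes l: "0 < l" shows "0 < lsi_c l"
proof (cases "l = 1")
  case False
  have "ln (1 / l) \<le> 1 / l - 1" using l by (intro ln_le_minus_one) simp
  moreover have "ln (1 / l) \<noteq> 1 / l - 1" using ln_eq_minus_one[of "1 / l"] l False by auto
  ultimately have "- ln l < 1 / l - 1" using l by (simp add: ln_div)
  then have "l * (- ln l) < l * (1 / l - 1)" using l by (rule mult_strict_left_mono)
  also have "l * (1 / l - 1) = 1 - l" using l by (simp add: algebra_simps)
  finally have "0 < 1 - l + l * ln l" by simp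
  then show ?thesis using False by (simp add: lsi_c_def)
qed (simp add: lsi_c_def)

text \<open>The integrand in \<open>lsi_c_integral\<close> is at most r. It follows that
  \<open>lsi_c2 l\<close> is nonnegative, so an upper bound for the squared distance can be
  multiplied by it.\<close>

lemma lsi_c_le_1:
  assumes l: "0 < l" shows "lsi_c l \<le> 1"
proof -
  have "((\<lambda>r::real. r) has_integral 1\<^sup>2 / 2 - 0\<^sup>2 / 2) {0..1}"
    by (rule fundamental_theorem_of_calculus)
       (auto intro!: derivative_eq_intros simp: has_real_derivative_iff_has_vector_derivative[symmetric])
  moreover have "r * (r\<^sup>2 / (r\<^sup>2 + l * (1 - r\<^sup>2))) \<le> r" if "r \<in> {0..1}" for r :: real
  proof -
    have "r\<^sup>2 \<le> 1" using that by (simp add: abs_square_le_1)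
    then have "r\<^sup>2 \<le> r\<^sup>2 + l * (1 - r\<^sup>2)" using l by simp
    then have "r\<^sup>2 / (r\<^sup>2 + l * (1 - r\<^sup>2)) \<le> 1" by (intro divide_le_eq_1[THEN iffD2]) (smt (verit) zero_le_power2)
    from mult_left_mono[OF this, of r] show ?thesis using that by simp
  qed
  ultimately have "lsi_c l / 2 \<le> 1\<^sup>2 / 2 - 0\<^sup>2 / 2"
    by (rule has_integral_le[OF lsi_c_integral[OF l]])
  then show ?thesis by simp
qed

section \<open>The function x ln x: Legendre duality with exp, continuity, semicontinuity of the
  entropy\<close>

lemma xlnx_young:
  fixes a b :: real
  assumes "0 \<le> a" shows "a * b \<le> a * ln a - a + exp b"
proof (cases "a = 0")
  case False
  then have a: "0 < a" using assms by simp
  have "1 + (b - ln a) \<le> exp (b - ln a)" by (rule exp_ge_add_one_self)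
  also have "\<dots> = exp b / a" using a by (simp add: exp_diff)
  finally have "a * (1 + (b - ln a)) \<le> a * (exp b / a)" using a by (intro mult_left_mono) auto
  then show ?thesis using a by (simp add: algebra_simps)
qed simp

lemma xlnx_ge: "0 \<le> (x::real) \<Longrightarrow> x - 1 \<le> x * ln x"
  using xlnx_young[of x 0] by simp

text \<open>The shift by 1 makes entropies nonnegative integrals, to which Fatou's lemma applies; as
  the reference measure has mass 1, it adds just 1.\<close>

lemma xlnx_nonneg: "0 \<le> (x::real) \<Longrightarrow> 0 \<le> x * ln x + 1"
  using xlnx_ge[of x] by linarith

text \<open>Only the limit 0 is delicate, where \<open>ln\<close> is not continuous; there x ln x is
  dominated by 2 sqrt x.\<close>

lemma xlnx_tendsto:
  assumes t: "\<And>n. 0 \<le> (t n :: real)" "t \<longlonglongrightarrow> a"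
  shows "(\<lambda>n. t n * ln (t n)) \<longlonglongrightarrow> a * ln a"
proof (cases "a = 0")
  case True
  have b: "\<bar>x * ln x\<bar> \<le> 2 * sqrt x" if "0 \<le> x" "x \<le> 1" for x :: real
  proof (cases "x = 0")
    case False
    then have x: "0 < x" using that by simp
    have "ln (1 / sqrt x) \<le> 1 / sqrt x - 1" using x by (intro ln_le_minus_one) simp
    then have "- ln x \<le> 2 / sqrt x" using x by (simp add: ln_div ln_sqrt)
    then have "x * (- ln x) \<le> x * (2 / sqrt x)" using x by (intro mult_left_mono) auto
    also have "\<dots> = 2 * (x / sqrt x)" by simp
    also have "\<dots> = 2 * sqrt x" using x real_div_sqrt[of x] by simp
    finally have "- (x * ln x) \<le> 2 * sqrt x" by simp
    moreover have "x * ln x \<le> 0" using x that by (intro mult_nonneg_nonpos) auto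
    ultimately show ?thesis by simp
  qed simp
  have s: "(\<lambda>n. 2 * sqrt (t n)) \<longlonglongrightarrow> 0"
    using tendsto_mult[OF tendsto_const tendsto_real_sqrt[OF t(2)]] True by fastforce
  have "\<forall>\<^sub>F n in sequentially. t n < 1" using t(2) True by (intro order_tendstoD(2)) auto
  then have "\<forall>\<^sub>F n in sequentially. norm (t n * ln (t n)) \<le> 2 * sqrt (t n)"
    by eventually_elim (use b t(1) in auto)
  then have "(\<lambda>n. t n * ln (t n)) \<longlonglongrightarrow> 0" using s by (rule Lim_null_comparison)
  then show ?thesis using True by simp
next
  case False
  then show ?thesis by (intro tendsto_intros t(2))
qed

text \<open>Lower semicontinuity of the entropy. Only upper bounds on entropies have to pass to the
  limit, so almost everywhere convergence is enough.\<close>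

lemma entropy_fatou:
  fixes g :: "nat \<Rightarrow> 'a::euclidean_space \<Rightarrow> real"
  assumes [measurable]: "\<And>n. g n \<in> borel_measurable borel"
    and g0: "\<And>n x. 0 \<le> g n x" and lim: "AE x in std_gaussian. (\<lambda>n. g n x) \<longlonglongrightarrow> h x"
    and B: "\<And>n. (\<integral>\<^sup>+x. ennreal (g n x * ln (g n x) + 1) \<partial>std_gaussian) \<le> ennreal (B n + 1)"
    and Bl: "B \<longlonglongrightarrow> b"
  shows "(\<integral>\<^sup>+x. ennreal (h x * ln (h x) + 1) \<partial>std_gaussian) \<le> ennreal (b + 1)"
proof -
  have "(\<integral>\<^sup>+x. ennreal (h x * ln (h x) + 1) \<partial>std_gaussian)
    = (\<integral>\<^sup>+x. liminf (\<lambda>n. ennreal (g n x * ln (g n x) + 1)) \<partial>std_gaussian)"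
  proof (intro nn_integral_cong_AE)
    show "AE x in std_gaussian. ennreal (h x * ln (h x) + 1) = liminf (\<lambda>n. ennreal (g n x * ln (g n x) + 1))"
      using lim
    proof eventually_elim
      fix x assume "(\<lambda>n. g n x) \<longlonglongrightarrow> h x"
      from xlnx_tendsto[OF g0 this]
      have "(\<lambda>n. ennreal (g n x * ln (g n x) + 1)) \<longlonglongrightarrow> ennreal (h x * ln (h x) + 1)"
        by (intro tendsto_ennrealI tendsto_add tendsto_const)
      then show "ennreal (h x * ln (h x) + 1) = liminf (\<lambda>n. ennreal (g n x * ln (g n x) + 1))"
        by (rule lim_imp_Liminf[OF sequentially_bot, symmetric])
    qed
  qed
  also have "\<dots> \<le> liminf (\<lambda>n. \<integral>\<^sup>+x. ennreal (g n x * ln (g n x) + 1) \<partial>std_gaussian)"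
    by (rule nn_integral_liminf) measurable
  also have "\<dots> \<le> liminf (\<lambda>n. ennreal (B n + 1))"
    by (rule Liminf_mono) (use B in auto)
  also have "\<dots> = ennreal (b + 1)"
    by (intro lim_imp_Liminf sequentially_bot tendsto_ennrealI tendsto_add tendsto_const Bl)
  finally show ?thesis .
qed

section \<open>Regularisation, passage to the limit and the entropy bound\<close>

locale lsi_setting = weak_pair f G
  for f :: "'a::euclidean_space \<Rightarrow> real" and G +
  fixes l :: real
  assumes l: "0 < l" and P: "prob_space (density std_gaussian (\<lambda>x. ennreal (f x)))"
    and poin: "density std_gaussian (\<lambda>x. ennreal (f x)) \<in> poincare_class l"
    and moment: "integrable std_gaussian (\<lambda>x. f x * norm x)"
    and mean: "\<And>b. b \<in> Basis \<Longrightarrow> (LINT x|std_gaussian. f x * (x \<bullet> b)) = 0"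
begin

abbreviation J :: real where
  "J \<equiv> (LINT x|std_gaussian. (norm (H x))\<^sup>2 / f x)"

definition kap :: "real \<Rightarrow> real" where
  "kap r = r\<^sup>2 / (r\<^sup>2 + l * (1 - r\<^sup>2))"

lemma f_mass: "integral\<^sup>L std_gaussian f = 1"
  by (rule gauss_density_prob(2)[OF fm f0 P])

lemma J_nonneg: "0 \<le> J"
  by (rule Bochner_Integration.integral_nonneg) (simp add: f0)

text \<open>The scalar estimate is applied to every component of H and summed; the means vanish by
  \<open>mean_H\<close> and centering.\<close>

lemma contraction:
  assumes c: "0 < c" "c < 1"
  shows "(LINT x|std_gaussian. (norm (vec_ou c H x))\<^sup>2 / ou c f x) \<le> kap c * J"
proof -
  have c2: "c\<^sup>2 < 1" using c by (simp add: abs_square_less_1)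
  have n2: "(norm v)\<^sup>2 = (\<Sum>b\<in>Basis. (v \<bullet> b)\<^sup>2)" for v :: 'a
    unfolding power2_norm_eq_inner euclidean_inner[of v v] by (simp add: power2_eq_square)
  have Jb: "integrable std_gaussian (\<lambda>x. (H x \<bullet> b)\<^sup>2 / f x)" if "b \<in> Basis" for b
  proof (rule Bochner_Integration.integrable_bound[OF fisher_int])
    show "AE x in std_gaussian. norm ((H x \<bullet> b)\<^sup>2 / f x) \<le> norm ((norm (H x))\<^sup>2 / f x)"
    proof (rule AE_I2)
      fix x
      have "(H x \<bullet> b)\<^sup>2 \<le> (norm (H x))\<^sup>2"
        using power_mono[OF Basis_le_norm[OF that, of "H x"] abs_ge_zero, of 2] by simp
      then show "norm ((H x \<bullet> b)\<^sup>2 / f x) \<le> norm ((norm (H x))\<^sup>2 / f x)"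
        using f0[of x] by (simp add: divide_right_mono)
    qed
  qed measurable
  have F: "integrable std_gaussian (\<lambda>x. (ou c (\<lambda>x. H x \<bullet> b) x)\<^sup>2 / ou c f x)"
    "(LINT x|std_gaussian. (ou c (\<lambda>x. H x \<bullet> b) x)\<^sup>2 / ou c f x) \<le> kap c * (LINT x|std_gaussian. (H x \<bullet> b)\<^sup>2 / f x)"
    if b: "b \<in> Basis" for b
  proof -
    have "(LINT x|std_gaussian. H x \<bullet> b) = 0" using mean_H[OF moment b] mean[OF b] by simp
    from fisher_contraction[OF l c fm f0 P poin integrable_inner_left[OF H_int] this _ Jb[OF b]]
    show "integrable std_gaussian (\<lambda>x. (ou c (\<lambda>x. H x \<bullet> b) x)\<^sup>2 / ou c f x)"
      "(LINT x|std_gaussian. (ou c (\<lambda>x. H x \<bullet> b) x)\<^sup>2 / ou c f x) \<le> kap c * (LINT x|std_gaussian. (H x \<bullet> b)\<^sup>2 / f x)"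
      unfolding kap_def by (auto simp: H_def)
  qed
  have "(LINT x|std_gaussian. (norm (vec_ou c H x))\<^sup>2 / ou c f x)
    = (LINT x|std_gaussian. (\<Sum>b\<in>Basis. (ou c (\<lambda>x. H x \<bullet> b) x)\<^sup>2 / ou c f x))"
    unfolding n2 vec_ou_inner[OF c2 H_int] sum_divide_distrib ..
  also have "\<dots> = (\<Sum>b\<in>Basis. LINT x|std_gaussian. (ou c (\<lambda>x. H x \<bullet> b) x)\<^sup>2 / ou c f x)"
    by (rule Bochner_Integration.integral_sum) (rule F(1))
  also have "\<dots> \<le> (\<Sum>b\<in>Basis. kap c * (LINT x|std_gaussian. (H x \<bullet> b)\<^sup>2 / f x))"
    by (rule sum_mono) (rule F(2))
  also have "\<dots> = kap c * (LINT x|std_gaussian. (\<Sum>b\<in>Basis. (H x \<bullet> b)\<^sup>2 / f x))"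
    unfolding sum_distrib_left[symmetric] by (subst Bochner_Integration.integral_sum) (auto intro: Jb)
  also have "(LINT x|std_gaussian. (\<Sum>b\<in>Basis. (H x \<bullet> b)\<^sup>2 / f x)) = J"
    unfolding n2 sum_divide_distrib ..
  finally show ?thesis .
qed

text \<open>The density is presmoothed at d, so the contraction is invoked at r d. Monotonicity
  replaces this by r and gives a bound independent of d.\<close>

lemma kap_mono:
  assumes "0 \<le> q" "q \<le> r" "r \<le> 1" shows "kap q \<le> kap r"
proof (cases "q = 0")
  case True
  have "r\<^sup>2 \<le> 1" using assms by (simp add: abs_square_le_1)
  then have "0 \<le> kap r" unfolding kap_def using l by (intro divide_nonneg_nonneg add_nonneg_nonneg) auto
  then show ?thesis using True by (simp add: kap_def)
next
  case False
  then have q: "0 < q" "0 < r" using assms by auto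
  have q1: "q\<^sup>2 \<le> 1" "r\<^sup>2 \<le> 1" using assms by (auto simp: abs_square_le_1)
  have d: "0 < q\<^sup>2 + l * (1 - q\<^sup>2)" "0 < r\<^sup>2 + l * (1 - r\<^sup>2)"
    using q q1 l by (auto intro!: add_pos_nonneg)
  have "q\<^sup>2 \<le> r\<^sup>2" using assms by (intro power_mono) auto
  then have "l * q\<^sup>2 \<le> l * r\<^sup>2" using l by simp
  then have "q\<^sup>2 * (r\<^sup>2 + l * (1 - r\<^sup>2)) \<le> r\<^sup>2 * (q\<^sup>2 + l * (1 - q\<^sup>2))" by (simp add: algebra_simps)
  then show ?thesis
    unfolding kap_def pos_divide_le_eq[OF d(1)] times_divide_eq_left pos_le_divide_eq[OF d(2)] .
qed

context
  fixes d :: real assumes d: "0 < d" "d < 1"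
begin

abbreviation (input) en :: "nat \<Rightarrow> real" where
  "en n \<equiv> 1 / real (Suc n)"

text \<open>Truncation bounds the density from above, the semigroup makes it differentiable with
  bounded gradient, and the added constant bounds it from below.\<close>

definition wn :: "nat \<Rightarrow> 'a \<Rightarrow> real" where
  "wn n x = en n + ou d (tf (en n)) x"

lemma en_pos: "0 < en n" by simp

lemma d2: "d\<^sup>2 < 1" using d by (simp add: abs_square_less_1)

lemma wn_regular:
  "regular_density (wn n) (\<lambda>x. d *\<^sub>R vec_ou d (tV (en n)) x) (en n) (en n + 1 / en n)
    (d / sqrt (1 - d\<^sup>2) * (1 / en n * (LINT z|(std_gaussian :: 'a measure). norm z)))"
proof
  show "GDERIV (wn n) x :> d *\<^sub>R vec_ou d (tV (en n)) x" for x
    using GDERIV_add[OF GDERIV_const[of "en n" x] grad_ou_trunc[OF en_pos d]] unfolding wn_def[abs_def] by simp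
  show "(\<lambda>x. d *\<^sub>R vec_ou d (tV (en n)) x) \<in> borel_measurable borel" by measurable
  show "norm (d *\<^sub>R vec_ou d (tV (en n)) x) \<le> d / sqrt (1 - d\<^sup>2) * (1 / en n * (LINT z|(std_gaussian :: 'a measure). norm z))" for x
    by (rule vec_ou_tV_bound[OF en_pos d])
  show "0 < en n" by simp
  show "en n \<le> wn n x" for x
    unfolding wn_def ou_def by (simp add: tf_bounds[OF en_pos] Bochner_Integration.integral_nonneg del: of_nat_Suc)
  show "wn n x \<le> en n + 1 / en n" for x
    unfolding wn_def using ou_bounded[OF tf_measurable(1) tf_bounds(3)[OF en_pos[of n]], where c=d and x=x] by (simp add: abs_le_iff del: of_nat_Suc)
qed

text \<open>The de Bruijn integrand of \<open>wn n\<close> with the two semigroup steps merged into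
  the parameter r d; d^2 is the square of the factor d in the gradient of
  \<open>ou d\<close>.\<close>

definition An :: "nat \<Rightarrow> real \<Rightarrow> real" where
  "An n r = r * (d\<^sup>2 * (LINT x|std_gaussian. (norm (vec_ou (r * d) (tV (en n)) x))\<^sup>2 / (en n + ou (r * d) (tf (en n)) x)))"

definition A :: "real \<Rightarrow> real" where
  "A r = r * (d\<^sup>2 * (LINT x|std_gaussian. (norm (vec_ou (r * d) H x))\<^sup>2 / ou (r * d) f x))"

abbreviation (input) mn :: "nat \<Rightarrow> real" where
  "mn n \<equiv> en n + integral\<^sup>L std_gaussian (tf (en n))"

lemma wn_entropy: "(An n has_integral (LINT x|std_gaussian. wn n x * ln (wn n x)) - mn n * ln (mn n)) {0..1}"
proof -
  interpret R: regular_density "wn n" "\<lambda>x. d *\<^sub>R vec_ou d (tV (en n)) x" "en n" "en n + 1 / en n"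
    "d / sqrt (1 - d\<^sup>2) * (1 / en n * (LINT z|(std_gaussian :: 'a measure). norm z))"
    by (rule wn_regular)
  have m: "integral\<^sup>L std_gaussian (wn n) = mn n"
    unfolding wn_def[abs_def] using ou_integral[OF d2 tf_int[OF en_pos, of n]]
    by (subst Bochner_Integration.integral_add) auto
  \<comment> \<open>The semigroup law is stated for parameters strictly between 0 and 1; the
    endpoints do not affect the integral.\<close>
  have eq: "r * (LINT x|std_gaussian. (norm (R.vou r x))\<^sup>2 / ou r (wn n) x) = An n r" if r: "r \<in> {0<..<1}" for r
  proof -
    have r': "0 < r" "r < 1" and r2: "r\<^sup>2 < 1" using r by (auto simp: abs_square_less_1)
    have v: "R.vou r x = d *\<^sub>R vec_ou (r * d) (tV (en n)) x" for x
      unfolding R.vou_def vec_ou_semigroup[OF r' d tV_int[OF en_pos], symmetric] vec_ou_def[of r]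
      by (rule integral_scaleR_right)
    have o: "ou r (wn n) x = en n + ou (r * d) (tf (en n)) x" for x
    proof -
      have "ou r (wn n) x = (LINT z|std_gaussian. en n + ou d (tf (en n)) (r *\<^sub>R x + sqrt (1 - r\<^sup>2) *\<^sub>R z))"
        unfolding ou_def[of r] wn_def ..
      also have "\<dots> = en n + ou r (ou d (tf (en n))) x"
        using integrable_ou_kernel[OF r2 ou_integral(1)[OF d2 tf_int[OF en_pos, of n]], of x]
        by (subst Bochner_Integration.integral_add) (auto simp: ou_def[of r])
      finally show ?thesis unfolding ou_semigroup[OF r' d tf_int[OF en_pos]] .
    qed
    have "(LINT x|std_gaussian. (norm (R.vou r x))\<^sup>2 / ou r (wn n) x)
      = (LINT x|std_gaussian. d\<^sup>2 * ((norm (vec_ou (r * d) (tV (en n)) x))\<^sup>2 / (en n + ou (r * d) (tf (en n)) x)))"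
      unfolding v o by (simp add: power_mult_distrib)
    also have "\<dots> = d\<^sup>2 * (LINT x|std_gaussian. (norm (vec_ou (r * d) (tV (en n)) x))\<^sup>2 / (en n + ou (r * d) (tf (en n)) x))"
      by (rule Bochner_Integration.integral_mult_right_zero)
    finally show ?thesis unfolding An_def by simp
  qed
  show ?thesis
    using has_integral_spike_interior[OF R.de_bruijn[unfolded cbox_interval[symmetric]], of "An n"] eq
    unfolding m by (simp add: box_real)
qed

text \<open>\<open>tV_young\<close> is averaged for fixed t and optimised in t afterwards, which
  yields a majorant independent of n. The factor 4 serves domination only.\<close>

lemma An_quotient_bound:
  assumes r: "0 < q" "q < 1"
  shows "(norm (vec_ou q (tV (en n)) x))\<^sup>2 / (en n + ou q (tf (en n)) x) \<le> 4 * ou q (\<lambda>x. (norm (H x))\<^sup>2 / f x) x"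
proof -
  have q2: "q\<^sup>2 < 1" using r by (simp add: abs_square_less_1)
  let ?U = "en n + ou q (tf (en n)) x" and ?Q = "ou q (\<lambda>x. (norm (H x))\<^sup>2 / f x) x"
  have U: "0 < ?U" unfolding ou_def
    by (intro add_pos_nonneg Bochner_Integration.integral_nonneg tf_bounds en_pos)
  have Q: "0 \<le> ?Q" unfolding ou_def by (rule Bochner_Integration.integral_nonneg) (simp add: f0)
  note i1 = integrable_ou_kernel[OF q2 tf_int[OF en_pos, of n], of x] and i2 = integrable_ou_kernel[OF q2 fisher_int, of x]
  have "norm (vec_ou q (tV (en n)) x) \<le> t * ?U + ?Q / t" if t: "0 < t" for t
  proof -
    have "norm (vec_ou q (tV (en n)) x) \<le> (LINT z|std_gaussian. t * tf (en n) (q *\<^sub>R x + sqrt (1 - q\<^sup>2) *\<^sub>R z)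
      + ((norm (H (q *\<^sub>R x + sqrt (1 - q\<^sup>2) *\<^sub>R z)))\<^sup>2 / f (q *\<^sub>R x + sqrt (1 - q\<^sup>2) *\<^sub>R z)) / t)"
      unfolding vec_ou_def
      by (rule Bochner_Integration.integral_norm_bound_integral[OF vec_ou_integrable[OF q2 tV_int[OF en_pos]]])
         (intro Bochner_Integration.integrable_add integrable_mult_right integrable_divide i1 i2, rule tV_young[OF en_pos t])
    also have "\<dots> = t * ou q (tf (en n)) x + ?Q / t"
      unfolding ou_def
      by (simp only: Bochner_Integration.integral_add[OF integrable_mult_right[OF i1] integrable_divide[OF i2]]
        Bochner_Integration.integral_mult_right_zero integral_divide_zero)
    also have "\<dots> \<le> t * ?U + ?Q / t" using t by (simp add: mult_left_mono)
    finally show ?thesis .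
  qed
  from square_le_of_young[OF norm_ge_zero U this Q]
  show ?thesis unfolding pos_divide_le_eq[OF U] by (simp only: mult_ac)
qed

text \<open>Invariance of the Gaussian measure integrates the majorant to \<open>4 * J\<close>,
  uniformly in n and r.\<close>

lemma An_bound:
  assumes r: "r \<in> {0..1}" shows "norm (An n r) \<le> 4 * J"
proof (cases "r = 0")
  case False
  then have r': "0 < r" "r \<le> 1" using r by auto
  have rd1: "r * d \<le> d" using r' d by simp
  have q: "0 < r * d" "r * d < 1" using r' d le_less_trans[OF rd1 d(2)] by auto
  then have q2: "(r * d)\<^sup>2 < 1" by (simp add: abs_square_less_1)
  let ?I = "LINT x|std_gaussian. (norm (vec_ou (r * d) (tV (en n)) x))\<^sup>2 / (en n + ou (r * d) (tf (en n)) x)"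
  have nn: "0 \<le> (norm (vec_ou (r * d) (tV (en n)) x))\<^sup>2 / (en n + ou (r * d) (tf (en n)) x)" for x
    unfolding ou_def by (intro divide_nonneg_nonneg add_nonneg_nonneg Bochner_Integration.integral_nonneg tf_bounds en_pos less_imp_le[OF en_pos]) simp
  have I0: "0 \<le> ?I" by (rule Bochner_Integration.integral_nonneg) (rule nn)
  note Qi = ou_integral[OF q2 fisher_int]
  have "?I \<le> (LINT x|std_gaussian. 4 * ou (r * d) (\<lambda>x. (norm (H x))\<^sup>2 / f x) x)"
  proof (rule integral_mono_AE')
    show "integrable std_gaussian (\<lambda>x. 4 * ou (r * d) (\<lambda>x. (norm (H x))\<^sup>2 / f x) x)" using Qi(1) by simp
    show "AE x in std_gaussian. (norm (vec_ou (r * d) (tV (en n)) x))\<^sup>2 / (en n + ou (r * d) (tf (en n)) x)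
      \<le> 4 * ou (r * d) (\<lambda>x. (norm (H x))\<^sup>2 / f x) x"
      by (intro AE_I2 An_quotient_bound q)
    show "AE x in std_gaussian. 0 \<le> 4 * ou (r * d) (\<lambda>x. (norm (H x))\<^sup>2 / f x) x"
      by (intro AE_I2 order_trans[OF nn An_quotient_bound] q)
  qed
  also have "\<dots> = 4 * J" using Qi(2) by simp
  finally have I4: "?I \<le> 4 * J" .
  have "An n r = (r * d\<^sup>2) * ?I" unfolding An_def by simp
  also have "\<dots> \<le> (1 * 1) * (4 * J)" using r' d2 I0 I4 by (intro mult_mono) auto
  finally have "An n r \<le> 4 * J" by simp
  moreover have "0 \<le> An n r" unfolding An_def using r' I0 by (intro mult_nonneg_nonneg) auto
  ultimately show ?thesis by simp
qed (use J_nonneg in \<open>simp add: An_def\<close>)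

lemma ou_tf_tendsto:
  assumes q: "0 < q" "q < 1"
  shows "(\<lambda>n. ou q (tf (en n)) x) \<longlonglongrightarrow> ou q f x" "(\<lambda>n. vec_ou q (tV (en n)) x) \<longlonglongrightarrow> vec_ou q H x"
proof -
  have q2: "q\<^sup>2 < 1" using q by (simp add: abs_square_less_1)
  show "(\<lambda>n. ou q (tf (en n)) x) \<longlonglongrightarrow> ou q f x"
    unfolding ou_def
  proof (rule integral_dominated_convergence[OF _ _ integrable_ou_kernel[OF q2 fint, of x]])
    show "AE z in std_gaussian. (\<lambda>n. tf (en n) (q *\<^sub>R x + sqrt (1 - q\<^sup>2) *\<^sub>R z)) \<longlonglongrightarrow> f (q *\<^sub>R x + sqrt (1 - q\<^sup>2) *\<^sub>R z)"
      unfolding tf_def by (intro AE_I2 trunc_tendsto f0)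
    show "AE z in std_gaussian. norm (tf (en n) (q *\<^sub>R x + sqrt (1 - q\<^sup>2) *\<^sub>R z)) \<le> f (q *\<^sub>R x + sqrt (1 - q\<^sup>2) *\<^sub>R z)" for n
      unfolding real_norm_def abs_of_nonneg[OF tf_bounds(1)[OF en_pos]] by (intro AE_I2 tf_bounds en_pos)
  qed measurable
  show "(\<lambda>n. vec_ou q (tV (en n)) x) \<longlonglongrightarrow> vec_ou q H x"
    unfolding vec_ou_def
  proof (rule integral_dominated_convergence[OF _ _ integrable_norm[OF vec_ou_integrable[OF q2 H_int, of x]]])
    show "AE z in std_gaussian. (\<lambda>n. tV (en n) (q *\<^sub>R x + sqrt (1 - q\<^sup>2) *\<^sub>R z)) \<longlonglongrightarrow> H (q *\<^sub>R x + sqrt (1 - q\<^sup>2) *\<^sub>R z)"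
    proof (rule AE_I2)
      fix z
      let ?y = "q *\<^sub>R x + sqrt (1 - q\<^sup>2) *\<^sub>R z"
      have "(\<lambda>n. tV (en n) ?y) \<longlonglongrightarrow> (if f ?y = 0 then 0 else 1) *\<^sub>R G ?y"
        unfolding tV_def by (intro tendsto_scaleR tendsto_const trunc_tendsto f0)
      then show "(\<lambda>n. tV (en n) ?y) \<longlonglongrightarrow> H ?y" using f0[of ?y] by (cases "f ?y = 0") (auto simp: H_def)
    qed
    show "AE z in std_gaussian. norm (tV (en n) (q *\<^sub>R x + sqrt (1 - q\<^sup>2) *\<^sub>R z)) \<le> norm (H (q *\<^sub>R x + sqrt (1 - q\<^sup>2) *\<^sub>R z))" for n
      by (intro AE_I2 tV_le en_pos)
  qed measurable
qed

lemma en_tendsto: "(\<lambda>n. en n) \<longlonglongrightarrow> 0"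
  by (rule lim_inverse_n'[THEN LIMSEQ_Suc])

text \<open>Dominated by \<open>An_quotient_bound\<close>; the limiting denominators are positive by
  \<open>ou_pos\<close>.\<close>

lemma An_tendsto:
  assumes r: "r \<in> {0..1}" shows "(\<lambda>n. An n r) \<longlonglongrightarrow> A r"
proof (cases "r = 0")
  case False
  then have r': "0 < r" "r \<le> 1" using r by auto
  have rd1: "r * d \<le> d" using r' d by simp
  have q: "0 < r * d" "r * d < 1" using r' d le_less_trans[OF rd1 d(2)] by auto
  then have q2: "(r * d)\<^sup>2 < 1" by (simp add: abs_square_less_1)
  have op: "0 < ou (r * d) f x" for x by (rule ou_pos[OF q2 fint f0]) (simp add: f_mass)
  show ?thesis unfolding An_def A_def
  proof (intro tendsto_mult tendsto_const integral_dominated_convergence[where w="\<lambda>x. 4 * ou (r * d) (\<lambda>x. (norm (H x))\<^sup>2 / f x) x"])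
    show "integrable std_gaussian (\<lambda>x. 4 * ou (r * d) (\<lambda>x. (norm (H x))\<^sup>2 / f x) x)"
      using ou_integral(1)[OF q2 fisher_int] by simp
    show "AE x in std_gaussian. (\<lambda>n. (norm (vec_ou (r * d) (tV (en n)) x))\<^sup>2 / (en n + ou (r * d) (tf (en n)) x))
      \<longlonglongrightarrow> (norm (vec_ou (r * d) H x))\<^sup>2 / ou (r * d) f x"
    proof (rule AE_I2)
      fix x
      have "(\<lambda>n. en n + ou (r * d) (tf (en n)) x) \<longlonglongrightarrow> 0 + ou (r * d) f x"
        by (intro tendsto_add en_tendsto ou_tf_tendsto q)
      then show "(\<lambda>n. (norm (vec_ou (r * d) (tV (en n)) x))\<^sup>2 / (en n + ou (r * d) (tf (en n)) x))
        \<longlonglongrightarrow> (norm (vec_ou (r * d) H x))\<^sup>2 / ou (r * d) f x"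
        using op[of x] by (intro tendsto_divide tendsto_power tendsto_norm ou_tf_tendsto q) auto
    qed
    show "AE x in std_gaussian. norm ((norm (vec_ou (r * d) (tV (en n)) x))\<^sup>2 / (en n + ou (r * d) (tf (en n)) x))
      \<le> 4 * ou (r * d) (\<lambda>x. (norm (H x))\<^sup>2 / f x) x" for n
    proof (rule AE_I2)
      fix x
      have "0 \<le> (norm (vec_ou (r * d) (tV (en n)) x))\<^sup>2 / (en n + ou (r * d) (tf (en n)) x)"
        unfolding ou_def by (intro divide_nonneg_nonneg add_nonneg_nonneg Bochner_Integration.integral_nonneg tf_bounds en_pos less_imp_le[OF en_pos]) simp
      then show "norm ((norm (vec_ou (r * d) (tV (en n)) x))\<^sup>2 / (en n + ou (r * d) (tf (en n)) x))
        \<le> 4 * ou (r * d) (\<lambda>x. (norm (H x))\<^sup>2 / f x) x"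
        using An_quotient_bound[OF q, of n x] by (simp only: real_norm_def abs_of_nonneg)
    qed
  qed measurable
qed (simp add: An_def A_def)

text \<open>The contraction rests on the Poincare inequality of \<open>f\<close>, so it is applied
  to the limit \<open>A\<close> and not to the approximations \<open>An n\<close>.\<close>

lemma A_le:
  assumes r: "r \<in> {0..1}" shows "A r \<le> r * kap r * J"
proof (cases "r = 0")
  case False
  then have r': "0 < r" "r \<le> 1" using r by auto
  have rd: "r * d \<le> r" using r' d by simp
  have rd1: "r * d \<le> d" using r' d by simp
  have q: "0 < r * d" "r * d < 1" using r' d le_less_trans[OF rd1 d(2)] by auto
  then have q2: "(r * d)\<^sup>2 < 1" by (simp add: abs_square_less_1)
  have op: "0 < ou (r * d) f x" for x by (rule ou_pos[OF q2 fint f0]) (simp add: f_mass)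
  let ?I = "LINT x|std_gaussian. (norm (vec_ou (r * d) H x))\<^sup>2 / ou (r * d) f x"
  have "0 \<le> ?I" by (rule Bochner_Integration.integral_nonneg) (intro divide_nonneg_nonneg zero_le_power2 less_imp_le[OF op])
  moreover have "?I \<le> kap r * J"
    using contraction[OF q] mult_right_mono[OF kap_mono[of "r * d" r] J_nonneg] q r' rd by simp
  ultimately have "d\<^sup>2 * ?I \<le> 1 * (kap r * J)" using d2 by (intro mult_mono) auto
  then show ?thesis unfolding A_def using r' by (simp add: mult.assoc mult_left_mono)
qed (simp add: A_def)

text \<open>The entropy of \<open>wn n\<close> is the integral of \<open>An n\<close> plus m ln m,
  with m the mass of \<open>wn n\<close>. The masses tend to 1, so this term disappears, and the
  constant majorant from \<open>An_bound\<close> carries the integrals to the limit.\<close>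

lemma entropy_ou: "(\<integral>\<^sup>+x. ennreal (ou d f x * ln (ou d f x) + 1) \<partial>std_gaussian) \<le> ennreal (lsi_c l / 2 * J + 1)"
proof -
  have Ai: "An n integrable_on {0..1}" for n
    by (rule has_integral_integrable[OF wn_entropy])
  have ci: "(\<lambda>_. 4 * J) integrable_on {0..1::real}" by (rule integrable_const_ivl)
  note DC = dominated_convergence[OF Ai ci An_bound An_tendsto]
  have K: "((\<lambda>r. r * kap r * J) has_integral lsi_c l / 2 * J) {0..1}"
    using has_integral_mult_left[OF lsi_c_integral[OF l], of J] unfolding kap_def by simp
  have IA: "integral {0..1} A \<le> lsi_c l / 2 * J"
    by (rule has_integral_le[OF integrable_integral[OF DC(1)] K]) (assumption | rule A_le)+
  have m: "mn \<longlonglongrightarrow> 1"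
  proof -
    have "(\<lambda>n. integral\<^sup>L std_gaussian (tf (en n))) \<longlonglongrightarrow> integral\<^sup>L std_gaussian f"
    proof (rule integral_dominated_convergence[OF _ _ fint])
      show "AE z in std_gaussian. (\<lambda>n. tf (en n) z) \<longlonglongrightarrow> f z"
        unfolding tf_def by (intro AE_I2 trunc_tendsto f0)
      show "AE z in std_gaussian. norm (tf (en n) z) \<le> f z" for n
        unfolding real_norm_def abs_of_nonneg[OF tf_bounds(1)[OF en_pos]] by (intro AE_I2 tf_bounds en_pos)
    qed measurable
    from tendsto_add[OF en_tendsto this] show ?thesis by (simp add: f_mass)
  qed
  have m0: "0 \<le> mn n" for n
    by (intro add_nonneg_nonneg Bochner_Integration.integral_nonneg tf_bounds en_pos less_imp_le[OF en_pos])
  let ?B = "\<lambda>n. integral {0..1} (An n) + mn n * ln (mn n)"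
  have Bl: "?B \<longlonglongrightarrow> integral {0..1} A"
    using tendsto_add[OF DC(2) xlnx_tendsto[OF m0 m]] by simp
  have E: "(LINT x|std_gaussian. wn n x * ln (wn n x)) = ?B n" for n
    using integral_unique[OF wn_entropy[of n]] by simp
  have "(\<integral>\<^sup>+x. ennreal (ou d f x * ln (ou d f x) + 1) \<partial>std_gaussian) \<le> ennreal (integral {0..1} A + 1)"
  proof (rule entropy_fatou[OF _ _ _ _ Bl])
    fix n
    interpret R: regular_density "wn n" "\<lambda>x. d *\<^sub>R vec_ou d (tV (en n)) x" "en n" "en n + 1 / en n"
      "d / sqrt (1 - d\<^sup>2) * (1 / en n * (LINT z|(std_gaussian :: 'a measure). norm z))"
      by (rule wn_regular)
    show "wn n \<in> borel_measurable borel" by measurable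
    show w0: "0 \<le> wn n x" for x using R.wa[of x] en_pos[of n] by linarith
    have wi: "integrable std_gaussian (\<lambda>x. wn n x * ln (wn n x) + 1)"
    proof -
      \<comment> \<open>At parameter 1 the semigroup is the identity, so the bound on the entropy
        integrand holds for \<open>wn n\<close> itself.\<close>
      have "ou 1 (wn n) x = wn n x" for x by (simp add: ou_def)
      then have "integrable std_gaussian (\<lambda>x. wn n x * ln (wn n x))"
        using R.ent_integrand[of 1] by (intro gauss.integrable_const_bound[OF AE_I2]) (auto simp: )
      then show ?thesis by (intro Bochner_Integration.integrable_add gauss.integrable_const)
    qed
    have "(\<integral>\<^sup>+x. ennreal (wn n x * ln (wn n x) + 1) \<partial>std_gaussian) = ennreal (LINT x|std_gaussian. wn n x * ln (wn n x) + 1)"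
      by (intro nn_integral_eq_integral wi AE_I2 xlnx_nonneg w0)
    also have "(LINT x|std_gaussian. wn n x * ln (wn n x) + 1) = ?B n + 1"
    proof -
      have "integrable std_gaussian (\<lambda>x. wn n x * ln (wn n x) + 1 - 1)" using wi by (intro Bochner_Integration.integrable_diff gauss.integrable_const)
      then show ?thesis unfolding E[symmetric] by (subst Bochner_Integration.integral_add) auto
    qed
    finally show "(\<integral>\<^sup>+x. ennreal (wn n x * ln (wn n x) + 1) \<partial>std_gaussian) \<le> ennreal (?B n + 1)" by simp
  next
    show "AE x in std_gaussian. (\<lambda>n. wn n x) \<longlonglongrightarrow> ou d f x"
      using tendsto_add[OF en_tendsto ou_tf_tendsto(1)[OF d]] unfolding wn_def by simp
  qed
  also have "\<dots> \<le> ennreal (lsi_c l / 2 * J + 1)" using IA by (intro ennreal_leI) simp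
  finally show ?thesis .
qed

end

text \<open>The presmoothing parameter is sent to 1. L1 convergence gives an almost everywhere
  convergent subsequence, and the bound of \<open>entropy_ou\<close> is the same along it.\<close>

theorem improved_lsi:
  assumes "integrable std_gaussian (\<lambda>x. f x * ln (f x))"
  shows "(LINT x|std_gaussian. f x * ln (f x)) \<le> lsi_c l / 2 * J"
proof -
  define c where "c = (\<lambda>n. 1 - 1 / real (n + 2))"
  have c: "0 < c n" "c n < 1" for n by (auto simp: c_def field_simps)
  have c2: "(c n)\<^sup>2 < 1" for n using c[of n] by (simp add: abs_square_less_1)
  have cl: "c \<longlonglongrightarrow> 1" unfolding c_def by real_asymp
  note oi = ou_integral(1)[OF c2]
  have "(\<lambda>n. LINT x|std_gaussian. norm (ou (c n) f x - f x)) \<longlonglongrightarrow> 0"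
    using ou_tendsto_L1[OF fint c2 cl] by simp
  from tendsto_L1_AE_subseq[OF _ this] oi[OF fint] fint
  obtain r where ae: "AE x in std_gaussian. (\<lambda>n. ou (c (r n)) f x - f x) \<longlonglongrightarrow> 0" by auto
  have "(\<integral>\<^sup>+x. ennreal (f x * ln (f x) + 1) \<partial>std_gaussian) \<le> ennreal (lsi_c l / 2 * J + 1)"
  proof (rule entropy_fatou[OF _ _ _ _ tendsto_const])
    show "ou (c (r n)) f \<in> borel_measurable borel" for n by measurable
    show "0 \<le> ou (c (r n)) f x" for n x unfolding ou_def by (rule Bochner_Integration.integral_nonneg) (rule f0)
    show "AE x in std_gaussian. (\<lambda>n. ou (c (r n)) f x) \<longlonglongrightarrow> f x"
      using ae by eventually_elim (simp add: LIM_zero_iff)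
    show "(\<integral>\<^sup>+x. ennreal (ou (c (r n)) f x * ln (ou (c (r n)) f x) + 1) \<partial>std_gaussian) \<le> ennreal (lsi_c l / 2 * J + 1)" for n
      by (rule entropy_ou[OF c])
  qed
  also have "(\<integral>\<^sup>+x. ennreal (f x * ln (f x) + 1) \<partial>std_gaussian) = ennreal (LINT x|std_gaussian. f x * ln (f x) + 1)"
    by (intro nn_integral_eq_integral Bochner_Integration.integrable_add gauss.integrable_const assms AE_I2 xlnx_nonneg f0)
  also have "(LINT x|std_gaussian. f x * ln (f x) + 1) = (LINT x|std_gaussian. f x * ln (f x)) + 1"
    using assms by (subst Bochner_Integration.integral_add) auto
  finally have "ennreal ((LINT x|std_gaussian. f x * ln (f x)) + 1) \<le> ennreal (lsi_c l / 2 * J + 1)" .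
  moreover have "0 \<le> lsi_c l / 2 * J" using lsi_c_pos[OF l] J_nonneg by simp
  ultimately show ?thesis by (subst (asm) ennreal_le_iff) auto
qed

end

section \<open>Talagrand's inequality\<close>

lemma cdf_distributionI: "prob_space M \<Longrightarrow> sets M = sets borel \<Longrightarrow> cdf_distribution M"
  by (rule cdf_distribution.intro, rule real_distribution.intro, assumption, rule real_distribution_axioms.intro)

lemma sets_gauss1: "sets gauss1 = sets borel"
  by (simp only: sets_density sets_lborel)

lemma cdf_distribution_gauss1: "cdf_distribution gauss1"
  by (rule cdf_distributionI, rule prob_space_gauss1, rule sets_gauss1)

interpretation gauss1: cdf_distribution gauss1
  by (rule cdf_distribution_gauss1)

text \<open>One inequality is the Galois connection between C and its pseudo-inverse. For the other,
  C stays below w to the left of \<open>I w\<close>, and continuity carries this over to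
  \<open>I w\<close>.\<close>

lemma (in cdf_distribution) cdf_pseudoinverse:
  assumes "isCont C (I w)" "0 < w" "w < 1"
  shows "C (I w) = w"
proof (rule antisym)
  show "w \<le> C (I w)" by (rule iffD2[OF pseudoinverse[OF assms(2,3)] order_refl])
  have "(C \<longlongrightarrow> C (I w)) (at_left (I w))"
    using assms(1) by (simp add: isCont_def filterlim_at_split)
  moreover have "\<forall>\<^sub>F x in at_left (I w). C x \<le> w"
    unfolding eventually_at_filter
  proof (intro always_eventually allI impI)
    fix x assume "x \<in> {..<I w}"
    then have "\<not> I w \<le> x" by (simp only: lessThan_iff not_le)
    then have "\<not> w \<le> C x" using iffD1[OF pseudoinverse[OF assms(2,3), of x]] by (rule contrapos_nn)
    then show "C x \<le> w" by (simp only: not_le less_imp_le)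
  qed
  ultimately show "C (I w) \<le> w" by (rule tendsto_upperbound) simp
qed

lemma gauss1_density_singleton: "emeasure (density gauss1 g) {x} = 0" if [measurable]: "g \<in> borel_measurable borel"
proof -
  have "AE y in lborel. y \<noteq> x" by (rule AE_lborel_singleton)
  then have "AE y in gauss1. y \<noteq> x" by (subst AE_density) auto
  then have "AE y in density gauss1 g. y \<noteq> x" by (subst AE_density) auto
  then show ?thesis by (subst (asm) AE_iff_measurable[of "{x}"]) auto
qed

lemma gauss1_singleton: "measure gauss1 {x} = 0"
  using gauss1_density_singleton[of "\<lambda>_. 1" x] by (simp add: density_1 measure_def)

text \<open>The indicator fixes the value 0 outside (0, 1), which makes the function measurable on
  the whole line.\<close>

definition normal_quantile :: "real \<Rightarrow> real" where
  "normal_quantile w = indicat_real {0<..<1} w *\<^sub>R gauss1.I w"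

lemma normal_quantile_measurable [measurable]: "normal_quantile \<in> borel_measurable borel"
  unfolding normal_quantile_def[abs_def]
  by (subst borel_measurable_restrict_space_iff[symmetric]) (auto intro: gauss1.measurable_CI)

lemma cdf_normal_quantile: "0 < w \<Longrightarrow> w < 1 \<Longrightarrow> cdf gauss1 (normal_quantile w) = w"
  unfolding normal_quantile_def using gauss1.cdf_pseudoinverse gauss1.isCont_cdf gauss1_singleton by simp

text \<open>The negative of the density is a primitive of s times the density and vanishes at
  infinity.\<close>

lemma normal_truncated_mean:
  "(LINT s|gauss1. indicat_real {q<..} s * s) = std_normal_density q"
proof -
  have i: "integrable lborel (\<lambda>s. std_normal_density s * s)" using integrable_std_normal_moment[of 1] by simp
  define k where "k = 1 / sqrt (2 * pi)"
  have std: "std_normal_density s = k * exp (- s\<^sup>2 / 2)" for s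
    unfolding std_normal_density_def k_def ..
  have D: "((\<lambda>s. - std_normal_density s) has_real_derivative std_normal_density s * s) (at s)" for s
    unfolding std by (auto intro!: derivative_eq_intros)
  have c: "isCont (\<lambda>s. std_normal_density s * s) s" for s
    unfolding std by (intro continuous_intros) auto
  have cd: "isCont (\<lambda>s. - std_normal_density s) s" for s using D by (rule DERIV_isCont)
  have "(LBINT s=ereal q..\<infinity>. std_normal_density s * s) = 0 - (- std_normal_density q)"
  proof (rule interval_integral_FTC_integrable)
    show "((\<lambda>s. - std_normal_density s) has_vector_derivative std_normal_density s * s) (at s)" for s
      using D by (simp add: has_real_derivative_iff_has_vector_derivative)
    show "set_integrable lborel (einterval (ereal q) \<infinity>) (\<lambda>s. std_normal_density s * s)"
      unfolding set_integrable_def by (rule integrable_mult_indicator) (use i in auto)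
    show "(((\<lambda>s. - std_normal_density s) \<circ> real_of_ereal) \<longlongrightarrow> - std_normal_density q) (at_right (ereal q))"
      unfolding ereal_tendsto_simps using cd[of q] by (simp add: isCont_def filterlim_at_split)
    have "((\<lambda>s. - std_normal_density s) \<longlongrightarrow> 0) at_top"
      unfolding std by real_asymp
    then show "(((\<lambda>s. - std_normal_density s) \<circ> real_of_ereal) \<longlongrightarrow> 0) (at_left \<infinity>)"
      unfolding ereal_tendsto_simps .
  qed (use c in auto)
  moreover have "(LBINT s=ereal q..\<infinity>. std_normal_density s * s) = (LINT s|lborel. indicat_real {q<..} s * (std_normal_density s * s))"
    by (simp add: interval_lebesgue_integral_def set_lebesgue_integral_def einterval_eq)
  ultimately show ?thesis by (subst integral_density) (auto simp: mult_ac)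
qed

locale density_1d =
  fixes g :: "real \<Rightarrow> real"
  assumes gm [measurable]: "g \<in> borel_measurable borel" and g0: "\<And>x. 0 \<le> g x"
    and gi: "integrable gauss1 g" and g1: "integral\<^sup>L gauss1 g = 1"
    and gln: "integrable gauss1 (\<lambda>x. g x * ln (g x))"
begin

definition \<mu> :: "real measure" where
  "\<mu> = density gauss1 (\<lambda>x. ennreal (g x))"

lemma sets_mu [simp, measurable_cong]: "sets \<mu> = sets borel" by (simp add: \<mu>_def)
lemma space_mu [simp]: "space \<mu> = UNIV" by (simp add: \<mu>_def)

sublocale mu: cdf_distribution \<mu>
proof (rule cdf_distributionI[OF prob_spaceI sets_mu])
  have "(\<integral>\<^sup>+x. ennreal (g x) \<partial>gauss1) = ennreal (integral\<^sup>L gauss1 g)"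
    by (rule nn_integral_eq_integral[OF gi]) (use g0 in auto)
  then show "emeasure \<mu> (space \<mu>) = 1" unfolding \<mu>_def g1 by (simp add: emeasure_density)
qed

lemma mu_integral:
  assumes [measurable]: "h \<in> borel_measurable borel"
  shows "integrable \<mu> h \<longleftrightarrow> integrable gauss1 (\<lambda>x. g x * h x)"
    and "(LINT x|\<mu>. (h x :: real)) = (LINT x|gauss1. g x * h x)"
proof -
  show "integrable \<mu> h \<longleftrightarrow> integrable gauss1 (\<lambda>x. g x * h x)"
    unfolding \<mu>_def by (subst integrable_density) (use g0 in auto)
  show "(LINT x|\<mu>. (h x :: real)) = (LINT x|gauss1. g x * h x)"
    unfolding \<mu>_def by (subst integral_density) (use g0 in auto)
qed

abbreviation F :: "real \<Rightarrow> real" where "F \<equiv> cdf \<mu>"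

text \<open>The monotone rearrangement of \<open>\<mu>\<close> onto the normal law.\<close>

definition S :: "real \<Rightarrow> real" where "S x = normal_quantile (F x)"

lemma F_integral: "F x = (LINT z|gauss1. indicat_real {..x} z * g z)"
proof -
  have "F x = (LINT z|\<mu>. indicat_real {..x} z)" by (simp add: cdf_def)
  then show ?thesis by (subst (asm) mu_integral) (simp_all add: mult.commute)
qed

lemma S_measurable [measurable]: "S \<in> borel_measurable borel"
  unfolding S_def[abs_def] by measurable

lemma mu_singleton: "measure \<mu> {x} = 0"
  by (simp add: measure_def \<mu>_def gauss1_density_singleton)

lemma F_inverse: "0 < w \<Longrightarrow> w < 1 \<Longrightarrow> F (mu.I w) = w"
  by (rule mu.cdf_pseudoinverse) (simp_all only: mu.isCont_cdf mu_singleton)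

abbreviation \<Omega> :: "real measure" where "\<Omega> \<equiv> restrict_space lborel {0<..<1}"

lemma space_Omega [simp]: "space \<Omega> = {0<..<1}" by (simp add: space_restrict_space)

lemma S_I: "w \<in> {0<..<1} \<Longrightarrow> S (mu.I w) = gauss1.I w"
  by (simp add: S_def F_inverse normal_quantile_def)

text \<open>Both laws are images of the uniform measure on (0, 1) under their quantile functions,
  and S carries one quantile function to the other.\<close>

lemma distr_S: "distr \<mu> borel S = gauss1"
proof -
  have "distr \<mu> borel S = distr (distr \<Omega> borel mu.I) borel S" unfolding mu.distr_I_eq_M ..
  also have "\<dots> = distr \<Omega> borel (S \<circ> mu.I)" by (rule distr_distr) auto
  also have "\<dots> = distr \<Omega> borel gauss1.I" by (rule distr_cong) (auto simp: S_I)
  also have "\<dots> = gauss1" by (rule gauss1.distr_I_eq_M)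
  finally show ?thesis .
qed

lemma AE_F: "AE x in \<mu>. 0 < F x \<and> F x < 1"
proof -
  have "AE x in distr \<Omega> borel mu.I. 0 < F x \<and> F x < 1"
    by (subst AE_distr_iff) (auto simp: F_inverse intro!: AE_I2)
  then show ?thesis unfolding mu.distr_I_eq_M .
qed

lemma S_integral:
  assumes [measurable]: "h \<in> borel_measurable borel"
  shows "integrable \<mu> (\<lambda>x. h (S x)) \<longleftrightarrow> integrable gauss1 h"
    and "(LINT x|\<mu>. (h (S x) :: real)) = integral\<^sup>L gauss1 h"
  using integrable_distr_eq[of S \<mu> borel h] integral_distr[of S \<mu> borel h] unfolding distr_S by auto

lemma S_moments:
  "integrable \<mu> S" "(LINT x|\<mu>. S x) = 0" "integrable \<mu> (\<lambda>x. (S x)\<^sup>2)" "(LINT x|\<mu>. (S x)\<^sup>2) = 1"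
proof -
  have m: "(\<lambda>s::real. s) \<in> borel_measurable borel" "(\<lambda>s::real. s\<^sup>2) \<in> borel_measurable borel" by measurable
  show "integrable \<mu> S" by (rule iffD2[OF S_integral(1)[OF m(1)] gauss1_moments(1)])
  show "(LINT x|\<mu>. S x) = 0" by (rule trans[OF S_integral(2)[OF m(1)] gauss1_moments(2)])
  show "integrable \<mu> (\<lambda>x. (S x)\<^sup>2)" by (rule iffD2[OF S_integral(1)[OF m(2)] gauss1_moments(3)])
  show "(LINT x|\<mu>. (S x)\<^sup>2) = 1" by (rule trans[OF S_integral(2)[OF m(2)] gauss1_moments(4)])
qed

text \<open>The normal density along S. Where F is 0 or 1 the quantile is a mere default; the value
  0 agrees there with the tail integral in \<open>tail_S\<close>.\<close>

definition \<psi> :: "real \<Rightarrow> real" where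
  "\<psi> t = (if 0 < F t \<and> F t < 1 then std_normal_density (S t) else 0)"

lemma psi_nonneg: "0 \<le> \<psi> t" by (simp add: \<psi>_def)

text \<open>In the uniform variable w the condition x > t reads w > F t, that is, a Gaussian tail
  beyond S t, whose mean is \<open>normal_truncated_mean\<close>. For F t = 0 it is the full mean,
  which is 0; for F t = 1 the tail is empty.\<close>

lemma tail_S: "(LINT x|\<mu>. indicat_real {t<..} x * S x) = \<psi> t"
proof -
  have "(LINT x|\<mu>. indicat_real {t<..} x * S x) = (LINT w|\<Omega>. indicat_real {t<..} (mu.I w) * S (mu.I w))"
    by (subst mu.distr_I_eq_M[symmetric], subst integral_distr) auto
  also have "\<dots> = (LINT w|\<Omega>. indicat_real {F t<..} w * gauss1.I w)"
  proof (intro Bochner_Integration.integral_cong refl)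
    fix w assume "w \<in> space \<Omega>"
    then have w: "0 < w" "w < 1" by auto
    have "t < mu.I w \<longleftrightarrow> F t < w"
      unfolding not_le[symmetric] by (rule arg_cong[of _ _ Not], rule mu.pseudoinverse[OF w, symmetric])
    then have "indicat_real {t<..} (mu.I w) = indicat_real {F t<..} w"
      by (simp only: indicator_def greaterThan_iff)
    then show "indicat_real {t<..} (mu.I w) * S (mu.I w) = indicat_real {F t<..} w * gauss1.I w"
      using S_I[of w] w by (simp only:) simp
  qed
  also have "\<dots> = \<psi> t"
  proof (cases "0 < F t \<and> F t < 1")
    case True
    have "(LINT w|\<Omega>. indicat_real {F t<..} w * gauss1.I w) = (LINT w|\<Omega>. indicat_real {S t<..} (gauss1.I w) * gauss1.I w)"
    proof (intro Bochner_Integration.integral_cong refl)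
      fix w assume w: "w \<in> space \<Omega>"
      then have w: "0 < w" "w < 1" by auto
      have "cdf gauss1 (S t) = F t" unfolding S_def using True by (intro cdf_normal_quantile) auto
      then have "w \<le> F t \<longleftrightarrow> gauss1.I w \<le> S t"
        using gauss1.pseudoinverse[OF w, of "S t"] by (simp only:)
      then have "S t < gauss1.I w \<longleftrightarrow> F t < w" unfolding not_le[symmetric] by (simp only:)
      then show "indicat_real {F t<..} w * gauss1.I w = indicat_real {S t<..} (gauss1.I w) * gauss1.I w"
        by (simp only: indicator_def greaterThan_iff)
    qed
    also have "\<dots> = (LINT s|gauss1. indicat_real {S t<..} s * s)"
      by (subst (2) gauss1.distr_I_eq_M[symmetric], subst integral_distr) auto
    finally show ?thesis using True by (simp add: normal_truncated_mean \<psi>_def)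
  next
    case False
    then consider "F t \<le> 0" | "1 \<le> F t" by linarith
    then show ?thesis
    proof cases
      case 1
      have "(LINT w|\<Omega>. indicat_real {F t<..} w * gauss1.I w) = (LINT w|\<Omega>. gauss1.I w)"
        using 1 by (intro Bochner_Integration.integral_cong refl) (auto simp: indicator_def)
      also have "\<dots> = (LINT s|gauss1. s)"
        by (subst (2) gauss1.distr_I_eq_M[symmetric], subst integral_distr) auto
      finally show ?thesis using False gauss1_moments by (auto simp: \<psi>_def)
    next
      case 2
      have "(LINT w|\<Omega>. indicat_real {F t<..} w * gauss1.I w) = (LINT w|\<Omega>. 0)"
        using 2 by (intro Bochner_Integration.integral_cong refl) (auto simp: indicator_def)
      then show ?thesis using False by (auto simp: \<psi>_def)
    qed
  qed
  finally show ?thesis .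
qed

text \<open>Finite entropy controls the second moment: \<open>xlnx_young\<close> with b = x^2 / 4,
  for which exp b is still integrable against the normal law.\<close>

lemma sq_moment: "integrable \<mu> (\<lambda>x. x\<^sup>2)"
proof -
  have e: "integrable gauss1 (\<lambda>x. exp (x\<^sup>2 / 4))"
  proof -
    define a where "a = sqrt (2 * pi * (sqrt 2)\<^sup>2)"
    define b where "b = sqrt (2 * pi)"
    have ab: "0 < a" "0 < b" by (simp_all add: a_def b_def)
    \<comment> \<open>exp(x^2 / 4) times the standard density is a multiple of the centered normal
      density of variance 2.\<close>
    have "integrable lborel (\<lambda>x. a / b * normal_density 0 (sqrt 2) x)"
      by (rule integrable_mult_right, rule integrable_normal_density) simp
    moreover have "a / b * normal_density 0 (sqrt 2) x = std_normal_density x * exp (x\<^sup>2 / 4)" for x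
    proof -
      have "a / b * normal_density 0 (sqrt 2) x = exp (- x\<^sup>2 / 4) / b"
        unfolding normal_density_def a_def[symmetric] using ab by simp
      also have "exp (- x\<^sup>2 / 4) = exp (- x\<^sup>2 / 2) * exp (x\<^sup>2 / 4)"
        by (simp add: exp_add[symmetric])
      finally show ?thesis unfolding std_normal_density_def b_def[symmetric] by simp
    qed
    ultimately have "integrable lborel (\<lambda>x. std_normal_density x * exp (x\<^sup>2 / 4))" by (simp only:)
    then show ?thesis by (subst integrable_density) auto
  qed
  have "integrable gauss1 (\<lambda>x. g x * (x\<^sup>2 / 4))"
  proof (rule Bochner_Integration.integrable_bound)
    show "integrable gauss1 (\<lambda>x. g x * ln (g x) - g x + exp (x\<^sup>2 / 4))" using gln gi e by simp
    show "AE x in gauss1. norm (g x * (x\<^sup>2 / 4)) \<le> norm (g x * ln (g x) - g x + exp (x\<^sup>2 / 4))"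
    proof (rule AE_I2)
      fix x
      have "0 \<le> g x * (x\<^sup>2 / 4)" using g0 by simp
      then show "norm (g x * (x\<^sup>2 / 4)) \<le> norm (g x * ln (g x) - g x + exp (x\<^sup>2 / 4))"
        using xlnx_young[OF g0[of x], of "x\<^sup>2 / 4"] by simp
    qed
  qed simp
  then have "integrable gauss1 (\<lambda>x. 4 * (g x * (x\<^sup>2 / 4)))" by (rule integrable_mult_right)
  then show ?thesis by (subst mu_integral) auto
qed

lemma xS_integrable: "integrable \<mu> (\<lambda>x. x * S x)"
proof (rule Bochner_Integration.integrable_bound)
  show "integrable \<mu> (\<lambda>x. x\<^sup>2 + (S x)\<^sup>2)" using sq_moment S_moments(3) by simp
  show "AE x in \<mu>. norm (x * S x) \<le> norm (x\<^sup>2 + (S x)\<^sup>2)"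
  proof (rule AE_I2)
    fix x
    have "2 * (\<bar>x\<bar> * \<bar>S x\<bar>) \<le> x\<^sup>2 + (S x)\<^sup>2" using sum_squares_bound[of "\<bar>x\<bar>" "\<bar>S x\<bar>"] by simp
    moreover have "0 \<le> \<bar>x\<bar> * \<bar>S x\<bar>" by simp
    ultimately have "\<bar>x\<bar> * \<bar>S x\<bar> \<le> x\<^sup>2 + (S x)\<^sup>2" by linarith
    then show "norm (x * S x) \<le> norm (x\<^sup>2 + (S x)\<^sup>2)" by (simp add: abs_mult)
  qed
qed simp

text \<open>A signed layer-cake kernel: its integral in t is x, for either sign of x.\<close>

definition layer :: "real \<Rightarrow> real \<Rightarrow> real" where
  "layer x t = indicat_real {0..<x} t - indicat_real {x..<0} t"

lemma layer_integral: "integrable lborel (layer x)" "(LINT t|lborel. layer x t) = x"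
  "(LINT t|lborel. \<bar>layer x t\<bar>) = \<bar>x\<bar>"
proof -
  have i: "integrable lborel (indicat_real {a..<b})" for a b :: real
    by (cases "a \<le> b") (auto intro!: integrable_real_indicator)
  show "integrable lborel (layer x)" unfolding layer_def[abs_def] by (intro Bochner_Integration.integrable_diff i)
  show "(LINT t|lborel. layer x t) = x"
    unfolding layer_def by (subst Bochner_Integration.integral_diff[OF i i]) (cases "0 \<le> x"; simp)
  have "\<bar>layer x t\<bar> = indicat_real {0..<x} t + indicat_real {x..<0} t" for t
    by (auto simp: layer_def indicator_def)
  then show "(LINT t|lborel. \<bar>layer x t\<bar>) = \<bar>x\<bar>"
    by (simp only:) (subst Bochner_Integration.integral_add[OF i i]; cases "0 \<le> x"; simp)
qed

lemma layer_measurable [measurable]: "(\<lambda>p. layer (fst p) (snd p)) \<in> borel_measurable (borel \<Otimes>\<^sub>M borel)"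
  unfolding layer_def indicator_def by simp

text \<open>Write x as the integral of \<open>layer x t\<close> and exchange the integrals; the
  inner one is a tail of S. For t < 0 it differs from the tail by the full mean of S, which is 0. In
  this way S need not be differentiated.\<close>

lemma psi_integral: "integrable lborel \<psi>" "(LINT t|lborel. \<psi> t) = (LINT x|\<mu>. x * S x)"
proof -
  interpret pr: pair_sigma_finite \<mu> "lborel :: real measure" ..
  have [measurable]: "(\<lambda>p. S (fst p) * layer (fst p) (snd p)) \<in> borel_measurable (\<mu> \<Otimes>\<^sub>M lborel)"
    by measurable
  have int: "integrable (\<mu> \<Otimes>\<^sub>M lborel) (\<lambda>(x, t). S x * layer x t)"
  proof (rule pr.Fubini_integrable)
    show "(\<lambda>(x, t). S x * layer x t) \<in> borel_measurable (\<mu> \<Otimes>\<^sub>M lborel)" unfolding split_beta by measurable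
    have "(LINT t|lborel. norm (S x * layer x t)) = \<bar>x * S x\<bar>" for x
      using layer_integral by (simp add: abs_mult)
    then show "integrable \<mu> (\<lambda>x. LINT t|lborel. norm (case (x, t) of (x, t) \<Rightarrow> S x * layer x t))"
      using integrable_abs[OF xS_integrable] by simp
    show "AE x in \<mu>. integrable lborel (\<lambda>t. case (x, t) of (x, t) \<Rightarrow> S x * layer x t)"
      using layer_integral by simp
  qed
  have inner: "(LINT x|\<mu>. S x * layer x t) = \<psi> t" for t
  proof (cases "0 \<le> t")
    case True
    then have e: "S x * layer x t = indicat_real {t<..} x * S x" for x by (auto simp: layer_def indicator_def)
    show ?thesis unfolding e by (rule tail_S)
  next
    case False
    have "S x * layer x t = indicat_real {t<..} x * S x - S x" for x using False by (auto simp: layer_def indicator_def)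
    moreover have "integrable \<mu> (\<lambda>x. indicat_real {t<..} x * S x)"
      using integrable_mult_indicator[of "{t<..}" \<mu> S] S_moments(1) by simp
    ultimately show ?thesis using tail_S[of t] S_moments by simp
  qed
  show "integrable lborel \<psi>" using pr.integrable_snd[OF int] unfolding inner by simp
  have "(LINT t|lborel. \<psi> t) = (LINT t|lborel. LINT x|\<mu>. S x * layer x t)" unfolding inner ..
  also have "\<dots> = (LINT x|\<mu>. LINT t|lborel. S x * layer x t)" by (rule pr.Fubini_integral[OF int])
  also have "\<dots> = (LINT x|\<mu>. x * S x)" using layer_integral(2) by (simp add: mult.commute)
  finally show "(LINT t|lborel. \<psi> t) = (LINT x|\<mu>. x * S x)" .
qed

lemma sq_dist_integrable: "integrable \<mu> (\<lambda>x. (x - S x)\<^sup>2)"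
  and sq_dist_integral: "(LINT x|\<mu>. (x - S x)\<^sup>2) = (LINT x|\<mu>. x\<^sup>2) + 1 - 2 * (LINT x|\<mu>. x * S x)"
proof -
  have e: "(x - S x)\<^sup>2 = x\<^sup>2 + (S x)\<^sup>2 - 2 * (x * S x)" for x by (simp add: power2_diff)
  show "integrable \<mu> (\<lambda>x. (x - S x)\<^sup>2)" unfolding e using sq_moment S_moments(3) xS_integrable by simp
  show "(LINT x|\<mu>. (x - S x)\<^sup>2) = (LINT x|\<mu>. x\<^sup>2) + 1 - 2 * (LINT x|\<mu>. x * S x)"
    unfolding e using sq_moment S_moments(3,4) xS_integrable by simp
qed

text \<open>Write \<open>\<phi>\<close> for the normal density and \<open>r = g \<phi> / (\<phi> \<circ> S)\<close>, the formal derivative of \<open>S\<close>. Then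
  \<open>ln g = ln r + (x\<^sup>2 - S\<^sup>2) / 2\<close> and \<open>ln r \<ge> 1 - 1 / r\<close>, and \<open>1 / r\<close> integrates to \<open>\<integral> x S d\<mu>\<close>.\<close>

theorem transport_cost: "(LINT x|\<mu>. (x - S x)\<^sup>2) \<le> 2 * (LINT x|gauss1. g x * ln (g x))"
proof -
  have psi_i: "integrable gauss1 (\<lambda>x. \<psi> x / std_normal_density x)" and
    psi_v: "(LINT x|gauss1. \<psi> x / std_normal_density x) = (LINT x|\<mu>. x * S x)"
  proof -
    have p: "std_normal_density x * (\<psi> x / std_normal_density x) = \<psi> x" for x
      using normal_density_pos[of 1 0 x] by simp
    show "integrable gauss1 (\<lambda>x. \<psi> x / std_normal_density x)"
      by (subst integrable_density) (use psi_integral p in auto)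
    show "(LINT x|gauss1. \<psi> x / std_normal_density x) = (LINT x|\<mu>. x * S x)"
      by (subst integral_density) (use psi_integral p in auto)
  qed
  have i2: "integrable gauss1 (\<lambda>x. g x * x\<^sup>2)" "integrable gauss1 (\<lambda>x. g x * (S x)\<^sup>2)"
    using sq_moment S_moments(3) by (simp_all add: mu_integral)
  have v2: "(LINT x|\<mu>. x\<^sup>2) = (LINT x|gauss1. g x * x\<^sup>2)" "(LINT x|gauss1. g x * (S x)\<^sup>2) = 1"
    using S_moments(4) by (simp_all add: mu_integral)
  \<comment> \<open>\<open>\<psi>\<close> is the density at S only where 0 < F < 1; up to a null set
    this holds wherever g is positive.\<close>
  have ae: "AE x in gauss1. 0 < g x \<longrightarrow> 0 < F x \<and> F x < 1"
    using AE_F unfolding \<mu>_def by (subst (asm) AE_density) auto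
  have "(LINT x|gauss1. g x - \<psi> x / std_normal_density x + (g x * x\<^sup>2 - g x * (S x)\<^sup>2) / 2)
    \<le> (LINT x|gauss1. g x * ln (g x))"
  proof (rule integral_mono_AE)
    show "integrable gauss1 (\<lambda>x. g x - \<psi> x / std_normal_density x + (g x * x\<^sup>2 - g x * (S x)\<^sup>2) / 2)"
      using gi psi_i i2 by simp
    show "integrable gauss1 (\<lambda>x. g x * ln (g x))" by (rule gln)
    show "AE x in gauss1. g x - \<psi> x / std_normal_density x + (g x * x\<^sup>2 - g x * (S x)\<^sup>2) / 2 \<le> g x * ln (g x)"
      using ae
    proof eventually_elim
      fix x assume H: "0 < g x \<longrightarrow> 0 < F x \<and> F x < 1"
      show "g x - \<psi> x / std_normal_density x + (g x * x\<^sup>2 - g x * (S x)\<^sup>2) / 2 \<le> g x * ln (g x)"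
      proof (cases "0 < g x")
        case True
        define p where "p = std_normal_density x"
        define q where "q = std_normal_density (S x)"
        have p: "0 < p" "0 < q" unfolding p_def q_def by (rule normal_density_pos, simp)+
        have psi: "\<psi> x = q" using H True by (simp add: \<psi>_def q_def)
        have "q / p = exp (- (S x)\<^sup>2 / 2) / exp (- x\<^sup>2 / 2)"
          unfolding p_def q_def std_normal_density_def by simp
        also have "\<dots> = exp ((x\<^sup>2 - (S x)\<^sup>2) / 2)"
          by (simp add: exp_diff[symmetric] diff_divide_distrib)
        finally have "ln (q / p) = (x\<^sup>2 - (S x)\<^sup>2) / 2" by simp
        \<comment> \<open>The quotient is 1 / r, so this is ln r >= 1 - 1 / r.\<close>
        moreover have "ln (q / p / g x) \<le> q / p / g x - 1" using p True by (intro ln_le_minus_one) simp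
        moreover have "ln (q / p / g x) = ln (q / p) - ln (g x)" using p True by (intro ln_divide_pos) auto
        ultimately have "1 - q / p / g x + (x\<^sup>2 - (S x)\<^sup>2) / 2 \<le> ln (g x)" by linarith
        then have "g x * (1 - q / p / g x + (x\<^sup>2 - (S x)\<^sup>2) / 2) \<le> g x * ln (g x)"
          using True by (intro mult_left_mono) auto
        then show ?thesis unfolding psi p_def[symmetric] using True by (simp add: algebra_simps)
      next
        case False
        then have "g x = 0" using g0[of x] by simp
        then show ?thesis using psi_nonneg[of x] by simp
      qed
    qed
  qed
  also have "(LINT x|gauss1. g x - \<psi> x / std_normal_density x + (g x * x\<^sup>2 - g x * (S x)\<^sup>2) / 2)
    = 1 - (LINT x|\<mu>. x * S x) + ((LINT x|\<mu>. x\<^sup>2) - 1) / 2"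
    using gi psi_i i2 by (simp add: g1 psi_v v2)
  finally show ?thesis unfolding sq_dist_integral by (simp add: field_simps)
qed

end

section \<open>The Knothe map: adding one coordinate, and induction over the coordinates\<close>

locale knothe_step = prob_space M for M :: "'b measure" +
  fixes f :: "'b \<times> real \<Rightarrow> real"
  assumes fm [measurable]: "f \<in> borel_measurable (M \<Otimes>\<^sub>M gauss1)" and f0: "\<And>p. 0 \<le> f p"
    and fint: "integrable (M \<Otimes>\<^sub>M gauss1) f" and fmass: "integral\<^sup>L (M \<Otimes>\<^sub>M gauss1) f = 1"
    and fln: "integrable (M \<Otimes>\<^sub>M gauss1) (\<lambda>p. f p * ln (f p))"
begin

sublocale pr: pair_prob_space M gauss1
  by (intro pair_prob_space.intro pair_sigma_finite.intro prob_space_axioms prob_space_gauss1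
    prob_space_imp_sigma_finite)

definition marg :: "'b \<Rightarrow> real" where
  "marg x = (LINT y|gauss1. f (x, y))"

definition sect_ent :: "'b \<Rightarrow> real" where
  "sect_ent x = (LINT y|gauss1. f (x, y) * ln (f (x, y)))"

text \<open>The monotone map of the conditional density given x, with its cdf written out as an
  integral so that joint measurability in x and y is visible.\<close>

definition fiber :: "'b \<Rightarrow> real \<Rightarrow> real" where
  "fiber x y = normal_quantile (LINT z|gauss1. indicat_real {..y} z * (f (x, z) / marg x))"

text \<open>The points at which both sections are integrable; by Fubini almost every x is
  one.\<close>

definition good :: "'b \<Rightarrow> bool" where
  "good x \<longleftrightarrow> x \<in> space M \<and> integrable gauss1 (\<lambda>y. f (x, y)) \<and> integrable gauss1 (\<lambda>y. f (x, y) * ln (f (x, y)))"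

lemma AE_good: "AE x in M. good x"
  using pr.AE_integrable_fst'[OF fint] pr.AE_integrable_fst'[OF fln] AE_space
  by eventually_elim (simp add: good_def)

lemma marg_measurable [measurable]: "marg \<in> borel_measurable M"
  unfolding marg_def[abs_def] by measurable

lemma marg_nonneg: "0 \<le> marg x"
  unfolding marg_def by (rule Bochner_Integration.integral_nonneg) (rule f0)

lemma marg_int: "integrable M marg" "integral\<^sup>L M marg = 1"
  using pr.integrable_fst'[OF fint] pr.integral_fst'[OF fint] unfolding marg_def[abs_def] fmass by auto

lemma sect_ent_int: "integrable M sect_ent" "integral\<^sup>L M sect_ent = (LINT p|(M \<Otimes>\<^sub>M gauss1). f p * ln (f p))"
  using pr.integrable_fst'[OF fln] pr.integral_fst'[OF fln] unfolding sect_ent_def[abs_def] by auto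

lemma fiber_measurable [measurable]: "(\<lambda>p. fiber (fst p) (snd p)) \<in> borel_measurable (M \<Otimes>\<^sub>M gauss1)"
proof -
  have "(\<lambda>p. LINT z|gauss1. (if z \<le> snd p then 1 else 0) * (f (fst p, z) / marg (fst p))) \<in> borel_measurable (M \<Otimes>\<^sub>M gauss1)"
    by measurable
  moreover have "indicat_real {..y} z = (if z \<le> y then 1 else 0)" for y z :: real by (simp add: indicator_def)
  ultimately show ?thesis unfolding fiber_def
    by (simp only:) (rule measurable_compose[OF _ normal_quantile_measurable])
qed

lemma sect_measurable: "x \<in> space M \<Longrightarrow> (\<lambda>y. f (x, y)) \<in> borel_measurable borel"
  using measurable_Pair2[OF fm, of x] by simp

text \<open>If \<open>marg x\<close> is 0, the section vanishes almost everywhere and everything is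
  0. Otherwise the one-dimensional theorem applies to the conditional density, and rescaling by
  \<open>marg x\<close> turns its entropy into \<open>sect_ent x - marg x * ln (marg x)\<close>. As
  the transport cost is nonnegative, so is this difference.\<close>

lemma fiber_props:
  assumes x: "good x"
  shows "\<And>h. h \<in> borel_measurable borel \<Longrightarrow>
      (\<integral>\<^sup>+y. ennreal (f (x, y)) * h (fiber x y) \<partial>gauss1) = ennreal (marg x) * (\<integral>\<^sup>+y. h y \<partial>gauss1)"
    and "marg x * ln (marg x) \<le> sect_ent x"
    and "(\<integral>\<^sup>+y. ennreal (f (x, y) * (y - fiber x y)\<^sup>2) \<partial>gauss1) \<le> ennreal (2 * (sect_ent x - marg x * ln (marg x)))"
proof -
  have xs: "x \<in> space M" and i: "integrable gauss1 (\<lambda>y. f (x, y))" "integrable gauss1 (\<lambda>y. f (x, y) * ln (f (x, y)))"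
    using x by (auto simp: good_def)
  have sm [measurable]: "(\<lambda>y. f (x, y)) \<in> borel_measurable borel" by (rule sect_measurable[OF xs])
  have "(\<forall>h. h \<in> borel_measurable borel \<longrightarrow>
      (\<integral>\<^sup>+y. ennreal (f (x, y)) * h (fiber x y) \<partial>gauss1) = ennreal (marg x) * (\<integral>\<^sup>+y. h y \<partial>gauss1))
    \<and> marg x * ln (marg x) \<le> sect_ent x
    \<and> (\<integral>\<^sup>+y. ennreal (f (x, y) * (y - fiber x y)\<^sup>2) \<partial>gauss1) \<le> ennreal (2 * (sect_ent x - marg x * ln (marg x)))"
  proof (cases "marg x = 0")
    case True
    then have ae: "AE y in gauss1. f (x, y) = 0"
      using integral_nonneg_eq_0_iff_AE[OF i(1)] f0 unfolding marg_def by simp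
    have D: "sect_ent x = 0"
    proof -
      have "sect_ent x = (LINT y|gauss1. 0)"
        unfolding sect_ent_def by (rule integral_cong_AE) (use ae in auto)
      then show ?thesis by simp
    qed
    have "(\<integral>\<^sup>+y. ennreal (f (x, y)) * k y \<partial>gauss1) = 0" for k
    proof -
      have "(\<integral>\<^sup>+y. ennreal (f (x, y)) * k y \<partial>gauss1) = (\<integral>\<^sup>+y. 0 \<partial>gauss1)"
        by (rule nn_integral_cong_AE) (use ae in auto)
      then show ?thesis by simp
    qed
    note z = this
    have "(\<integral>\<^sup>+y. ennreal (f (x, y) * (y - fiber x y)\<^sup>2) \<partial>gauss1) = 0"
      using z[of "\<lambda>y. ennreal ((y - fiber x y)\<^sup>2)"] by (simp add: ennreal_mult f0)
    then show ?thesis using z True D by simp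
  next
    case False
    then have m: "0 < marg x" using marg_nonneg[of x] by simp
    define g where "g = (\<lambda>y. f (x, y) / marg x)"
    have fg: "f (x, y) = marg x * g y" for y using m by (simp add: g_def)
    have lng: "g y * ln (g y) = (f (x, y) * ln (f (x, y)) - ln (marg x) * f (x, y)) / marg x" for y
    proof (cases "f (x, y) = 0")
      case False
      then have "0 < f (x, y)" using f0[of "(x, y)"] by simp
      then have "ln (g y) = ln (f (x, y)) - ln (marg x)" using m by (simp add: g_def ln_div)
      then have "g y * ln (g y) = f (x, y) / marg x * (ln (f (x, y)) - ln (marg x))" by (simp only: g_def)
      then show ?thesis by (simp add: algebra_simps diff_divide_distrib)
    qed (simp add: g_def)
    interpret d: density_1d g
    proof
      show "g \<in> borel_measurable borel" unfolding g_def by measurable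
      show "0 \<le> g y" for y unfolding g_def using f0 m by simp
      show "integrable gauss1 g" unfolding g_def using i(1) by (rule integrable_divide)
      show "integral\<^sup>L gauss1 g = 1" unfolding g_def using m by (simp add: marg_def)
      show "integrable gauss1 (\<lambda>y. g y * ln (g y))"
        unfolding lng by (intro integrable_divide Bochner_Integration.integrable_diff integrable_mult_right i)
    qed
    have S: "d.S = fiber x"
      unfolding d.S_def[abs_def] d.F_integral unfolding fiber_def[abs_def] g_def ..
    have ent: "(LINT y|gauss1. g y * ln (g y)) = (sect_ent x - ln (marg x) * marg x) / marg x"
      unfolding lng integral_divide_zero
      by (subst Bochner_Integration.integral_diff) (use i in \<open>auto simp: sect_ent_def marg_def\<close>)
    have cost: "(LINT y|gauss1. g y * (y - fiber x y)\<^sup>2) \<le> 2 * ((sect_ent x - ln (marg x) * marg x) / marg x)"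
      and cost_i: "integrable gauss1 (\<lambda>y. g y * (y - fiber x y)\<^sup>2)"
    proof -
      have [measurable]: "(\<lambda>y. (y - fiber x y)\<^sup>2) \<in> borel_measurable borel" using d.S_measurable unfolding S by measurable
      show "integrable gauss1 (\<lambda>y. g y * (y - fiber x y)\<^sup>2)"
        using d.sq_dist_integrable unfolding S by (subst (asm) d.mu_integral) auto
      show "(LINT y|gauss1. g y * (y - fiber x y)\<^sup>2) \<le> 2 * ((sect_ent x - ln (marg x) * marg x) / marg x)"
        using d.transport_cost unfolding S ent by (subst (asm) d.mu_integral) auto
    qed
    have g0: "0 \<le> g y * (y - fiber x y)\<^sup>2" for y using d.g0 by simp
    have "marg x * (LINT y|gauss1. g y * (y - fiber x y)\<^sup>2) \<le> marg x * (2 * ((sect_ent x - ln (marg x) * marg x) / marg x))"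
      using cost m by (intro mult_left_mono) auto
    then have c2: "marg x * (LINT y|gauss1. g y * (y - fiber x y)\<^sup>2) \<le> 2 * (sect_ent x - marg x * ln (marg x))"
      using m by (simp add: mult.commute)
    have "0 \<le> (LINT y|gauss1. g y * (y - fiber x y)\<^sup>2)" by (rule Bochner_Integration.integral_nonneg) (rule g0)
    then have "0 \<le> marg x * (LINT y|gauss1. g y * (y - fiber x y)\<^sup>2)" using m by simp
    from order.trans[OF this c2] have e: "marg x * ln (marg x) \<le> sect_ent x" by simp
    have "(\<integral>\<^sup>+y. ennreal (f (x, y) * (y - fiber x y)\<^sup>2) \<partial>gauss1)
      = (\<integral>\<^sup>+y. ennreal (marg x * (g y * (y - fiber x y)\<^sup>2)) \<partial>gauss1)"
      unfolding fg by (simp only: mult.assoc)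
    also have "\<dots> = ennreal (LINT y|gauss1. marg x * (g y * (y - fiber x y)\<^sup>2))"
      by (intro nn_integral_eq_integral integrable_mult_right cost_i AE_I2 mult_nonneg_nonneg[OF less_imp_le[OF m] g0])
    also have "\<dots> \<le> ennreal (2 * (sect_ent x - marg x * ln (marg x)))"
      using c2 by (intro ennreal_leI) simp
    finally have c: "(\<integral>\<^sup>+y. ennreal (f (x, y) * (y - fiber x y)\<^sup>2) \<partial>gauss1) \<le> ennreal (2 * (sect_ent x - marg x * ln (marg x)))" .
    have "(\<integral>\<^sup>+y. ennreal (f (x, y)) * h (fiber x y) \<partial>gauss1) = ennreal (marg x) * (\<integral>\<^sup>+y. h y \<partial>gauss1)"
      if h [measurable]: "h \<in> borel_measurable borel" for h
    proof -
      have [measurable]: "d.S \<in> borel_measurable borel" "g \<in> borel_measurable borel" by (rule d.S_measurable d.gm)+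
      have "(\<integral>\<^sup>+y. h y \<partial>gauss1) = (\<integral>\<^sup>+y. h y \<partial>distr d.\<mu> borel d.S)" unfolding d.distr_S ..
      also have "\<dots> = (\<integral>\<^sup>+y. h (d.S y) \<partial>d.\<mu>)" by (subst nn_integral_distr) auto
      also have "\<dots> = (\<integral>\<^sup>+y. ennreal (g y) * h (d.S y) \<partial>gauss1)"
        unfolding d.\<mu>_def by (subst nn_integral_density) auto
      finally have "ennreal (marg x) * (\<integral>\<^sup>+y. h y \<partial>gauss1) = (\<integral>\<^sup>+y. ennreal (marg x) * (ennreal (g y) * h (d.S y)) \<partial>gauss1)"
        by (subst nn_integral_cmult) auto
      also have "\<dots> = (\<integral>\<^sup>+y. ennreal (f (x, y)) * h (fiber x y) \<partial>gauss1)"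
        unfolding fg S ennreal_mult[OF less_imp_le[OF m] d.g0] by (simp only: mult.assoc)
      finally show ?thesis ..
    qed
    then show ?thesis using e c by blast
  qed
  then show "\<And>h. h \<in> borel_measurable borel \<Longrightarrow>
      (\<integral>\<^sup>+y. ennreal (f (x, y)) * h (fiber x y) \<partial>gauss1) = ennreal (marg x) * (\<integral>\<^sup>+y. h y \<partial>gauss1)"
    and "marg x * ln (marg x) \<le> sect_ent x"
    and "(\<integral>\<^sup>+y. ennreal (f (x, y) * (y - fiber x y)\<^sup>2) \<partial>gauss1) \<le> ennreal (2 * (sect_ent x - marg x * ln (marg x)))"
    by auto
qed

text \<open>The integrand is at least -1, and \<open>fiber_props(2)\<close> bounds it above by the
  entropy of the section.\<close>

lemma marg_ln_int: "integrable M (\<lambda>x. marg x * ln (marg x))"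
proof (rule Bochner_Integration.integrable_bound)
  show "integrable M (\<lambda>x. \<bar>sect_ent x\<bar> + 1)"
    by (intro Bochner_Integration.integrable_add integrable_abs sect_ent_int integrable_const)
  show "AE x in M. norm (marg x * ln (marg x)) \<le> norm (\<bar>sect_ent x\<bar> + 1)"
    using AE_good
  proof eventually_elim
    case (elim x)
    have "- 1 \<le> marg x * ln (marg x)" using xlnx_young[OF marg_nonneg[of x], of 0] marg_nonneg[of x] by simp
    then show ?case using fiber_props(2)[OF elim] by simp
  qed
qed simp

text \<open>Cost and entropy split alike: the squared distance is a sum over coordinates, and the
  joint entropy is that of the marginal plus the average conditional one. Adding the two bounds
  loses nothing, so the constant 2 is independent of the dimension.\<close>

lemma knothe_extend:
  assumes S [measurable]: "S \<in> measurable M M" and SM: "distr (density M (\<lambda>x. ennreal (marg x))) M S = M"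
    and k [measurable]: "k \<in> borel_measurable M"
    and cost: "(\<integral>\<^sup>+x. ennreal (marg x) * k x \<partial>M) \<le> ennreal (2 * (LINT x|M. marg x * ln (marg x)))"
  shows "(\<lambda>p. (S (fst p), fiber (fst p) (snd p))) \<in> measurable (M \<Otimes>\<^sub>M gauss1) (M \<Otimes>\<^sub>M gauss1)"
    and "distr (density (M \<Otimes>\<^sub>M gauss1) (\<lambda>p. ennreal (f p))) (M \<Otimes>\<^sub>M gauss1) (\<lambda>p. (S (fst p), fiber (fst p) (snd p))) = M \<Otimes>\<^sub>M gauss1"
    and "(\<integral>\<^sup>+p. ennreal (f p) * (k (fst p) + ennreal ((snd p - fiber (fst p) (snd p))\<^sup>2)) \<partial>(M \<Otimes>\<^sub>M gauss1))
      \<le> ennreal (2 * (LINT p|(M \<Otimes>\<^sub>M gauss1). f p * ln (f p)))"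
proof -
  let ?P = "M \<Otimes>\<^sub>M gauss1" and ?R = "\<lambda>p. (S (fst p), fiber (fst p) (snd p))"
  have fib [measurable]: "(\<lambda>p. fiber (fst p) (snd p)) \<in> measurable ?P gauss1" using fiber_measurable by simp
  show R [measurable]: "?R \<in> measurable ?P ?P" by measurable
  show "distr (density ?P (\<lambda>p. ennreal (f p))) ?P ?R = ?P"
  proof (rule measure_eqI)
    fix A assume "A \<in> sets (distr (density ?P (\<lambda>p. ennreal (f p))) ?P ?R)"
    then have A [measurable]: "A \<in> sets ?P" by simp
    let ?h = "\<lambda>p. indicator A p :: ennreal"
    have "emeasure (distr (density ?P (\<lambda>p. ennreal (f p))) ?P ?R) A = (\<integral>\<^sup>+p. ?h p \<partial>distr (density ?P (\<lambda>p. ennreal (f p))) ?P ?R)"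
      by (rule nn_integral_indicator[symmetric]) (unfold sets_distr, rule A)
    also have "\<dots> = (\<integral>\<^sup>+p. ?h (?R p) \<partial>density ?P (\<lambda>p. ennreal (f p)))"
      by (rule nn_integral_distr) measurable
    also have "\<dots> = (\<integral>\<^sup>+p. ennreal (f p) * ?h (?R p) \<partial>?P)"
      by (rule nn_integral_density) measurable
    also have "\<dots> = (\<integral>\<^sup>+x. \<integral>\<^sup>+y. ennreal (f (x, y)) * ?h (S x, fiber x y) \<partial>gauss1 \<partial>M)"
      by (subst gauss1.nn_integral_fst[symmetric]) simp_all
    also have "\<dots> = (\<integral>\<^sup>+x. ennreal (marg x) * (\<integral>\<^sup>+y. ?h (S x, y) \<partial>gauss1) \<partial>M)"
    proof (rule nn_integral_cong_AE)
      show "AE x in M. (\<integral>\<^sup>+y. ennreal (f (x, y)) * ?h (S x, fiber x y) \<partial>gauss1) = ennreal (marg x) * (\<integral>\<^sup>+y. ?h (S x, y) \<partial>gauss1)"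
        using AE_good
      proof eventually_elim
        case (elim x)
        then have "S x \<in> space M" using measurable_space[OF S] by (simp add: good_def)
        then have "(\<lambda>y. ?h (S x, y)) \<in> borel_measurable borel"
          using measurable_Pair2[of ?h M gauss1 borel "S x"] by simp
        from fiber_props(1)[OF elim this] show ?case .
      qed
    qed
    also have "\<dots> = (\<integral>\<^sup>+x. (\<integral>\<^sup>+y. ?h (S x, y) \<partial>gauss1) \<partial>(density M (\<lambda>x. ennreal (marg x))))"
      by (rule nn_integral_density[symmetric]) measurable
    also have "\<dots> = (\<integral>\<^sup>+x. (\<integral>\<^sup>+y. ?h (x, y) \<partial>gauss1) \<partial>(distr (density M (\<lambda>x. ennreal (marg x))) M S))"
      by (rule nn_integral_distr[symmetric]) measurable
    also have "\<dots> = (\<integral>\<^sup>+p. ?h p \<partial>?P)" unfolding SM by (rule gauss1.nn_integral_fst) measurable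
    also have "\<dots> = emeasure ?P A" by (rule nn_integral_indicator) (rule A)
    finally show "emeasure (distr (density ?P (\<lambda>p. ennreal (f p))) ?P ?R) A = emeasure ?P A" .
  qed simp
  let ?E = "LINT x|M. marg x * ln (marg x)"
  have E: "integral\<^sup>L M (\<lambda>x. sect_ent x - marg x * ln (marg x)) = (LINT p|?P. f p * ln (f p)) - ?E"
    using sect_ent_int marg_ln_int by simp
  have aeE: "AE x in M. 0 \<le> 2 * (sect_ent x - marg x * ln (marg x))"
    using AE_good by eventually_elim (use fiber_props(2) in simp)
  have "(\<integral>\<^sup>+p. ennreal (f p) * (k (fst p) + ennreal ((snd p - fiber (fst p) (snd p))\<^sup>2)) \<partial>?P)
    = (\<integral>\<^sup>+p. ennreal (f p) * k (fst p) + ennreal (f p * (snd p - fiber (fst p) (snd p))\<^sup>2) \<partial>?P)"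
    by (simp add: distrib_left ennreal_mult f0)
  also have "\<dots> = (\<integral>\<^sup>+p. ennreal (f p) * k (fst p) \<partial>?P) + (\<integral>\<^sup>+p. ennreal (f p * (snd p - fiber (fst p) (snd p))\<^sup>2) \<partial>?P)"
    by (rule nn_integral_add) measurable
  also have "(\<integral>\<^sup>+p. ennreal (f p) * k (fst p) \<partial>?P) = (\<integral>\<^sup>+x. ennreal (marg x) * k x \<partial>M)"
  proof -
    have "(\<integral>\<^sup>+p. ennreal (f p) * k (fst p) \<partial>?P) = (\<integral>\<^sup>+x. \<integral>\<^sup>+y. ennreal (f (x, y)) * k x \<partial>gauss1 \<partial>M)"
      by (subst gauss1.nn_integral_fst[symmetric]) simp_all
    also have "\<dots> = (\<integral>\<^sup>+x. ennreal (marg x) * k x \<partial>M)"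
    proof (rule nn_integral_cong_AE)
      show "AE x in M. (\<integral>\<^sup>+y. ennreal (f (x, y)) * k x \<partial>gauss1) = ennreal (marg x) * k x"
        using AE_good
      proof eventually_elim
        case (elim x)
        show ?case using fiber_props(1)[OF elim, of "\<lambda>_. k x"] gauss1.emeasure_space_1 by simp
      qed
    qed
    finally show ?thesis .
  qed
  also have "(\<integral>\<^sup>+p. ennreal (f p * (snd p - fiber (fst p) (snd p))\<^sup>2) \<partial>?P)
    = (\<integral>\<^sup>+x. \<integral>\<^sup>+y. ennreal (f (x, y) * (y - fiber x y)\<^sup>2) \<partial>gauss1 \<partial>M)"
    by (subst gauss1.nn_integral_fst[symmetric]) simp_all
  also have "\<dots> \<le> (\<integral>\<^sup>+x. ennreal (2 * (sect_ent x - marg x * ln (marg x))) \<partial>M)"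
    by (rule nn_integral_mono_AE[OF eventually_mono[OF AE_good fiber_props(3)]])
  also have "\<dots> = ennreal (LINT x|M. 2 * (sect_ent x - marg x * ln (marg x)))"
    by (intro nn_integral_eq_integral integrable_mult_right Bochner_Integration.integrable_diff sect_ent_int marg_ln_int aeE)
  also have "(LINT x|M. 2 * (sect_ent x - marg x * ln (marg x))) = 2 * ((LINT p|?P. f p * ln (f p)) - ?E)"
    unfolding E[symmetric] by (rule Bochner_Integration.integral_mult_right_zero)
  finally have "(\<integral>\<^sup>+p. ennreal (f p) * (k (fst p) + ennreal ((snd p - fiber (fst p) (snd p))\<^sup>2)) \<partial>?P)
    \<le> (\<integral>\<^sup>+x. ennreal (marg x) * k x \<partial>M) + ennreal (2 * ((LINT p|?P. f p * ln (f p)) - ?E))"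
    by (simp add: add_left_mono)
  also have "\<dots> \<le> ennreal (2 * ?E) + ennreal (2 * ((LINT p|?P. f p * ln (f p)) - ?E))"
    by (rule add_right_mono[OF cost])
  also have "\<dots> = ennreal (2 * ?E + 2 * ((LINT p|?P. f p * ln (f p)) - ?E))"
  \<comment> \<open>Merging the terms requires both to be nonnegative; for the marginal entropy this
    follows from x ln x >= x - 1 and mass 1.\<close>
  proof (rule ennreal_plus[symmetric])
    have "0 \<le> (LINT x|M. marg x * ln (marg x) - (marg x - 1))"
    proof (rule Bochner_Integration.integral_nonneg)
      fix x show "0 \<le> marg x * ln (marg x) - (marg x - 1)" using xlnx_young[OF marg_nonneg[of x], of 0] by simp
    qed
    also have "\<dots> = ?E - (integral\<^sup>L M marg - 1)"
      using marg_ln_int marg_int prob_space by simp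
    finally show "0 \<le> 2 * ?E" by (simp add: marg_int)
    have "0 \<le> integral\<^sup>L M (\<lambda>x. 2 * (sect_ent x - marg x * ln (marg x)))" by (rule integral_nonneg_AE[OF aeE])
    then have "0 \<le> 2 * integral\<^sup>L M (\<lambda>x. sect_ent x - marg x * ln (marg x))"
      by (simp only: Bochner_Integration.integral_mult_right_zero)
    then show "0 \<le> 2 * ((LINT p|?P. f p * ln (f p)) - ?E)" unfolding E .
  qed
  finally show "(\<integral>\<^sup>+p. ennreal (f p) * (k (fst p) + ennreal ((snd p - fiber (fst p) (snd p))\<^sup>2)) \<partial>?P)
    \<le> ennreal (2 * (LINT p|?P. f p * ln (f p)))" by simp
qed

end

text \<open>Mass and finite entropy pass to the marginal, so the induction hypothesis for I feeds
  \<open>knothe_extend\<close>. Over the empty index set the space is a single point and the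
  identity serves.\<close>

lemma knothe_map:
  fixes I :: "'i set" and f :: "('i \<Rightarrow> real) \<Rightarrow> real"
  defines "M \<equiv> \<lambda>I :: 'i set. PiM I (\<lambda>_. gauss1)"
  assumes "finite I" and "f \<in> borel_measurable (M I)" and "\<And>x. 0 \<le> f x"
    and "integrable (M I) f" and "integral\<^sup>L (M I) f = 1" and "integrable (M I) (\<lambda>x. f x * ln (f x))"
  shows "\<exists>S \<in> measurable (M I) (M I). distr (density (M I) (\<lambda>x. ennreal (f x))) (M I) S = M I \<and>
    (\<integral>\<^sup>+x. ennreal (f x) * (\<Sum>i\<in>I. ennreal ((x i - S x i)\<^sup>2)) \<partial>(M I)) \<le> ennreal (2 * (LINT x|(M I). f x * ln (f x)))"
  using assms(2-)
proof (induction I arbitrary: f rule: finite_induct)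
  case empty
  have M0: "M {} = count_space {\<lambda>_. undefined}" unfolding M_def by (rule PiM_empty)
  have f1: "f (\<lambda>_. undefined) = 1" using empty.prems(4) unfolding M0 by (simp add: lebesgue_integral_count_space_finite)
  have "density (M {}) (\<lambda>x. ennreal (f x)) = density (M {}) (\<lambda>_. 1)"
    by (rule density_cong) (use f1 in \<open>auto simp: M0 AE_count_space\<close>)
  then have d: "density (M {}) (\<lambda>x. ennreal (f x)) = M {}" by (simp add: density_1)
  show ?case
    by (rule bexI[of _ "\<lambda>x. x"]) (auto simp: d distr_id)
next
  case (insert i I)
  have P: "prob_space (M J)" for J unfolding M_def by (intro prob_space_PiM prob_space_gauss1)
  interpret MI: prob_space "M I" by (rule P)
  let ?P = "M I \<Otimes>\<^sub>M gauss1"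
  \<comment> \<open>\<open>E\<close> and \<open>D\<close> identify a function on
    \<open>insert i I\<close> with the pair of its restriction to I and its value at i.\<close>
  define E where "E = (\<lambda>p :: ('i \<Rightarrow> real) \<times> real. (fst p)(i := snd p))"
  define D where "D = (\<lambda>z :: 'i \<Rightarrow> real. (restrict z I, z i))"
  have Em [measurable]: "E \<in> measurable ?P (M (insert i I))"
    unfolding E_def M_def by (rule measurable_fun_upd[where J=I]) auto
  have Dm [measurable]: "D \<in> measurable (M (insert i I)) ?P"
    unfolding D_def M_def by (intro measurable_Pair measurable_restrict_subset measurable_component_singleton) auto
  have DE: "D (E p) = p" if "p \<in> space ?P" for p
  proof -
    have "fst p \<in> extensional I" using that by (auto simp: space_pair_measure M_def space_PiM PiE_def)
    then have "restrict (E p) I = fst p"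
      using insert.hyps(2) by (auto simp: E_def restrict_def extensional_def fun_eq_iff)
    then show ?thesis by (simp add: D_def E_def)
  qed
  have dE: "distr ?P (M (insert i I)) E = M (insert i I)"
  proof -
    have base: "distr (gauss1 \<Otimes>\<^sub>M M I) (M (insert i I)) (\<lambda>(x, X). X(i := x)) = M (insert i I)"
      unfolding M_def by (rule distr_pair_PiM_eq_PiM) (rule prob_space_gauss1)+
    interpret ps: pair_prob_space "M I" gauss1
      by (intro pair_prob_space.intro pair_sigma_finite.intro P prob_space_gauss1 prob_space_imp_sigma_finite)
    have "distr ?P (M (insert i I)) E = distr (distr (gauss1 \<Otimes>\<^sub>M M I) ?P (\<lambda>(x, y). (y, x))) (M (insert i I)) E"
      using ps.distr_pair_swap by simp
    also have "\<dots> = distr (gauss1 \<Otimes>\<^sub>M M I) (M (insert i I)) (\<lambda>(x, X). X(i := x))"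
      by (subst distr_distr[OF Em]) (auto simp: o_def E_def case_prod_unfold)
    finally show ?thesis unfolding base .
  qed
  note prems = insert.prems
  have [measurable]: "f \<in> borel_measurable (M (insert i I))" by (rule prems(1))
  interpret K: knothe_step "M I" "\<lambda>p. f (E p)"
  proof
    show "(\<lambda>p. f (E p)) \<in> borel_measurable ?P" by measurable
    show "0 \<le> f (E p)" for p by (rule prems(2))
    show "integrable ?P (\<lambda>p. f (E p))"
      using prems(3) by (subst (asm) dE[symmetric], subst (asm) integrable_distr_eq) auto
    show "(LINT p|?P. f (E p)) = 1"
      using prems(4) by (subst (asm) dE[symmetric], subst (asm) integral_distr) auto
    show "integrable ?P (\<lambda>p. f (E p) * ln (f (E p)))"
      using prems(5) by (subst (asm) dE[symmetric], subst (asm) integrable_distr_eq) auto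
  qed
  from insert.IH[OF K.marg_measurable K.marg_nonneg K.marg_int K.marg_ln_int]
  obtain S where S [measurable]: "S \<in> measurable (M I) (M I)"
    and SM: "distr (density (M I) (\<lambda>x. ennreal (K.marg x))) (M I) S = M I"
    and cost: "(\<integral>\<^sup>+x. ennreal (K.marg x) * (\<Sum>j\<in>I. ennreal ((x j - S x j)\<^sup>2)) \<partial>(M I)) \<le> ennreal (2 * (LINT x|(M I). K.marg x * ln (K.marg x)))"
    by blast
  have comp [measurable]: "(\<lambda>x. x j) \<in> borel_measurable (M I)" if "j \<in> I" for j
    using measurable_component_singleton[OF that, of "\<lambda>_. gauss1"] unfolding M_def by simp
  have km: "(\<lambda>x. \<Sum>j\<in>I. ennreal ((x j - S x j)\<^sup>2)) \<in> borel_measurable (M I)"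
  proof (rule borel_measurable_sum)
    fix j assume j: "j \<in> I"
    have "(\<lambda>x. S x j) \<in> borel_measurable (M I)" using measurable_compose[OF S comp[OF j]] .
    then show "(\<lambda>x. ennreal ((x j - S x j)\<^sup>2)) \<in> borel_measurable (M I)" using comp[OF j] by measurable
  qed
  note X = K.knothe_extend[OF S SM km cost]
  define R where "R = (\<lambda>p. (S (fst p), K.fiber (fst p) (snd p)))"
  have Rm [measurable]: "R \<in> measurable ?P ?P" using X(1) unfolding R_def .
  define S' where "S' = (\<lambda>z. E (R (D z)))"
  have S'm: "S' \<in> measurable (M (insert i I)) (M (insert i I))" unfolding S'_def by measurable
  have dens: "density (M (insert i I)) (\<lambda>x. ennreal (f x)) = distr (density ?P (\<lambda>p. ennreal (f (E p)))) (M (insert i I)) E"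
    by (subst (1) dE[symmetric], subst density_distr) auto
  have "distr (density (M (insert i I)) (\<lambda>x. ennreal (f x))) (M (insert i I)) S'
    = distr (density ?P (\<lambda>p. ennreal (f (E p)))) (M (insert i I)) (S' \<circ> E)"
    unfolding dens by (rule distr_distr) (use S'm in auto)
  also have "\<dots> = distr (density ?P (\<lambda>p. ennreal (f (E p)))) (M (insert i I)) (E \<circ> R)"
    by (rule distr_cong) (auto simp: S'_def DE)
  also have "\<dots> = distr (distr (density ?P (\<lambda>p. ennreal (f (E p)))) ?P R) (M (insert i I)) E"
    by (rule distr_distr[symmetric]) auto
  also have "\<dots> = M (insert i I)" unfolding R_def X(2) by (rule dE)
  finally have dS': "distr (density (M (insert i I)) (\<lambda>x. ennreal (f x))) (M (insert i I)) S' = M (insert i I)" .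
  have comp' [measurable]: "(\<lambda>x. x j) \<in> borel_measurable (M (insert i I))" if "j \<in> insert i I" for j
    using measurable_component_singleton[OF that, of "\<lambda>_. gauss1"] unfolding M_def by simp
  have km': "(\<lambda>x. ennreal (f x) * (\<Sum>j\<in>insert i I. ennreal ((x j - S' x j)\<^sup>2))) \<in> borel_measurable (M (insert i I))"
  proof (intro borel_measurable_times_ennreal borel_measurable_sum)
    fix j assume j: "j \<in> insert i I"
    have "(\<lambda>x. S' x j) \<in> borel_measurable (M (insert i I))" using measurable_compose[OF S'm comp'[OF j]] .
    then show "(\<lambda>x. ennreal ((x j - S' x j)\<^sup>2)) \<in> borel_measurable (M (insert i I))" using comp'[OF j] by measurable
  qed measurable
  have "(\<integral>\<^sup>+x. ennreal (f x) * (\<Sum>j\<in>insert i I. ennreal ((x j - S' x j)\<^sup>2)) \<partial>(M (insert i I)))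
    = (\<integral>\<^sup>+p. ennreal (f (E p)) * (\<Sum>j\<in>insert i I. ennreal ((E p j - S' (E p) j)\<^sup>2)) \<partial>?P)"
    by (subst (1) dE[symmetric], rule nn_integral_distr) (use km' in auto)
  also have "\<dots> = (\<integral>\<^sup>+p. ennreal (f (E p)) * ((\<Sum>j\<in>I. ennreal ((fst p j - S (fst p) j)\<^sup>2)) + ennreal ((snd p - K.fiber (fst p) (snd p))\<^sup>2)) \<partial>?P)"
  proof (rule nn_integral_cong)
    fix p assume p: "p \<in> space ?P"
    have "(\<Sum>j\<in>I. ennreal ((E p j - S' (E p) j)\<^sup>2)) = (\<Sum>j\<in>I. ennreal ((fst p j - S (fst p) j)\<^sup>2))"
    proof (rule sum.cong[OF refl])
      fix j assume "j \<in> I"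
      then have "j \<noteq> i" using insert.hyps(2) by auto
      then have E_j: "E q j = fst q j" for q by (simp add: E_def)
      show "ennreal ((E p j - S' (E p) j)\<^sup>2) = ennreal ((fst p j - S (fst p) j)\<^sup>2)"
        unfolding S'_def DE[OF p] E_j by (simp add: R_def)
    qed
    moreover have "E p i - S' (E p) i = snd p - K.fiber (fst p) (snd p)"
      by (simp add: S'_def DE[OF p] R_def) (simp add: E_def)
    ultimately show "ennreal (f (E p)) * (\<Sum>j\<in>insert i I. ennreal ((E p j - S' (E p) j)\<^sup>2))
      = ennreal (f (E p)) * ((\<Sum>j\<in>I. ennreal ((fst p j - S (fst p) j)\<^sup>2)) + ennreal ((snd p - K.fiber (fst p) (snd p))\<^sup>2))"
      unfolding sum.insert[OF insert.hyps] by (simp only: add.commute)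
  qed
  also have "\<dots> \<le> ennreal (2 * (LINT p|?P. f (E p) * ln (f (E p))))" by (rule X(3))
  also have "(LINT p|?P. f (E p) * ln (f (E p))) = (LINT x|(M (insert i I)). f x * ln (f x))"
    using integral_distr[of E ?P "M (insert i I)" "\<lambda>x. f x * ln (f x)"] unfolding dE by simp
  finally show ?case using S'm dS' by blast
qed

text \<open>The law of (x, T x), with T the Knothe map read in coordinates, is a coupling, and its
  cost bounds the infimum.\<close>

theorem talagrand:
  fixes f :: "'a::euclidean_space \<Rightarrow> real"
  assumes fm [measurable]: "f \<in> borel_measurable borel" and f0: "\<And>x. 0 \<le> f x"
    and P: "prob_space (density std_gaussian (\<lambda>x. ennreal (f x)))"
    and ent: "integrable std_gaussian (\<lambda>x. f x * ln (f x))"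
  shows "(enn2ereal (W2 (density std_gaussian (\<lambda>x. ennreal (f x))) std_gaussian))\<^sup>2
    \<le> ereal (2 * (LINT x|std_gaussian. f x * ln (f x)))"
proof -
  let ?g = "std_gaussian :: 'a measure"
  let ?nu = "density ?g (\<lambda>x. ennreal (f x))"
  let ?M = "PiM (Basis :: 'a set) (\<lambda>_. gauss1)"
  let ?e = "vec_of :: ('a \<Rightarrow> real) \<Rightarrow> 'a"
  let ?E = "LINT x|?g. f x * ln (f x)"
  define coords where "coords = (\<lambda>x :: 'a. \<lambda>b\<in>(Basis :: 'a set). x \<bullet> b)"
  have em [measurable]: "?e \<in> measurable ?M borel"
  proof (rule borel_measurable_sum)
    fix b :: 'a assume "b \<in> Basis"
    then have "(\<lambda>z. z b) \<in> borel_measurable ?M"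
      using measurable_component_singleton[of b Basis "\<lambda>_. gauss1"] by simp
    then show "(\<lambda>z. z b *\<^sub>R b) \<in> borel_measurable ?M" by measurable
  qed
  have cm [measurable]: "coords \<in> measurable borel ?M"
    unfolding coords_def by (rule measurable_restrict) simp
  have g: "distr ?M borel ?e = ?g" by (rule std_gaussian_PiM[symmetric])
  have ce: "coords (?e z) = z" if "z \<in> space ?M" for z
  proof -
    have "z \<in> extensional Basis" using that by (auto simp: space_PiM PiE_def)
    then show ?thesis by (auto simp: coords_def restrict_def extensional_def fun_eq_iff)
  qed
  note mass = gauss_density_prob[OF fm f0 P]
  have int_e: "integrable ?M (\<lambda>z. h (?e z))" "(LINT z|?M. h (?e z)) = integral\<^sup>L ?g h"
    if "integrable ?g h" and [measurable]: "h \<in> borel_measurable borel" for h :: "'a \<Rightarrow> real"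
    using that(1) integrable_distr_eq[of ?e ?M borel h] integral_distr[of ?e ?M borel h] unfolding g by auto
  obtain S where S [measurable]: "S \<in> measurable ?M ?M"
    and dS: "distr (density ?M (\<lambda>z. ennreal (f (?e z)))) ?M S = ?M"
    and cost: "(\<integral>\<^sup>+z. ennreal (f (?e z)) * (\<Sum>b\<in>Basis. ennreal ((z b - S z b)\<^sup>2)) \<partial>?M)
      \<le> ennreal (2 * (LINT z|?M. f (?e z) * ln (f (?e z))))"
    using knothe_map[of "Basis :: 'a set" "\<lambda>z. f (?e z)"] int_e[OF mass(1)] int_e[OF ent] f0 mass(2) by auto
  have E: "(LINT z|?M. f (?e z) * ln (f (?e z))) = ?E" by (rule int_e(2)[OF ent]) measurable
  define T where "T = (\<lambda>x. ?e (S (coords x)))"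
  have T [measurable]: "T \<in> measurable borel borel" unfolding T_def by measurable
  have Te: "T (?e z) = ?e (S z)" if "z \<in> space ?M" for z unfolding T_def ce[OF that] ..
  have nu: "?nu = distr (density ?M (\<lambda>z. ennreal (f (?e z)))) borel ?e"
    unfolding g[symmetric] by (rule density_distr) measurable
  have "distr ?nu borel T = distr (density ?M (\<lambda>z. ennreal (f (?e z)))) borel (T \<circ> ?e)"
    unfolding nu by (rule distr_distr) auto
  also have "\<dots> = distr (density ?M (\<lambda>z. ennreal (f (?e z)))) borel (?e \<circ> S)"
    by (rule distr_cong) (auto simp: Te)
  also have "\<dots> = distr (distr (density ?M (\<lambda>z. ennreal (f (?e z)))) ?M S) borel ?e"
    by (rule distr_distr[symmetric]) auto
  also have "\<dots> = ?g" unfolding dS by (rule g)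
  finally have dT: "distr ?nu borel T = ?g" .
  define \<pi> where "\<pi> = distr ?nu borel (\<lambda>x. (x, T x))"
  have pm [measurable]: "(\<lambda>x. (x, T x)) \<in> measurable ?nu (borel :: ('a \<times> 'a) measure)"
    by (simp add: borel_prod[symmetric])
  have [measurable]: "fst \<in> measurable (borel :: ('a \<times> 'a) measure) borel"
    "snd \<in> measurable (borel :: ('a \<times> 'a) measure) borel"
    by (simp_all add: borel_prod[symmetric])
  have "distr \<pi> borel fst = distr ?nu borel (\<lambda>x. x)"
    unfolding \<pi>_def by (subst distr_distr) (auto simp: o_def)
  also have "\<dots> = ?nu" by (rule distr_id2) simp
  finally have m1: "distr \<pi> borel fst = ?nu" .
  have "distr \<pi> borel snd = distr ?nu borel T"
    unfolding \<pi>_def by (subst distr_distr) (auto simp: o_def)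
  then have m2: "distr \<pi> borel snd = ?g" unfolding dT .
  have cpl: "\<pi> \<in> couplings ?nu ?g"
    unfolding couplings_def using m1 m2 by (simp add: \<pi>_def)
  have nrm: "ennreal ((norm (?e z - ?e w))\<^sup>2) = (\<Sum>b\<in>Basis. ennreal ((z b - w b)\<^sup>2))" for z w :: "'a \<Rightarrow> real"
  proof -
    have d: "?e z - ?e w = ?e (\<lambda>b. z b - w b)" by (simp add: sum_subtractf scaleR_diff_left)
    have "(norm (?e (\<lambda>b. z b - w b)))\<^sup>2 = (\<Sum>b\<in>(Basis::'a set). (z b - w b)\<^sup>2)"
      by (simp add: norm_eq_sqrt_inner euclidean_inner[of "?e _" "?e _"] sum_nonneg power2_eq_square)
    then show ?thesis unfolding d by (simp add: sum_ennreal)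
  qed
  have "(\<integral>\<^sup>+p. ennreal ((norm (fst p - snd p))\<^sup>2) \<partial>\<pi>) = (\<integral>\<^sup>+x. ennreal ((norm (x - T x))\<^sup>2) \<partial>?nu)"
    unfolding \<pi>_def by (subst nn_integral_distr) auto
  also have "\<dots> = (\<integral>\<^sup>+z. ennreal ((norm (?e z - T (?e z)))\<^sup>2) \<partial>density ?M (\<lambda>z. ennreal (f (?e z))))"
    unfolding nu by (rule nn_integral_distr) auto
  also have "\<dots> = (\<integral>\<^sup>+z. ennreal (f (?e z)) * ennreal ((norm (?e z - T (?e z)))\<^sup>2) \<partial>?M)"
    by (rule nn_integral_density) measurable
  also have "\<dots> = (\<integral>\<^sup>+z. ennreal (f (?e z)) * (\<Sum>b\<in>Basis. ennreal ((z b - S z b)\<^sup>2)) \<partial>?M)"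
    by (rule nn_integral_cong) (simp only: Te nrm)
  also have "\<dots> \<le> ennreal (2 * ?E)" using cost unfolding E .
  finally have c: "(\<integral>\<^sup>+(x, y). ennreal ((norm (x - y))\<^sup>2) \<partial>\<pi>) \<le> ennreal (2 * ?E)"
    by (simp add: case_prod_unfold)
  \<comment> \<open>Needed to take the square root and to compare real bounds with values in
    [0, infinity].\<close>
  have E0: "0 \<le> ?E"
  proof -
    have "0 \<le> (LINT x|?g. f x * ln (f x) - (f x - 1))"
      using xlnx_ge[OF f0] by (intro Bochner_Integration.integral_nonneg) (simp add: algebra_simps)
    also have "\<dots> = ?E - (integral\<^sup>L ?g f - 1)"
      using ent mass(1) gauss.prob_space by simp
    finally show ?thesis using mass(2) by simp
  qed
  have "W2 ?nu ?g \<le> ennreal_sqrt (\<integral>\<^sup>+(x, y). ennreal ((norm (x - y))\<^sup>2) \<partial>\<pi>)"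
    unfolding W2_def by (rule INF_lower[OF cpl])
  also have "\<dots> \<le> ennreal (sqrt (2 * ?E))"
  proof -
    have "enn2real (\<integral>\<^sup>+(x, y). ennreal ((norm (x - y))\<^sup>2) \<partial>\<pi>) \<le> 2 * ?E"
      using enn2real_mono[OF c] E0 by simp
    moreover have "(\<integral>\<^sup>+(x, y). ennreal ((norm (x - y))\<^sup>2) \<partial>\<pi>) \<noteq> \<infinity>" using c by (auto simp: top_unique)
    ultimately show ?thesis by (simp add: ennreal_sqrt_def ennreal_leI)
  qed
  finally have W: "W2 ?nu ?g \<le> ennreal (sqrt (2 * ?E))" .
  then obtain r where r: "0 \<le> r" "W2 ?nu ?g = ennreal r"
    by (cases "W2 ?nu ?g") (auto simp: top_unique)
  then have "r \<le> sqrt (2 * ?E)" using W E0 by (simp add: ennreal_le_iff)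
  then have "r\<^sup>2 \<le> 2 * ?E" using r(1) E0 power_mono[of r "sqrt (2 * ?E)" 2] by simp
  then show ?thesis unfolding r(2) using r(1) by (simp add: enn2ereal_ennreal)
qed

theorem corollary3:
  fixes f :: "real ^ 'n \<Rightarrow> real" and \<nu> :: "(real ^ 'n) measure" and l :: real
  assumes "l > 0"
    and "f \<in> borel_measurable borel" and "\<And>x. 0 \<le> f x"
    and "W11_loc f" and "finite_entropy f" and "finite_fisher f"
    and "\<nu> = density std_gaussian (\<lambda>x. ennreal (f x))"
    and "prob_space \<nu>" and "centered \<nu>" and "\<nu> \<in> poincare_class l"
  shows "ereal (lsi_deficit f) \<ge> ereal (lsi_c2 l) * (enn2ereal (W2 \<nu> std_gaussian))\<^sup>2"
proof -
  note l = assms(1) and fm [measurable] = assms(2) and f0 = assms(3) and nu = assms(7)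
  have P: "prob_space (density std_gaussian (\<lambda>x. ennreal (f x)))" using assms(8) unfolding nu .
  have ent: "integrable std_gaussian (\<lambda>x. f x * ln (f x))" using assms(5) unfolding finite_entropy_def .
  have "\<exists>G. is_weak_gradient f G" using assms(4) unfolding W11_loc_def .
  then have wg: "is_weak_gradient f (weak_grad f)" unfolding weak_grad_def by (rule someI_ex)
  have cen: "integrable (density std_gaussian (\<lambda>x. ennreal (f x))) (\<lambda>x. x)"
    "(LINT x|density std_gaussian (\<lambda>x. ennreal (f x)). x) = 0"
    using assms(9) unfolding centered_def nu by auto
  have "integrable (density std_gaussian (\<lambda>x. ennreal (f x))) (\<lambda>x. norm x)"
    using cen(1) by (rule integrable_norm)
  then have moment: "integrable std_gaussian (\<lambda>x. f x * norm x)"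
    by (subst (asm) integral_density_real(2)) (auto intro: f0)
  have mean: "(LINT x|std_gaussian. f x * (x \<bullet> b)) = 0" for b
  proof -
    have "(LINT x|std_gaussian. f x * (x \<bullet> b)) = (LINT x|density std_gaussian (\<lambda>x. ennreal (f x)). x \<bullet> b)"
      by (rule integral_density_real(1)[symmetric]) (auto intro: f0)
    also have "\<dots> = 0" using integral_inner_left[OF cen(1), of b] cen(2) by simp
    finally show ?thesis .
  qed
  note fint = gauss_density_prob(1)[OF fm f0 P] and fi = assms(6)[unfolded finite_fisher_def]
    and poin = assms(10)[unfolded nu]
  interpret lsi_setting f "weak_grad f" l
    by (intro lsi_setting.intro weak_pair.intro lsi_setting_axioms.intro wg fm f0 fint fi l P poin moment mean)
  \<comment> \<open>H is the weak gradient set to 0 off the region of integration in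
    \<open>fisher_gauss\<close>.\<close>
  have J: "J = fisher_gauss f"
    unfolding fisher_gauss_def set_lebesgue_integral_def
    by (rule Bochner_Integration.integral_cong) (auto simp: H_def)
  let ?E = "entropy_gauss f"
  have W: "(enn2ereal (W2 \<nu> std_gaussian))\<^sup>2 \<le> ereal (2 * ?E)"
    using talagrand[OF fm f0 P ent] unfolding nu entropy_gauss_def .
  have c: "0 < lsi_c l" "lsi_c l \<le> 1" using l by (rule lsi_c_pos, rule lsi_c_le_1)
  have "?E \<le> lsi_c l / 2 * fisher_gauss f"
    using improved_lsi[OF ent] unfolding J entropy_gauss_def .
  then have "?E / lsi_c l \<le> fisher_gauss f / 2" using c(1) by (simp add: field_simps)
  moreover have "lsi_c2 l * (2 * ?E) = ?E / lsi_c l - ?E"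
    by (simp add: lsi_c2_def field_simps)
  ultimately have D: "lsi_c2 l * (2 * ?E) \<le> lsi_deficit f"
    by (simp add: lsi_deficit_def)
  \<comment> \<open>Nonnegativity allows the transport bound to be multiplied by this constant in
    the extended reals.\<close>
  have "0 \<le> lsi_c2 l" using c by (simp add: lsi_c2_def)
  then have "ereal (lsi_c2 l) * (enn2ereal (W2 \<nu> std_gaussian))\<^sup>2 \<le> ereal (lsi_c2 l) * ereal (2 * ?E)"
    using W by (intro ereal_mult_left_mono) auto
  also have "\<dots> \<le> ereal (lsi_deficit f)" using D by simp
  finally show ?thesis .
qed

end
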